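(* Let $H$ be a Hopf algebra over a field $\mathbb{K}$ with involutive antipode ($S^2=\mathrm{id}$). Then the Gerstenhaber-Schack double complex $C^{pq}_{GS}(H,H)=\mathrm{Hom}_{\mathbb{K}}(H^{\otimes p},H^{\otimes q})$, with its vertical and horizontal cosimplicial structures and the operators $\tau_{\mathrm{alg}}$ (on columns) and $\tau_{\mathrm{coalg}}$ (on rows), is a cylindrical $\mathbb{K}$-module. Therefore the operator $$\tau_{\mathrm{diag}}:=\tau_{\mathrm{alg}}\circ\tau_{\mathrm{coalg}}=\tau_{\mathrm{coalg}}\circ\tau_{\mathrm{alg}}$$ completes the diagonal cosimplicial $\mathbb{K}$-module $C^n_{\mathrm{diag}}(H)=\mathrm{Hom}_{\mathbb{K}}(H^{\otimes n},H^{\otimes n})$ to a cocyclic $\mathbb{K}$-module.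
   Context: Notation. $H=(H,m,\Delta,\eta,\varepsilon,S)$, Sweedler notation $\Delta(u)=u_{(1)}\otimes u_{(2)}$, all tensor products over $\mathbb{K}$; $u^1\otimes\cdots\otimes u^p\in H^{\otimes p}$ is written $(u^1,\dots,u^p)$; $H$ need not be finite dimensional. For $u\in H$ and $v=v^1\otimes\cdots\otimes v^q\in H^{\otimes q}$ put $u\triangleright v:=u_{(1)}v^1\otimes\cdots\otimes u_{(q)}v^q$ and $v\triangleleft u:=v^1u_{(1)}\otimes\cdots\otimes v^qu_{(q)}$; for $q=0$ both actions on $\mathbb{K}$ are via $\varepsilon$. For $f$ with values in $H^{\otimes n}$ write $f=f^{(1)}\otimes\cdots\otimes f^{(n)}$ (summation understood). Columns ($q\ge 0$ fixed): for $f\in \mathrm{Hom}_{\mathbb{K}}(H^{\otimes n},H^{\otimes q})$, $(\delta^v_0f)(u^0,\dots,u^n)=u^0\triangleright f(u^1,\dots,u^n)$; $(\delta^v_if)(u^0,\dots,u^n)=f(u^0,\dots,u^{i-1}u^i,\dots,u^n)$ for $1\le i\le n$; $(\delta^v_{n+1}f)(u^0,\dots,u^n)=f(u^0,\dots,u^{n-1})\triangleleft u^n$; $(\sigma^v_jf)(u^1,\dots,u^{n-1})=f(u^1,\dots,u^j,1,u^{j+1},\dots,u^{n-1})$ for $0\le j\le n-1$; and $$(\tau_{\mathrm{alg}}f)(u^1,\dots,u^n)=(u^1_{(3)}\cdots u^n_{(3)})\triangleright f\big(S^{-1}(u^1_{(2)}\cdots u^n_{(2)}),u^1_{(1)},\dots,u^{n-1}_{(1)}\big)\triangleleft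 u^n_{(1)}.$$ Rows ($p\ge0$ fixed): for $f\in\mathrm{Hom}_{\mathbb{K}}(H^{\otimes p},H^{\otimes n})$, $(\delta^h_0f)(u^1,\dots,u^p)=u^1_{(1)}\cdots u^p_{(1)}\otimes f(u^1_{(2)},\dots,u^p_{(2)})$; $\delta^h_if=(\mathrm{id}^{i-1}\otimes\Delta\otimes\mathrm{id}^{n-i})f$ for $1\le i\le n$; $(\delta^h_{n+1}f)(u^1,\dots,u^p)=f(u^1_{(1)},\dots,u^p_{(1)})\otimes u^1_{(2)}\cdots u^p_{(2)}$; $\sigma^h_jf=(\mathrm{id}^{j}\otimes\varepsilon\otimes\mathrm{id}^{n-j-1})f$ for $0\le j\le n-1$; and $$(\tau_{\mathrm{coalg}}f)(u^1,\dots,u^p)=\big(u^1_{(1)}\cdots u^p_{(1)}S(f^{(1)}(u^1_{(2)},\dots,u^p_{(2)}))\big)\triangleright\big(f^{(2)}(u^1_{(2)},\dots,u^p_{(2)})\otimes\cdots\otimes f^{(n)}(u^1_{(2)},\dots,u^p_{(2)})\otimes u^1_{(3)}\cdots u^p_{(3)}\big).$$ In degree $n=0$ both $\tau_{\mathrm{alg}}$ and $\tau_{\mathrm{coalg}}$ are the identity. Diagonal: $C^n_{\mathrm{diag}}(H)=\mathrm{Hom}_{\mathbb{K}}(H^{\otimes n},H^{\otimes n})$ with cofaces $\delta^{\mathrm{diag}}_i=\delta^v_i\delta^h_i$ and codegeneracies $\sigma^{\mathrm{diag}}_j=\sigma^v_j\sigma^h_j$. Definitions. A para-cocyclic $\mathbb{K}$-module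 is a cosimplicial $\mathbb{K}$-module $(C^\bullet,\delta_\bullet,\sigma_\bullet)$ with $\mathbb{K}$-linear maps $\tau_n:C^n\to C^n$ such that $\tau_n\delta_i=\delta_{i-1}\tau_{n-1}$ for $1\le i\le n$, $\tau_n\delta_0=\delta_n$, $\tau_n\sigma_i=\sigma_{i-1}\tau_{n+1}$ for $1\le i\le n$, $\tau_n\sigma_0=\sigma_n\tau_{n+1}^2$. It is cocyclic (cyclic) if moreover $\tau_n^{n+1}=\mathrm{id}$ for all $n$. A bi-para-cocyclic $\mathbb{K}$-module is a double complex whose rows and columns are para-cocyclic $\mathbb{K}$-modules and all of whose vertical structure maps commute with all horizontal ones. It is cylindrical if in addition $\tau_v^{p+1}\circ\tau_h^{q+1}=\mathrm{id}$ in bidegree $(p,q)$, where $\tau_v,\tau_h$ are the vertical and horizontal operators. *)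

theory Defs
  imports Complex_Main "HOL-Library.Function_Algebras" "HOL-Library.FuncSet"
begin

section \<open>Linear maps on subspaces\<close>

text \<open>Functions into a module form a module under the pointwise operations; addition is the one of
  \<^theory>\<open>HOL-Library.Function_Algebras\<close>.\<close>

definition fun_scale :: "('k \<Rightarrow> 'v \<Rightarrow> 'v) \<Rightarrow> 'k \<Rightarrow> ('a \<Rightarrow> 'v) \<Rightarrow> 'a \<Rightarrow> 'v" where
  "fun_scale s c f = (\<lambda>x. s c (f x))"

definition linear_on ::
  "('k \<Rightarrow> 'v \<Rightarrow> 'v) \<Rightarrow> ('k \<Rightarrow> 'w \<Rightarrow> 'w) \<Rightarrow> 'v::plus set \<Rightarrow> 'w::plus set \<Rightarrow> ('v \<Rightarrow> 'w) \<Rightarrow> bool" where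
  "linear_on s1 s2 V W f \<longleftrightarrow>
     f \<in> V \<rightarrow> W \<and>
     (\<forall>x\<in>V. \<forall>y\<in>V. f (x + y) = f x + f y) \<and>
     (\<forall>c. \<forall>x\<in>V. f (s1 c x) = s2 c (f x))"


section \<open>Tensor powers of a vector space\<close>

definition multilinear ::
  "('k::field \<Rightarrow> 'v::ab_group_add \<Rightarrow> 'v) \<Rightarrow> ('k \<Rightarrow> 'w::ab_group_add \<Rightarrow> 'w) \<Rightarrow> nat \<Rightarrow> ('v list \<Rightarrow> 'w) \<Rightarrow> bool"
where
  "multilinear s1 s2 n F \<longleftrightarrow>
     (\<forall>xs ys. Suc (length xs + length ys) = n \<longrightarrow> Vector_Spaces.linear s1 s2 (\<lambda>x. F (xs @ x # ys)))"

text \<open>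
  The pure tensor \<open>v\<^sub>1 \<otimes> \<cdots> \<otimes> v\<^sub>n\<close> is the evaluation \<open>\<phi> \<mapsto> \<phi> [v\<^sub>1, \<dots>, v\<^sub>n]\<close> of multilinear forms, and the
  \<open>n\<close>-th tensor power is the span of the pure tensors of length \<open>n\<close>. Over a field this has the
  universal property of the \<open>n\<close>-fold tensor product (\<open>tensor_power_universal\<close> and
  \<open>tensor_power_unique\<close> below). A form \<open>\<phi>\<close> is a function on lists that is multilinear in every
  length, so that concatenation of lists is the tensor product; a vector \<open>v\<close> is identified with
  \<open>pure_tensor s [v]\<close> and a scalar \<open>c\<close> with \<open>c\<close> times \<open>pure_tensor s []\<close>.
\<close>

type_synonym ('k, 'v) tensor = "('v list \<Rightarrow> 'k) \<Rightarrow> 'k"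

abbreviation tensor_scale :: "'k::field \<Rightarrow> ('k, 'v) tensor \<Rightarrow> ('k, 'v) tensor" where
  "tensor_scale \<equiv> fun_scale (*)"

definition pure_tensor :: "('k::field \<Rightarrow> 'v::ab_group_add \<Rightarrow> 'v) \<Rightarrow> 'v list \<Rightarrow> ('k, 'v) tensor" where
  "pure_tensor s xs = (\<lambda>\<phi>. if \<forall>n. multilinear s (*) n \<phi> then \<phi> xs else 0)"

definition tensor_power :: "('k::field \<Rightarrow> 'v::ab_group_add \<Rightarrow> 'v) \<Rightarrow> nat \<Rightarrow> ('k, 'v) tensor set" where
  "tensor_power s n = module.span tensor_scale (pure_tensor s ` {xs. length xs = n})"

text \<open>
  For \<open>F\<close> multilinear on lists of length \<open>n\<close>, \<open>tensor_lift n F\<close> is the linear map on the \<open>n\<close>-th tensor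
  power given by \<open>F\<close> on pure tensors (\<open>linear_tensor_lift\<close> and \<open>tensor_lift_pure\<close> below). For
  \<open>t = \<Sum> x\<^sub>1 \<otimes> \<cdots> \<otimes> x\<^sub>n\<close>, the expression \<open>tensor_lift n (\<lambda>xs. F xs) t\<close> renders \<open>\<Sum> F [x\<^sub>1, \<dots>, x\<^sub>n]\<close>.
\<close>

definition tensor_lift :: "nat \<Rightarrow> ('v list \<Rightarrow> ('k::field, 'w) tensor) \<Rightarrow> ('k, 'v) tensor \<Rightarrow> ('k, 'w) tensor" where
  "tensor_lift n F t = (\<lambda>\<phi>. t (\<lambda>xs. if length xs = n then F xs \<phi> else 0))"

lemma vector_space_mult: "vector_space ((*) :: 'k::field \<Rightarrow> 'k \<Rightarrow> 'k)"
  by unfold_locales (simp_all add: algebra_simps)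

lemma vector_space_fun_scale: "vector_space s \<Longrightarrow> vector_space (fun_scale s)"
  by (auto simp: vector_space_def fun_scale_def fun_eq_iff)

lemma vector_space_tensor: "vector_space (tensor_scale :: 'k::field \<Rightarrow> ('k, 'v) tensor \<Rightarrow> _)"
  by (intro vector_space_fun_scale vector_space_mult)

lemma pure_cutoff:
  fixes s :: "'k::field \<Rightarrow> 'v::ab_group_add \<Rightarrow> 'v"
  assumes "vector_space s" "multilinear s (*) n \<phi>" "length xs = n"
  shows "pure_tensor s xs (\<lambda>ys. if length ys = n then \<phi> ys else 0) = \<phi> xs"
proof -
  have "multilinear s (*) m (\<lambda>ys. if length ys = n then \<phi> ys else 0)" for m
    using assms(1,2) vector_space_mult by (auto simp: multilinear_def Vector_Spaces.linear_iff)
  then show ?thesis using assms(3) by (simp add: pure_tensor_def)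
qed

lemma multilinear_pure:
  fixes s :: "'k::field \<Rightarrow> 'v::ab_group_add \<Rightarrow> 'v"
  assumes "vector_space s"
  shows "multilinear s tensor_scale n (pure_tensor s)"
  using assms vector_space_tensor
  by (auto simp: multilinear_def Vector_Spaces.linear_iff pure_tensor_def fun_eq_iff fun_scale_def)

lemma linear_tensor_lift:
  fixes F :: "'v list \<Rightarrow> ('k::field, 'w) tensor"
  shows "Vector_Spaces.linear tensor_scale tensor_scale (tensor_lift n F)"
  unfolding Vector_Spaces.linear_iff
  by (intro conjI vector_space_tensor) (auto simp: tensor_lift_def fun_scale_def fun_eq_iff)

lemma tensor_lift_pure:
  fixes s :: "'k::field \<Rightarrow> 'v::ab_group_add \<Rightarrow> 'v"
  assumes "vector_space s" "multilinear s tensor_scale n F" "length xs = n"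
  shows "tensor_lift n F (pure_tensor s xs) = F xs"
proof
  fix \<phi>
  have "multilinear s (*) n (\<lambda>xs. F xs \<phi>)"
    using assms(1,2) vector_space_mult
    by (auto simp: multilinear_def Vector_Spaces.linear_iff fun_scale_def)
  then show "tensor_lift n F (pure_tensor s xs) \<phi> = F xs \<phi>"
    using pure_cutoff[OF assms(1) _ assms(3)] by (simp add: tensor_lift_def)
qed

lemma tensor_power_unique:
  fixes s :: "'k::field \<Rightarrow> 'v::ab_group_add \<Rightarrow> 'v" and s' :: "'k \<Rightarrow> 'w::ab_group_add \<Rightarrow> 'w"
  assumes "vector_space s" "vector_space s'"
    and "linear_on tensor_scale s' (tensor_power s n) UNIV L"
    and "linear_on tensor_scale s' (tensor_power s n) UNIV L'"
    and "\<And>xs. length xs = n \<Longrightarrow> L (pure_tensor s xs) = L' (pure_tensor s xs)"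
    and "t \<in> tensor_power s n"
  shows "L t = L' t"
proof -
  interpret T: vector_space "tensor_scale :: 'k \<Rightarrow> ('k, 'v) tensor \<Rightarrow> _" by (rule vector_space_tensor)
  interpret W: vector_space s' by fact
  note lin = assms(3,4)[unfolded linear_on_def]
  have z: "L 0 = 0" "L' 0 = 0"
    using lin T.span_zero unfolding tensor_power_def
    by (metis T.scale_zero_left W.scale_zero_left)+
  let ?B = "pure_tensor s ` {xs. length xs = n}"
  have "t \<in> T.span ?B" using assms(6) by (simp add: tensor_power_def)
  then have "t \<in> T.span ?B \<and> L t = L' t"
  proof (induction rule: T.span_induct_alt)
    case base
    show ?case using z T.span_zero by metis
  next
    case (step c x y)
    then have x: "x \<in> T.span ?B" "L x = L' x" using assms(5) T.span_base by auto
    have cx: "tensor_scale c x \<in> T.span ?B" by (rule T.span_scale[OF x(1)])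
    have "L (tensor_scale c x + y) = L' (tensor_scale c x + y)"
      using lin x cx step by (simp add: tensor_power_def)
    then show ?case using cx step T.span_add by blast
  qed
  then show ?thesis by blast
qed

lemma separating_functional:
  assumes "vector_space s" "\<And>l. Vector_Spaces.linear s (*) l \<Longrightarrow> l w = (0::'k::field)"
  shows "w = 0"
proof (rule ccontr)
  assume "w \<noteq> 0"
  interpret P: vector_space_pair s "(*) :: 'k \<Rightarrow> 'k \<Rightarrow> 'k"
    using assms(1) vector_space_mult by (simp add: vector_space_pair_def)
  have ind: "P.vs1.independent {w}" using \<open>w \<noteq> 0\<close> by simp
  show False
    using assms(2)[OF P.linear_construct[OF ind, of "\<lambda>_. 1"]] P.construct_basis[OF ind, of w "\<lambda>_. 1"] by simp
qed

lemma tensor_power_universal: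
  fixes s :: "'k::field \<Rightarrow> 'v::ab_group_add \<Rightarrow> 'v" and s' :: "'k \<Rightarrow> 'w::ab_group_add \<Rightarrow> 'w"
  assumes "vector_space s" "vector_space s'" "multilinear s s' n F"
  shows "\<exists>L. Vector_Spaces.linear tensor_scale s' L \<and> (\<forall>xs. length xs = n \<longrightarrow> L (pure_tensor s xs) = F xs)"
proof -
  interpret P: vector_space_pair "tensor_scale :: 'k \<Rightarrow> ('k,'v) tensor \<Rightarrow> _" s'
    using assms(2) vector_space_tensor by (simp add: vector_space_pair_def)
  let ?B = "pure_tensor s ` {xs. length xs = n}"
  obtain B where B: "B \<subseteq> ?B" "P.vs1.independent B" "?B \<subseteq> P.vs1.span B"
    using P.vs1.maximal_independent_subset[of ?B] by blast
  define r where "r b = (SOME xs. length xs = n \<and> pure_tensor s xs = b)" for b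
  have r: "length (r b) = n \<and> pure_tensor s (r b) = b" if "b \<in> B" for b
    unfolding r_def by (rule someI_ex) (use that B(1) in auto)
  define L where "L = P.construct B (\<lambda>b. F (r b))"
  have lin: "Vector_Spaces.linear tensor_scale s' L"
    unfolding L_def by (rule P.linear_construct[OF B(2)])
  interpret L: Vector_Spaces.linear tensor_scale s' L by (rule lin)
  have "L (pure_tensor s xs) = F xs" if xs: "length xs = n" for xs
  proof -
    obtain T c where T: "finite T" "T \<subseteq> B" "pure_tensor s xs = (\<Sum>b\<in>T. tensor_scale (c b) b)"
      using B(3) xs unfolding P.vs1.span_explicit by blast
    have "L (pure_tensor s xs) = (\<Sum>b\<in>T. s' (c b) (L b))"
      by (simp add: T(3) L.sum L.scale)
    also have "\<dots> = (\<Sum>b\<in>T. s' (c b) (F (r b)))"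
      using T(2) by (intro sum.cong) (auto simp: L_def P.construct_basis[OF B(2)])
    finally have 1: "L (pure_tensor s xs) = (\<Sum>b\<in>T. s' (c b) (F (r b)))" .
    have "l (L (pure_tensor s xs) - F xs) = 0" if "Vector_Spaces.linear s' (*) l" for l :: "'w \<Rightarrow> 'k"
    proof -
      interpret l: Vector_Spaces.linear s' "(*)" l by fact
      have "multilinear s (*) n (\<lambda>ys. l (F ys))"
        using assms(3) that Vector_Spaces.linear_compose unfolding multilinear_def o_def by blast
      then have ev: "pure_tensor s ys (\<lambda>ys. if length ys = n then l (F ys) else 0) = l (F ys)"
        if "length ys = n" for ys
        using pure_cutoff[OF assms(1)] that by blast
      have sum_apply: "(\<Sum>b\<in>T. tensor_scale (c b) b) \<phi> = (\<Sum>b\<in>T. c b * b \<phi>)" for \<phi>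
        using T(1) by (induction T rule: finite_induct) (auto simp: fun_scale_def)
      have "l (F xs) = (\<Sum>b\<in>T. c b * b (\<lambda>ys. if length ys = n then l (F ys) else 0))"
        using ev[OF xs] by (simp add: T(3) sum_apply)
      also have "\<dots> = (\<Sum>b\<in>T. c b * l (F (r b)))"
      proof (rule sum.cong)
        fix b assume "b \<in> T"
        then have "length (r b) = n" "pure_tensor s (r b) = b" using r T(2) by auto
        then show "c b * b (\<lambda>ys. if length ys = n then l (F ys) else 0) = c b * l (F (r b))"
          using ev[of "r b"] by simp
      qed simp
      also have "\<dots> = l (L (pure_tensor s xs))" by (simp add: 1 l.sum l.scale)
      finally show ?thesis by (simp add: l.diff)
    qed
    then show ?thesis using separating_functional[OF assms(2)] by fastforce
  qed
  then show ?thesis using lin by blast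
qed

lemma pure_singleton_eq_iff:
  fixes s :: "'k::field \<Rightarrow> 'v::ab_group_add \<Rightarrow> 'v"
  assumes "vector_space s"
  shows "pure_tensor s [x] = pure_tensor s [y] \<longleftrightarrow> x = y"
proof -
  have "multilinear s s 1 hd"
    using assms by (auto simp: multilinear_def Vector_Spaces.linear_iff)
  then obtain L where "\<And>xs. length xs = 1 \<Longrightarrow> L (pure_tensor s xs) = hd xs"
    using tensor_power_universal[OF assms assms] by blast
  then show ?thesis by (metis One_nat_def length_Cons list.sel(1) list.size(3))
qed


section \<open>Hopf algebras\<close>

text \<open>The underlying ring is that of the type \<open>'h\<close>; the remaining structure is a record.\<close>

record ('k, 'h) hopf =
  hscale :: "'k \<Rightarrow> 'h \<Rightarrow> 'h"
  comult :: "'h \<Rightarrow> ('k, 'h) tensor"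
  counit :: "'h \<Rightarrow> 'k"
  antipode :: "'h \<Rightarrow> 'h"

abbreviation hpure :: "('k::field, 'h::ring_1) hopf \<Rightarrow> 'h list \<Rightarrow> ('k, 'h) tensor" where
  "hpure H \<equiv> pure_tensor (hscale H)"

abbreviation hpower :: "('k::field, 'h::ring_1) hopf \<Rightarrow> nat \<Rightarrow> ('k, 'h) tensor set" where
  "hpower H \<equiv> tensor_power (hscale H)"

definition tensor_mult ::
  "('k::field, 'h::ring_1) hopf \<Rightarrow> nat \<Rightarrow> ('k, 'h) tensor \<Rightarrow> ('k, 'h) tensor \<Rightarrow> ('k, 'h) tensor" where
  "tensor_mult H n s t = tensor_lift n (\<lambda>xs. tensor_lift n (\<lambda>ys. hpure H (map2 (*) xs ys)) t) s"

locale hopf_algebra =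
  fixes H :: "('k::field, 'h::ring_1) hopf"
  assumes vector_space: "vector_space (hscale H)"
    and scale_mult_left: "hscale H c (x * y) = hscale H c x * y"
    and scale_mult_right: "hscale H c (x * y) = x * hscale H c y"
    and linear_comult: "Vector_Spaces.linear (hscale H) tensor_scale (comult H)"
    and comult_in: "comult H u \<in> hpower H 2"
    and linear_counit: "Vector_Spaces.linear (hscale H) (*) (counit H)"
    and coassoc:
      "tensor_lift 2 (\<lambda>u. tensor_lift 2 (\<lambda>v. hpure H [v ! 0, v ! 1, u ! 1]) (comult H (u ! 0))) (comult H x) =
       tensor_lift 2 (\<lambda>u. tensor_lift 2 (\<lambda>v. hpure H [u ! 0, v ! 0, v ! 1]) (comult H (u ! 1))) (comult H x)"
    and counit_left: "tensor_lift 2 (\<lambda>u. hpure H [hscale H (counit H (u ! 0)) (u ! 1)]) (comult H x) = hpure H [x]"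
    and counit_right: "tensor_lift 2 (\<lambda>u. hpure H [hscale H (counit H (u ! 1)) (u ! 0)]) (comult H x) = hpure H [x]"
    and comult_mult: "comult H (x * y) = tensor_mult H 2 (comult H x) (comult H y)"
    and comult_one: "comult H 1 = hpure H [1, 1]"
    and counit_mult: "counit H (x * y) = counit H x * counit H y"
    and counit_one: "counit H 1 = 1"
    and linear_antipode: "Vector_Spaces.linear (hscale H) (hscale H) (antipode H)"
    and antipode_left:
      "tensor_lift 2 (\<lambda>u. hpure H [antipode H (u ! 0) * u ! 1]) (comult H x) = hpure H [hscale H (counit H x) 1]"
    and antipode_right:
      "tensor_lift 2 (\<lambda>u. hpure H [u ! 0 * antipode H (u ! 1)]) (comult H x) = hpure H [hscale H (counit H x) 1]"

text \<open>\<open>u\<^sub>(\<^sub>1\<^sub>) \<otimes> \<cdots> \<otimes> u\<^sub>(\<^sub>n\<^sub>)\<close>, which is \<open>\<epsilon>(u)\<close> for \<open>n = 0\<close>.\<close>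

primrec icomult :: "('k::field, 'h::ring_1) hopf \<Rightarrow> nat \<Rightarrow> 'h \<Rightarrow> ('k, 'h) tensor" where
  "icomult H 0 u = tensor_scale (counit H u) (hpure H [])"
| "icomult H (Suc n) u = tensor_lift 2 (\<lambda>v. tensor_lift n (\<lambda>w. hpure H (v ! 0 # w)) (icomult H n (v ! 1))) (comult H u)"

text \<open>
  \<open>sweedler H k [u\<^sup>1, \<dots>, u\<^sup>p] G\<close> is the Sweedler sum of \<open>G [[u\<^sup>1\<^sub>(\<^sub>1\<^sub>), \<dots>, u\<^sup>1\<^sub>(\<^sub>k\<^sub>)], \<dots>, [u\<^sup>p\<^sub>(\<^sub>1\<^sub>), \<dots>, u\<^sup>p\<^sub>(\<^sub>k\<^sub>)]]\<close>,
  and \<open>leg i\<close> extracts \<open>[u\<^sup>1\<^sub>(\<^sub>i\<^sub>), \<dots>, u\<^sup>p\<^sub>(\<^sub>i\<^sub>)]\<close> (counted from 1) from the argument of \<open>G\<close>.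
\<close>

primrec sweedler ::
  "('k::field, 'h::ring_1) hopf \<Rightarrow> nat \<Rightarrow> 'h list \<Rightarrow> ('h list list \<Rightarrow> ('k, 'h) tensor) \<Rightarrow> ('k, 'h) tensor" where
  "sweedler H k [] G = G []"
| "sweedler H k (u # us) G = tensor_lift k (\<lambda>v. sweedler H k us (\<lambda>m. G (v # m))) (icomult H k u)"

definition leg :: "nat \<Rightarrow> 'h list list \<Rightarrow> 'h list" where
  "leg i m = map (\<lambda>v. v ! (i - 1)) m"

definition lact ::
  "('k::field, 'h::ring_1) hopf \<Rightarrow> nat \<Rightarrow> 'h \<Rightarrow> ('k, 'h) tensor \<Rightarrow> ('k, 'h) tensor" where
  "lact H q u t = tensor_mult H q (icomult H q u) t"

definition ract ::
  "('k::field, 'h::ring_1) hopf \<Rightarrow> nat \<Rightarrow> ('k, 'h) tensor \<Rightarrow> 'h \<Rightarrow> ('k, 'h) tensor" where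
  "ract H q t u = tensor_mult H q t (icomult H q u)"


section \<open>The Gerstenhaber-Schack double complex\<close>

text \<open>
  \<open>GS H p q\<close> is the space of linear maps from the \<open>p\<close>-th to the \<open>q\<close>-th tensor power of \<open>H\<close>. Such a
  map is represented by its extension by 0 outside the \<open>p\<close>-th tensor power, so that equality of maps
  is equality in HOL.
\<close>

abbreviation hom_scale ::
  "'k::field \<Rightarrow> (('k, 'h) tensor \<Rightarrow> ('k, 'h) tensor) \<Rightarrow> ('k, 'h) tensor \<Rightarrow> ('k, 'h) tensor" where
  "hom_scale \<equiv> fun_scale tensor_scale"

definition GS ::
  "('k::field, 'h::ring_1) hopf \<Rightarrow> nat \<Rightarrow> nat \<Rightarrow> (('k, 'h) tensor \<Rightarrow> ('k, 'h) tensor) set" where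
  "GS H p q = {f. linear_on tensor_scale tensor_scale (hpower H p) (hpower H q) f \<and>
                  (\<forall>t. t \<notin> hpower H p \<longrightarrow> f t = 0)}"

definition hom_of ::
  "('k::field, 'h::ring_1) hopf \<Rightarrow> nat \<Rightarrow> ('h list \<Rightarrow> ('k, 'h) tensor) \<Rightarrow> ('k, 'h) tensor \<Rightarrow> ('k, 'h) tensor" where
  "hom_of H p F = (\<lambda>t. if t \<in> hpower H p then tensor_lift p F t else 0)"

text \<open>
  In the vertical structure maps the list \<open>us\<close> of arguments is \<open>[u\<^sup>0, \<dots>, u\<^sup>n]\<close> for the cofaces and
  \<open>[u\<^sup>1, u\<^sup>2, \<dots>]\<close> otherwise. All operators carry the bidegree of their argument \<open>f\<close>.
\<close>

definition delta_v ::
  "('k::field, 'h::ring_1) hopf \<Rightarrow> nat \<Rightarrow> nat \<Rightarrow> nat \<Rightarrow>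
   (('k, 'h) tensor \<Rightarrow> ('k, 'h) tensor) \<Rightarrow> ('k, 'h) tensor \<Rightarrow> ('k, 'h) tensor" where
  "delta_v H n q i f =
     (if i = 0 then hom_of H (Suc n) (\<lambda>us. lact H q (hd us) (f (hpure H (tl us))))
      else if i = Suc n then hom_of H (Suc n) (\<lambda>us. ract H q (f (hpure H (butlast us))) (last us))
      else hom_of H (Suc n)
             (\<lambda>us. f (hpure H (take (i - 1) us @ [us ! (i - 1) * us ! i] @ drop (i + 1) us))))"

definition sigma_v ::
  "('k::field, 'h::ring_1) hopf \<Rightarrow> nat \<Rightarrow> nat \<Rightarrow> nat \<Rightarrow>
   (('k, 'h) tensor \<Rightarrow> ('k, 'h) tensor) \<Rightarrow> ('k, 'h) tensor \<Rightarrow> ('k, 'h) tensor" where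
  "sigma_v H n q j f = hom_of H (n - 1) (\<lambda>us. f (hpure H (take j us @ [1] @ drop j us)))"

definition tau_alg ::
  "('k::field, 'h::ring_1) hopf \<Rightarrow> nat \<Rightarrow> nat \<Rightarrow>
   (('k, 'h) tensor \<Rightarrow> ('k, 'h) tensor) \<Rightarrow> ('k, 'h) tensor \<Rightarrow> ('k, 'h) tensor" where
  "tau_alg H n q f =
     (if n = 0 then f
      else hom_of H n (\<lambda>us. sweedler H 3 us (\<lambda>m.
        lact H q (prod_list (leg 3 m))
          (ract H q (f (hpure H (inv (antipode H) (prod_list (leg 2 m)) # butlast (leg 1 m))))
            (last (leg 1 m))))))"

definition delta_h ::
  "('k::field, 'h::ring_1) hopf \<Rightarrow> nat \<Rightarrow> nat \<Rightarrow> nat \<Rightarrow>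
   (('k, 'h) tensor \<Rightarrow> ('k, 'h) tensor) \<Rightarrow> ('k, 'h) tensor \<Rightarrow> ('k, 'h) tensor" where
  "delta_h H p n i f =
     (if i = 0 then hom_of H p (\<lambda>us. sweedler H 2 us (\<lambda>m.
        tensor_lift n (\<lambda>v. hpure H (prod_list (leg 1 m) # v)) (f (hpure H (leg 2 m)))))
      else if i = Suc n then hom_of H p (\<lambda>us. sweedler H 2 us (\<lambda>m.
        tensor_lift n (\<lambda>v. hpure H (v @ [prod_list (leg 2 m)])) (f (hpure H (leg 1 m)))))
      else (\<lambda>t. tensor_lift n (\<lambda>v. tensor_lift 2 (\<lambda>w. hpure H (take (i - 1) v @ w @ drop i v)) (comult H (v ! (i - 1)))) (f t)))"

definition sigma_h ::
  "('k::field, 'h::ring_1) hopf \<Rightarrow> nat \<Rightarrow> nat \<Rightarrow> nat \<Rightarrow>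
   (('k, 'h) tensor \<Rightarrow> ('k, 'h) tensor) \<Rightarrow> ('k, 'h) tensor \<Rightarrow> ('k, 'h) tensor" where
  "sigma_h H p n j f =
     (\<lambda>t. tensor_lift n (\<lambda>v. tensor_scale (counit H (v ! j)) (hpure H (take j v @ drop (j + 1) v))) (f t))"

definition tau_coalg ::
  "('k::field, 'h::ring_1) hopf \<Rightarrow> nat \<Rightarrow> nat \<Rightarrow>
   (('k, 'h) tensor \<Rightarrow> ('k, 'h) tensor) \<Rightarrow> ('k, 'h) tensor \<Rightarrow> ('k, 'h) tensor" where
  "tau_coalg H p n f =
     (if n = 0 then f
      else hom_of H p (\<lambda>us. sweedler H 3 us (\<lambda>m.
        tensor_lift n (\<lambda>v. lact H n (prod_list (leg 1 m) * antipode H (hd v))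
                      (hpure H (tl v @ [prod_list (leg 3 m)])))
          (f (hpure H (leg 2 m))))))"

definition delta_diag ::
  "('k::field, 'h::ring_1) hopf \<Rightarrow> nat \<Rightarrow> nat \<Rightarrow>
   (('k, 'h) tensor \<Rightarrow> ('k, 'h) tensor) \<Rightarrow> ('k, 'h) tensor \<Rightarrow> ('k, 'h) tensor" where
  "delta_diag H n i = delta_v H n (Suc n) i \<circ> delta_h H n n i"

definition sigma_diag ::
  "('k::field, 'h::ring_1) hopf \<Rightarrow> nat \<Rightarrow> nat \<Rightarrow>
   (('k, 'h) tensor \<Rightarrow> ('k, 'h) tensor) \<Rightarrow> ('k, 'h) tensor \<Rightarrow> ('k, 'h) tensor" where
  "sigma_diag H n j = sigma_v H n (n - 1) j \<circ> sigma_h H n n j"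

definition tau_diag ::
  "('k::field, 'h::ring_1) hopf \<Rightarrow> nat \<Rightarrow>
   (('k, 'h) tensor \<Rightarrow> ('k, 'h) tensor) \<Rightarrow> ('k, 'h) tensor \<Rightarrow> ('k, 'h) tensor" where
  "tau_diag H n = tau_alg H n n \<circ> tau_coalg H n n"


section \<open>Cocyclic and cylindrical modules\<close>

text \<open>
  The graded pieces are submodules \<open>C n\<close> of one ambient module. Structure maps are indexed by the
  degree of their argument: \<open>d n i\<close> maps \<open>C n\<close> to \<open>C (n + 1)\<close> for \<open>i \<le> n + 1\<close>, and \<open>s n j\<close> maps
  \<open>C n\<close> to \<open>C (n - 1)\<close> for \<open>j < n\<close>.
\<close>

locale cosimplicial_module = module scale
  for scale :: "'k::comm_ring_1 \<Rightarrow> 'v::ab_group_add \<Rightarrow> 'v" +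
  fixes C :: "nat \<Rightarrow> 'v set"
    and d s :: "nat \<Rightarrow> nat \<Rightarrow> 'v \<Rightarrow> 'v"
  assumes subspace_C: "subspace (C n)"
    and linear_d: "i \<le> Suc n \<Longrightarrow> linear_on scale scale (C n) (C (Suc n)) (d n i)"
    and linear_s: "j \<le> n \<Longrightarrow> linear_on scale scale (C (Suc n)) (C n) (s (Suc n) j)"
    and d_d: "\<lbrakk>x \<in> C n; i < j; j \<le> n + 2\<rbrakk> \<Longrightarrow> d (Suc n) j (d n i x) = d (Suc n) i (d n (j - 1) x)"
    and s_s: "\<lbrakk>x \<in> C (n + 2); i \<le> j; j \<le> n\<rbrakk> \<Longrightarrow>
                s (Suc n) j (s (n + 2) i x) = s (Suc n) i (s (n + 2) (Suc j) x)"
    and s_d_less: "\<lbrakk>x \<in> C n; i < j; j \<le> n\<rbrakk> \<Longrightarrow> s (Suc n) j (d n i x) = d (n - 1) i (s n (j - 1) x)"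
    and s_d_eq: "\<lbrakk>x \<in> C n; i = j \<or> i = Suc j; j \<le> n\<rbrakk> \<Longrightarrow> s (Suc n) j (d n i x) = x"
    and s_d_greater: "\<lbrakk>x \<in> C n; Suc j < i; i \<le> Suc n\<rbrakk> \<Longrightarrow> s (Suc n) j (d n i x) = d (n - 1) (i - 1) (s n j x)"

locale para_cocyclic_module = cosimplicial_module scale C d s
  for scale :: "'k::comm_ring_1 \<Rightarrow> 'v::ab_group_add \<Rightarrow> 'v" and C d s +
  fixes t :: "nat \<Rightarrow> 'v \<Rightarrow> 'v"
  assumes linear_t: "linear_on scale scale (C n) (C n) (t n)"
    and t_d: "\<lbrakk>x \<in> C n; 1 \<le> i; i \<le> Suc n\<rbrakk> \<Longrightarrow> t (Suc n) (d n i x) = d n (i - 1) (t n x)"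
    and t_d_0: "x \<in> C n \<Longrightarrow> t (Suc n) (d n 0 x) = d n (Suc n) x"
    and t_s: "\<lbrakk>x \<in> C (Suc n); 1 \<le> i; i \<le> n\<rbrakk> \<Longrightarrow> t n (s (Suc n) i x) = s (Suc n) (i - 1) (t (Suc n) x)"
    and t_s_0: "x \<in> C (Suc n) \<Longrightarrow> t n (s (Suc n) 0 x) = s (Suc n) n (t (Suc n) (t (Suc n) x))"

locale cocyclic_module = para_cocyclic_module scale C d s t
  for scale :: "'k::comm_ring_1 \<Rightarrow> 'v::ab_group_add \<Rightarrow> 'v" and C d s t +
  assumes t_power: "x \<in> C n \<Longrightarrow> (t n ^^ Suc n) x = x"

text \<open>In bidegree \<open>(p, q)\<close>, the vertical maps change \<open>p\<close> and the horizontal maps change \<open>q\<close>.\<close>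

locale bi_para_cocyclic_module =
  fixes scale :: "'k::comm_ring_1 \<Rightarrow> 'v::ab_group_add \<Rightarrow> 'v"
    and C :: "nat \<Rightarrow> nat \<Rightarrow> 'v set"
    and dv sv :: "nat \<Rightarrow> nat \<Rightarrow> nat \<Rightarrow> 'v \<Rightarrow> 'v" and tv :: "nat \<Rightarrow> nat \<Rightarrow> 'v \<Rightarrow> 'v"
    and dh sh :: "nat \<Rightarrow> nat \<Rightarrow> nat \<Rightarrow> 'v \<Rightarrow> 'v" and th :: "nat \<Rightarrow> nat \<Rightarrow> 'v \<Rightarrow> 'v"
  assumes column: "para_cocyclic_module scale (\<lambda>p. C p q) (\<lambda>p. dv p q) (\<lambda>p. sv p q) (\<lambda>p. tv p q)"
    and row: "para_cocyclic_module scale (\<lambda>q. C p q) (\<lambda>q. dh p q) (\<lambda>q. sh p q) (\<lambda>q. th p q)"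
    and dv_dh: "\<lbrakk>x \<in> C p q; i \<le> Suc p; j \<le> Suc q\<rbrakk> \<Longrightarrow>
                  dv p (Suc q) i (dh p q j x) = dh (Suc p) q j (dv p q i x)"
    and dv_sh: "\<lbrakk>x \<in> C p (Suc q); i \<le> Suc p; j \<le> q\<rbrakk> \<Longrightarrow>
                  dv p q i (sh p (Suc q) j x) = sh (Suc p) (Suc q) j (dv p (Suc q) i x)"
    and dv_th: "\<lbrakk>x \<in> C p q; i \<le> Suc p\<rbrakk> \<Longrightarrow> dv p q i (th p q x) = th (Suc p) q (dv p q i x)"
    and sv_dh: "\<lbrakk>x \<in> C (Suc p) q; i \<le> p; j \<le> Suc q\<rbrakk> \<Longrightarrow>
                  sv (Suc p) (Suc q) i (dh (Suc p) q j x) = dh p q j (sv (Suc p) q i x)"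
    and sv_sh: "\<lbrakk>x \<in> C (Suc p) (Suc q); i \<le> p; j \<le> q\<rbrakk> \<Longrightarrow>
                  sv (Suc p) q i (sh (Suc p) (Suc q) j x) = sh p (Suc q) j (sv (Suc p) (Suc q) i x)"
    and sv_th: "\<lbrakk>x \<in> C (Suc p) q; i \<le> p\<rbrakk> \<Longrightarrow> sv (Suc p) q i (th (Suc p) q x) = th p q (sv (Suc p) q i x)"
    and tv_dh: "\<lbrakk>x \<in> C p q; j \<le> Suc q\<rbrakk> \<Longrightarrow> tv p (Suc q) (dh p q j x) = dh p q j (tv p q x)"
    and tv_sh: "\<lbrakk>x \<in> C p (Suc q); j \<le> q\<rbrakk> \<Longrightarrow> tv p q (sh p (Suc q) j x) = sh p (Suc q) j (tv p (Suc q) x)"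
    and tv_th: "x \<in> C p q \<Longrightarrow> tv p q (th p q x) = th p q (tv p q x)"

locale cylindrical_module = bi_para_cocyclic_module scale C dv sv tv dh sh th
  for scale :: "'k::comm_ring_1 \<Rightarrow> 'v::ab_group_add \<Rightarrow> 'v" and C dv sv tv dh sh th +
  assumes cylindrical: "x \<in> C p q \<Longrightarrow> (tv p q ^^ Suc p) ((th p q ^^ Suc q) x) = x"

end

theory Submission
  imports Defs
begin

text \<open>Write \<open>u\<^sub>k\<close> for the \<open>k\<close>-th Sweedler legs of the arguments \<open>u\<^sup>1, \<dots>, u\<^sup>p\<close>, \<open>U\<^sub>k\<close> for the product of these legs, and
let the arrows stand for the diagonal actions of \<open>H\<close> on tensor powers.

\<^bold>\<open>Scalar Sweedler calculus.\<close> Over a field, a tensor is determined by its pairings with multilinear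
forms, so a cochain \<open>f\<close> is determined by the scalars \<open>ev f us \<psi> = \<psi>(f(us))\<close>. Fix a basis of \<open>H\<close>. The
pairing of a tensor with \<open>\<psi>\<close> is a finite linear combination of values of \<open>\<psi>\<close> at lists of basis vectors,
hence it makes sense for every function \<open>\<psi>\<close>, linear or not. The Sweedler sums \<open>sw u G\<close> (one element) and
\<open>sws us G\<close> (a list of elements, that is, the coalgebra \<open>H \<otimes> \<cdots> \<otimes> H\<close>) are defined in this way for
arbitrary \<open>G\<close>. Coassociativity and the exchange of independent sums then hold without side conditions and
serve as rewrite rules; only the laws for unit, counit, product and antipode ask for linearity in the
legs concerned. Each structure map of the double complex becomes one explicit Sweedler sum in the scalars
\<open>ev f us \<psi>\<close>, the diagonal actions being moved to the forms as \<open>L\<close> and \<open>R\<close>. Every identity of operators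
is thereby reduced to cancellations \<open>u\<^sub>1 S(u\<^sub>2) = \<epsilon>(u) = S(u\<^sub>1) u\<^sub>2\<close> of adjacent legs, and their mirror
images \<open>u\<^sub>2 S(u\<^sub>1) = \<epsilon>(u) = S(u\<^sub>2) u\<^sub>1\<close>, which hold because \<open>S\<^sup>2 = id\<close>.

\<^bold>\<open>Powers.\<close> For \<open>\<tau> = \<tau>\<^sub>a\<^sub>l\<^sub>g\<close> put \<open>(\<iota> g)(u) = U\<^sub>3 \<triangleright> g(S(U\<^sub>2), u\<^sub>1)\<close>. This is a left inverse of the coface
\<open>\<delta>\<^sub>0\<close>, and \<open>\<tau> \<iota> = \<iota> \<rho>\<close> for an operator \<open>\<rho>\<close> that moves one argument from the back to the front
(\<open>vtau_vdegen\<close>). Therefore \<open>\<tau>\<^sup>k = \<iota> \<rho>\<^sup>k \<delta>\<^sub>0\<close>, and since \<open>p + 1\<close> applications of \<open>\<rho>\<close> turn the list of arguments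
once around, \<open>\<tau>\<^sup>p\<^sup>+\<^sup>1 f(u) = U\<^sub>5 S(U\<^sub>2) \<triangleright> f(u\<^sub>3) \<triangleleft> S(U\<^sub>4) U\<^sub>1\<close> (\<open>tau_alg_full_power\<close>). In the same manner the
full power of \<open>\<tau>\<^sub>c\<^sub>o\<^sub>a\<^sub>l\<^sub>g\<close> is \<open>U\<^sub>1 S(U\<^sub>4) \<triangleright> f(u\<^sub>3) \<triangleleft> S(U\<^sub>2) U\<^sub>5\<close> (\<open>tau_coalg_full_power\<close>), and the two
conjugations are inverse to each other (\<open>cylindrical_identity\<close>).

\<^bold>\<open>Mixed relations.\<close> The inner horizontal cofaces and the horizontal codegeneracies compose \<open>f\<close> with a map
built from \<open>\<Delta>\<close> or \<open>\<epsilon>\<close>. As \<open>\<Delta>\<close> and \<open>\<epsilon>\<close> are multiplicative these are maps of \<open>H\<close>-bimodules, and the vertical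
maps use only the bimodule structure of the coefficients. Dually, the inner vertical cofaces and the
vertical codegeneracies precompose \<open>f\<close> with a coalgebra map that preserves the product of the arguments,
which is all that the horizontal maps use. The last cofaces are \<open>\<delta>\<^sub>n\<^sub>+\<^sub>1 = \<tau> \<delta>\<^sub>0\<close>. So only four relations
are left for a calculation: \<open>\<delta>\<^sub>0\<close> and \<open>\<tau>\<close> of one direction commute with \<open>\<delta>\<^sub>0\<close> and \<open>\<tau>\<close> of the other; the
hardest is \<open>tau_alg_tau_coalg\<close>.

\<^bold>\<open>Diagonal.\<close> The diagonal of any cylindrical module is cocyclic (\<open>diagonal_cocyclic\<close>): on it the commuting
operators satisfy \<open>(\<tau>\<^sub>v \<tau>\<^sub>h)\<^sup>n\<^sup>+\<^sup>1 = \<tau>\<^sub>v\<^sup>n\<^sup>+\<^sup>1 \<tau>\<^sub>h\<^sup>n\<^sup>+\<^sup>1 = id\<close>.\<close>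

declare One_nat_def [simp del] plus_fun_apply [simp del] zero_fun_apply [simp del]

section \<open>Finitely supported functionals\<close>

text \<open>A functional on functions that is a finite linear combination of evaluations, at points satisfying \<open>P\<close>.
Such functionals commute with one another (\<open>fsupp_swap\<close>), which is Fubini's theorem for Sweedler sums, and
they see a function only at the points that satisfy \<open>P\<close> (\<open>fsupp_cong\<close>).\<close>

definition fsupp :: "('a \<Rightarrow> bool) \<Rightarrow> (('a \<Rightarrow> 'k::field) \<Rightarrow> 'k) \<Rightarrow> bool" where
  "fsupp P x \<longleftrightarrow> (\<exists>cs. (\<forall>p\<in>set cs. P (snd p)) \<and> (\<forall>\<psi>. x \<psi> = (\<Sum>p\<leftarrow>cs. fst p * \<psi> (snd p))))"

lemma fsupp_cong:
  assumes "fsupp P x" "\<And>a. P a \<Longrightarrow> \<psi> a = \<chi> a"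
  shows "x \<psi> = x \<chi>"
proof -
  obtain cs where cs: "\<forall>p\<in>set cs. P (snd p)" "\<And>\<psi>. x \<psi> = (\<Sum>p\<leftarrow>cs. fst p * \<psi> (snd p))"
    using assms(1) by (auto simp: fsupp_def)
  show ?thesis
    unfolding cs(2) by (rule arg_cong[of _ _ sum_list], rule map_cong) (use cs(1) assms(2) in auto)
qed

lemma fsupp_add:
  assumes "fsupp P x"
  shows "x (\<lambda>a. \<psi> a + \<chi> a) = x \<psi> + x \<chi>"
  using assms by (auto simp: fsupp_def algebra_simps sum_list_addf)

lemma fsupp_mult:
  assumes "fsupp P x"
  shows "x (\<lambda>a. c * \<psi> a) = c * x \<psi>"
  using assms by (auto simp: fsupp_def sum_list_const_mult algebra_simps)

lemma fsupp_zero: "fsupp P x \<Longrightarrow> x (\<lambda>a. 0) = 0"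
  by (auto simp: fsupp_def)

lemma fsupp_swap:
  assumes "fsupp P x" "fsupp Q y"
  shows "x (\<lambda>a. y (\<lambda>b. G a b)) = y (\<lambda>b. x (\<lambda>a. G a b))"
proof -
  obtain cs where cs: "\<And>\<psi>. x \<psi> = (\<Sum>p\<leftarrow>cs. fst p * \<psi> (snd p))"
    using assms(1) by (auto simp: fsupp_def)
  have "(\<Sum>p\<leftarrow>cs. fst p * y (\<lambda>b. G (snd p) b)) = y (\<lambda>b. \<Sum>p\<leftarrow>cs. fst p * G (snd p) b)"
  proof (induction cs)
    case Nil
    show ?case using fsupp_zero[OF assms(2)] by simp
  next
    case (Cons p cs)
    then show ?case by (simp add: fsupp_add[OF assms(2)] fsupp_mult[OF assms(2)])
  qed
  then show ?thesis by (simp add: cs)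
qed

lemma fsupp_single: "P a \<Longrightarrow> fsupp P (\<lambda>\<psi>. \<psi> a)"
  unfolding fsupp_def by (rule exI[of _ "[(1, a)]"]) simp

lemma fsupp_null: "fsupp P (\<lambda>\<psi>. 0)"
  unfolding fsupp_def by (rule exI[of _ "[]"]) simp

lemma fsupp_plus:
  assumes "fsupp P x" "fsupp P y"
  shows "fsupp P (\<lambda>\<psi>. x \<psi> + y \<psi>)"
proof -
  obtain cs where cs: "\<forall>p\<in>set cs. P (snd p)" "\<And>\<psi>. x \<psi> = (\<Sum>p\<leftarrow>cs. fst p * \<psi> (snd p))"
    using assms(1) by (auto simp: fsupp_def)
  obtain ds where ds: "\<forall>p\<in>set ds. P (snd p)" "\<And>\<psi>. y \<psi> = (\<Sum>p\<leftarrow>ds. fst p * \<psi> (snd p))"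
    using assms(2) by (auto simp: fsupp_def)
  show ?thesis
    unfolding fsupp_def by (rule exI[of _ "cs @ ds"]) (use cs ds in auto)
qed

lemma fsupp_scale:
  assumes "fsupp P x"
  shows "fsupp P (\<lambda>\<psi>. c * x \<psi>)"
proof -
  obtain cs where cs: "\<forall>p\<in>set cs. P (snd p)" "\<And>\<psi>. x \<psi> = (\<Sum>p\<leftarrow>cs. fst p * \<psi> (snd p))"
    using assms(1) by (auto simp: fsupp_def)
  show ?thesis
    unfolding fsupp_def
    by (rule exI[of _ "map (\<lambda>p. (c * fst p, snd p)) cs"])
      (use cs in \<open>auto simp: sum_list_const_mult[symmetric] o_def mult.assoc\<close>)
qed

lemma fsupp_bind:
  assumes "fsupp P x" "\<And>a. P a \<Longrightarrow> fsupp Q (y a)"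
  shows "fsupp Q (\<lambda>\<psi>. x (\<lambda>a. y a \<psi>))"
proof -
  obtain cs where cs: "\<forall>p\<in>set cs. P (snd p)" "\<And>\<psi>. x \<psi> = (\<Sum>p\<leftarrow>cs. fst p * \<psi> (snd p))"
    using assms(1) by (auto simp: fsupp_def)
  have "fsupp Q (\<lambda>\<psi>. \<Sum>p\<leftarrow>cs. fst p * y (snd p) \<psi>)"
    using cs(1)
  proof (induction cs)
    case Nil
    show ?case by (simp add: fsupp_null)
  next
    case (Cons p cs)
    then show ?case by (auto intro!: fsupp_plus fsupp_scale assms(2))
  qed
  then show ?thesis by (simp add: cs(2))
qed

lemma fsupp_mono: "fsupp P x \<Longrightarrow> (\<And>a. P a \<Longrightarrow> Q a) \<Longrightarrow> fsupp Q x"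
  unfolding fsupp_def by blast


section \<open>Linear and multilinear forms\<close>

context hopf_algebra
begin

text \<open>Linear forms, linear endomorphisms and multilinear forms of \<open>H\<close> as bare predicates: their closure rules
serve as introduction rules, so that side conditions on linearity are proved by resolution. The
predicate \<open>entry_lin\<close> describes lists that depend linearly on a parameter through a single entry; a
multilinear form composed with such a list is linear.\<close>

definition lin :: "('h \<Rightarrow> 'k) \<Rightarrow> bool" where
  "lin g \<longleftrightarrow> (\<forall>x y. g (x + y) = g x + g y) \<and> (\<forall>c x. g (hscale H c x) = c * g x)"

definition linH :: "('h \<Rightarrow> 'h) \<Rightarrow> bool" where
  "linH g \<longleftrightarrow> (\<forall>x y. g (x + y) = g x + g y) \<and> (\<forall>c x. g (hscale H c x) = hscale H c (g x))"

definition entry_lin :: "('h \<Rightarrow> 'h list) \<Rightarrow> bool" where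
  "entry_lin g \<longleftrightarrow> (\<exists>xs h ys. linH h \<and> g = (\<lambda>x. xs @ h x # ys))"

definition ml :: "nat \<Rightarrow> ('h list \<Rightarrow> 'k) \<Rightarrow> bool" where
  "ml n \<psi> \<longleftrightarrow> (\<forall>xs ys. Suc (length xs + length ys) = n \<longrightarrow> lin (\<lambda>x. \<psi> (xs @ x # ys)))"

lemma lin_iff: "lin g \<longleftrightarrow> Vector_Spaces.linear (hscale H) (*) g"
  using vector_space vector_space_mult by (auto simp: lin_def Vector_Spaces.linear_iff)

lemma linH_iff: "linH g \<longleftrightarrow> Vector_Spaces.linear (hscale H) (hscale H) g"
  using vector_space by (auto simp: linH_def Vector_Spaces.linear_iff)

lemma ml_iff: "ml n \<psi> \<longleftrightarrow> multilinear (hscale H) (*) n \<psi>"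
  by (simp add: ml_def multilinear_def lin_iff)

lemma mlI: "(\<And>xs ys. Suc (length xs + length ys) = n \<Longrightarrow> lin (\<lambda>x. \<psi> (xs @ x # ys))) \<Longrightarrow> ml n \<psi>"
  by (simp add: ml_def)

lemma lin_comp: "lin F \<Longrightarrow> linH g \<Longrightarrow> lin (\<lambda>x. F (g x))"
  by (simp add: lin_def linH_def)

lemma lin_mlD:
  assumes "ml n \<psi>" "entry_lin g" "\<And>x. length (g x) = n"
  shows "lin (\<lambda>x. \<psi> (g x))"
proof -
  obtain xs h ys where g: "linH h" "g = (\<lambda>x. xs @ h x # ys)" using assms(2) by (auto simp: entry_lin_def)
  have "lin (\<lambda>x. \<psi> (xs @ x # ys))" using assms(1) assms(3)[of 0] g(2) by (simp add: ml_def)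
  then show ?thesis unfolding g(2) by (rule lin_comp) (rule g(1))
qed

lemma lin_add: "lin f \<Longrightarrow> lin g \<Longrightarrow> lin (\<lambda>x. f x + g x)"
  and lin_zero: "lin (\<lambda>x. 0)"
  by (simp_all add: lin_def algebra_simps)

lemma lin_sum_list: "(\<And>p. p \<in> set cs \<Longrightarrow> lin (g p)) \<Longrightarrow> lin (\<lambda>x. \<Sum>p\<leftarrow>cs. g p x)"
  by (induction cs) (auto intro: lin_add lin_zero)

lemma lin_mult_left: "lin g \<Longrightarrow> lin (\<lambda>x. c * g x)"
  by (simp add: lin_def algebra_simps)

lemma lin_mult_right: "lin g \<Longrightarrow> lin (\<lambda>x. g x * c)"
  by (simp add: lin_def algebra_simps)

lemma lin_fsupp:
  assumes "fsupp P x" "\<And>a. P a \<Longrightarrow> lin (\<lambda>z. G z a)"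
  shows "lin (\<lambda>z. x (G z))"
proof -
  obtain cs where cs: "\<forall>p\<in>set cs. P (snd p)" "\<And>\<psi>. x \<psi> = (\<Sum>p\<leftarrow>cs. fst p * \<psi> (snd p))"
    using assms(1) by (auto simp: fsupp_def)
  show ?thesis unfolding cs(2) by (intro lin_sum_list lin_mult_left assms(2)) (use cs(1) in auto)
qed

lemma linH_id: "linH (\<lambda>x. x)" by (simp add: linH_def)
lemma linH_mult_left: "linH g \<Longrightarrow> linH (\<lambda>x. c * g x)"
  by (simp add: linH_def algebra_simps scale_mult_right)
lemma linH_mult_right: "linH g \<Longrightarrow> linH (\<lambda>x. g x * c)"
  by (simp add: linH_def algebra_simps scale_mult_left)
lemma linH_comp: "linH f \<Longrightarrow> linH g \<Longrightarrow> linH (\<lambda>x. f (g x))" by (simp add: linH_def)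
lemma linH_antipode': "linH (antipode H)"
  using linear_antipode by (simp add: linH_iff)
lemma linH_antipode: "linH g \<Longrightarrow> linH (\<lambda>x. antipode H (g x))"
  by (rule linH_comp[OF linH_antipode'])
lemma lin_counit': "lin (counit H)"
  using linear_counit by (simp add: lin_iff)
lemma lin_counit: "linH g \<Longrightarrow> lin (\<lambda>x. counit H (g x))"
  by (rule lin_comp[OF lin_counit'])

lemma linH_prod:
  assumes "entry_lin g" shows "linH (\<lambda>x. prod_list (g x))"
proof -
  obtain xs h ys where g: "linH h" "g = (\<lambda>x. xs @ h x # ys)" using assms by (auto simp: entry_lin_def)
  show ?thesis unfolding g(2) by (simp add: linH_mult_left linH_mult_right g(1))
qed

lemma entry_lin_Cons1: "linH g \<Longrightarrow> entry_lin (\<lambda>x. g x # c)"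
  unfolding entry_lin_def by (rule exI[of _ "[]"]) auto

lemma entry_lin_Cons2: "entry_lin g \<Longrightarrow> entry_lin (\<lambda>x. c # g x)"
  unfolding entry_lin_def by (metis append_Cons)

lemma entry_lin_append1: "entry_lin g \<Longrightarrow> entry_lin (\<lambda>x. g x @ c)"
  unfolding entry_lin_def by (metis append_Cons append_assoc)

lemma entry_lin_append2: "entry_lin g \<Longrightarrow> entry_lin (\<lambda>x. c @ g x)"
  unfolding entry_lin_def by (metis append_assoc)

lemma entry_lin_map2_left:
  assumes "entry_lin g" "\<And>x. length (g x) = length v"
  shows "entry_lin (\<lambda>x. map2 (*) (g x) v)"
proof -
  obtain xs h ys where g: "linH h" "g = (\<lambda>x. xs @ h x # ys)" using assms(1) by (auto simp: entry_lin_def)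
  have "length v = length xs + Suc (length ys)" using assms(2)[of 0] by (simp add: g(2))
  then obtain v1 y v2 where v: "v = v1 @ y # v2" "length v1 = length xs" "length v2 = length ys"
    by (metis append_eq_conv_conj length_Suc_conv length_append length_take le_add1 min.absorb2 add_left_cancel append_take_drop_id)
  have "(\<lambda>x. map2 (*) (g x) v) = (\<lambda>x. map2 (*) xs v1 @ (h x * y) # map2 (*) ys v2)"
    using v by (simp add: g(2) v(1))
  then show ?thesis unfolding entry_lin_def using linH_mult_right[OF g(1)] by blast
qed

lemma entry_lin_map2_right:
  assumes "entry_lin g" "\<And>x. length (g x) = length v"
  shows "entry_lin (\<lambda>x. map2 (*) v (g x))"
proof -
  obtain xs h ys where g: "linH h" "g = (\<lambda>x. xs @ h x # ys)" using assms(1) by (auto simp: entry_lin_def)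
  have "length v = length xs + Suc (length ys)" using assms(2)[of 0] by (simp add: g(2))
  then obtain v1 y v2 where v: "v = v1 @ y # v2" "length v1 = length xs" "length v2 = length ys"
    by (metis append_eq_conv_conj length_Suc_conv length_append length_take le_add1 min.absorb2 add_left_cancel append_take_drop_id)
  have "(\<lambda>x. map2 (*) v (g x)) = (\<lambda>x. map2 (*) v1 xs @ (y * h x) # map2 (*) v2 ys)"
    using v by (simp add: g(2) v(1))
  then show ?thesis unfolding entry_lin_def using linH_mult_left[OF g(1)] by blast
qed


section \<open>Multilinear extension from a basis\<close>

sublocale V: vector_space "hscale H" by (rule vector_space)

definition bas :: "'h set" where "bas = V.extend_basis {}"

lemma independent_bas: "V.independent bas" and span_bas: "V.span bas = UNIV"
  by (simp_all add: bas_def V.independent_extend_basis V.span_extend_basis V.independent_empty)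

text \<open>The linear form that agrees with \<open>\<psi>\<close> on the basis \<open>bas\<close>.\<close>

definition linext :: "('h \<Rightarrow> 'k) \<Rightarrow> 'h \<Rightarrow> 'k" where
  "linext \<psi> x = (\<Sum>b | V.representation bas x b \<noteq> 0. V.representation bas x b * \<psi> b)"

lemma linext_superset:
  assumes "finite A" "{b. V.representation bas x b \<noteq> 0} \<subseteq> A"
  shows "linext \<psi> x = (\<Sum>b\<in>A. V.representation bas x b * \<psi> b)"
  unfolding linext_def by (rule sum.mono_neutral_left) (use assms in auto)

lemma lin_linext: "lin (linext \<psi>)"
proof -
  let ?R = "V.representation bas"
  have fin: "finite {b. ?R x b \<noteq> 0}" for x by (rule V.finite_representation)
  have "linext \<psi> (x + y) = linext \<psi> x + linext \<psi> y" for x y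
  proof -
    let ?A = "{b. ?R x b \<noteq> 0} \<union> {b. ?R y b \<noteq> 0}"
    have R: "?R (x + y) = (\<lambda>b. ?R x b + ?R y b)"
      by (rule V.representation_add) (simp_all add: independent_bas span_bas)
    have "{b. ?R (x + y) b \<noteq> 0} \<subseteq> ?A" by (auto simp: R)
    then show ?thesis
      using fin by (simp add: linext_superset[of ?A] R algebra_simps sum.distrib)
  qed
  moreover have "linext \<psi> (hscale H c x) = c * linext \<psi> x" for c x
  proof -
    have R: "?R (hscale H c x) = (\<lambda>b. c * ?R x b)"
      by (rule V.representation_scale) (simp_all add: independent_bas span_bas)
    have "{b. ?R (hscale H c x) b \<noteq> 0} \<subseteq> {b. ?R x b \<noteq> 0}" by (auto simp: R)
    then show ?thesis
      using fin by (simp add: linext_superset[of "{b. ?R x b \<noteq> 0}"] R algebra_simps sum_distrib_left)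
  qed
  ultimately show ?thesis by (simp add: lin_def)
qed

lemma linext_eq:
  assumes "lin \<psi>" shows "linext \<psi> x = \<psi> x"
proof -
  interpret l: Vector_Spaces.linear "hscale H" "(*)" \<psi> using assms by (simp add: lin_iff)
  have "\<psi> x = \<psi> (\<Sum>b | V.representation bas x b \<noteq> 0. hscale H (V.representation bas x b) b)"
    by (subst V.sum_nonzero_representation_eq) (simp_all add: independent_bas span_bas)
  also have "\<dots> = linext \<psi> x" by (simp add: l.sum l.scale linext_def)
  finally show ?thesis by simp
qed

lemma linext_basis: "b \<in> bas \<Longrightarrow> linext \<psi> b = \<psi> b"
  by (simp add: linext_def V.representation_basis[OF independent_bas])

lemma fsupp_linext: "fsupp (\<lambda>b. b \<in> bas) (\<lambda>\<psi>. linext \<psi> x)"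
proof -
  let ?A = "{b. V.representation bas x b \<noteq> 0}"
  obtain bs where bs: "set bs = ?A" "distinct bs"
    using finite_distinct_list[OF V.finite_representation] by metis
  have "\<forall>\<psi>. linext \<psi> x = (\<Sum>p\<leftarrow>map (\<lambda>b. (V.representation bas x b, b)) bs. fst p * \<psi> (snd p))"
    using bs by (simp add: linext_def o_def sum_list_distinct_conv_sum_set)
  then show ?thesis
    unfolding fsupp_def using bs V.representation_ne_zero
    by (intro exI[of _ "map (\<lambda>b. (V.representation bas x b, b)) bs"]) auto
qed

text \<open>The multilinear extension of \<open>\<psi>\<close> from lists of basis vectors. It is multilinear in every degree, as the
forms on which tensors are evaluated have to be.\<close>

primrec mlext :: "'h list \<Rightarrow> ('h list \<Rightarrow> 'k) \<Rightarrow> 'k" where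
  "mlext [] \<psi> = \<psi> []"
| "mlext (x # xs) \<psi> = linext (\<lambda>b. mlext xs (\<lambda>bs. \<psi> (b # bs))) x"

definition blist :: "nat \<Rightarrow> 'h list \<Rightarrow> bool" where
  "blist n bs \<longleftrightarrow> length bs = n \<and> set bs \<subseteq> bas"

lemma fsupp_mlext: "fsupp (blist (length xs)) (mlext xs)"
proof (induction xs)
  case Nil
  show ?case unfolding mlext.simps by (rule fsupp_single) (simp add: blist_def)
next
  case (Cons x xs)
  have "fsupp (blist (Suc (length xs))) (\<lambda>\<psi>. mlext xs (\<lambda>bs. \<psi> (b # bs)))" if "b \<in> bas" for b
    by (rule fsupp_bind[where y = "\<lambda>bs \<psi>. \<psi> (b # bs)", OF Cons fsupp_single]) (use that in \<open>simp add: blist_def\<close>)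
  from fsupp_bind[OF fsupp_linext this] show ?case by simp
qed

lemma lin_mlext_slot: "lin (\<lambda>x. mlext (xs @ x # ys) \<psi>)"
proof (induction xs arbitrary: \<psi>)
  case Nil
  show ?case by (simp add: lin_linext)
next
  case (Cons a xs)
  show ?case by (simp, rule lin_fsupp[OF fsupp_linext]) (rule Cons)
qed

lemma ml_mlext: "ml n (\<lambda>xs. mlext xs \<psi>)"
  by (intro mlI lin_mlext_slot)

lemma mlext_eq: "ml (length xs) \<psi> \<Longrightarrow> mlext xs \<psi> = \<psi> xs"
proof (induction xs arbitrary: \<psi>)
  case (Cons x xs)
  have "ml (length xs) (\<lambda>bs. \<psi> (b # bs))" for b
    by (rule mlI, rule lin_mlD[OF Cons.prems]) (simp_all add: entry_lin_Cons1 entry_lin_Cons2 entry_lin_append2 linH_id)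
  then have "mlext (x # xs) \<psi> = linext (\<lambda>b. \<psi> (b # xs)) x" by (simp add: Cons.IH)
  also have "\<dots> = \<psi> (x # xs)"
    by (rule linext_eq, rule lin_mlD[OF Cons.prems]) (simp_all add: entry_lin_Cons1 linH_id)
  finally show ?case .
qed simp

lemma mlext_blist: "blist n bs \<Longrightarrow> mlext bs \<psi> = \<psi> bs"
  unfolding blist_def by (induction bs arbitrary: \<psi> n) (auto simp: linext_basis)

text \<open>The pairing of a tensor with an arbitrary function on lists, of which only the values at lists of basis
vectors matter. For a function that is multilinear in the degree of the tensor this is the usual pairing
(\<open>E_cutoff\<close>). It is not the value \<open>t \<psi>\<close>, because a pure tensor vanishes on \<open>\<psi>\<close> as soon as \<open>\<psi>\<close> fails to
be multilinear in some other degree.\<close>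

definition E :: "('k, 'h) tensor \<Rightarrow> ('h list \<Rightarrow> 'k) \<Rightarrow> 'k" where
  "E t \<psi> = t (\<lambda>xs. mlext xs \<psi>)"

interpretation T: vector_space "tensor_scale :: 'k \<Rightarrow> ('k, 'h) tensor \<Rightarrow> _" by (rule vector_space_tensor)

lemma E_add: "E (s + t) \<psi> = E s \<psi> + E t \<psi>"
  and E_scale: "E (tensor_scale c t) \<psi> = c * E t \<psi>"
  and E_zero: "E 0 \<psi> = 0"
  by (simp_all add: E_def fun_scale_def plus_fun_apply zero_fun_apply)

lemma pure_ml: "(\<And>n. ml n \<psi>) \<Longrightarrow> hpure H xs \<psi> = \<psi> xs"
  by (simp add: pure_tensor_def ml_iff)

lemma E_pure: "E (hpure H xs) \<psi> = mlext xs \<psi>"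
  unfolding E_def by (rule pure_ml) (rule ml_mlext)

lemma pure_in: "length xs = n \<Longrightarrow> hpure H xs \<in> hpower H n"
  unfolding tensor_power_def by (rule T.span_base) simp

lemma hpower_zero: "0 \<in> hpower H n"
  and hpower_add: "s \<in> hpower H n \<Longrightarrow> t \<in> hpower H n \<Longrightarrow> s + t \<in> hpower H n"
  and hpower_scale: "t \<in> hpower H n \<Longrightarrow> tensor_scale c t \<in> hpower H n"
  unfolding tensor_power_def by (rule T.span_zero T.span_add T.span_scale; assumption)+

lemma hpower_induct [consumes 1, case_names zero step]:
  assumes "t \<in> hpower H n" "P 0"
    and "\<And>c xs t. length xs = n \<Longrightarrow> t \<in> hpower H n \<Longrightarrow> P t \<Longrightarrow> P (tensor_scale c (hpure H xs) + t)"
  shows "P t"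
proof -
  let ?B = "pure_tensor (hscale H) ` {xs. length xs = n}"
  have "t \<in> T.span ?B" using assms(1) by (simp add: tensor_power_def)
  then have "t \<in> T.span ?B \<and> P t"
  proof (induction rule: T.span_induct_alt)
    case base
    then show ?case using assms(2) T.span_zero by blast
  next
    case (step c x y)
    then obtain xs where "x = hpure H xs" "length xs = n" by auto
    moreover have "tensor_scale c x + y \<in> T.span ?B"
      using step by (metis T.span_add T.span_scale T.span_base)
    ultimately show ?case using step assms(3)[of xs y c] by (simp add: tensor_power_def)
  qed
  then show ?thesis by blast
qed

lemma fsupp_E:
  assumes "t \<in> hpower H n" shows "fsupp (blist n) (E t)"
  using assms
proof (induction rule: hpower_induct)
  case zero
  have "E 0 = (\<lambda>\<psi>. 0)" by (rule ext) (rule E_zero)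
  then show ?case by (simp only: fsupp_null)
next
  case (step c xs t)
  have "E (tensor_scale c (hpure H xs) + t) = (\<lambda>\<psi>. c * mlext xs \<psi> + E t \<psi>)"
    by (simp add: fun_eq_iff E_add E_scale E_pure)
  then show ?case using fsupp_plus[OF fsupp_scale[OF fsupp_mlext[of xs, unfolded step(1)]] step(3)] by simp
qed

text \<open>Forms multilinear in the single degree \<open>n\<close> separate points: a form that is multilinear in all degrees is
in particular multilinear in degree \<open>n\<close>, and on every other form all tensors vanish.\<close>

lemma tensor_eqI:
  assumes "s \<in> hpower H n" "t \<in> hpower H n" "\<And>\<psi>. ml n \<psi> \<Longrightarrow> E s \<psi> = E t \<psi>"
  shows "s = t"
proof
  fix \<phi>
  show "s \<phi> = t \<phi>"
  proof (cases "\<forall>m. ml m \<phi>")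
    case True
    then have "(\<lambda>xs. mlext xs \<phi>) = \<phi>" by (simp add: fun_eq_iff mlext_eq)
    then show ?thesis using assms(3)[of \<phi>] True by (simp add: E_def)
  next
    case False
    have z: "t \<phi> = 0" if "t \<in> hpower H n" for t
      using that
      by (induction rule: hpower_induct) (use False in \<open>auto simp: fun_scale_def pure_tensor_def ml_iff plus_fun_apply zero_fun_apply\<close>)
    show ?thesis by (simp only: z[OF assms(1)] z[OF assms(2)])
  qed
qed

lemma E_cutoff:
  assumes "t \<in> hpower H n" "ml n \<psi>"
  shows "t (\<lambda>xs. if length xs = n then \<psi> xs else 0) = E t \<psi>"
  using assms(1)
proof (induction rule: hpower_induct)
  case zero
  show ?case unfolding E_zero by (simp add: zero_fun_apply)
next
  case (step c xs t)
  have "hpure H xs (\<lambda>xs. if length xs = n then \<psi> xs else 0) = \<psi> xs"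
    using pure_cutoff[OF vector_space] assms(2) step(1) by (simp add: ml_iff)
  then show ?case using step assms(2)
    unfolding E_add E_scale E_pure by (simp add: plus_fun_apply mlext_eq fun_scale_def)
qed

lemma E_mlext: "t \<in> hpower H n \<Longrightarrow> E t (\<lambda>xs. mlext xs \<psi>) = E t \<psi>"
  by (rule fsupp_cong[OF fsupp_E]) (auto intro: mlext_blist)

text \<open>Multilinear maps on lists of length \<open>n\<close> with values in the \<open>m\<close>-th tensor power, tested by multilinear forms.\<close>

definition tml :: "nat \<Rightarrow> nat \<Rightarrow> ('h list \<Rightarrow> ('k, 'h) tensor) \<Rightarrow> bool" where
  "tml n m F \<longleftrightarrow> (\<forall>xs. length xs = n \<longrightarrow> F xs \<in> hpower H m) \<and> (\<forall>\<psi>. ml m \<psi> \<longrightarrow> ml n (\<lambda>xs. E (F xs) \<psi>))"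

lemma tmlI:
  "(\<And>xs. length xs = n \<Longrightarrow> F xs \<in> hpower H m) \<Longrightarrow> (\<And>\<psi>. ml m \<psi> \<Longrightarrow> ml n (\<lambda>xs. E (F xs) \<psi>)) \<Longrightarrow> tml n m F"
  by (simp add: tml_def)

lemma tml_in: "tml n m F \<Longrightarrow> length xs = n \<Longrightarrow> F xs \<in> hpower H m"
  by (simp add: tml_def)

lemma ml_cong: "(\<And>xs. length xs = n \<Longrightarrow> \<psi> xs = \<chi> xs) \<Longrightarrow> ml n \<psi> \<longleftrightarrow> ml n \<chi>"
  by (auto simp: ml_def)

lemma tml_E_all:
  assumes "tml n m F" shows "ml n (\<lambda>xs. E (F xs) \<psi>)"
proof -
  have "ml n (\<lambda>xs. E (F xs) (\<lambda>ys. mlext ys \<psi>))" using assms ml_mlext by (simp add: tml_def)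
  then show ?thesis
    by (rule ml_cong[THEN iffD1, rotated]) (use assms in \<open>simp add: E_mlext[of _ m] tml_def\<close>)
qed

lemma tml_multilinear:
  assumes "tml n m F" shows "multilinear (hscale H) tensor_scale n F"
  unfolding multilinear_def Vector_Spaces.linear_iff
proof (intro allI impI conjI vector_space vector_space_tensor)
  fix xs ys :: "'h list" assume len: "Suc (length xs + length ys) = n"
  have F: "F (xs @ x # ys) \<in> hpower H m" for x using tml_in[OF assms] len by simp
  have l: "lin (\<lambda>x. E (F (xs @ x # ys)) \<psi>)" if "ml m \<psi>" for \<psi>
    using assms len that by (simp add: tml_def ml_def)
  fix x y
  show "F (xs @ (x + y) # ys) = F (xs @ x # ys) + F (xs @ y # ys)"
    by (rule tensor_eqI[OF F hpower_add[OF F F]]) (use l in \<open>simp add: E_add lin_def\<close>)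
  fix c
  show "F (xs @ hscale H c x # ys) = tensor_scale c (F (xs @ x # ys))"
    by (rule tensor_eqI[OF F hpower_scale[OF F]]) (use l in \<open>simp add: E_scale lin_def\<close>)
qed

lemma tensor_lift_in:
  assumes "tml n m F" "t \<in> hpower H n"
  shows "tensor_lift n F t \<in> hpower H m"
  using assms(2)
proof (induction rule: hpower_induct)
  interpret l: Vector_Spaces.linear tensor_scale tensor_scale "tensor_lift n F :: ('k,'h) tensor \<Rightarrow> ('k,'h) tensor"
    by (rule linear_tensor_lift)
  case zero
  show ?case by (subst l.zero) (rule hpower_zero)
next
  interpret l: Vector_Spaces.linear tensor_scale tensor_scale "tensor_lift n F :: ('k,'h) tensor \<Rightarrow> ('k,'h) tensor"
    by (rule linear_tensor_lift)
  case (step c xs t)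
  have "tensor_lift n F (hpure H xs) = F xs"
    by (rule tensor_lift_pure[OF vector_space tml_multilinear[OF assms(1)] step(1)])
  then show ?case
    using step tml_in[OF assms(1) step(1)] by (simp add: l.add l.scale hpower_add hpower_scale)
qed

lemma E_tensor_lift:
  assumes "tml n m F" "t \<in> hpower H n"
  shows "E (tensor_lift n F t) \<psi> = E t (\<lambda>xs. E (F xs) \<psi>)"
proof -
  have "E (tensor_lift n F t) \<psi> = t (\<lambda>xs. if length xs = n then E (F xs) \<psi> else 0)"
    unfolding E_def[of "tensor_lift n F t"] tensor_lift_def by (simp add: E_def cong: if_cong)
  also have "\<dots> = E t (\<lambda>xs. E (F xs) \<psi>)"
    by (rule E_cutoff[OF assms(2) tml_E_all[OF assms(1)]])
  finally show ?thesis .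
qed


section \<open>Sweedler sums\<close>

text \<open>The Sweedler sum of \<open>G u\<^sub>1 u\<^sub>2\<close>. For \<open>G\<close> that is not bilinear it is the sum over the expansion of \<open>\<Delta>(u)\<close> in
the chosen basis; this keeps coassociativity and the exchange of sums unconditional.\<close>

definition sw :: "'h \<Rightarrow> ('h \<Rightarrow> 'h \<Rightarrow> 'k) \<Rightarrow> 'k" where
  "sw u G = E (comult H u) (\<lambda>v. G (v ! 0) (v ! 1))"

definition inbas2 :: "'h \<times> 'h \<Rightarrow> bool" where
  "inbas2 p \<longleftrightarrow> fst p \<in> bas \<and> snd p \<in> bas"

lemma fsupp_sw: "fsupp inbas2 (\<lambda>\<psi>. sw u (\<lambda>a b. \<psi> (a, b)))"
proof -
  have "fsupp inbas2 (\<lambda>\<psi>. E (comult H u) (\<lambda>v. \<psi> (v ! 0, v ! 1)))"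
    by (rule fsupp_bind[OF fsupp_E[OF comult_in] fsupp_single])
      (auto simp: inbas2_def blist_def)
  then show ?thesis by (simp add: sw_def)
qed

lemma sw_cong_bas: "(\<And>a b. a \<in> bas \<Longrightarrow> b \<in> bas \<Longrightarrow> F a b = G a b) \<Longrightarrow> sw u F = sw u G"
  using fsupp_cong[OF fsupp_sw, of "\<lambda>p. F (fst p) (snd p)" "\<lambda>p. G (fst p) (snd p)" u]
  by (simp add: inbas2_def)

lemma sw_mult_left: "sw u (\<lambda>a b. c * G a b) = c * sw u G"
  using fsupp_mult[OF fsupp_sw, of u c "\<lambda>p. G (fst p) (snd p)"] by simp

lemma fsupp_sw_swap:
  assumes "fsupp P x" shows "x (\<lambda>v. sw u (\<lambda>a b. G v a b)) = sw u (\<lambda>a b. x (\<lambda>v. G v a b))"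
  using fsupp_swap[OF assms fsupp_sw, where G = "\<lambda>v p. G v (fst p) (snd p)"] by simp

lemma sw_swap: "sw u (\<lambda>a b. sw v (\<lambda>c d. G a b c d)) = sw v (\<lambda>c d. sw u (\<lambda>a b. G a b c d))"
  using fsupp_sw_swap[OF fsupp_sw, where G = "\<lambda>p c d. G (fst p) (snd p) c d"] by simp

lemma lin_E:
  assumes "Vector_Spaces.linear (hscale H) tensor_scale t"
  shows "lin (\<lambda>x. E (t x) \<psi>)"
  using assms by (simp add: lin_def Vector_Spaces.linear_iff E_add E_scale)

lemma lin_sw': "lin (\<lambda>u. sw u G)"
  unfolding sw_def by (rule lin_E[OF linear_comult])

lemma lin_sw1: "linH g \<Longrightarrow> lin (\<lambda>x. sw (g x) G)"
  by (rule lin_comp[OF lin_sw'])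

lemma lin_sw2: "(\<And>a b. lin (\<lambda>x. G a b x)) \<Longrightarrow> lin (\<lambda>x. sw u (\<lambda>a b. G a b x))"
  using lin_fsupp[OF fsupp_sw, of "\<lambda>x p. G (fst p) (snd p) x" u] by simp

lemma entry_lin_id: "entry_lin (\<lambda>x. x # c)" by (rule entry_lin_Cons1[OF linH_id])

lemma lin_mlext: "entry_lin g \<Longrightarrow> lin (\<lambda>x. mlext (g x) \<psi>)"
  unfolding entry_lin_def using lin_comp[OF lin_mlext_slot] by auto

lemmas lin_rules = linH_id linH_mult_left linH_mult_right linH_antipode linH_prod
  entry_lin_Cons1 entry_lin_Cons2 entry_lin_append1 entry_lin_append2
  lin_mult_left lin_mult_right lin_counit lin_sw1 lin_sw2 lin_mlext

lemma ml2I: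
  assumes "\<And>b. lin (\<lambda>a. \<psi> [a, b])" "\<And>a. lin (\<lambda>b. \<psi> [a, b])"
  shows "ml 2 \<psi>"
proof (rule mlI)
  fix xs ys :: "'h list" assume "Suc (length xs + length ys) = 2"
  then have "(xs = [] \<and> (\<exists>b. ys = [b])) \<or> (ys = [] \<and> (\<exists>a. xs = [a]))"
    by (cases xs; cases ys) (auto simp: numeral_2_eq_2)
  then show "lin (\<lambda>x. \<psi> (xs @ x # ys))" using assms by auto
qed

lemma ml1I: "lin (\<lambda>a. \<psi> [a]) \<Longrightarrow> ml 1 \<psi>"
  by (rule mlI) auto

lemma length2: "length xs = 2 \<longleftrightarrow> (\<exists>a b. xs = [a, b])"
  by (auto simp: numeral_2_eq_2 length_Suc_conv)

lemma tml2I: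
  assumes "\<And>a b. F [a, b] \<in> hpower H m"
    and "\<And>\<psi> b. lin (\<lambda>a. E (F [a, b]) \<psi>)" "\<And>\<psi> a. lin (\<lambda>b. E (F [a, b]) \<psi>)"
  shows "tml 2 m F"
  by (rule tmlI) (use assms in \<open>auto simp: length2 intro: ml2I\<close>)

lemma E_lift_comult:
  assumes "\<And>a b. F [a, b] \<in> hpower H m"
    and "\<And>\<psi> b. lin (\<lambda>a. E (F [a, b]) \<psi>)" "\<And>\<psi> a. lin (\<lambda>b. E (F [a, b]) \<psi>)"
  shows "E (tensor_lift 2 F (comult H u)) \<psi> = sw u (\<lambda>a b. E (F [a, b]) \<psi>)"
    and "tensor_lift 2 F (comult H u) \<in> hpower H m"
proof -
  have t: "tml 2 m F" by (rule tml2I) (fact assms)+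
  have "E (tensor_lift 2 F (comult H u)) \<psi> = E (comult H u) (\<lambda>xs. E (F xs) \<psi>)"
    by (rule E_tensor_lift[OF t comult_in])
  also have "\<dots> = E (comult H u) (\<lambda>v. E (F [v ! 0, v ! 1]) \<psi>)"
    by (rule fsupp_cong[OF fsupp_E[OF comult_in]]) (auto simp: blist_def length2)
  finally show "E (tensor_lift 2 F (comult H u)) \<psi> = sw u (\<lambda>a b. E (F [a, b]) \<psi>)" by (simp add: sw_def)
  show "tensor_lift 2 F (comult H u) \<in> hpower H m" by (rule tensor_lift_in[OF t comult_in])
qed

text \<open>Both sides are sums over basis vectors, on which \<open>G\<close> agrees with its trilinear extension; for the
extension the claim is the coassociativity of \<open>\<Delta>\<close>.\<close>

lemma sw_coassoc: "sw x (\<lambda>r c. sw r (\<lambda>a b. G a b c)) = sw x (\<lambda>a r. sw r (\<lambda>b c. G a b c))"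
proof -
  let ?\<psi> = "\<lambda>v. G (v ! 0) (v ! 1) (v ! 2)"
  let ?F1 = "\<lambda>u. tensor_lift 2 (\<lambda>v. hpure H [v ! 0, v ! 1, u ! 1]) (comult H (u ! 0))"
  let ?F2 = "\<lambda>u. tensor_lift 2 (\<lambda>v. hpure H [u ! 0, v ! 0, v ! 1]) (comult H (u ! 1))"
  have F1: "E (?F1 [a, b]) \<psi> = sw a (\<lambda>c d. mlext [c, d, b] \<psi>)" for a b \<psi>
    by (subst E_lift_comult(1)[where m = 3]) (simp_all add: E_pure pure_in lin_rules del: mlext.simps)
  have F1_in: "?F1 [a, b] \<in> hpower H 3" for a b
    by (rule E_lift_comult(2)) (simp_all add: E_pure pure_in lin_rules del: mlext.simps)
  have F2: "E (?F2 [a, b]) \<psi> = sw b (\<lambda>c d. mlext [a, c, d] \<psi>)" for a b \<psi>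
    by (subst E_lift_comult(1)[where m = 3]) (simp_all add: E_pure pure_in lin_rules del: mlext.simps)
  have F2_in: "?F2 [a, b] \<in> hpower H 3" for a b
    by (rule E_lift_comult(2)) (simp_all add: E_pure pure_in lin_rules del: mlext.simps)
  have "E (tensor_lift 2 ?F1 (comult H x)) ?\<psi> = sw x (\<lambda>r c. sw r (\<lambda>a b. mlext [a, b, c] ?\<psi>))"
    by (subst E_lift_comult(1)[where m = 3], rule F1_in) (simp_all only: F1, (intro lin_rules)+)
  moreover have "E (tensor_lift 2 ?F2 (comult H x)) ?\<psi> = sw x (\<lambda>a r. sw r (\<lambda>b c. mlext [a, b, c] ?\<psi>))"
    by (subst E_lift_comult(1)[where m = 3], rule F2_in) (simp_all only: F2, (intro lin_rules)+)
  ultimately have "sw x (\<lambda>r c. sw r (\<lambda>a b. mlext [a, b, c] ?\<psi>)) = sw x (\<lambda>a r. sw r (\<lambda>b c. mlext [a, b, c] ?\<psi>))"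
    using coassoc[of x] by simp
  moreover have "mlext [a, b, c] ?\<psi> = G a b c" if "a \<in> bas" "b \<in> bas" "c \<in> bas" for a b c
    using that by (subst mlext_blist[of 3]) (simp_all add: blist_def)
  ultimately show ?thesis by (simp cong: sw_cong_bas)
qed

lemma mlext_single: "lin (\<lambda>a. \<psi> [a]) \<Longrightarrow> mlext [x] \<psi> = \<psi> [x]"
  using ml1I[of \<psi>] by (intro mlext_eq) (simp add: One_nat_def)

lemma mlext_pair: "(\<And>b. lin (\<lambda>a. \<psi> [a, b])) \<Longrightarrow> (\<And>a. lin (\<lambda>b. \<psi> [a, b])) \<Longrightarrow> mlext [x, y] \<psi> = \<psi> [x, y]"
  using ml2I by (intro mlext_eq) (simp add: numeral_2_eq_2)

lemma linH_scale: "linH g \<Longrightarrow> linH (\<lambda>x. hscale H c (g x))"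
  by (simp add: linH_def V.scale_right_distrib mult.commute)

lemma linH_scale_left: "lin g \<Longrightarrow> linH (\<lambda>x. hscale H (g x) c)"
  by (simp add: linH_def lin_def V.scale_left_distrib)

lemma E_lift_comult_single:
  assumes "\<And>b. linH (\<lambda>a. g a b)" "\<And>a. linH (\<lambda>b. g a b)" "lin F"
  shows "E (tensor_lift 2 (\<lambda>u. hpure H [g (u ! 0) (u ! 1)]) (comult H x)) (\<lambda>v. F (hd v)) = sw x (\<lambda>a b. F (g a b))"
proof -
  have "E (tensor_lift 2 (\<lambda>u. hpure H [g (u ! 0) (u ! 1)]) (comult H x)) (\<lambda>v. F (hd v))
     = sw x (\<lambda>a b. mlext [g a b] (\<lambda>v. F (hd v)))"
    by (subst E_lift_comult[where m = 1]) (simp_all add: pure_in E_pure lin_mlext entry_lin_Cons1 assms del: mlext.simps)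
  then show ?thesis using assms(3) by (simp add: mlext_single del: mlext.simps)
qed

lemma lin_scale: "lin F \<Longrightarrow> F (hscale H c x) = c * F x"
  by (simp add: lin_def)

lemma sw_counit_left:
  assumes "lin F" shows "sw x (\<lambda>a b. counit H a * F b) = F x"
proof -
  have "sw x (\<lambda>a b. F (hscale H (counit H a) b)) = mlext [x] (\<lambda>v. F (hd v))"
    using E_lift_comult_single[OF _ _ assms, of "\<lambda>a b. hscale H (counit H a) b" x]
    by (simp add: counit_left linH_scale linH_scale_left linH_id lin_counit' E_pure del: mlext.simps)
  then show ?thesis using assms by (simp add: mlext_single lin_scale del: mlext.simps)
qed

lemma sw_counit_right:
  assumes "lin F" shows "sw x (\<lambda>a b. counit H b * F a) = F x"
proof -
  have "sw x (\<lambda>a b. F (hscale H (counit H b) a)) = mlext [x] (\<lambda>v. F (hd v))"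
    using E_lift_comult_single[OF _ _ assms, of "\<lambda>a b. hscale H (counit H b) a" x]
    by (simp add: counit_right linH_scale linH_scale_left linH_id lin_counit' E_pure del: mlext.simps)
  then show ?thesis using assms by (simp add: mlext_single lin_scale del: mlext.simps)
qed

lemma sw_antipode_left:
  assumes "lin F" shows "sw x (\<lambda>a b. F (antipode H a * b)) = counit H x * F 1"
proof -
  have "sw x (\<lambda>a b. F (antipode H a * b)) = mlext [hscale H (counit H x) 1] (\<lambda>v. F (hd v))"
    using E_lift_comult_single[OF _ _ assms, of "\<lambda>a b. antipode H a * b" x]
    by (simp add: antipode_left lin_rules linH_antipode' E_pure del: mlext.simps)
  then show ?thesis using assms by (simp add: mlext_single lin_scale del: mlext.simps)
qed

lemma sw_antipode_right:
  assumes "lin F" shows "sw x (\<lambda>a b. F (a * antipode H b)) = counit H x * F 1"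
proof -
  have "sw x (\<lambda>a b. F (a * antipode H b)) = mlext [hscale H (counit H x) 1] (\<lambda>v. F (hd v))"
    using E_lift_comult_single[OF _ _ assms, of "\<lambda>a b. a * antipode H b" x]
    by (simp add: antipode_right lin_rules linH_antipode' E_pure del: mlext.simps)
  then show ?thesis using assms by (simp add: mlext_single lin_scale del: mlext.simps)
qed

lemma sw_one:
  assumes "\<And>b. lin (\<lambda>a. G a b)" "\<And>a. lin (\<lambda>b. G a b)"
  shows "sw 1 G = G 1 1"
  unfolding sw_def by (simp add: comult_one E_pure mlext_pair assms del: mlext.simps)

lemma ml_entry_lin: "(\<And>xs ys. Suc (length xs + length ys) = n \<Longrightarrow> entry_lin (\<lambda>x. g (xs @ x # ys))) \<Longrightarrow> ml n (\<lambda>v. mlext (g v) \<psi>)"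
  by (intro mlI lin_mlext) auto

lemma entry_lin_slot: "entry_lin (\<lambda>x. xs @ x # ys)"
  unfolding entry_lin_def using linH_id by blast

lemma E_tensor_mult:
  assumes "s \<in> hpower H n" "t \<in> hpower H n"
  shows "tensor_mult H n s t \<in> hpower H n"
    and "E (tensor_mult H n s t) \<psi> = E s (\<lambda>xs. E t (\<lambda>ys. mlext (map2 (*) xs ys) \<psi>))"
proof -
  have t1: "tml n n (\<lambda>ys. hpure H (map2 (*) xs ys))" if "length xs = n" for xs
    by (rule tmlI) (simp_all add: that pure_in E_pure ml_entry_lin entry_lin_map2_right entry_lin_slot)
  have t2: "tml n n (\<lambda>xs. tensor_lift n (\<lambda>ys. hpure H (map2 (*) xs ys)) t)"
  proof (rule tmlI)
    fix xs :: "'h list" assume xs: "length xs = n"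
    show "tensor_lift n (\<lambda>ys. hpure H (map2 (*) xs ys)) t \<in> hpower H n"
      by (rule tensor_lift_in[OF t1[OF xs] assms(2)])
  next
    fix \<psi> assume "ml n \<psi>"
    have "ml n (\<lambda>xs. E t (\<lambda>ys. mlext (map2 (*) xs ys) \<psi>))"
      by (rule mlI, rule lin_fsupp[OF fsupp_E[OF assms(2)]], rule lin_mlext)
        (simp add: entry_lin_map2_left entry_lin_slot blist_def)
    then show "ml n (\<lambda>xs. E (tensor_lift n (\<lambda>ys. hpure H (map2 (*) xs ys)) t) \<psi>)"
      by (rule ml_cong[THEN iffD1, rotated]) (simp add: E_tensor_lift[OF t1 assms(2)] E_pure)
  qed
  show "tensor_mult H n s t \<in> hpower H n"
    unfolding tensor_mult_def by (rule tensor_lift_in[OF t2 assms(1)])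
  show "E (tensor_mult H n s t) \<psi> = E s (\<lambda>xs. E t (\<lambda>ys. mlext (map2 (*) xs ys) \<psi>))"
    unfolding tensor_mult_def E_tensor_lift[OF t2 assms(1)]
    by (rule fsupp_cong[OF fsupp_E[OF assms(1)]])
      (simp add: blist_def E_tensor_lift[OF t1 assms(2)] E_pure)
qed

lemma sw_mult:
  assumes "\<And>b. lin (\<lambda>a. G a b)" "\<And>a. lin (\<lambda>b. G a b)"
  shows "sw (x * y) G = sw x (\<lambda>a b. sw y (\<lambda>c d. G (a * c) (b * d)))"
proof -
  have "sw (x * y) G = E (comult H x) (\<lambda>xs. E (comult H y) (\<lambda>ys. mlext (map2 (*) xs ys) (\<lambda>v. G (v ! 0) (v ! 1))))"
    by (simp add: sw_def comult_mult E_tensor_mult[OF comult_in comult_in])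
  also have "\<dots> = E (comult H x) (\<lambda>xs. E (comult H y) (\<lambda>ys. G (xs ! 0 * ys ! 0) (xs ! 1 * ys ! 1)))"
    by (intro fsupp_cong[OF fsupp_E[OF comult_in]])
      (auto simp: blist_def length2 mlext_pair assms simp del: mlext.simps)
  finally show ?thesis by (simp add: sw_def)
qed

lemma eq_by_lin:
  assumes "\<And>F. lin F \<Longrightarrow> F x = F y" shows "x = y"
proof -
  have "x - y = 0"
  proof (rule separating_functional[OF vector_space])
    fix l assume l: "Vector_Spaces.linear (hscale H) (*) l"
    then interpret l: Vector_Spaces.linear "hscale H" "(*)" l .
    show "l (x - y) = 0" using assms[of l] l by (simp add: lin_iff l.diff)
  qed
  then show ?thesis by simp
qed

lemma antipode_one: "antipode H 1 = 1"
proof (rule eq_by_lin)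
  fix F assume F: "lin F"
  have "sw 1 (\<lambda>a b. F (antipode H a * b)) = F (antipode H 1)"
    by (subst sw_one) (auto intro!: lin_comp[OF F] lin_rules)
  then show "F (antipode H 1) = F 1" by (simp add: sw_antipode_left F counit_one)
qed

lemma counit_antipode: "counit H (antipode H x) = counit H x"
proof -
  have "sw x (\<lambda>a b. counit H (antipode H a * b)) = counit H x"
    by (simp add: sw_antipode_left lin_counit' counit_one)
  then have "sw x (\<lambda>a b. counit H b * counit H (antipode H a)) = counit H x"
    by (simp add: counit_mult mult.commute)
  then show ?thesis by (subst (asm) sw_counit_right) (intro lin_rules)
qed

lemma sw_antipode_right': 
  assumes "\<And>y. lin (\<lambda>a. G a y)" "\<And>a. lin (\<lambda>y. G a y)"
  shows "sw x (\<lambda>a r. sw r (\<lambda>b c. G a (b * antipode H c))) = G x 1"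
  by (simp add: sw_antipode_right[OF assms(2)] sw_counit_right[OF assms(1)])

text \<open>Both sides are convolution inverses of the product of \<open>H\<close>: the sum of
\<open>S(x\<^sub>1 y\<^sub>1) x\<^sub>2 y\<^sub>2 S(y\<^sub>3) S(x\<^sub>3)\<close> cancels from the right to \<open>S(x y)\<close> and from the left to \<open>S(y) S(x)\<close>.\<close>

lemma antipode_mult: "antipode H (x * y) = antipode H y * antipode H x"
proof (rule eq_by_lin)
  fix F assume F: "lin F"
  let ?S = "antipode H"
  note rules = lin_rules lin_comp[OF F]
  let ?T = "\<lambda>x1 x2 x3 y1 y2 y3. F (?S (x1 * y1) * x2 * (y2 * ?S y3) * ?S x3)"
  let ?A = "sw x (\<lambda>x1 x'. sw x' (\<lambda>x2 x3. sw y (\<lambda>y1 y'. sw y' (\<lambda>y2 y3. ?T x1 x2 x3 y1 y2 y3))))"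
  have "?A = sw x (\<lambda>x1 x'. sw x' (\<lambda>x2 x3. F (?S (x1 * y) * x2 * 1 * ?S x3)))"
    by (subst sw_antipode_right') (intro rules refl)+
  also have "\<dots> = sw x (\<lambda>x1 x'. sw x' (\<lambda>x2 x3. F (?S (x1 * y) * (x2 * ?S x3))))"
    by (simp add: mult.assoc)
  also have "\<dots> = F (?S (x * y) * 1)"
    by (subst sw_antipode_right') (intro rules refl)+
  finally have 1: "?A = F (?S (x * y))" by simp
  have "?A = sw x (\<lambda>x' x3. sw x' (\<lambda>x1 x2. sw y (\<lambda>y' y3. sw y' (\<lambda>y1 y2. ?T x1 x2 x3 y1 y2 y3))))"
    by (simp only: sw_coassoc)
  also have "\<dots> = sw x (\<lambda>x' x3. sw y (\<lambda>y' y3. sw x' (\<lambda>x1 x2. sw y' (\<lambda>y1 y2. ?T x1 x2 x3 y1 y2 y3))))"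
    by (subst sw_swap) (rule refl)
  also have "\<dots> = sw x (\<lambda>x' x3. sw y (\<lambda>y' y3. sw (x' * y') (\<lambda>a b. F (?S a * b * (?S y3 * ?S x3)))))"
    by (subst sw_mult) (intro rules | simp add: mult.assoc)+
  also have "\<dots> = sw x (\<lambda>x' x3. sw y (\<lambda>y' y3. counit H (x' * y') * F (?S y3 * ?S x3)))"
    by (subst sw_antipode_left[where F = "\<lambda>z. F (z * (?S _ * ?S _))"]) (intro rules | simp)+
  also have "\<dots> = sw x (\<lambda>x' x3. counit H x' * sw y (\<lambda>y' y3. counit H y' * F (?S y3 * ?S x3)))"
    by (simp add: counit_mult mult.assoc sw_mult_left)
  also have "\<dots> = F (?S y * ?S x)"
    by (subst sw_counit_left, intro rules)+ (rule refl)
  finally show "F (?S (x * y)) = F (?S y * ?S x)" using 1 by simp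
qed

text \<open>The antipode reverses the coproduct, by the same convolution argument in \<open>H \<otimes> H\<close>.\<close>

lemma sw_antipode:
  assumes G: "\<And>b. lin (\<lambda>a. G a b)" "\<And>a. lin (\<lambda>b. G a b)"
  shows "sw (antipode H x) G = sw x (\<lambda>a b. G (antipode H b) (antipode H a))"
proof -
  let ?S = "antipode H"
  note rules = lin_rules lin_comp[OF G(1)] lin_comp[OF G(2)]
  \<comment> \<open>the element \<open>\<Delta>(S x\<^sub>1) \<Delta>(x\<^sub>2) (S x\<^sub>4 \<otimes> S x\<^sub>3)\<close>, evaluated in two ways\<close>
  let ?A = "sw x (\<lambda>x1 r. sw r (\<lambda>x2 r. sw r (\<lambda>x3 x4. sw (?S x1) (\<lambda>p q. sw x2 (\<lambda>c d. G (p * c * ?S x4) (q * d * ?S x3))))))"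
  have "?A = sw x (\<lambda>x' r. sw r (\<lambda>x3 x4. sw x' (\<lambda>x1 x2. sw (?S x1 * x2) (\<lambda>p q. G (p * ?S x4) (q * ?S x3)))))"
    apply (subst sw_mult) apply (intro rules)+
    apply (subst sw_coassoc[symmetric])
    apply (subst sw_swap)
    apply (rule refl)
    done
  also have "\<dots> = sw x (\<lambda>x' r. sw r (\<lambda>x3 x4. counit H x' * G (?S x4) (?S x3)))"
    by (subst sw_antipode_left[where F = "\<lambda>z. sw z (\<lambda>p q. G (p * _) (q * _))"], intro rules, subst sw_one) (intro rules | simp)+
  also have "\<dots> = sw x (\<lambda>a b. G (?S b) (?S a))"
    by (simp only: sw_mult_left) (subst sw_counit_left, intro rules, rule refl)
  finally have 1: "?A = sw x (\<lambda>a b. G (?S b) (?S a))" .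
  have "?A = sw x (\<lambda>x1 r. sw (?S x1) (\<lambda>p q. sw r (\<lambda>x2 r. sw r (\<lambda>x3 x4. sw x2 (\<lambda>c d. G (p * c * ?S x4) (q * d * ?S x3))))))"
    by (simp only: sw_swap[of "?S _"])
  also have "\<dots> = sw x (\<lambda>x1 r. sw (?S x1) (\<lambda>p q. sw r (\<lambda>c r. sw r (\<lambda>d r. sw r (\<lambda>x3 x4. G (p * c * ?S x4) (q * (d * ?S x3)))))))"
    by (subst sw_swap) (simp only: sw_coassoc mult.assoc)
  also have "\<dots> = sw x (\<lambda>x1 r. sw (?S x1) (\<lambda>p q. sw r (\<lambda>c r. sw r (\<lambda>d' x4. sw d' (\<lambda>d x3. G (p * c * ?S x4) (q * (d * ?S x3)))))))"
    by (simp only: sw_coassoc)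
  also have "\<dots> = sw x (\<lambda>x1 r. sw (?S x1) (\<lambda>p q. sw r (\<lambda>c r. sw r (\<lambda>d' x4. counit H d' * G (p * c * ?S x4) q))))"
    by (subst sw_antipode_right[where F = "\<lambda>z. G _ (_ * z)"]) (intro rules | simp)+
  also have "\<dots> = sw x (\<lambda>x1 r. sw (?S x1) (\<lambda>p q. sw r (\<lambda>c x4. G (p * (c * ?S x4)) q)))"
    by (subst sw_counit_left) (intro rules | simp add: mult.assoc)+
  also have "\<dots> = sw x (\<lambda>x1 r. counit H r * sw (?S x1) G)"
    by (subst sw_antipode_right[where F = "\<lambda>z. G (_ * z) _"]) (intro rules | simp add: sw_mult_left)+
  also have "\<dots> = sw (?S x) G"
    by (subst sw_counit_right) (intro rules | simp)+
  finally show ?thesis using 1 by simp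
qed


section \<open>Iterated coproducts\<close>

text \<open>The Sweedler sum over all \<open>n\<close> legs of \<open>u\<close>; it is the pairing with the \<open>n\<close>-fold coproduct (\<open>E_icomult\<close>).\<close>

primrec swn :: "nat \<Rightarrow> 'h \<Rightarrow> ('h list \<Rightarrow> 'k) \<Rightarrow> 'k" where
  "swn 0 u \<psi> = counit H u * \<psi> []"
| "swn (Suc n) u \<psi> = sw u (\<lambda>a b. swn n b (\<lambda>w. \<psi> (a # w)))"

lemma fsupp_bind_sw:
  assumes "\<And>a b. inbas2 (a, b) \<Longrightarrow> fsupp Q (y a b)"
  shows "fsupp Q (\<lambda>\<psi>. sw u (\<lambda>a b. y a b \<psi>))"
  using fsupp_bind[OF fsupp_sw, of Q "\<lambda>p. y (fst p) (snd p)"] assms by simp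

lemma fsupp_swn: "fsupp (blist n) (swn n u)"
proof (induction n arbitrary: u)
  case 0
  have "fsupp (blist 0) (\<lambda>\<psi>. counit H u * \<psi> [])"
    by (rule fsupp_scale[OF fsupp_single]) (simp add: blist_def)
  moreover have "swn 0 u = (\<lambda>\<psi>. counit H u * \<psi> [])" by (rule ext) simp
  ultimately show ?case by simp
next
  case (Suc n)
  have *: "fsupp (blist (Suc n)) (\<lambda>\<psi>. swn n b (\<lambda>w. \<psi> (a # w)))" if "inbas2 (a, b)" for a b
    by (rule fsupp_bind[where y = "\<lambda>bs \<psi>. \<psi> (a # bs)", OF Suc fsupp_single])
      (use that in \<open>simp add: blist_def inbas2_def\<close>)
  have "swn (Suc n) u = (\<lambda>\<psi>. sw u (\<lambda>a b. swn n b (\<lambda>w. \<psi> (a # w))))" by (rule ext) simp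
  then show ?case using fsupp_bind_sw[OF *] by simp
qed

lemma lin_swn': "lin (\<lambda>u. swn n u \<psi>)"
  by (cases n) (auto intro!: lin_rules lin_sw' lin_counit')

lemma lin_swn1: "linH g \<Longrightarrow> lin (\<lambda>x. swn n (g x) \<psi>)"
  by (rule lin_comp[OF lin_swn'])

lemma lin_swn2: "(\<And>w. length w = n \<Longrightarrow> lin (\<lambda>x. G w x)) \<Longrightarrow> lin (\<lambda>x. swn n u (\<lambda>w. G w x))"
  by (rule lin_fsupp[OF fsupp_swn]) (simp add: blist_def)

lemma swn_cong: "(\<And>w. length w = n \<Longrightarrow> \<psi> w = \<chi> w) \<Longrightarrow> swn n u \<psi> = swn n u \<chi>"
  by (rule fsupp_cong[OF fsupp_swn]) (simp add: blist_def)

lemma swn_cong_bas: "(\<And>w. blist n w \<Longrightarrow> \<psi> w = \<chi> w) \<Longrightarrow> swn n u \<psi> = swn n u \<chi>"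
  by (rule fsupp_cong[OF fsupp_swn])

lemma swn_mult_left: "swn n u (\<lambda>w. c * \<psi> w) = c * swn n u \<psi>"
  by (rule fsupp_mult[OF fsupp_swn])

lemma fsupp_swn_swap: "fsupp P x \<Longrightarrow> x (\<lambda>v. swn n u (\<lambda>w. G v w)) = swn n u (\<lambda>w. x (\<lambda>v. G v w))"
  by (rule fsupp_swap[OF _ fsupp_swn])

lemmas swn_swap = fsupp_swn_swap[OF fsupp_swn]
lemmas swn_sw_swap = fsupp_sw_swap[OF fsupp_swn]

lemma E_icomult_aux: "icomult H n u \<in> hpower H n \<and> (\<forall>\<psi>. E (icomult H n u) \<psi> = swn n u \<psi>)"
proof (induction n arbitrary: u)
  case 0
  show ?case by (simp add: hpower_scale pure_in E_scale E_pure)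
next
  case (Suc n)
  let ?F = "\<lambda>v. tensor_lift n (\<lambda>w. hpure H (v ! 0 # w)) (icomult H n (v ! 1))"
  have t: "tml n (Suc n) (\<lambda>w. hpure H (a # w))" for a
    by (rule tmlI) (simp_all add: pure_in E_pure ml_entry_lin entry_lin_Cons2 entry_lin_slot del: mlext.simps)
  have F: "?F [a, b] \<in> hpower H (Suc n)" "E (?F [a, b]) \<psi> = swn n b (\<lambda>w. mlext (a # w) \<psi>)" for a b \<psi>
    using Suc by (simp_all add: tensor_lift_in[OF t] E_tensor_lift[OF t] E_pure del: mlext.simps)
  have l: "lin (\<lambda>a. E (?F [a, b]) \<psi>)" "lin (\<lambda>b. E (?F [a, b]) \<psi>)" for a b \<psi>
    unfolding F(2) by (intro lin_rules lin_swn1 lin_swn2)+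
  have "E (icomult H (Suc n) u) \<psi> = swn (Suc n) u \<psi>" for \<psi>
  proof -
    have "E (icomult H (Suc n) u) \<psi> = sw u (\<lambda>a b. swn n b (\<lambda>w. mlext (a # w) \<psi>))"
      by (simp only: icomult.simps E_lift_comult(1)[OF F(1) l] F(2))
    also have "\<dots> = sw u (\<lambda>a b. swn n b (\<lambda>w. \<psi> (a # w)))"
      by (intro sw_cong_bas swn_cong_bas mlext_blist) (simp add: blist_def)
    finally show ?thesis by simp
  qed
  moreover have "icomult H (Suc n) u \<in> hpower H (Suc n)"
    using E_lift_comult(2)[OF F(1) l] by simp
  ultimately show ?case by blast
qed

lemma icomult_in: "icomult H n u \<in> hpower H n"
  and E_icomult: "E (icomult H n u) \<psi> = swn n u \<psi>"
  using E_icomult_aux by auto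

lemma sw_counit_right_bas:
  assumes "b \<in> bas" shows "sw b (\<lambda>c d. counit H d * G c) = G b"
proof -
  have "sw b (\<lambda>c d. counit H d * G c) = sw b (\<lambda>c d. counit H d * linext G c)"
    by (rule sw_cong_bas) (simp add: linext_basis)
  then show ?thesis by (simp add: sw_counit_right lin_linext linext_basis assms)
qed

text \<open>For \<open>\<psi>\<close> that is not linear, a Sweedler sum with one leg \<open>u\<^sub>1\<close> gives \<open>\<psi> [u]\<close> at the basis vectors \<open>u\<close>.\<close>

lemma swn_1_bas: "b \<in> bas \<Longrightarrow> swn 1 b \<psi> = \<psi> [b]"
  by (simp add: One_nat_def sw_counit_right_bas)

lemma swn_append: "swn (n + m) u \<psi> = sw u (\<lambda>a b. swn n a (\<lambda>w. swn m b (\<lambda>w'. \<psi> (w @ w'))))"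
proof (induction n arbitrary: u \<psi>)
  case 0
  show ?case by (simp add: sw_counit_left lin_swn')
next
  case (Suc n)
  show ?case by (simp add: Suc sw_coassoc)
qed

lemma swn_snoc: "swn (Suc n) u \<psi> = sw u (\<lambda>a b. swn n a (\<lambda>w. \<psi> (w @ [b])))"
proof -
  have "swn (Suc n) u \<psi> = sw u (\<lambda>a b. swn n a (\<lambda>w. swn 1 b (\<lambda>w'. \<psi> (w @ w'))))"
    using swn_append[of n 1 u \<psi>] by (simp add: One_nat_def)
  also have "\<dots> = sw u (\<lambda>a b. swn n a (\<lambda>w. \<psi> (w @ [b])))"
    by (rule sw_cong_bas) (simp add: swn_1_bas)
  finally show ?thesis .
qed

lemma lin_ml_Cons: "ml (Suc n) \<psi> \<Longrightarrow> ml n (\<lambda>v. \<psi> (a # v))"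
  by (rule mlI, erule lin_mlD) (simp_all add: entry_lin_Cons2 entry_lin_slot)

lemma swn_mult:
  assumes "ml n \<psi>"
  shows "swn n (x * y) \<psi> = swn n x (\<lambda>ws. swn n y (\<lambda>vs. \<psi> (map2 (*) ws vs)))"
  using assms
proof (induction n arbitrary: x y \<psi>)
  case 0
  show ?case by (simp add: counit_mult mult.assoc)
next
  case (Suc n)
  have l: "lin (\<lambda>a. swn n b (\<lambda>w. \<psi> (a # w)))" for b
    by (rule lin_swn2, rule lin_mlD[OF Suc.prems]) (simp_all add: entry_lin_id)
  have "swn (Suc n) (x * y) \<psi> = sw x (\<lambda>a b. sw y (\<lambda>c d. swn n (b * d) (\<lambda>w. \<psi> ((a * c) # w))))"
    by (simp add: sw_mult l lin_swn')
  also have "\<dots> = sw x (\<lambda>a b. sw y (\<lambda>c d. swn n b (\<lambda>ws. swn n d (\<lambda>vs. \<psi> ((a * c) # map2 (*) ws vs)))))"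
    by (simp add: Suc.IH lin_ml_Cons[OF Suc.prems])
  also have "\<dots> = swn (Suc n) x (\<lambda>ws. swn (Suc n) y (\<lambda>vs. \<psi> (map2 (*) ws vs)))"
    by (simp add: swn_sw_swap) (rule sw_swap)
  finally show ?case .
qed

lemma swn_one: "ml n \<psi> \<Longrightarrow> swn n 1 \<psi> = \<psi> (replicate n 1)"
proof (induction n arbitrary: \<psi>)
  case 0
  show ?case by (simp add: counit_one)
next
  case (Suc n)
  have l: "lin (\<lambda>a. swn n b (\<lambda>w. \<psi> (a # w)))" for b
    by (rule lin_swn2, rule lin_mlD[OF Suc.prems]) (simp_all add: entry_lin_id)
  show ?case by (simp add: sw_one l lin_swn' Suc.IH lin_ml_Cons[OF Suc.prems])
qed


section \<open>The diagonal actions on forms\<close>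

text \<open>The transposes of the diagonal actions: \<open>L n u \<psi>\<close> and \<open>R n u \<psi>\<close> pair with a tensor \<open>t\<close> as \<open>\<psi>\<close> pairs with
\<open>u \<triangleright> t\<close> and \<open>t \<triangleleft> u\<close> (\<open>E_lact\<close>, \<open>E_ract\<close>). Transposition reverses the order of composition, whence the order
of the factors in \<open>L_L\<close> and \<open>R_R\<close>.\<close>

definition L :: "nat \<Rightarrow> 'h \<Rightarrow> ('h list \<Rightarrow> 'k) \<Rightarrow> 'h list \<Rightarrow> 'k" where
  "L n u \<psi> v = swn n u (\<lambda>w. \<psi> (map2 (*) w v))"

definition R :: "nat \<Rightarrow> 'h \<Rightarrow> ('h list \<Rightarrow> 'k) \<Rightarrow> 'h list \<Rightarrow> 'k" where
  "R n u \<psi> v = swn n u (\<lambda>w. \<psi> (map2 (*) v w))"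

lemma L_cong: "(\<And>v. length v = n \<Longrightarrow> \<psi> v = \<chi> v) \<Longrightarrow> length v = n \<Longrightarrow> L n u \<psi> v = L n u \<chi> v"
  and R_cong: "(\<And>v. length v = n \<Longrightarrow> \<psi> v = \<chi> v) \<Longrightarrow> length v = n \<Longrightarrow> R n u \<psi> v = R n u \<chi> v"
  unfolding L_def R_def by (rule swn_cong; simp)+

lemma lin_L1: "linH g \<Longrightarrow> lin (\<lambda>x. L n (g x) \<psi> v)"
  and lin_R1: "linH g \<Longrightarrow> lin (\<lambda>x. R n (g x) \<psi> v)"
  unfolding L_def R_def by (rule lin_swn1; assumption)+

lemma lin_L2: "(\<And>w. length w = n \<Longrightarrow> lin (\<lambda>x. \<psi> x w)) \<Longrightarrow> length v = n \<Longrightarrow> lin (\<lambda>x. L n u (\<psi> x) v)"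
  and lin_R2: "(\<And>w. length w = n \<Longrightarrow> lin (\<lambda>x. \<psi> x w)) \<Longrightarrow> length v = n \<Longrightarrow> lin (\<lambda>x. R n u (\<psi> x) v)"
  unfolding L_def R_def by (rule lin_swn2; simp)+

lemma lin_L3:
  assumes "ml n \<psi>" "entry_lin g" "\<And>x. length (g x) = n" shows "lin (\<lambda>x. L n u \<psi> (g x))"
  unfolding L_def by (rule lin_swn2, rule lin_mlD[OF assms(1)]) (simp_all add: assms entry_lin_map2_right)

lemma lin_R3:
  assumes "ml n \<psi>" "entry_lin g" "\<And>x. length (g x) = n" shows "lin (\<lambda>x. R n u \<psi> (g x))"
  unfolding R_def by (rule lin_swn2, rule lin_mlD[OF assms(1)]) (simp_all add: assms entry_lin_map2_left)

lemma ml_L: "ml n \<psi> \<Longrightarrow> ml n (L n u \<psi>)"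
  and ml_R: "ml n \<psi> \<Longrightarrow> ml n (R n u \<psi>)"
  by (rule mlI, erule lin_L3 lin_R3; simp add: entry_lin_slot)+

lemma map2_mult_assoc: "map2 (*) (map2 (*) a b) c = map2 (*) a (map2 (*) b (c :: 'h list))"
proof (induction a arbitrary: b c)
  case (Cons x a)
  then show ?case by (cases b; cases c) (simp_all add: mult.assoc)
qed simp

lemma L_L: "ml n \<psi> \<Longrightarrow> length v = n \<Longrightarrow> L n u' (L n u \<psi>) v = L n (u * u') \<psi> v"
proof -
  assume a: "ml n \<psi>" "length v = n"
  have "L n (u * u') \<psi> v = swn n u (\<lambda>w. swn n u' (\<lambda>w'. \<psi> (map2 (*) (map2 (*) w w') v)))"
    unfolding L_def
    by (rule swn_mult, rule mlI, rule lin_mlD[OF a(1)]) (use a in \<open>simp_all add: entry_lin_map2_left entry_lin_slot\<close>)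
  also have "\<dots> = L n u' (L n u \<psi>) v"
    unfolding L_def map2_mult_assoc by (rule swn_swap)
  finally show ?thesis by simp
qed

lemma R_R: "ml n \<psi> \<Longrightarrow> length v = n \<Longrightarrow> R n u' (R n u \<psi>) v = R n (u' * u) \<psi> v"
proof -
  assume a: "ml n \<psi>" "length v = n"
  have "R n (u' * u) \<psi> v = swn n u' (\<lambda>w. swn n u (\<lambda>w'. \<psi> (map2 (*) v (map2 (*) w w'))))"
    unfolding R_def
    by (rule swn_mult, rule mlI, rule lin_mlD[OF a(1)]) (use a in \<open>simp_all add: entry_lin_map2_right entry_lin_slot\<close>)
  then show ?thesis by (simp add: R_def map2_mult_assoc)
qed

lemma L_R: "L n u (R n w \<psi>) v = R n w (L n u \<psi>) v"
  unfolding L_def R_def map2_mult_assoc[symmetric] by (subst swn_swap) (rule refl)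

lemma map2_one_left: "length v = n \<Longrightarrow> map2 (*) (replicate n 1) (v :: 'h list) = v"
  and map2_one_right: "length v = n \<Longrightarrow> map2 (*) (v :: 'h list) (replicate n 1) = v"
  by (induction v arbitrary: n) auto

lemma L_one: "ml n \<psi> \<Longrightarrow> length v = n \<Longrightarrow> L n 1 \<psi> v = \<psi> v"
  unfolding L_def
  by (subst swn_one, rule mlI, erule lin_mlD) (simp_all add: entry_lin_map2_left entry_lin_slot map2_one_left)

lemma R_one: "ml n \<psi> \<Longrightarrow> length v = n \<Longrightarrow> R n 1 \<psi> v = \<psi> v"
  unfolding R_def
  by (subst swn_one, rule mlI, erule lin_mlD) (simp_all add: entry_lin_map2_right entry_lin_slot map2_one_right)

lemma L_0: "L 0 u \<psi> [] = counit H u * \<psi> []" and R_0: "R 0 u \<psi> [] = counit H u * \<psi> []"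
  by (simp_all add: L_def R_def)

lemma L_Cons: "L (Suc n) u \<psi> (x # v) = sw u (\<lambda>a b. L n b (\<lambda>v. \<psi> (a * x # v)) v)"
  and R_Cons: "R (Suc n) u \<psi> (x # v) = sw u (\<lambda>a b. R n b (\<lambda>v. \<psi> (x * a # v)) v)"
  by (simp_all add: L_def R_def)

lemma L_append: "length v = n \<Longrightarrow> L (n + m) u \<psi> (v @ v') = sw u (\<lambda>a b. L n a (\<lambda>v. L m b (\<lambda>v'. \<psi> (v @ v')) v') v)"
  unfolding L_def swn_append
  by (intro sw_cong_bas swn_cong) (simp cong: swn_cong)

lemma R_append: "length v = n \<Longrightarrow> R (n + m) u \<psi> (v @ v') = sw u (\<lambda>a b. R n a (\<lambda>v. R m b (\<lambda>v'. \<psi> (v @ v')) v') v)"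
  unfolding R_def swn_append
  by (intro sw_cong_bas swn_cong) (simp cong: swn_cong)

lemma L_snoc: "length v = n \<Longrightarrow> L (Suc n) u \<psi> (v @ [y]) = sw u (\<lambda>a b. L n a (\<lambda>v. \<psi> (v @ [b * y])) v)"
  and R_snoc: "length v = n \<Longrightarrow> R (Suc n) u \<psi> (v @ [y]) = sw u (\<lambda>a b. R n a (\<lambda>v. \<psi> (v @ [y * b])) v)"
  unfolding L_def R_def swn_snoc
  by (intro sw_cong_bas swn_cong; simp)+

lemma E_lact:
  assumes "t \<in> hpower H q" "ml q \<psi>"
  shows "E (lact H q u t) \<psi> = E t (L q u \<psi>)" and "lact H q u t \<in> hpower H q"
proof -
  have "E (lact H q u t) \<psi> = swn q u (\<lambda>w. E t (\<lambda>v. mlext (map2 (*) w v) \<psi>))"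
    by (simp add: lact_def E_tensor_mult icomult_in assms E_icomult)
  also have "\<dots> = swn q u (\<lambda>w. E t (\<lambda>v. \<psi> (map2 (*) w v)))"
    by (intro swn_cong fsupp_cong[OF fsupp_E[OF assms(1)]] mlext_eq) (simp add: assms blist_def)
  also have "\<dots> = E t (L q u \<psi>)"
    unfolding L_def by (rule fsupp_swap[OF fsupp_swn fsupp_E[OF assms(1)]])
  finally show "E (lact H q u t) \<psi> = E t (L q u \<psi>)" .
  show "lact H q u t \<in> hpower H q"
    by (simp add: lact_def E_tensor_mult icomult_in assms)
qed

lemma E_ract:
  assumes "t \<in> hpower H q" "ml q \<psi>"
  shows "E (ract H q t u) \<psi> = E t (R q u \<psi>)" and "ract H q t u \<in> hpower H q"
proof -
  have "E (ract H q t u) \<psi> = E t (\<lambda>v. swn q u (\<lambda>w. mlext (map2 (*) v w) \<psi>))"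
    by (simp add: ract_def E_tensor_mult icomult_in assms E_icomult)
  also have "\<dots> = E t (R q u \<psi>)"
    unfolding R_def
    by (intro swn_cong fsupp_cong[OF fsupp_E[OF assms(1)]] mlext_eq) (simp add: assms blist_def)
  finally show "E (ract H q t u) \<psi> = E t (R q u \<psi>)" .
  show "ract H q t u \<in> hpower H q"
    by (simp add: ract_def E_tensor_mult icomult_in assms)
qed


section \<open>The coalgebra of lists\<close>

text \<open>The Sweedler sum for the coalgebra of lists of a fixed length, a tensor power of \<open>H\<close>: every entry is split
into two legs. Further legs are obtained by nesting.\<close>

primrec sws :: "'h list \<Rightarrow> ('h list \<Rightarrow> 'h list \<Rightarrow> 'k) \<Rightarrow> 'k" where
  "sws [] G = G [] []"
| "sws (u # us) G = sw u (\<lambda>a b. sws us (\<lambda>as bs. G (a # as) (b # bs)))"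

definition len2 :: "nat \<Rightarrow> 'h list \<times> 'h list \<Rightarrow> bool" where
  "len2 n p \<longleftrightarrow> length (fst p) = n \<and> length (snd p) = n"

lemma fsupp_sws: "fsupp (len2 (length us)) (\<lambda>\<psi>. sws us (\<lambda>a b. \<psi> (a, b)))"
proof (induction us)
  case Nil
  show ?case unfolding sws.simps by (rule fsupp_single) (simp add: len2_def)
next
  case (Cons u us)
  have *: "fsupp (len2 (Suc (length us))) (\<lambda>\<psi>. sws us (\<lambda>as bs. \<psi> (a # as, b # bs)))" for a b
    using fsupp_bind[where y = "\<lambda>q \<psi>. \<psi> (a # fst q, b # snd q)", OF Cons fsupp_single, of "len2 (Suc (length us))"]
    by (simp add: len2_def)
  show ?case using fsupp_bind_sw[OF *] by simp
qed

lemma sws_cong_len: "(\<And>a b. length a = length us \<Longrightarrow> length b = length us \<Longrightarrow> F a b = G a b) \<Longrightarrow> sws us F = sws us G"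
  using fsupp_cong[OF fsupp_sws, of us "\<lambda>p. F (fst p) (snd p)" "\<lambda>p. G (fst p) (snd p)"]
  by (simp add: len2_def)

lemma sws_cong: "us = vs \<Longrightarrow> (\<And>a b. length a = length vs \<Longrightarrow> length b = length vs \<Longrightarrow> F a b = G a b) \<Longrightarrow> sws us F = sws vs G"
  by (auto intro: sws_cong_len)

lemma sws_mult_left: "sws u (\<lambda>a b. c * G a b) = c * sws u G"
  using fsupp_mult[OF fsupp_sws, of u c "\<lambda>p. G (fst p) (snd p)"] by simp

lemma sws_mult_right: "sws u (\<lambda>a b. G a b * c) = sws u G * c"
  using sws_mult_left[of u c G] by (simp add: mult.commute)

lemma fsupp_sws_swap:
  assumes "fsupp P x" shows "x (\<lambda>v. sws u (\<lambda>a b. G v a b)) = sws u (\<lambda>a b. x (\<lambda>v. G v a b))"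
  using fsupp_swap[OF assms fsupp_sws, where G = "\<lambda>v p. G v (fst p) (snd p)"] by simp

lemma sws_swap: "sws u (\<lambda>a b. sws v (\<lambda>c d. G a b c d)) = sws v (\<lambda>c d. sws u (\<lambda>a b. G a b c d))"
  using fsupp_sws_swap[OF fsupp_sws, where G = "\<lambda>p c d. G (fst p) (snd p) c d"] by simp

lemma sws_sw_swap: "sws u (\<lambda>a b. sw v (\<lambda>c d. G a b c d)) = sw v (\<lambda>c d. sws u (\<lambda>a b. G a b c d))"
  using fsupp_sw_swap[OF fsupp_sws, where G = "\<lambda>p c d. G (fst p) (snd p) c d"] by simp

lemma lin_sws2:
  "(\<And>a b. length a = length u \<Longrightarrow> length b = length u \<Longrightarrow> lin (\<lambda>x. G a b x)) \<Longrightarrow> lin (\<lambda>x. sws u (\<lambda>a b. G a b x))"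
  using lin_fsupp[OF fsupp_sws, of u "\<lambda>x p. G (fst p) (snd p) x"] by (simp add: len2_def)

lemma lin_sws_slot: "lin (\<lambda>x. sws (xs @ x # ys) G)"
  by (induction xs arbitrary: G) (auto intro: lin_sw' lin_sw2)

lemma lin_sws1: "entry_lin g \<Longrightarrow> lin (\<lambda>x. sws (g x) G)"
  unfolding entry_lin_def using lin_comp[OF lin_sws_slot] by auto

lemma sws_append: "sws (us @ vs) G = sws us (\<lambda>a b. sws vs (\<lambda>c d. G (a @ c) (b @ d)))"
  by (induction us arbitrary: G) simp_all

lemma sws_coassoc: "sws us (\<lambda>r c. sws r (\<lambda>a b. G a b c)) = sws us (\<lambda>a r. sws r (\<lambda>b c. G a b c))"
proof (induction us arbitrary: G)
  case (Cons u us)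
  have "sws (u # us) (\<lambda>r c. sws r (\<lambda>a b. G a b c))
    = sw u (\<lambda>r c. sw r (\<lambda>a b. sws us (\<lambda>rs cs. sws rs (\<lambda>as bs. G (a # as) (b # bs) (c # cs)))))"
    by (simp add: sws_sw_swap)
  also have "\<dots> = sw u (\<lambda>a r. sw r (\<lambda>b c. sws us (\<lambda>as rs. sws rs (\<lambda>bs cs. G (a # as) (b # bs) (c # cs)))))"
    by (simp add: sw_coassoc Cons)
  also have "\<dots> = sws (u # us) (\<lambda>a r. sws r (\<lambda>b c. G a b c))"
    by (simp add: sws_sw_swap)
  finally show ?case .
qed simp

definition counits :: "'h list \<Rightarrow> 'k" where
  "counits us = prod_list (map (counit H) us)"

lemma counits_simps [simp]: "counits [] = 1" "counits (u # us) = counit H u * counits us" "counits (us @ vs) = counits us * counits vs"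
  by (simp_all add: counits_def)

lemma counit_prod: "counit H (prod_list us) = counits us"
  by (induction us) (simp_all add: counit_one counit_mult)

lemma lin_counits: "entry_lin g \<Longrightarrow> lin (\<lambda>x. counits (g x))"
  unfolding counit_prod[symmetric] by (rule lin_counit[OF linH_prod])

lemma sws_counit_left: "ml (length us) G \<Longrightarrow> sws us (\<lambda>a b. counits a * G b) = G us"
proof (induction us arbitrary: G)
  case (Cons u us)
  have "sws (u # us) (\<lambda>a b. counits a * G b) = sw u (\<lambda>a b. counit H a * sws us (\<lambda>as bs. counits as * G (b # bs)))"
    by (simp add: mult.assoc sws_mult_left)
  also have "\<dots> = sw u (\<lambda>a b. counit H a * G (b # us))"
    using Cons.prems by (simp add: Cons.IH lin_ml_Cons)
  also have "\<dots> = G (u # us)"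
    by (rule sw_counit_left, rule lin_mlD[OF Cons.prems]) (simp_all add: entry_lin_id)
  finally show ?case .
qed simp

lemma sws_counit_right: "ml (length us) G \<Longrightarrow> sws us (\<lambda>a b. counits b * G a) = G us"
proof (induction us arbitrary: G)
  case (Cons u us)
  have "sws (u # us) (\<lambda>a b. counits b * G a) = sw u (\<lambda>a b. counit H b * sws us (\<lambda>as bs. counits bs * G (a # as)))"
    by (simp add: mult.assoc sws_mult_left)
  also have "\<dots> = sw u (\<lambda>a b. counit H b * G (a # us))"
    using Cons.prems by (simp add: Cons.IH lin_ml_Cons)
  also have "\<dots> = G (u # us)"
    by (rule sw_counit_right, rule lin_mlD[OF Cons.prems]) (simp_all add: entry_lin_id)
  finally show ?case .
qed simp

text \<open>The product of a list of arguments is a map of coalgebras.\<close>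

lemma sw_prod:
  assumes "\<And>b. lin (\<lambda>a. G a b)" "\<And>a. lin (\<lambda>b. G a b)"
  shows "sw (prod_list us) G = sws us (\<lambda>a b. G (prod_list a) (prod_list b))"
  using assms
proof (induction us arbitrary: G)
  case Nil
  then show ?case by (simp add: sw_one)
next
  case (Cons u us)
  have "sw (prod_list (u # us)) G = sw u (\<lambda>a b. sw (prod_list us) (\<lambda>c d. G (a * c) (b * d)))"
    by (simp add: sw_mult Cons.prems)
  also have "\<dots> = sw u (\<lambda>a b. sws us (\<lambda>c d. G (a * prod_list c) (b * prod_list d)))"
    by (subst Cons.IH) (intro lin_rules Cons.prems[THEN lin_comp] refl)+
  finally show ?case by simp
qed

lemma sws_antipode_left:
  assumes "lin F" shows "sws us (\<lambda>a b. F (antipode H (prod_list a) * prod_list b)) = counits us * F 1"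
proof -
  have "sw (prod_list us) (\<lambda>a b. F (antipode H a * b)) = sws us (\<lambda>a b. F (antipode H (prod_list a) * prod_list b))"
    by (rule sw_prod) (intro lin_comp[OF assms] lin_rules)+
  then show ?thesis by (simp add: sw_antipode_left assms counit_prod)
qed

lemma sws_antipode_right:
  assumes "lin F" shows "sws us (\<lambda>a b. F (prod_list a * antipode H (prod_list b))) = counits us * F 1"
proof -
  have "sw (prod_list us) (\<lambda>a b. F (a * antipode H b)) = sws us (\<lambda>a b. F (prod_list a * antipode H (prod_list b)))"
    by (rule sw_prod) (intro lin_comp[OF assms] lin_rules)+
  then show ?thesis by (simp add: sw_antipode_right assms counit_prod)
qed


section \<open>Sweedler notation with several legs\<close>

text \<open>The scalar counterpart of \<open>sweedler\<close>; for two and three legs it is rewritten as nested \<open>sws\<close>.\<close>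

primrec swm :: "nat \<Rightarrow> 'h list \<Rightarrow> ('h list list \<Rightarrow> 'k) \<Rightarrow> 'k" where
  "swm k [] G = G []"
| "swm k (u # us) G = swn k u (\<lambda>v. swm k us (\<lambda>m. G (v # m)))"

definition lenm :: "nat \<Rightarrow> nat \<Rightarrow> 'h list list \<Rightarrow> bool" where
  "lenm k n m \<longleftrightarrow> length m = n \<and> (\<forall>v\<in>set m. length v = k)"

lemma fsupp_swm: "fsupp (lenm k (length us)) (swm k us)"
proof (induction us)
  case Nil
  have "swm k [] = (\<lambda>G. G [])" by (rule ext) simp
  then show ?case by (simp add: fsupp_single lenm_def)
next
  case (Cons u us)
  have *: "fsupp (lenm k (Suc (length us))) (\<lambda>G. swm k us (\<lambda>m. G (v # m)))" if "blist k v" for v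
    using fsupp_bind[where y = "\<lambda>m G. G (v # m)", OF Cons fsupp_single, of "lenm k (Suc (length us))"] that
    by (simp add: lenm_def blist_def)
  have "swm k (u # us) = (\<lambda>G. swn k u (\<lambda>v. swm k us (\<lambda>m. G (v # m))))" by (rule ext) simp
  then show ?case using fsupp_bind[OF fsupp_swn *] by simp
qed

text \<open>The hypotheses under which a Sweedler sum of tensors may be paired with a form under the sum sign: values
in one tensor power, and multilinearity in the legs of each single argument.\<close>

definition sgood :: "nat \<Rightarrow> nat \<Rightarrow> nat \<Rightarrow> ('h list list \<Rightarrow> ('k, 'h) tensor) \<Rightarrow> bool" where
  "sgood k n q G \<longleftrightarrow> (\<forall>m. lenm k n m \<longrightarrow> G m \<in> hpower H q) \<and>
     (\<forall>m1 m2 \<psi>. lenm k (length m1) m1 \<longrightarrow> lenm k (length m2) m2 \<longrightarrow> Suc (length m1 + length m2) = n \<longrightarrow> ml q \<psi> \<longrightarrow>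
        ml k (\<lambda>v. E (G (m1 @ v # m2)) \<psi>))"

lemma E_sweedler_aux:
  "sgood k (length us) q G \<Longrightarrow>
     sweedler H k us G \<in> hpower H q \<and> (\<forall>\<psi>. ml q \<psi> \<longrightarrow> E (sweedler H k us G) \<psi> = swm k us (\<lambda>m. E (G m) \<psi>))"
proof (induction us arbitrary: G)
  case Nil
  then show ?case by (simp add: sgood_def lenm_def)
next
  case (Cons u us)
  have g: "sgood k (length us) q (\<lambda>m. G (v # m))" if "length v = k" for v
    unfolding sgood_def
  proof (intro conjI allI impI)
    fix m assume "lenm k (length us) m"
    then show "G (v # m) \<in> hpower H q" using Cons.prems that by (simp add: sgood_def lenm_def)
  next
    fix m1 m2 \<psi> assume "lenm k (length m1) m1" "lenm k (length m2) m2" "Suc (length m1 + length m2) = length us" "ml q \<psi>"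
    then show "ml k (\<lambda>w. E (G (v # m1 @ w # m2)) \<psi>)"
      using Cons.prems[unfolded sgood_def, THEN conjunct2, rule_format, of "v # m1" m2 \<psi>] that
      by (simp add: lenm_def)
  qed
  have IH: "sweedler H k us (\<lambda>m. G (v # m)) \<in> hpower H q"
    "ml q \<psi> \<Longrightarrow> E (sweedler H k us (\<lambda>m. G (v # m))) \<psi> = swm k us (\<lambda>m. E (G (v # m)) \<psi>)" if "length v = k" for v \<psi>
    using Cons.IH[OF g[OF that]] by auto
  have t: "tml k q (\<lambda>v. sweedler H k us (\<lambda>m. G (v # m)))"
  proof (rule tmlI)
    fix \<psi> assume ml: "ml q \<psi>"
    have "ml k (\<lambda>v. swm k us (\<lambda>m. E (G (v # m)) \<psi>))"
    proof (rule mlI, rule lin_fsupp[OF fsupp_swm])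
      fix xs ys :: "'h list" and m assume *: "Suc (length xs + length ys) = k" "lenm k (length us) m"
      have "ml k (\<lambda>v. E (G ([] @ v # m)) \<psi>)"
        using Cons.prems[unfolded sgood_def, THEN conjunct2, rule_format, of "[]" m \<psi>] * ml by (simp add: lenm_def)
      then show "lin (\<lambda>x. E (G ((xs @ x # ys) # m)) \<psi>)" using * by (simp add: ml_def)
    qed
    then show "ml k (\<lambda>v. E (sweedler H k us (\<lambda>m. G (v # m))) \<psi>)"
      by (rule ml_cong[THEN iffD1, rotated]) (simp add: IH ml)
  qed (rule IH)
  show ?case
  proof (intro conjI allI impI)
    show "sweedler H k (u # us) G \<in> hpower H q"
      by (simp add: tensor_lift_in[OF t icomult_in])
    fix \<psi> assume ml: "ml q \<psi>"
    show "E (sweedler H k (u # us) G) \<psi> = swm k (u # us) (\<lambda>m. E (G m) \<psi>)"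
      by (simp add: E_tensor_lift[OF t icomult_in] E_icomult IH ml cong: swn_cong)
  qed
qed

lemma sweedler_in: "sgood k (length us) q G \<Longrightarrow> sweedler H k us G \<in> hpower H q"
  and E_sweedler: "sgood k (length us) q G \<Longrightarrow> ml q \<psi> \<Longrightarrow> E (sweedler H k us G) \<psi> = swm k us (\<lambda>m. E (G m) \<psi>)"
  using E_sweedler_aux by auto

lemma swn_2: "swn 2 u \<psi> = sw u (\<lambda>a b. \<psi> [a, b])"
proof -
  have "swn 2 u \<psi> = sw u (\<lambda>a b. swn 1 b (\<lambda>w. \<psi> (a # w)))" by (simp add: numeral_2_eq_2 One_nat_def)
  also have "\<dots> = sw u (\<lambda>a b. \<psi> [a, b])" by (rule sw_cong_bas) (simp add: swn_1_bas)
  finally show ?thesis .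
qed

lemma swn_3: "swn 3 u \<psi> = sw u (\<lambda>a r. sw r (\<lambda>b c. \<psi> [a, b, c]))"
proof -
  have "swn (Suc 2) u \<psi> = sw u (\<lambda>a r. sw r (\<lambda>b c. \<psi> [a, b, c]))"
    unfolding swn.simps by (simp only: swn_2)
  then show ?thesis by (simp add: numeral_3_eq_3 numeral_2_eq_2)
qed

lemma leg_simps: "leg i [] = []" "leg i (v # m) = v ! (i - 1) # leg i m" "leg i (m @ m') = leg i m @ leg i m'"
  "length (leg i m) = length m"
  by (simp_all add: leg_def)

lemma swm_2: "swm 2 us (\<lambda>m. F (leg 1 m) (leg 2 m)) = sws us F"
proof (induction us arbitrary: F)
  case (Cons u us)
  have "swm 2 us (\<lambda>m. F (a # leg 1 m) (b # leg 2 m)) = sws us (\<lambda>as bs. F (a # as) (b # bs))" for a b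
    by (rule Cons)
  then show ?case by (simp add: leg_simps swn_2)
qed (simp add: leg_simps)

lemma swm_3: "swm 3 us (\<lambda>m. F (leg 1 m) (leg 2 m) (leg 3 m)) = sws us (\<lambda>a r. sws r (\<lambda>b c. F a b c))"
proof (induction us arbitrary: F)
  case (Cons u us)
  have "swm 3 us (\<lambda>m. F (a # leg 1 m) (b # leg 2 m) (c # leg 3 m)) = sws us (\<lambda>as r. sws r (\<lambda>bs cs. F (a # as) (b # bs) (c # cs)))" for a b c
    by (rule Cons)
  then show ?case by (simp add: leg_simps swn_3 sws_sw_swap)
qed (simp add: leg_simps)


section \<open>Cochains as families of functionals\<close>

definition ev :: "(('k, 'h) tensor \<Rightarrow> ('k, 'h) tensor) \<Rightarrow> 'h list \<Rightarrow> ('h list \<Rightarrow> 'k) \<Rightarrow> 'k" where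
  "ev f us \<psi> = E (f (hpure H us)) \<psi>"

lemma GS_in: "f \<in> GS H p q \<Longrightarrow> t \<in> hpower H p \<Longrightarrow> f t \<in> hpower H q"
  by (auto simp: GS_def linear_on_def)

lemma GS_pure_in: "f \<in> GS H p q \<Longrightarrow> length us = p \<Longrightarrow> f (hpure H us) \<in> hpower H q"
  by (simp add: GS_in pure_in)

lemma GS_add: "f \<in> GS H p q \<Longrightarrow> s \<in> hpower H p \<Longrightarrow> t \<in> hpower H p \<Longrightarrow> f (s + t) = f s + f t"
  and GS_scale: "f \<in> GS H p q \<Longrightarrow> t \<in> hpower H p \<Longrightarrow> f (tensor_scale c t) = tensor_scale c (f t)"
  and GS_outside: "f \<in> GS H p q \<Longrightarrow> t \<notin> hpower H p \<Longrightarrow> f t = 0"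
  by (auto simp: GS_def linear_on_def)

lemma GS_zero: "f \<in> GS H p q \<Longrightarrow> f 0 = 0"
  using GS_scale[of f p q 0 0] hpower_zero[of p] by simp

lemma GSI:
  assumes "\<And>t. t \<in> hpower H p \<Longrightarrow> f t \<in> hpower H q"
    and "\<And>s t. s \<in> hpower H p \<Longrightarrow> t \<in> hpower H p \<Longrightarrow> f (s + t) = f s + f t"
    and "\<And>c t. t \<in> hpower H p \<Longrightarrow> f (tensor_scale c t) = tensor_scale c (f t)"
    and "\<And>t. t \<notin> hpower H p \<Longrightarrow> f t = 0"
  shows "f \<in> GS H p q"
  using assms by (auto simp: GS_def linear_on_def)

lemma fsupp_ev: "f \<in> GS H p q \<Longrightarrow> length us = p \<Longrightarrow> fsupp (blist q) (ev f us)"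
  unfolding ev_def by (rule fsupp_E[OF GS_pure_in])

lemma ev_cong:
  assumes "f \<in> GS H p q" "length us = p" "\<And>v. length v = q \<Longrightarrow> \<psi> v = \<chi> v"
  shows "ev f us \<psi> = ev f us \<chi>"
  by (rule fsupp_cong[OF fsupp_ev[OF assms(1,2)]]) (simp add: blist_def assms(3))

lemma lin_ev1:
  assumes "f \<in> GS H p q" "entry_lin g" "\<And>x. length (g x) = p"
  shows "lin (\<lambda>x. ev f (g x) \<psi>)"
proof -
  obtain xs h ys where g: "linH h" "g = (\<lambda>x. xs @ h x # ys)" using assms(2) by (auto simp: entry_lin_def)
  have len: "length (xs @ x # ys) = p" for x using assms(3)[of 0] g(2) by simp
  have m: "Vector_Spaces.linear (hscale H) tensor_scale (\<lambda>x. hpure H (xs @ x # ys))"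
    using multilinear_pure[OF vector_space, of p] len by (simp add: multilinear_def)
  have "lin (\<lambda>x. ev f (xs @ x # ys) \<psi>)"
    using m unfolding lin_def ev_def
    by (simp add: Vector_Spaces.linear_iff GS_add[OF assms(1) pure_in[OF len] pure_in[OF len]]
        GS_scale[OF assms(1) pure_in[OF len]] E_add E_scale)
  then show ?thesis unfolding g(2) by (rule lin_comp) (rule g(1))
qed

lemma ml_ev: "f \<in> GS H p q \<Longrightarrow> ml p (\<lambda>us. ev f us \<psi>)"
  by (rule mlI, erule lin_ev1) (simp_all add: entry_lin_slot)

lemma lin_ev2:
  assumes "f \<in> GS H p q" "\<And>v. length v = q \<Longrightarrow> lin (\<lambda>x. \<psi> x v)" "length us = p"
  shows "lin (\<lambda>x. ev f us (\<psi> x))"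
  by (rule lin_fsupp[OF fsupp_ev[OF assms(1,3)]]) (simp add: assms(2) blist_def)

text \<open>All identities between operators are proved by this test.\<close>

lemma GS_eqI:
  assumes "f \<in> GS H p q" "g \<in> GS H p q"
    and "\<And>us \<psi>. length us = p \<Longrightarrow> ml q \<psi> \<Longrightarrow> ev f us \<psi> = ev g us \<psi>"
  shows "f = g"
proof
  fix t
  show "f t = g t"
  proof (cases "t \<in> hpower H p")
    case True
    then show ?thesis
    proof (induction rule: hpower_induct)
      case zero
      show ?case using GS_zero[OF assms(1)] GS_zero[OF assms(2)] by simp
    next
      case (step c xs t)
      have "f (hpure H xs) = g (hpure H xs)"
        by (rule tensor_eqI[of _ q])
          (use assms step in \<open>simp_all add: GS_pure_in ev_def\<close>)
      then show ?case
        using step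
        by (simp only: GS_add[OF assms(1) hpower_scale[OF pure_in]] GS_add[OF assms(2) hpower_scale[OF pure_in]]
            GS_scale[OF assms(1) pure_in] GS_scale[OF assms(2) pure_in])
    qed
  next
    case False
    then show ?thesis using GS_outside assms(1,2) by metis
  qed
qed

lemma GS_hom_of:
  assumes "tml p q F"
  shows "hom_of H p F \<in> GS H p q"
proof -
  interpret l: Vector_Spaces.linear tensor_scale tensor_scale "tensor_lift p F :: ('k,'h) tensor \<Rightarrow> ('k,'h) tensor"
    by (rule linear_tensor_lift)
  show ?thesis
    by (rule GSI)
      (simp_all add: hom_of_def tensor_lift_in[OF assms] hpower_add hpower_scale l.add l.scale)
qed

lemma ev_hom_of:
  assumes "tml p q F" "length us = p"
  shows "ev (hom_of H p F) us \<psi> = E (F us) \<psi>"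
  by (simp add: ev_def hom_of_def pure_in assms tensor_lift_pure[OF vector_space tml_multilinear[OF assms(1)]])

lemma GS_post:
  assumes "tml n m F" "f \<in> GS H p n"
  shows "(\<lambda>t. tensor_lift n F (f t)) \<in> GS H p m"
proof -
  interpret l: Vector_Spaces.linear tensor_scale tensor_scale "tensor_lift n F :: ('k,'h) tensor \<Rightarrow> ('k,'h) tensor"
    by (rule linear_tensor_lift)
  show ?thesis
    by (rule GSI)
      (simp_all add: tensor_lift_in[OF assms(1)] GS_in[OF assms(2)] GS_add[OF assms(2)] GS_scale[OF assms(2)]
        GS_outside[OF assms(2)] l.add l.scale l.zero)
qed

lemma ev_post:
  assumes "tml n m F" "f \<in> GS H p n" "length us = p"
  shows "ev (\<lambda>t. tensor_lift n F (f t)) us \<psi> = ev f us (\<lambda>v. E (F v) \<psi>)"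
  unfolding ev_def by (rule E_tensor_lift[OF assms(1) GS_pure_in[OF assms(2,3)]])

lemma GS_subspace: "module.subspace hom_scale (GS H p q)"
proof -
  interpret M: vector_space "hom_scale :: 'k \<Rightarrow> (('k,'h) tensor \<Rightarrow> ('k,'h) tensor) \<Rightarrow> _"
    by (rule vector_space_fun_scale[OF vector_space_tensor])
  show ?thesis
  proof (rule M.subspaceI)
    show "0 \<in> GS H p q"
      by (rule GSI) (simp_all add: hpower_zero zero_fun_apply)
    fix f g assume "f \<in> GS H p q" "g \<in> GS H p q"
    then show "f + g \<in> GS H p q"
      by (intro GSI)
        (simp_all add: plus_fun_apply[of f g] GS_in GS_add GS_scale GS_outside hpower_add T.scale_right_distrib)
  next
    fix f c assume "f \<in> GS H p q"
    then show "hom_scale c f \<in> GS H p q"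
      by (intro GSI)
        (simp_all add: fun_scale_def[of _ c f] GS_in GS_add GS_scale GS_outside hpower_scale T.scale_right_distrib mult.commute)
  qed
qed

lemma module_hom: "module (hom_scale :: 'k \<Rightarrow> (('k,'h) tensor \<Rightarrow> ('k,'h) tensor) \<Rightarrow> _)"
  using vector_space_fun_scale[OF vector_space_tensor] by (simp add: module_iff_vector_space)

lemma GS_plus: "f \<in> GS H p q \<Longrightarrow> g \<in> GS H p q \<Longrightarrow> f + g \<in> GS H p q"
  and GS_hscale: "f \<in> GS H p q \<Longrightarrow> hom_scale c f \<in> GS H p q"
  using GS_subspace module.subspace_def[OF module_hom] by auto

lemma ev_plus: "ev (f + g) us \<psi> = ev f us \<psi> + ev g us \<psi>"
  by (simp add: ev_def plus_fun_apply[of f g] E_add)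

lemma ev_hscale: "ev (hom_scale c f) us \<psi> = c * ev f us \<psi>"
  by (simp add: ev_def fun_scale_def[of _ c f] E_scale)

text \<open>An operator is linear as soon as its scalars are given by a formula linear in the scalars of \<open>f\<close>.\<close>

lemma linear_on_GS:
  assumes "\<And>f. f \<in> GS H p q \<Longrightarrow> op f \<in> GS H p' q'"
    and "\<And>f us \<psi>. f \<in> GS H p q \<Longrightarrow> length us = p' \<Longrightarrow> ml q' \<psi> \<Longrightarrow> ev (op f) us \<psi> = \<Phi> us \<psi> (ev f)"
    and "\<And>us \<psi> x y. length us = p' \<Longrightarrow> \<Phi> us \<psi> (\<lambda>a b. x a b + y a b) = \<Phi> us \<psi> x + \<Phi> us \<psi> y"
    and "\<And>us \<psi> c x. length us = p' \<Longrightarrow> \<Phi> us \<psi> (\<lambda>a b. c * x a b) = c * \<Phi> us \<psi> x"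
  shows "linear_on hom_scale hom_scale (GS H p q) (GS H p' q') op"
  unfolding linear_on_def
proof (intro conjI ballI allI)
  show "op \<in> GS H p q \<rightarrow> GS H p' q'" using assms(1) by blast
  fix f g assume f: "f \<in> GS H p q" and g: "g \<in> GS H p q"
  have "ev (f + g) = (\<lambda>a b. ev f a b + ev g a b)" by (simp add: fun_eq_iff ev_plus)
  then show "op (f + g) = op f + op g"
    by (intro GS_eqI[of _ p' q'] assms(1) GS_plus f g) (simp add: assms(2-4) f g GS_plus ev_plus)
next
  fix c f assume f: "f \<in> GS H p q"
  have "ev (hom_scale c f) = (\<lambda>a b. c * ev f a b)" by (simp add: fun_eq_iff ev_hscale)
  then show "op (hom_scale c f) = hom_scale c (op f)"
    by (intro GS_eqI[of _ p' q'] assms(1) GS_hscale f) (simp add: assms(2-4) f GS_hscale ev_hscale)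
qed

lemma sws_plus: "sws u (\<lambda>a b. F a b + G a b) = sws u F + sws u G"
  using fsupp_add[OF fsupp_sws, of u "\<lambda>p. F (fst p) (snd p)" "\<lambda>p. G (fst p) (snd p)"] by simp


section \<open>Evaluation of Sweedler expressions\<close>

lemma ml_ConsI:
  assumes "\<And>t. length t = n \<Longrightarrow> lin (\<lambda>h. \<psi> (h # t))" "\<And>h. ml n (\<lambda>t. \<psi> (h # t))"
  shows "ml (Suc n) \<psi>"
proof (rule mlI)
  fix xs ys :: "'h list" assume "Suc (length xs + length ys) = Suc n"
  then show "lin (\<lambda>x. \<psi> (xs @ x # ys))"
    using assms(1)[of ys] assms(2)[of "hd xs", unfolded ml_def, rule_format, of "tl xs" ys] by (cases xs) auto
qed

lemma ml_snocI:
  assumes "\<And>t. length t = n \<Longrightarrow> lin (\<lambda>h. \<psi> (t @ [h]))" "\<And>h. ml n (\<lambda>t. \<psi> (t @ [h]))"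
  shows "ml (Suc n) \<psi>"
proof (rule mlI)
  fix xs ys :: "'h list" assume "Suc (length xs + length ys) = Suc n"
  then show "lin (\<lambda>x. \<psi> (xs @ x # ys))"
    using assms(1)[of xs] assms(2)[of "last ys", unfolded ml_def, rule_format, of xs "butlast ys"]
    by (cases ys rule: rev_cases) auto
qed

lemma ml3I:
  assumes "\<And>b c. lin (\<lambda>a. \<psi> [a, b, c])" "\<And>a c. lin (\<lambda>b. \<psi> [a, b, c])" "\<And>a b. lin (\<lambda>c. \<psi> [a, b, c])"
  shows "ml 3 \<psi>"
proof -
  have "ml (Suc 2) \<psi>"
    by (rule ml_ConsI) (use assms in \<open>auto simp: length2 intro: ml2I\<close>)
  then show ?thesis by simp
qed

lemma ml_lin_slot: "ml n \<psi> \<Longrightarrow> Suc (length xs + length ys) = n \<Longrightarrow> lin (\<lambda>x. \<psi> (xs @ x # ys))"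
  by (simp add: ml_def)

lemma E_sweedler2:
  assumes "\<And>a b. length a = n \<Longrightarrow> length b = n \<Longrightarrow> K a b \<in> hpower H q"
    and "\<And>b \<psi>. length b = n \<Longrightarrow> ml q \<psi> \<Longrightarrow> ml n (\<lambda>a. E (K a b) \<psi>)"
    and "\<And>a \<psi>. length a = n \<Longrightarrow> ml q \<psi> \<Longrightarrow> ml n (\<lambda>b. E (K a b) \<psi>)"
  shows "tml n q (\<lambda>us. sweedler H 2 us (\<lambda>m. K (leg 1 m) (leg 2 m)))"
    and "length us = n \<Longrightarrow> ml q \<psi> \<Longrightarrow>
      E (sweedler H 2 us (\<lambda>m. K (leg 1 m) (leg 2 m))) \<psi> = sws us (\<lambda>a b. E (K a b) \<psi>)"
proof -
  have "sgood 2 n q (\<lambda>m. K (leg 1 m) (leg 2 m))"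
    unfolding sgood_def
    by (intro conjI allI impI)
      (auto intro!: ml2I assms(1) ml_lin_slot[OF assms(2)] ml_lin_slot[OF assms(3)] simp: leg_simps lenm_def)
  note g = this
  show e: "E (sweedler H 2 us (\<lambda>m. K (leg 1 m) (leg 2 m))) \<psi> = sws us (\<lambda>a b. E (K a b) \<psi>)"
    if "length us = n" "ml q \<psi>" for us \<psi>
    using E_sweedler[of 2 us q _ \<psi>] that g swm_2[of us "\<lambda>a b. E (K a b) \<psi>"] by simp
  show "tml n q (\<lambda>us. sweedler H 2 us (\<lambda>m. K (leg 1 m) (leg 2 m)))"
  proof (rule tmlI)
    fix \<psi> assume "ml q \<psi>"
    have "ml n (\<lambda>us. sws us (\<lambda>a b. E (K a b) \<psi>))" by (rule mlI, rule lin_sws1, rule entry_lin_slot)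
    then show "ml n (\<lambda>us. E (sweedler H 2 us (\<lambda>m. K (leg 1 m) (leg 2 m))) \<psi>)"
      by (rule ml_cong[THEN iffD1, rotated]) (simp add: e \<open>ml q \<psi>\<close>)
  qed (use sweedler_in g in auto)
qed

lemma E_sweedler3:
  assumes "\<And>a b c. length a = n \<Longrightarrow> length b = n \<Longrightarrow> length c = n \<Longrightarrow> K a b c \<in> hpower H q"
    and "\<And>b c \<psi>. length b = n \<Longrightarrow> length c = n \<Longrightarrow> ml q \<psi> \<Longrightarrow> ml n (\<lambda>a. E (K a b c) \<psi>)"
    and "\<And>a c \<psi>. length a = n \<Longrightarrow> length c = n \<Longrightarrow> ml q \<psi> \<Longrightarrow> ml n (\<lambda>b. E (K a b c) \<psi>)"
    and "\<And>a b \<psi>. length a = n \<Longrightarrow> length b = n \<Longrightarrow> ml q \<psi> \<Longrightarrow> ml n (\<lambda>c. E (K a b c) \<psi>)"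
  shows "tml n q (\<lambda>us. sweedler H 3 us (\<lambda>m. K (leg 1 m) (leg 2 m) (leg 3 m)))"
    and "length us = n \<Longrightarrow> ml q \<psi> \<Longrightarrow>
      E (sweedler H 3 us (\<lambda>m. K (leg 1 m) (leg 2 m) (leg 3 m))) \<psi> = sws us (\<lambda>a r. sws r (\<lambda>b c. E (K a b c) \<psi>))"
proof -
  have "sgood 3 n q (\<lambda>m. K (leg 1 m) (leg 2 m) (leg 3 m))"
    unfolding sgood_def
    by (intro conjI allI impI)
      (auto intro!: ml3I assms(1) ml_lin_slot[OF assms(2)] ml_lin_slot[OF assms(3)] ml_lin_slot[OF assms(4)]
        simp: leg_simps lenm_def)
  note g = this
  show e: "E (sweedler H 3 us (\<lambda>m. K (leg 1 m) (leg 2 m) (leg 3 m))) \<psi> = sws us (\<lambda>a r. sws r (\<lambda>b c. E (K a b c) \<psi>))"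
    if "length us = n" "ml q \<psi>" for us \<psi>
    using E_sweedler[of 3 us q _ \<psi>] that g swm_3[of us "\<lambda>a b c. E (K a b c) \<psi>"] by simp
  show "tml n q (\<lambda>us. sweedler H 3 us (\<lambda>m. K (leg 1 m) (leg 2 m) (leg 3 m)))"
  proof (rule tmlI)
    fix \<psi> assume "ml q \<psi>"
    have "ml n (\<lambda>us. sws us (\<lambda>a r. sws r (\<lambda>b c. E (K a b c) \<psi>)))" by (rule mlI, rule lin_sws1, rule entry_lin_slot)
    then show "ml n (\<lambda>us. E (sweedler H 3 us (\<lambda>m. K (leg 1 m) (leg 2 m) (leg 3 m))) \<psi>)"
      by (rule ml_cong[THEN iffD1, rotated]) (simp add: e \<open>ml q \<psi>\<close>)
  qed (use sweedler_in g in auto)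
qed


section \<open>The structure maps on functionals\<close>

lemma len_Suc: "length us = Suc n \<longleftrightarrow> (\<exists>h t. us = h # t \<and> length t = n)"
  by (auto simp: length_Suc_conv)

text \<open>The changes of the argument list made by the inner vertical cofaces and by the vertical codegeneracies.\<close>

definition merge :: "nat \<Rightarrow> 'h list \<Rightarrow> 'h list" where
  "merge i us = take (i - 1) us @ [us ! (i - 1) * us ! i] @ drop (i + 1) us"

definition insert_one :: "nat \<Rightarrow> 'h list \<Rightarrow> 'h list" where
  "insert_one j us = take j us @ [1] @ drop j us"

lemma length_merge: "1 \<le> i \<Longrightarrow> i < length us \<Longrightarrow> length (merge i us) = length us - 1"
  and length_insert_one: "j \<le> length us \<Longrightarrow> length (insert_one j us) = Suc (length us)"
  by (auto simp: merge_def insert_one_def)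

lemma merge_append: "length A = i - 1 \<Longrightarrow> 1 \<le> i \<Longrightarrow> merge i (A @ a # b # B) = A @ (a * b) # B"
  by (auto simp: merge_def nth_append)

lemma entry_lin_merge_slot:
  assumes "1 \<le> i" "i < Suc (length xs + length ys)"
  shows "entry_lin (\<lambda>x. merge i (xs @ x # ys))"
proof -
  consider "length xs < i - 1" | "length xs = i - 1" | "length xs = i" | "length xs > i" using assms(1) by linarith
  then show ?thesis
  proof cases
    case 1
    define k where "k = i - 2 - length xs"
    have k: "Suc k < length ys" "length xs + Suc k = i - 1" using 1 assms by (auto simp: k_def)
    then have ys: "ys = take k ys @ ys ! k # ys ! Suc k # drop (Suc (Suc k)) ys"
      by (simp add: Cons_nth_drop_Suc)
    have "merge i (xs @ x # ys) = xs @ x # take k ys @ (ys ! k * ys ! Suc k) # drop (Suc (Suc k)) ys" for x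
      using merge_append[of "xs @ x # take k ys" i "ys ! k" "ys ! Suc k" "drop (Suc (Suc k)) ys"] k assms ys by simp
    then show ?thesis by (simp add: entry_lin_slot)
  next
    case 2
    then obtain y ys' where ys: "ys = y # ys'" using assms by (cases ys) auto
    then show ?thesis using 2 assms
      by (simp add: merge_append) (intro entry_lin_append2 entry_lin_Cons1 linH_mult_right linH_id)
  next
    case 3
    then obtain xs' y where xs: "xs = xs' @ [y]" using assms by (cases xs rule: rev_cases) auto
    then show ?thesis using 3 assms
      by (simp add: merge_append) (intro entry_lin_append2 entry_lin_Cons1 linH_mult_left linH_id)
  next
    case 4
    define k where "k = i - 1"
    have k: "Suc k < length xs" "k = i - 1" using 4 assms by (auto simp: k_def)
    then have xs: "xs = take k xs @ xs ! k # xs ! Suc k # drop (Suc (Suc k)) xs"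
      by (simp add: Cons_nth_drop_Suc)
    have "merge i (xs @ x # ys) = (take k xs @ (xs ! k * xs ! Suc k) # drop (Suc (Suc k)) xs) @ x # ys" for x
      using merge_append[of "take k xs" i "xs ! k" "xs ! Suc k" "drop (Suc (Suc k)) xs @ x # ys"] k assms xs
      by (metis append_Cons append_assoc length_take less_or_eq_imp_le min.absorb2 Suc_lessD)
    then show ?thesis by (simp only: entry_lin_slot)
  qed
qed

lemma entry_lin_insert_one_slot: "entry_lin (\<lambda>x. insert_one j (xs @ x # ys))"
proof (cases "j \<le> length xs")
  case True
  then have "insert_one j (xs @ x # ys) = (take j xs @ 1 # drop j xs) @ x # ys" for x by (simp add: insert_one_def)
  then show ?thesis by (simp only: entry_lin_slot)
next
  case False
  then obtain k where "j = length xs + Suc k" by (metis add_Suc_right less_imp_Suc_add not_le)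
  then have "insert_one j (xs @ x # ys) = xs @ x # (take k ys @ 1 # drop k ys)" for x by (simp add: insert_one_def)
  then show ?thesis by (simp only: entry_lin_slot)
qed

lemma delta_v_0:
  assumes f: "f \<in> GS H n q"
  shows "delta_v H n q 0 f \<in> GS H (Suc n) q"
    and "length us = n \<Longrightarrow> ml q \<psi> \<Longrightarrow> ev (delta_v H n q 0 f) (u # us) \<psi> = ev f us (L q u \<psi>)"
proof -
  have e: "E (lact H q (hd us) (f (hpure H (tl us)))) \<psi> = ev f (tl us) (L q (hd us) \<psi>)" if "length us = Suc n" "ml q \<psi>" for us \<psi>
    unfolding ev_def by (rule E_lact) (use that in \<open>simp_all add: GS_pure_in[OF f]\<close>)
  have t: "tml (Suc n) q (\<lambda>us. lact H q (hd us) (f (hpure H (tl us))))"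
  proof (rule tmlI)
    fix \<psi> assume ml: "ml q \<psi>"
    have "ml (Suc n) (\<lambda>us. ev f (tl us) (L q (hd us) \<psi>))"
      by (rule ml_ConsI) (simp_all add: lin_ev2[OF f] lin_L1 linH_id ml_ev[OF f])
    then show "ml (Suc n) (\<lambda>us. E (lact H q (hd us) (f (hpure H (tl us)))) \<psi>)"
      by (rule ml_cong[THEN iffD1, rotated]) (simp add: e ml)
  qed (rule E_lact(2)[OF GS_pure_in[OF f] ml_mlext], simp)
  show "delta_v H n q 0 f \<in> GS H (Suc n) q"
    by (simp add: delta_v_def GS_hom_of[OF t])
  show "ev (delta_v H n q 0 f) (u # us) \<psi> = ev f us (L q u \<psi>)" if "length us = n" "ml q \<psi>"
    using that e[of "u # us" \<psi>] by (simp add: delta_v_def ev_hom_of[OF t])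
qed

lemma delta_v_last:
  assumes f: "f \<in> GS H n q"
  shows "delta_v H n q (Suc n) f \<in> GS H (Suc n) q"
    and "length us = n \<Longrightarrow> ml q \<psi> \<Longrightarrow> ev (delta_v H n q (Suc n) f) (us @ [u]) \<psi> = ev f us (R q u \<psi>)"
proof -
  have e: "E (ract H q (f (hpure H (butlast us))) (last us)) \<psi> = ev f (butlast us) (R q (last us) \<psi>)" if "length us = Suc n" "ml q \<psi>" for us \<psi>
    unfolding ev_def by (rule E_ract) (use that in \<open>simp_all add: GS_pure_in[OF f]\<close>)
  have t: "tml (Suc n) q (\<lambda>us. ract H q (f (hpure H (butlast us))) (last us))"
  proof (rule tmlI)
    fix \<psi> assume ml: "ml q \<psi>"
    have "ml (Suc n) (\<lambda>us. ev f (butlast us) (R q (last us) \<psi>))"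
      by (rule ml_snocI) (simp_all add: lin_ev2[OF f] lin_R1 linH_id ml_ev[OF f])
    then show "ml (Suc n) (\<lambda>us. E (ract H q (f (hpure H (butlast us))) (last us)) \<psi>)"
      by (rule ml_cong[THEN iffD1, rotated]) (simp add: e ml)
  qed (rule E_ract(2)[OF GS_pure_in[OF f] ml_mlext], simp)
  show "delta_v H n q (Suc n) f \<in> GS H (Suc n) q"
    by (simp add: delta_v_def GS_hom_of[OF t])
  show "ev (delta_v H n q (Suc n) f) (us @ [u]) \<psi> = ev f us (R q u \<psi>)" if "length us = n" "ml q \<psi>"
    using that e[of "us @ [u]" \<psi>] by (simp add: delta_v_def ev_hom_of[OF t])
qed

lemma delta_v_mid:
  assumes f: "f \<in> GS H n q" and i: "1 \<le> i" "i \<le> n"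
  shows "delta_v H n q i f \<in> GS H (Suc n) q"
    and "length us = Suc n \<Longrightarrow> ev (delta_v H n q i f) us \<psi> = ev f (merge i us) \<psi>"
proof -
  have t: "tml (Suc n) q (\<lambda>us. f (hpure H (merge i us)))"
  proof (rule tmlI)
    fix \<psi>
    show "ml (Suc n) (\<lambda>us. E (f (hpure H (merge i us))) \<psi>)"
      unfolding ev_def[symmetric] by (rule mlI, rule lin_ev1[OF f]) (use i in \<open>simp_all add: entry_lin_merge_slot length_merge\<close>)
  qed (use i in \<open>auto intro: GS_pure_in[OF f] simp: length_merge\<close>)
  have d: "delta_v H n q i f = hom_of H (Suc n) (\<lambda>us. f (hpure H (merge i us)))"
    using i by (simp add: delta_v_def merge_def)
  show "delta_v H n q i f \<in> GS H (Suc n) q" by (simp add: d GS_hom_of[OF t])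
  show "ev (delta_v H n q i f) us \<psi> = ev f (merge i us) \<psi>" if "length us = Suc n"
    using that by (simp add: d ev_hom_of[OF t]) (simp add: ev_def)
qed

lemma sigma_v:
  assumes f: "f \<in> GS H (Suc n) q" and j: "j \<le> n"
  shows "sigma_v H (Suc n) q j f \<in> GS H n q"
    and "length us = n \<Longrightarrow> ev (sigma_v H (Suc n) q j f) us \<psi> = ev f (insert_one j us) \<psi>"
proof -
  have t: "tml n q (\<lambda>us. f (hpure H (insert_one j us)))"
  proof (rule tmlI)
    fix \<psi>
    show "ml n (\<lambda>us. E (f (hpure H (insert_one j us))) \<psi>)"
      unfolding ev_def[symmetric] by (rule mlI, rule lin_ev1[OF f]) (use j in \<open>simp_all add: entry_lin_insert_one_slot length_insert_one\<close>)
  qed (use j in \<open>auto intro: GS_pure_in[OF f] simp: length_insert_one\<close>)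
  have d: "sigma_v H (Suc n) q j f = hom_of H n (\<lambda>us. f (hpure H (insert_one j us)))"
    by (simp add: sigma_v_def insert_one_def)
  show "sigma_v H (Suc n) q j f \<in> GS H n q" by (simp add: d GS_hom_of[OF t])
  show "ev (sigma_v H (Suc n) q j f) us \<psi> = ev f (insert_one j us) \<psi>" if "length us = n"
    using that by (simp add: d ev_hom_of[OF t]) (simp add: ev_def)
qed

lemma delta_h_0:
  assumes f: "f \<in> GS H p n"
  shows "delta_h H p n 0 f \<in> GS H p (Suc n)"
    and "length us = p \<Longrightarrow> ml (Suc n) \<psi> \<Longrightarrow>
      ev (delta_h H p n 0 f) us \<psi> = sws us (\<lambda>a b. ev f b (\<lambda>v. \<psi> (prod_list a # v)))"
proof -
  let ?K = "\<lambda>a b. tensor_lift n (\<lambda>v. hpure H (prod_list a # v)) (f (hpure H b))"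
  have t: "tml n (Suc n) (\<lambda>v. hpure H (x # v))" for x
    by (rule tmlI) (simp_all add: pure_in E_pure ml_entry_lin entry_lin_Cons2 entry_lin_slot del: mlext.simps)
  have e: "E (?K a b) \<psi> = ev f b (\<lambda>v. \<psi> (prod_list a # v))" if "length b = p" "ml (Suc n) \<psi>" for a b \<psi>
  proof -
    have "E (?K a b) \<psi> = ev f b (\<lambda>v. mlext (prod_list a # v) \<psi>)"
      unfolding ev_def by (simp add: E_tensor_lift[OF t GS_pure_in[OF f that(1)]] E_pure del: mlext.simps)
    also have "\<dots> = ev f b (\<lambda>v. \<psi> (prod_list a # v))"
      by (rule ev_cong[OF f that(1)], rule mlext_eq) (simp add: that)
    finally show ?thesis .
  qed
  have 1: "?K a b \<in> hpower H (Suc n)" if "length b = p" for a b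
    by (rule tensor_lift_in[OF t GS_pure_in[OF f that]])
  have 2: "ml p (\<lambda>a. E (?K a b) \<psi>)" if "length b = p" "ml (Suc n) \<psi>" for b \<psi>
    unfolding e[OF that]
    by (rule mlI, rule lin_ev2[OF f _ that(1)], rule lin_mlD[OF that(2)], (intro entry_lin_Cons1 linH_prod entry_lin_slot)) simp_all
  have 3: "ml p (\<lambda>b. E (?K a b) \<psi>)" if "ml (Suc n) \<psi>" for a \<psi>
    by (rule ml_cong[THEN iffD1, OF _ ml_ev[OF f]]) (simp add: e that)
  note s = E_sweedler2[of p ?K "Suc n", OF 1 2 3, simplified]
  show "delta_h H p n 0 f \<in> GS H p (Suc n)" by (simp add: delta_h_def GS_hom_of[OF s(1)])
  show "ev (delta_h H p n 0 f) us \<psi> = sws us (\<lambda>a b. ev f b (\<lambda>v. \<psi> (prod_list a # v)))"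
    if "length us = p" "ml (Suc n) \<psi>"
    using that by (simp add: delta_h_def ev_hom_of[OF s(1)] s(2) e cong: sws_cong)
qed

lemma delta_h_last:
  assumes f: "f \<in> GS H p n"
  shows "delta_h H p n (Suc n) f \<in> GS H p (Suc n)"
    and "length us = p \<Longrightarrow> ml (Suc n) \<psi> \<Longrightarrow>
      ev (delta_h H p n (Suc n) f) us \<psi> = sws us (\<lambda>a b. ev f a (\<lambda>v. \<psi> (v @ [prod_list b])))"
proof -
  let ?K = "\<lambda>a b. tensor_lift n (\<lambda>v. hpure H (v @ [prod_list b])) (f (hpure H a))"
  have t: "tml n (Suc n) (\<lambda>v. hpure H (v @ [x]))" for x
    by (rule tmlI) (simp_all add: pure_in E_pure, rule ml_entry_lin, rule entry_lin_append1, rule entry_lin_slot)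
  have e: "E (?K a b) \<psi> = ev f a (\<lambda>v. \<psi> (v @ [prod_list b]))" if "length a = p" "ml (Suc n) \<psi>" for a b \<psi>
  proof -
    have "E (?K a b) \<psi> = ev f a (\<lambda>v. mlext (v @ [prod_list b]) \<psi>)"
      unfolding ev_def by (simp add: E_tensor_lift[OF t GS_pure_in[OF f that(1)]] E_pure del: mlext.simps)
    also have "\<dots> = ev f a (\<lambda>v. \<psi> (v @ [prod_list b]))"
      by (rule ev_cong[OF f that(1)], rule mlext_eq) (simp add: that)
    finally show ?thesis .
  qed
  have 1: "?K a b \<in> hpower H (Suc n)" if "length a = p" for a b
    by (rule tensor_lift_in[OF t GS_pure_in[OF f that]])
  have 2: "ml p (\<lambda>b. E (?K a b) \<psi>)" if "length a = p" "ml (Suc n) \<psi>" for a \<psi>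
    unfolding e[OF that]
    by (rule mlI, rule lin_ev2[OF f _ that(1)], rule lin_mlD[OF that(2)], (intro entry_lin_append2 entry_lin_Cons1 linH_prod entry_lin_slot)) simp_all
  have 3: "ml p (\<lambda>a. E (?K a b) \<psi>)" if "ml (Suc n) \<psi>" for b \<psi>
    by (rule ml_cong[THEN iffD1, OF _ ml_ev[OF f]]) (simp add: e that)
  note s = E_sweedler2[of p ?K "Suc n", OF 1 3 2, simplified]
  show "delta_h H p n (Suc n) f \<in> GS H p (Suc n)" by (simp add: delta_h_def GS_hom_of[OF s(1)])
  show "ev (delta_h H p n (Suc n) f) us \<psi> = sws us (\<lambda>a b. ev f a (\<lambda>v. \<psi> (v @ [prod_list b])))"
    if "length us = p" "ml (Suc n) \<psi>"
    using that by (simp add: delta_h_def ev_hom_of[OF s(1)] s(2) e cong: sws_cong)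
qed

text \<open>The transposes on forms of the comultiplication of the \<open>i\<close>-th factor and of the counit of the \<open>j\<close>-th factor
(factors are counted from 1 in the first case and from 0 in the second, like the cofaces and codegeneracies).\<close>

definition dup :: "nat \<Rightarrow> ('h list \<Rightarrow> 'k) \<Rightarrow> 'h list \<Rightarrow> 'k" where
  "dup i \<psi> v = sw (v ! (i - 1)) (\<lambda>x y. \<psi> (take (i - 1) v @ [x, y] @ drop i v))"

definition del :: "nat \<Rightarrow> ('h list \<Rightarrow> 'k) \<Rightarrow> 'h list \<Rightarrow> 'k" where
  "del j \<psi> v = counit H (v ! j) * \<psi> (take j v @ drop (j + 1) v)"

lemma dup_append: "length A = i - 1 \<Longrightarrow> 1 \<le> i \<Longrightarrow> dup i \<psi> (A @ z # B) = sw z (\<lambda>x y. \<psi> (A @ x # y # B))"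
  by (cases i) (simp_all add: dup_def One_nat_def)

lemma del_append: "length A = j \<Longrightarrow> del j \<psi> (A @ z # B) = counit H z * \<psi> (A @ B)"
  by (simp add: del_def nth_append One_nat_def)

lemma split_nth:
  assumes "j < length v" obtains A z B where "v = A @ z # B" "length A = j"
  using assms id_take_nth_drop[of j v] by (metis length_take min.absorb2 less_imp_le)

lemma ml_dup:
  assumes "ml (Suc n) \<psi>" "1 \<le> i" "i \<le> n" shows "ml n (dup i \<psi>)"
proof (rule mlI)
  fix xs ys :: "'h list" assume len: "Suc (length xs + length ys) = n"
  consider "length xs < i - 1" | "length xs = i - 1" | "length xs > i - 1" by linarith
  then show "lin (\<lambda>x. dup i \<psi> (xs @ x # ys))"
  proof cases
    case 1
    then have "i - 2 - length xs < length ys" using len assms by linarith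
    then obtain A z B where ys: "ys = A @ z # B" "length A = i - 2 - length xs" by (rule split_nth)
    have "dup i \<psi> (xs @ x # ys) = sw z (\<lambda>a b. \<psi> (xs @ x # A @ a # b # B))" for x
      using dup_append[of "xs @ x # A" i \<psi> z B] 1 ys assms by simp
    then show ?thesis
      by simp (rule lin_sw2, rule lin_mlD[OF assms(1)]; use len ys in \<open>simp add: entry_lin_slot\<close>)
  next
    case 2
    then show ?thesis using dup_append assms(2) by (simp add: lin_sw')
  next
    case 3
    then obtain A z B where xs: "xs = A @ z # B" "length A = i - 1" by (rule split_nth)
    have "dup i \<psi> (xs @ x # ys) = sw z (\<lambda>a b. \<psi> ((A @ a # b # B) @ x # ys))" for x
      using dup_append[of A i \<psi> z "B @ x # ys"] xs assms by simp
    then show ?thesis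
      by (simp only:) (rule lin_sw2, rule lin_mlD[OF assms(1)], rule entry_lin_slot, use len xs in simp)
  qed
qed

lemma ml_del:
  assumes "ml n \<psi>" "j \<le> n" shows "ml (Suc n) (del j \<psi>)"
proof (rule mlI)
  fix xs ys :: "'h list" assume len: "Suc (length xs + length ys) = Suc n"
  consider "length xs < j" | "length xs = j" | "length xs > j" by linarith
  then show "lin (\<lambda>x. del j \<psi> (xs @ x # ys))"
  proof cases
    case 1
    then have "j - 1 - length xs < length ys" using len assms by linarith
    then obtain A z B where ys: "ys = A @ z # B" "length A = j - 1 - length xs" by (rule split_nth)
    have "del j \<psi> (xs @ x # ys) = counit H z * \<psi> (xs @ x # A @ B)" for x
      using del_append[of "xs @ x # A" j \<psi> z B] 1 ys assms by simp
    then show ?thesis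
      by simp (rule lin_mult_left, rule lin_mlD[OF assms(1)]; use len ys in \<open>simp add: entry_lin_slot\<close>)
  next
    case 2
    then show ?thesis using del_append by (simp add: lin_mult_right lin_counit')
  next
    case 3
    then obtain A z B where xs: "xs = A @ z # B" "length A = j" by (rule split_nth)
    have "del j \<psi> (xs @ x # ys) = counit H z * \<psi> ((A @ B) @ x # ys)" for x
      using del_append[of A j \<psi> z "B @ x # ys"] xs assms by simp
    then show ?thesis
      by (simp only:) (rule lin_mult_left, rule lin_mlD[OF assms(1)], rule entry_lin_slot, use len xs in simp)
  qed
qed

lemma delta_h_mid:
  assumes f: "f \<in> GS H p n" and i: "1 \<le> i" "i \<le> n"
  shows "delta_h H p n i f \<in> GS H p (Suc n)"
    and "length us = p \<Longrightarrow> ml (Suc n) \<psi> \<Longrightarrow> ev (delta_h H p n i f) us \<psi> = ev f us (dup i \<psi>)"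
proof -
  let ?F = "\<lambda>v. tensor_lift 2 (\<lambda>w. hpure H (take (i - 1) v @ w @ drop i v)) (comult H (v ! (i - 1)))"
  have in1: "hpure H (take (i - 1) v @ [a, b] @ drop i v) \<in> hpower H (Suc n)" if "length v = n" for v a b
    by (rule pure_in) (use that i in simp)
  have lin1: "lin (\<lambda>a. E (hpure H (A @ [a, b] @ B)) \<psi>)" "lin (\<lambda>b. E (hpure H (A @ [a, b] @ B)) \<psi>)" for A B a b \<psi>
    unfolding E_pure by (intro lin_rules)+
  have F: "?F v \<in> hpower H (Suc n)" "ml (Suc n) \<psi> \<Longrightarrow> E (?F v) \<psi> = dup i \<psi> v" if "length v = n" for v \<psi>
  proof -
    show "?F v \<in> hpower H (Suc n)" by (rule E_lift_comult(2)[OF in1[OF that] lin1])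
    assume ml: "ml (Suc n) \<psi>"
    have "mlext (take (i - 1) v @ [a, b] @ drop i v) \<psi> = \<psi> (take (i - 1) v @ [a, b] @ drop i v)" for a b
      by (rule mlext_eq) (use that i ml in simp)
    then show "E (?F v) \<psi> = dup i \<psi> v"
      unfolding E_lift_comult(1)[OF in1[OF that] lin1] E_pure dup_def by simp
  qed
  have t: "tml n (Suc n) ?F"
  proof (rule tmlI)
    fix \<psi> assume ml: "ml (Suc n) \<psi>"
    show "ml n (\<lambda>v. E (?F v) \<psi>)"
      by (rule ml_cong[THEN iffD1, OF _ ml_dup[OF ml i]]) (simp add: F ml)
  qed (rule F)
  have d: "delta_h H p n i f = (\<lambda>t. tensor_lift n ?F (f t))"
    using i by (simp add: delta_h_def)
  show "delta_h H p n i f \<in> GS H p (Suc n)" unfolding d by (rule GS_post[OF t f])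
  show "ev (delta_h H p n i f) us \<psi> = ev f us (dup i \<psi>)" if "length us = p" "ml (Suc n) \<psi>"
    unfolding d ev_post[OF t f that(1)] by (rule ev_cong[OF f that(1)]) (simp add: F that)
qed

lemma sigma_h:
  assumes f: "f \<in> GS H p (Suc n)" and j: "j \<le> n"
  shows "sigma_h H p (Suc n) j f \<in> GS H p n"
    and "length us = p \<Longrightarrow> ml n \<psi> \<Longrightarrow> ev (sigma_h H p (Suc n) j f) us \<psi> = ev f us (del j \<psi>)"
proof -
  let ?F = "\<lambda>v. tensor_scale (counit H (v ! j)) (hpure H (take j v @ drop (j + 1) v))"
  have F: "?F v \<in> hpower H n" "ml n \<psi> \<Longrightarrow> E (?F v) \<psi> = del j \<psi> v" if "length v = Suc n" for v \<psi>
    using that j by (simp_all add: hpower_scale pure_in E_scale E_pure del_def mlext_eq)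
  have t: "tml (Suc n) n ?F"
  proof (rule tmlI)
    fix \<psi> assume ml: "ml n \<psi>"
    show "ml (Suc n) (\<lambda>v. E (?F v) \<psi>)"
      by (rule ml_cong[THEN iffD1, OF _ ml_del[OF ml j]]) (simp add: F ml)
  qed (rule F)
  have d: "sigma_h H p (Suc n) j f = (\<lambda>t. tensor_lift (Suc n) ?F (f t))"
    by (simp add: sigma_h_def)
  show "sigma_h H p (Suc n) j f \<in> GS H p n" unfolding d by (rule GS_post[OF t f])
  show "ev (sigma_h H p (Suc n) j f) us \<psi> = ev f us (del j \<psi>)" if "length us = p" "ml n \<psi>"
    unfolding d ev_post[OF t f that(1)] by (rule ev_cong[OF f that(1)]) (simp add: F that)
qed

lemma tau_coalg_0: "tau_coalg H p 0 f = f" and tau_alg_0: "tau_alg H 0 q f = f"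
  by (simp_all add: tau_coalg_def tau_alg_def)

text \<open>The transpose of the map \<open>h \<otimes> v \<mapsto> x S(h) \<triangleright> (v \<otimes> y)\<close>, from which the horizontal cyclic operator is built.\<close>

definition tau_form :: "nat \<Rightarrow> 'h \<Rightarrow> 'h \<Rightarrow> ('h list \<Rightarrow> 'k) \<Rightarrow> 'h list \<Rightarrow> 'k" where
  "tau_form n x y \<psi> v = L n (x * antipode H (hd v)) \<psi> (tl v @ [y])"

lemma tau_form_Cons: "tau_form n x y \<psi> (h # v) = L n (x * antipode H h) \<psi> (v @ [y])"
  by (simp add: tau_form_def)

lemma lin_TH1: "linH g \<Longrightarrow> lin (\<lambda>x. tau_form n (g x) y \<psi> v)"
  unfolding tau_form_def by (intro lin_L1 linH_mult_right)

lemma lin_TH2: "linH g \<Longrightarrow> ml n \<psi> \<Longrightarrow> length v = n \<Longrightarrow> n \<noteq> 0 \<Longrightarrow> lin (\<lambda>y. tau_form n x (g y) \<psi> v)"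
  unfolding tau_form_def by (rule lin_L3) (auto intro: lin_rules)

lemma ml_tau_form: "ml (Suc n) \<psi> \<Longrightarrow> ml (Suc n) (tau_form (Suc n) x y \<psi>)"
  by (rule ml_ConsI; simp add: tau_form_Cons)
    (intro lin_L1 linH_mult_left linH_antipode linH_id,
      rule mlI, erule lin_L3, simp_all add: entry_lin_append1 entry_lin_slot del: append_assoc append.simps)

lemma tau_coalg:
  assumes f: "f \<in> GS H p n" and n: "n \<noteq> 0"
  shows "tau_coalg H p n f \<in> GS H p n"
    and "length us = p \<Longrightarrow> ml n \<psi> \<Longrightarrow>
      ev (tau_coalg H p n f) us \<psi> = sws us (\<lambda>a r. sws r (\<lambda>b c. ev f b (tau_form n (prod_list a) (prod_list c) \<psi>)))"
proof -
  let ?K = "\<lambda>a b c. tensor_lift n (\<lambda>v. lact H n (prod_list a * antipode H (hd v)) (hpure H (tl v @ [prod_list c]))) (f (hpure H b))"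
  have l: "lact H n (x * antipode H (hd v)) (hpure H (tl v @ [y])) \<in> hpower H n"
    "ml n \<psi> \<Longrightarrow> E (lact H n (x * antipode H (hd v)) (hpure H (tl v @ [y]))) \<psi> = tau_form n x y \<psi> v"
    if "length v = n" for v x y \<psi>
  proof -
    have i: "hpure H (tl v @ [y]) \<in> hpower H n" by (rule pure_in) (use that n in simp)
    show "lact H n (x * antipode H (hd v)) (hpure H (tl v @ [y])) \<in> hpower H n" by (rule E_lact(2)[OF i ml_mlext])
    show "E (lact H n (x * antipode H (hd v)) (hpure H (tl v @ [y]))) \<psi> = tau_form n x y \<psi> v" if "ml n \<psi>"
      unfolding E_lact(1)[OF i that] tau_form_def E_pure
      by (rule mlext_eq) (use \<open>length v = n\<close> n that in \<open>simp add: ml_L\<close>)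
  qed
  have t: "tml n n (\<lambda>v. lact H n (x * antipode H (hd v)) (hpure H (tl v @ [y])))" for x y
  proof (rule tmlI)
    fix \<psi> assume ml: "ml n \<psi>"
    have "ml n (tau_form n x y \<psi>)" using ml_tau_form[of "n - 1" \<psi>] ml n by simp
    then show "ml n (\<lambda>v. E (lact H n (x * antipode H (hd v)) (hpure H (tl v @ [y]))) \<psi>)"
      by (rule ml_cong[THEN iffD1, rotated]) (simp add: l ml)
  qed (rule l)
  have e: "E (?K a b c) \<psi> = ev f b (tau_form n (prod_list a) (prod_list c) \<psi>)" if "length b = p" "ml n \<psi>" for a b c \<psi>
  proof -
    have "E (?K a b c) \<psi> = ev f b (\<lambda>v. E (lact H n (prod_list a * antipode H (hd v)) (hpure H (tl v @ [prod_list c]))) \<psi>)"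
      unfolding ev_def by (simp add: E_tensor_lift[OF t GS_pure_in[OF f that(1)]])
    also have "\<dots> = ev f b (tau_form n (prod_list a) (prod_list c) \<psi>)"
      by (rule ev_cong[OF f that(1)]) (simp add: l that)
    finally show ?thesis .
  qed
  have 1: "?K a b c \<in> hpower H n" if "length b = p" for a b c
    by (rule tensor_lift_in[OF t GS_pure_in[OF f that]])
  have 2: "ml p (\<lambda>a. E (?K a b c) \<psi>)" if "length b = p" "ml n \<psi>" for b c \<psi>
    unfolding e[OF that]
    by (rule mlI, rule lin_ev2[OF f _ that(1)], intro lin_TH1 linH_prod entry_lin_slot)
  have 3: "ml p (\<lambda>b. E (?K a b c) \<psi>)" if "ml n \<psi>" for a c \<psi>
    by (rule ml_cong[THEN iffD1, OF _ ml_ev[OF f]]) (simp add: e that)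
  have 4: "ml p (\<lambda>c. E (?K a b c) \<psi>)" if "length b = p" "ml n \<psi>" for a b \<psi>
    unfolding e[OF that]
    by (rule mlI, rule lin_ev2[OF f _ that(1)], rule lin_TH2, (intro linH_prod entry_lin_slot)) (use that n in simp_all)
  have s1: "tml p n (\<lambda>us. sweedler H 3 us (\<lambda>m. ?K (leg 1 m) (leg 2 m) (leg 3 m)))"
    by (rule E_sweedler3(1)[where K = ?K]) (rule 1 2 3 4; assumption)+
  have s2: "E (sweedler H 3 us (\<lambda>m. ?K (leg 1 m) (leg 2 m) (leg 3 m))) \<psi> = sws us (\<lambda>a r. sws r (\<lambda>b c. E (?K a b c) \<psi>))"
    if "length us = p" "ml n \<psi>" for us \<psi>
    by (rule E_sweedler3(2)[where K = ?K]) (rule 1 2 3 4 that; assumption?)+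
  show "tau_coalg H p n f \<in> GS H p n" using n by (simp add: tau_coalg_def GS_hom_of[OF s1])
  show "ev (tau_coalg H p n f) us \<psi> = sws us (\<lambda>a r. sws r (\<lambda>b c. ev f b (tau_form n (prod_list a) (prod_list c) \<psi>)))"
    if "length us = p" "ml n \<psi>"
    using that n by (simp add: tau_coalg_def ev_hom_of[OF s1] s2 e cong: sws_cong)
qed

end

text \<open>For an involution \<open>S\<close> the inverse antipode in the vertical cyclic operator is \<open>S\<close> itself.\<close>

locale involutive_hopf_algebra = hopf_algebra H for H :: "('k::field, 'h::ring_1) hopf" +
  assumes antipode_antipode [simp]: "antipode H (antipode H x) = x"
begin

lemma inv_antipode: "inv (antipode H) = antipode H"
  by (rule inv_unique_comp) (simp_all add: fun_eq_iff)

lemma tau_alg: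
  assumes f: "f \<in> GS H n q" and n: "n \<noteq> 0"
  shows "tau_alg H n q f \<in> GS H n q"
    and "length us = n \<Longrightarrow> ml q \<psi> \<Longrightarrow>
      ev (tau_alg H n q f) us \<psi> = sws us (\<lambda>a r. sws r (\<lambda>b c.
        ev f (antipode H (prod_list b) # butlast a) (R q (last a) (L q (prod_list c) \<psi>))))"
proof -
  let ?S = "antipode H"
  let ?K = "\<lambda>a b c. lact H q (prod_list c) (ract H q (f (hpure H (?S (prod_list b) # butlast a))) (last a))"
  have in1: "f (hpure H (x # butlast a)) \<in> hpower H q" if "length a = n" for x a
    by (rule GS_pure_in[OF f]) (use that n in simp)
  have in2: "ract H q (f (hpure H (x # butlast a))) y \<in> hpower H q" if "length a = n" for x a y
    by (rule E_ract(2)[OF in1[OF that] ml_mlext])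
  have 1: "?K a b c \<in> hpower H q" if "length a = n" for a b c
    by (rule E_lact(2)[OF in2[OF that] ml_mlext])
  have e: "E (?K a b c) \<psi> = ev f (?S (prod_list b) # butlast a) (R q (last a) (L q (prod_list c) \<psi>))"
    if "length a = n" "ml q \<psi>" for a b c \<psi>
    unfolding ev_def E_lact(1)[OF in2[OF that(1)] that(2)] by (rule E_ract(1)[OF in1[OF that(1)] ml_L[OF that(2)]])
  have 2: "ml n (\<lambda>b. E (?K a b c) \<psi>)" if "length a = n" "ml q \<psi>" for a c \<psi>
    unfolding e[OF that]
    by (rule mlI, rule lin_ev1[OF f]) (use n that in \<open>simp_all add: lin_rules entry_lin_slot\<close>)
  have 3: "ml n (\<lambda>c. E (?K a b c) \<psi>)" if "length a = n" "ml q \<psi>" for a b \<psi>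
    unfolding e[OF that]
    by (rule mlI, rule lin_ev2[OF f], rule lin_R2, rule lin_L1, rule linH_prod, rule entry_lin_slot) (use n that in simp_all)
  have 4: "ml n (\<lambda>a. E (?K a b c) \<psi>)" if "ml q \<psi>" for b c \<psi>
  proof -
    obtain k where k: "n = Suc k" using n by (cases n) auto
    have "ml (Suc k) (\<lambda>a. ev f (?S (prod_list b) # butlast a) (R q (last a) (L q (prod_list c) \<psi>)))"
    proof (rule ml_snocI)
      fix t :: "'h list" assume "length t = k"
      then show "lin (\<lambda>h. ev f (?S (prod_list b) # butlast (t @ [h])) (R q (last (t @ [h])) (L q (prod_list c) \<psi>)))"
        using k by (auto intro!: lin_ev2[OF f] lin_R1 linH_id)
    next
      fix h
      show "ml k (\<lambda>t. ev f (?S (prod_list b) # butlast (t @ [h])) (R q (last (t @ [h])) (L q (prod_list c) \<psi>)))"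
        by (simp only: butlast_snoc last_snoc, rule mlI, rule lin_ev1[OF f], (intro entry_lin_Cons2 entry_lin_slot)) (use k in simp)
    qed
    then show ?thesis
      unfolding k[symmetric] by (rule ml_cong[THEN iffD1, rotated]) (simp add: e that)
  qed
  have s1: "tml n q (\<lambda>us. sweedler H 3 us (\<lambda>m. ?K (leg 1 m) (leg 2 m) (leg 3 m)))"
    by (rule E_sweedler3(1)[where K = ?K]) (rule 1 2 3 4; assumption)+
  have s2: "E (sweedler H 3 us (\<lambda>m. ?K (leg 1 m) (leg 2 m) (leg 3 m))) \<psi> = sws us (\<lambda>a r. sws r (\<lambda>b c. E (?K a b c) \<psi>))"
    if "length us = n" "ml q \<psi>" for us \<psi>
    by (rule E_sweedler3(2)[where K = ?K]) (rule 1 2 3 4 that; assumption?)+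
  show "tau_alg H n q f \<in> GS H n q" using n by (simp add: tau_alg_def inv_antipode GS_hom_of[OF s1])
  show "ev (tau_alg H n q f) us \<psi> = sws us (\<lambda>a r. sws r (\<lambda>b c.
        ev f (antipode H (prod_list b) # butlast a) (R q (last a) (L q (prod_list c) \<psi>))))"
    if "length us = n" "ml q \<psi>"
    using that n by (simp add: tau_alg_def inv_antipode ev_hom_of[OF s1] s2 e cong: sws_cong)
qed


abbreviation S :: "'h \<Rightarrow> 'h" where "S \<equiv> antipode H"
abbreviation \<pi> :: "'h list \<Rightarrow> 'h" where "\<pi> \<equiv> prod_list"

section \<open>Cancellation\<close>

text \<open>The antipode axioms and, applying \<open>S\<close> to them, their mirror images; the latter rest on the
involutivity of \<open>S\<close>.\<close>

lemma sw_cancel1: "lin F \<Longrightarrow> sw u (\<lambda>a b. F (S a * b)) = counit H u * F 1" by (rule sw_antipode_left)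
lemma sw_cancel2: "lin F \<Longrightarrow> sw u (\<lambda>a b. F (a * S b)) = counit H u * F 1" by (rule sw_antipode_right)

lemma sw_cancel3:
  assumes "lin F" shows "sw u (\<lambda>a b. F (S b * a)) = counit H u * F 1"
  using sw_cancel1[OF lin_comp[OF assms linH_antipode'], of u] by (simp add: antipode_mult antipode_one)

lemma sw_cancel4:
  assumes "lin F" shows "sw u (\<lambda>a b. F (b * S a)) = counit H u * F 1"
  using sw_cancel2[OF lin_comp[OF assms linH_antipode'], of u] by (simp add: antipode_mult antipode_one)

lemma sws_cancel1: "lin F \<Longrightarrow> sws us (\<lambda>a b. F (S (\<pi> a) * \<pi> b)) = counits us * F 1" by (rule sws_antipode_left)
lemma sws_cancel2: "lin F \<Longrightarrow> sws us (\<lambda>a b. F (\<pi> a * S (\<pi> b))) = counits us * F 1" by (rule sws_antipode_right)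

lemma sws_cancel3:
  assumes "lin F" shows "sws us (\<lambda>a b. F (S (\<pi> b) * \<pi> a)) = counits us * F 1"
  using sws_cancel1[OF lin_comp[OF assms linH_antipode'], of us] by (simp add: antipode_mult antipode_one)

lemma sws_cancel4:
  assumes "lin F" shows "sws us (\<lambda>a b. F (\<pi> b * S (\<pi> a))) = counits us * F 1"
  using sws_cancel2[OF lin_comp[OF assms linH_antipode'], of us] by (simp add: antipode_mult antipode_one)

text \<open>Cancellation of two adjacent legs next to a third one: the cancelled pair contributes a counit, which the
remaining leg absorbs.\<close>

lemma sws_cancel_left:
  assumes "\<And>m c. length m = length u \<Longrightarrow> length c = length u \<Longrightarrow> sws m (\<lambda>a b. F a b c) = counits m * G c" "ml (length u) G"
  shows "sws u (\<lambda>a r. sws r (\<lambda>b c. F a b c)) = G u"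
proof -
  have "sws u (\<lambda>a r. sws r (\<lambda>b c. F a b c)) = sws u (\<lambda>m c. counits m * G c)"
    unfolding sws_coassoc[symmetric] by (rule sws_cong_len) (rule assms(1))
  then show ?thesis by (simp add: sws_counit_left assms(2))
qed

lemma sws_cancel_right:
  assumes "\<And>m a. length m = length u \<Longrightarrow> length a = length u \<Longrightarrow> sws m (\<lambda>b c. F a b c) = counits m * G a" "ml (length u) G"
  shows "sws u (\<lambda>a r. sws r (\<lambda>b c. F a b c)) = G u"
proof -
  have "sws u (\<lambda>a r. sws r (\<lambda>b c. F a b c)) = sws u (\<lambda>a m. counits m * G a)"
    by (rule sws_cong_len) (rule assms(1))
  then show ?thesis by (simp add: sws_counit_right assms(2))
qed

lemma sw_cancel_left:
  assumes "\<And>m c. sw m (\<lambda>a b. F a b c) = counit H m * G c" "lin G"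
  shows "sw u (\<lambda>a r. sw r (\<lambda>b c. F a b c)) = G u"
  unfolding sw_coassoc[symmetric] by (simp add: assms sw_counit_left)

lemma sw_cancel_right:
  assumes "\<And>m a. sw m (\<lambda>b c. F a b c) = counit H m * G a" "lin G"
  shows "sw u (\<lambda>a r. sw r (\<lambda>b c. F a b c)) = G u"
  by (simp add: assms sw_counit_right)


section \<open>Abstract cochains\<close>

text \<open>What remains of a cochain in the scalar calculus: multilinear in the arguments, and finitely supported in
the form. Unlike \<open>ev f\<close> such a functional need not come from a linear map, so that auxiliary operators can
be defined directly on scalars.\<close>

definition cochain :: "nat \<Rightarrow> nat \<Rightarrow> ('h list \<Rightarrow> ('h list \<Rightarrow> 'k) \<Rightarrow> 'k) \<Rightarrow> bool" where
  "cochain p q g \<longleftrightarrow> (\<forall>\<psi>. ml p (\<lambda>us. g us \<psi>)) \<and> (\<forall>us. length us = p \<longrightarrow> fsupp (\<lambda>v. length v = q) (g us))"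

lemma cochain_fsupp: "cochain p q g \<Longrightarrow> length us = p \<Longrightarrow> fsupp (\<lambda>v. length v = q) (g us)"
  by (simp add: cochain_def)

lemma cochain_ml: "cochain p q g \<Longrightarrow> ml p (\<lambda>us. g us \<psi>)"
  by (simp add: cochain_def)

lemma cochain_lin1: "cochain p q g \<Longrightarrow> entry_lin h \<Longrightarrow> (\<And>x. length (h x) = p) \<Longrightarrow> lin (\<lambda>x. g (h x) \<psi>)"
  unfolding cochain_def by (rule lin_mlD[where g = h]) auto

lemma cochain_lin2: "cochain p q g \<Longrightarrow> length us = p \<Longrightarrow> (\<And>v. length v = q \<Longrightarrow> lin (\<lambda>x. \<psi> x v)) \<Longrightarrow> lin (\<lambda>x. g us (\<psi> x))"
  unfolding cochain_def by (rule lin_fsupp[where P = "\<lambda>v. length v = q"]) auto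

lemma cochain_cong: "cochain p q g \<Longrightarrow> length us = p \<Longrightarrow> (\<And>v. length v = q \<Longrightarrow> \<psi> v = \<chi> v) \<Longrightarrow> g us \<psi> = g us \<chi>"
  by (rule fsupp_cong[OF cochain_fsupp]) auto

lemma cochain_ev: "f \<in> GS H p q \<Longrightarrow> cochain p q (ev f)"
  unfolding cochain_def using ml_ev fsupp_mono[OF fsupp_ev] by (auto simp: blist_def)

lemma cochain_bind:
  assumes "cochain p q g" "length us = p" "\<And>v. length v = q \<Longrightarrow> fsupp P (y v)"
  shows "fsupp P (\<lambda>\<psi>. g us (\<lambda>v. y v \<psi>))"
  by (rule fsupp_bind[OF cochain_fsupp[OF assms(1,2)] assms(3)])

lemma fsupp_L: "fsupp (\<lambda>v. length v = q) y \<Longrightarrow> fsupp (\<lambda>v. length v = q) (\<lambda>\<psi>. y (L q u \<psi>))"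
  unfolding L_def by (erule fsupp_bind, rule fsupp_bind[OF fsupp_swn fsupp_single]) (simp add: blist_def)

lemma fsupp_R: "fsupp (\<lambda>v. length v = q) y \<Longrightarrow> fsupp (\<lambda>v. length v = q) (\<lambda>\<psi>. y (R q u \<psi>))"
  unfolding R_def by (erule fsupp_bind, rule fsupp_bind[OF fsupp_swn fsupp_single]) (simp add: blist_def)

lemma fsupp_bind_sws:
  assumes "\<And>a b. length a = length u \<Longrightarrow> length b = length u \<Longrightarrow> fsupp Q (y a b)"
  shows "fsupp Q (\<lambda>\<psi>. sws u (\<lambda>a b. y a b \<psi>))"
  using fsupp_bind[OF fsupp_sws, of u Q "\<lambda>p. y (fst p) (snd p)"] assms by (simp add: len2_def)

lemma ml_front_last: "cochain (Suc n) q g \<Longrightarrow> ml (Suc n) (\<lambda>a. g (x # butlast a) (R q (last a) \<psi>))"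
  by (rule ml_snocI; simp only: butlast_snoc last_snoc;
      (rule cochain_lin2, assumption, simp, rule lin_R1, rule linH_id)?;
      rule mlI, erule cochain_lin1, intro entry_lin_Cons2 entry_lin_slot, simp)

lemma ml_butlast_last: "cochain n q g \<Longrightarrow> ml (Suc n) (\<lambda>a. g (butlast a) (R q (last a) \<psi>))"
  by (rule ml_snocI; simp only: butlast_snoc last_snoc;
      (rule cochain_lin2, assumption, assumption, rule lin_R1, rule linH_id)?;
      rule mlI, erule cochain_lin1, rule entry_lin_slot, simp)

text \<open>The vertical cyclic operator on scalars, with \<open>S\<close> in place of its inverse.\<close>

definition vtau :: "nat \<Rightarrow> ('h list \<Rightarrow> ('h list \<Rightarrow> 'k) \<Rightarrow> 'k) \<Rightarrow> 'h list \<Rightarrow> ('h list \<Rightarrow> 'k) \<Rightarrow> 'k" where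
  "vtau q g us \<psi> = sws us (\<lambda>a r. sws r (\<lambda>b c. g (S (\<pi> b) # butlast a) (R q (last a) (L q (\<pi> c) \<psi>))))"

lemma ev_tau_alg: "f \<in> GS H (Suc n) q \<Longrightarrow> length us = Suc n \<Longrightarrow> ml q \<psi> \<Longrightarrow> ev (tau_alg H (Suc n) q f) us \<psi> = vtau q (ev f) us \<psi>"
  by (simp add: tau_alg vtau_def)

lemma vtau_snoc:
  "vtau q g (w @ [l]) \<psi> = sws w (\<lambda>a r. sws r (\<lambda>b c. sw l (\<lambda>x s. sw s (\<lambda>y z. g (S (\<pi> b * y) # a) (R q x (L q (\<pi> c * z) \<psi>))))))"
proof -
  have "vtau q g (w @ [l]) \<psi> = sws w (\<lambda>a r. sw l (\<lambda>x s. sws r (\<lambda>b c. sw s (\<lambda>y z. g (S (\<pi> b * y) # a) (R q x (L q (\<pi> c * z) \<psi>))))))"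
    by (simp add: vtau_def sws_append)
  then show ?thesis by (simp add: sws_sw_swap)
qed

section \<open>Splitting the arguments of the vertical cyclic operator\<close>

lemma sw_S_prod:
  assumes "\<And>b. lin (\<lambda>a. G a b)" "\<And>a. lin (\<lambda>b. G a b)"
  shows "sw (S (\<pi> b * y)) G = sws b (\<lambda>b1 b2. sw y (\<lambda>y1 y2. G (S (\<pi> b2 * y2)) (S (\<pi> b1 * y1))))"
proof -
  have l: "lin (\<lambda>a. G (S x) (S a))" "lin (\<lambda>a. G (S a) (S x))" for x
    by (rule lin_comp[OF assms(1) linH_antipode'] lin_comp[OF assms(2) linH_antipode'])+
  have "sw (S (\<pi> b * y)) G = sw (\<pi> b * y) (\<lambda>m n. G (S n) (S m))"
    by (rule sw_antipode) (fact assms)+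
  also have "\<dots> = sw (\<pi> b) (\<lambda>b1 b2. sw y (\<lambda>y1 y2. G (S (b2 * y2)) (S (b1 * y1))))"
    by (rule sw_mult[where G = "\<lambda>m n. G (S n) (S m)"]) (fact l)+
  also have "\<dots> = sws b (\<lambda>b1 b2. sw y (\<lambda>y1 y2. G (S (\<pi> b2 * y2)) (S (\<pi> b1 * y1))))"
    by (rule sw_prod; intro lin_sw2 lin_comp[OF assms(1)] lin_comp[OF assms(2)] linH_antipode linH_mult_right linH_id)
  finally show ?thesis .
qed

text \<open>The argument list \<open>(S(U\<^sub>2), u\<^sub>1)\<close> of the cyclic operator has to be split into legs whenever another map with
coproducts is applied after it. The antipode reverses the legs of its argument, so that they interlock:
the two parts are \<open>(S(U\<^sub>4), u\<^sub>1)\<close> and \<open>(S(U\<^sub>3), u\<^sub>2)\<close>. Here \<open>w\<close> is the list of all arguments but the last,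
and \<open>y\<close> is a leg of the last one.\<close>

lemma sws_cycle:
  assumes "\<And>q. length q = Suc (length w) \<Longrightarrow> ml (Suc (length w)) (\<lambda>p. K p q)" "\<And>p. length p = Suc (length w) \<Longrightarrow> ml (Suc (length w)) (\<lambda>q. K p q)"
  shows "sws w (\<lambda>a b. sws (S (\<pi> b * y) # a) K) =
    sws w (\<lambda>a1 r. sws r (\<lambda>a2 r. sws r (\<lambda>b1 b2. sw y (\<lambda>y1 y2. K (S (\<pi> b2 * y2) # a1) (S (\<pi> b1 * y1) # a2)))))"
proof -
  have "sws w (\<lambda>a b. sws (S (\<pi> b * y) # a) K)
    = sws w (\<lambda>a b. sws b (\<lambda>b1 b2. sw y (\<lambda>y1 y2. sws a (\<lambda>a1 a2. K (S (\<pi> b2 * y2) # a1) (S (\<pi> b1 * y1) # a2)))))"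
  proof (rule sws_cong_len)
    fix a b :: "'h list" assume len: "length a = length w" "length b = length w"
    show "sws (S (\<pi> b * y) # a) K = sws b (\<lambda>b1 b2. sw y (\<lambda>y1 y2. sws a (\<lambda>a1 a2. K (S (\<pi> b2 * y2) # a1) (S (\<pi> b1 * y1) # a2))))"
      unfolding sws.simps
      by (rule sw_S_prod; rule lin_sws2, rule lin_mlD[OF assms(1)] lin_mlD[OF assms(2)]; (rule entry_lin_id)?; use len in simp)
  qed
  also have "\<dots> = sws w (\<lambda>a b. sws a (\<lambda>a1 a2. sws b (\<lambda>b1 b2. sw y (\<lambda>y1 y2. K (S (\<pi> b2 * y2) # a1) (S (\<pi> b1 * y1) # a2)))))"
    by (rule sws_cong_len, subst sws_sw_swap[symmetric], rule sws_swap)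
  also have "\<dots> = sws w (\<lambda>a1 r. sws r (\<lambda>a2 r. sws r (\<lambda>b1 b2. sw y (\<lambda>y1 y2. K (S (\<pi> b2 * y2) # a1) (S (\<pi> b1 * y1) # a2)))))"
    by (rule sws_coassoc)
  finally show ?thesis .
qed

text \<open>The product of the second part above is \<open>S(U\<^sub>3) U\<^sub>2\<close>, which cancels up to the contribution of the last
argument.\<close>

lemma sws_cycle_prod:
  assumes "\<And>x. ml (Suc (length w)) (\<lambda>p. K p x)" "\<And>p. length p = Suc (length w) \<Longrightarrow> lin (K p)"
  shows "sws w (\<lambda>a b. sws (S (\<pi> b * y) # a) (\<lambda>p q. K p (\<pi> q))) =
    sws w (\<lambda>a b. sw y (\<lambda>y1 y2. K (S (\<pi> b * y2) # a) (S y1)))"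
proof -
  have "sws w (\<lambda>a b. sws (S (\<pi> b * y) # a) (\<lambda>p q. K p (\<pi> q))) =
    sws w (\<lambda>a1 r. sws r (\<lambda>a2 r. sws r (\<lambda>b1 b2. sw y (\<lambda>y1 y2. K (S (\<pi> b2 * y2) # a1) (\<pi> (S (\<pi> b1 * y1) # a2))))))"
    by (rule sws_cycle) (rule assms, rule mlI, rule lin_comp[OF assms(2)], simp, rule linH_prod, rule entry_lin_slot)
  also have "\<dots> = sws w (\<lambda>a1 r. sws r (\<lambda>a2 r. sws r (\<lambda>b1 b2. sw y (\<lambda>y1 y2. K (S (\<pi> b2 * y2) # a1) (S y1 * (S (\<pi> b1) * \<pi> a2))))))"
    by (simp add: antipode_mult mult.assoc)
  also have "\<dots> = sws w (\<lambda>a b. sw y (\<lambda>y1 y2. K (S (\<pi> b * y2) # a) (S y1)))"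
  proof (rule sws_cong_len, rule sws_cancel_left)
    fix a1 r m c :: "'h list" assume len: "length a1 = length w" "length r = length w" "length c = length r"
    have "sws m (\<lambda>a b. sw y (\<lambda>y1 y2. K (S (\<pi> c * y2) # a1) (S y1 * (S (\<pi> b) * \<pi> a))))
      = counits m * sw y (\<lambda>y1 y2. K (S (\<pi> c * y2) # a1) (S y1 * 1))"
      by (rule sws_cancel3[where F = "\<lambda>z. sw y (\<lambda>y1 y2. K (S (\<pi> c * y2) # a1) (S y1 * z))"])
        (intro lin_sw2 lin_comp[OF assms(2)] linH_mult_left linH_id, use len in simp)
    then show "sws m (\<lambda>a b. sw y (\<lambda>y1 y2. K (S (\<pi> c * y2) # a1) (S y1 * (S (\<pi> b) * \<pi> a))))
      = counits m * sw y (\<lambda>y1 y2. K (S (\<pi> c * y2) # a1) (S y1))" by simp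
  next
    fix a1 r :: "'h list" assume len: "length a1 = length w" "length r = length w"
    show "ml (length r) (\<lambda>b. sw y (\<lambda>y1 y2. K (S (\<pi> b * y2) # a1) (S y1)))"
      by (rule mlI, rule lin_sw2, rule lin_mlD[OF assms(1)], intro entry_lin_Cons1 linH_antipode linH_mult_right linH_prod entry_lin_slot)
        (use len in simp)
  qed
  finally show ?thesis .
qed

lemma sws_cycle_prod2:
  assumes "\<And>x z. ml (Suc (length w)) (\<lambda>p. K p x z)" "\<And>p z. length p = Suc (length w) \<Longrightarrow> lin (\<lambda>x. K p x z)"
    "\<And>p x. length p = Suc (length w) \<Longrightarrow> lin (\<lambda>z. K p x z)"
  shows "sws w (\<lambda>a b. sws (S (\<pi> b * y) # a) (\<lambda>p r. sws r (\<lambda>q s. K p (\<pi> q) (\<pi> s)))) =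
    sws w (\<lambda>a b. sw y (\<lambda>y1 r. sw r (\<lambda>y2 y3. K (S (\<pi> b * y3) # a) (S y2) (S y1))))"
proof -
  have "sws w (\<lambda>a b. sws (S (\<pi> b * y) # a) (\<lambda>p r. sws r (\<lambda>q s. K p (\<pi> q) (\<pi> s)))) =
    sws w (\<lambda>a b. sws (S (\<pi> b * y) # a) (\<lambda>r s. sws r (\<lambda>p q. K p (\<pi> q) (\<pi> s))))"
    unfolding sws_coassoc ..
  also have "\<dots> = sws w (\<lambda>a b. sw y (\<lambda>y1 y2. sws (S (\<pi> b * y2) # a) (\<lambda>p q. K p (\<pi> q) (S y1))))"
    by (rule sws_cycle_prod) (rule mlI, rule lin_sws1, rule entry_lin_slot, rule lin_sws2, rule assms, simp)
  also have "\<dots> = sw y (\<lambda>y1 y2. sws w (\<lambda>a b. sws (S (\<pi> b * y2) # a) (\<lambda>p q. K p (\<pi> q) (S y1))))"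
    by (rule sws_sw_swap)
  also have "\<dots> = sw y (\<lambda>y1 r. sws w (\<lambda>a b. sw r (\<lambda>y2 y3. K (S (\<pi> b * y3) # a) (S y2) (S y1))))"
    by (subst sws_cycle_prod) (rule assms, rule assms, assumption, rule refl)
  also have "\<dots> = sws w (\<lambda>a b. sw y (\<lambda>y1 r. sw r (\<lambda>y2 y3. K (S (\<pi> b * y3) # a) (S y2) (S y1))))"
    by (rule sws_sw_swap[symmetric])
  finally show ?thesis .
qed

lemma sws_cycle_prod2_one:
  assumes "\<And>x z. ml (Suc (length w)) (\<lambda>p. K p x z)" "\<And>p z. length p = Suc (length w) \<Longrightarrow> lin (\<lambda>x. K p x z)"
    "\<And>p x. length p = Suc (length w) \<Longrightarrow> lin (\<lambda>z. K p x z)"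
  shows "sws w (\<lambda>a b. sws (S (\<pi> b) # a) (\<lambda>p r. sws r (\<lambda>q s. K p (\<pi> q) (\<pi> s)))) =
    sws w (\<lambda>a b. K (S (\<pi> b) # a) 1 1)"
proof -
  have l: "lin (\<lambda>y3. K (S (\<pi> b * y3) # a) (S y2) (S y1))" "lin (\<lambda>y2. K (S (\<pi> b * y3) # a) (S y2) (S y1))"
    "lin (\<lambda>y1. K (S (\<pi> b * y3) # a) (S y2) (S y1))"
    if "length a = length w" for a b y1 y2 y3
    using that
    by - (rule lin_mlD[OF assms(1)] lin_comp[OF assms(2)] lin_comp[OF assms(3)];
        (intro entry_lin_Cons1 linH_antipode linH_mult_left linH_id)?; simp)+
  have "sws w (\<lambda>a b. sws (S (\<pi> b) # a) (\<lambda>p r. sws r (\<lambda>q s. K p (\<pi> q) (\<pi> s)))) =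
    sws w (\<lambda>a b. sw 1 (\<lambda>y1 r. sw r (\<lambda>y2 y3. K (S (\<pi> b * y3) # a) (S y2) (S y1))))"
    using sws_cycle_prod2[of w K 1, OF assms] by simp
  also have "\<dots> = sws w (\<lambda>a b. K (S (\<pi> b) # a) 1 1)"
    by (rule sws_cong_len)
      (subst sw_one, (intro lin_sw2 lin_sw' l; assumption)+, subst sw_one, (intro l; assumption)+, simp add: antipode_one)
  finally show ?thesis .
qed

end

context hopf_algebra
begin

section \<open>Merging and inserting arguments\<close>

lemma delta_v_in: "f \<in> GS H n q \<Longrightarrow> i \<le> Suc n \<Longrightarrow> delta_v H n q i f \<in> GS H (Suc n) q"
  by (cases "i = 0"; cases "i = Suc n") (simp_all add: delta_v_0 delta_v_last delta_v_mid Suc_leI)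

lemma delta_h_in: "f \<in> GS H p n \<Longrightarrow> i \<le> Suc n \<Longrightarrow> delta_h H p n i f \<in> GS H p (Suc n)"
  by (cases "i = 0"; cases "i = Suc n") (simp_all add: delta_h_0 delta_h_last delta_h_mid Suc_leI)

lemma tau_coalg_in: "f \<in> GS H p n \<Longrightarrow> tau_coalg H p n f \<in> GS H p n"
  by (cases "n = 0") (simp_all add: tau_coalg_0 tau_coalg)

lemma nth_merge: "1 \<le> i \<Longrightarrow> i < length us \<Longrightarrow> k < length us - 1 \<Longrightarrow>
  merge i us ! k = (if k < i - 1 then us ! k else if k = i - 1 then us ! (i - 1) * us ! i else us ! Suc k)"
  by (auto simp: merge_def nth_append min_def One_nat_def nth_Cons' intro!: arg_cong[of _ _ "(!) us"])

lemma nth_insert_one: "j \<le> length us \<Longrightarrow> k \<le> length us \<Longrightarrow>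
  insert_one j us ! k = (if k < j then us ! k else if k = j then 1 else us ! (k - 1))"
  by (auto simp: insert_one_def nth_append min_def One_nat_def nth_Cons' intro!: arg_cong[of _ _ "(!) us"])

lemma merge_merge: "1 \<le> i \<Longrightarrow> i < j \<Longrightarrow> j < length us \<Longrightarrow> merge i (merge j us) = merge (j - 1) (merge i us)"
proof -
  assume a: "1 \<le> i" "i < j" "j < length us"
  obtain i' j' where ij: "i = Suc i'" "j = Suc (Suc j')" using a by (cases i; cases j; cases "j - 1") (auto simp: One_nat_def)
  have nth: "merge (Suc l) ws ! k = (if k < l then ws ! k else if k = l then ws ! l * ws ! Suc l else ws ! Suc k)"
    if "Suc l < length ws" "Suc k < length ws" for l k ws
    using nth_merge[of "Suc l" ws k] that by simp
  show ?thesis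
    unfolding ij
  proof (rule nth_equalityI)
    show "length (merge (Suc i') (merge (Suc (Suc j')) us)) = length (merge (Suc (Suc j') - 1) (merge (Suc i') us))"
      using a ij by (simp add: length_merge)
    fix k assume "k < length (merge (Suc i') (merge (Suc (Suc j')) us))"
    then have k: "Suc (Suc k) < length us" using a ij by (simp add: length_merge)
    consider "k < i'" | "k = i'" | "i' < k" by linarith
    then show "merge (Suc i') (merge (Suc (Suc j')) us) ! k = merge (Suc (Suc j') - 1) (merge (Suc i') us) ! k"
      using a ij k by cases (cases "i' = j'"; auto simp: nth length_merge mult.assoc)+
  qed
qed

lemma nth_merge_Suc: "Suc l < length ws \<Longrightarrow> Suc k < length ws \<Longrightarrow>
    merge (Suc l) ws ! k = (if k < l then ws ! k else if k = l then ws ! l * ws ! Suc l else ws ! Suc k)"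
  using nth_merge[of "Suc l" ws k] by simp

lemma length_merge_Suc: "Suc l < length ws \<Longrightarrow> length (merge (Suc l) ws) = length ws - 1"
  by (simp add: length_merge)

lemma nth_insert_one_less: "k < j \<Longrightarrow> j \<le> length us \<Longrightarrow> insert_one j us ! k = us ! k"
  and nth_insert_one_eq: "j \<le> length us \<Longrightarrow> insert_one j us ! j = 1"
  and nth_insert_one_Suc: "j \<le> k \<Longrightarrow> k < length us \<Longrightarrow> insert_one j us ! Suc k = us ! k"
  by (simp_all add: nth_insert_one)

lemma insert_one_insert_one:
  assumes "i \<le> j" "j \<le> length us" shows "insert_one i (insert_one j us) = insert_one (Suc j) (insert_one i us)"
proof (rule nth_equalityI)
  fix k assume "k < length (insert_one i (insert_one j us))"
  then have k: "k < Suc (Suc (length us))" using assms by (simp add: length_insert_one)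
  consider "k < i" | "k = i" | k' where "k = Suc k'" "i \<le> k'" "k' < j" | k' where "k = Suc k'" "k' = j" | k' where "k = Suc (Suc k')" "j \<le> k'"
    using assms(1) by (cases k; cases "k - 1") force+
  then show "insert_one i (insert_one j us) ! k = insert_one (Suc j) (insert_one i us) ! k"
    using assms k by cases (simp_all add: length_insert_one nth_insert_one_less nth_insert_one_eq nth_insert_one_Suc)
qed (use assms in \<open>simp add: length_insert_one\<close>)

lemma merge_insert_one_less:
  assumes "1 \<le> i" "i < j" "j \<le> length us" shows "merge i (insert_one j us) = insert_one (j - 1) (merge i us)"
proof -
  obtain i' j' where ij: "i = Suc i'" "j = Suc j'" "i' < j'" using assms by (cases i; cases j) (auto simp: One_nat_def)
  show ?thesis
    unfolding ij
  proof (rule nth_equalityI)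
    fix k assume "k < length (merge (Suc i') (insert_one (Suc j') us))"
    then have k: "k < length us" using assms ij by (simp add: length_merge_Suc length_insert_one)
    consider "k < j'" | "k = j'" | k' where "k = Suc k'" "j' \<le> k'" by (cases k) force+
    then show "merge (Suc i') (insert_one (Suc j') us) ! k = insert_one (Suc j' - 1) (merge (Suc i') us) ! k"
      using assms ij k by cases (simp_all add: nth_merge_Suc length_insert_one length_merge_Suc nth_insert_one_less nth_insert_one_eq nth_insert_one_Suc)
  qed (use assms ij in \<open>simp add: length_insert_one length_merge_Suc\<close>)
qed

lemma merge_insert_one_eq:
  assumes "1 \<le> i" "i \<le> length us" "i = j \<or> i = Suc j" shows "merge i (insert_one j us) = us"
proof -
  obtain i' where i: "i = Suc i'" using assms(1) by (cases i) (auto simp: One_nat_def)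
  show ?thesis
    unfolding i
  proof (rule nth_equalityI)
    fix k assume "k < length (merge (Suc i') (insert_one j us))"
    then have k: "k < length us" using assms i by (auto simp: length_merge_Suc length_insert_one)
    consider "k < i'" | "k = i'" | "i' < k" by linarith
    then show "merge (Suc i') (insert_one j us) ! k = us ! k"
      using assms(2,3) i k by cases (auto simp: nth_merge_Suc length_insert_one nth_insert_one_less nth_insert_one_eq nth_insert_one_Suc)
  qed (use assms i in \<open>auto simp: length_insert_one length_merge_Suc\<close>)
qed

lemma merge_insert_one_greater:
  assumes "Suc j < i" "i \<le> length us" shows "merge i (insert_one j us) = insert_one j (merge (i - 1) us)"
proof -
  obtain i' where i: "i = Suc (Suc i')" "j \<le> i'" using assms(1) by (cases i; cases "i - 1") auto
  show ?thesis
    unfolding i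
  proof (rule nth_equalityI)
    fix k assume "k < length (merge (Suc (Suc i')) (insert_one j us))"
    then have k: "k < length us" using assms i by (simp add: length_merge_Suc length_insert_one)
    consider "k < j" | "k = j" | k' where "k = Suc k'" "j \<le> k'" by (cases k) force+
    then show "merge (Suc (Suc i')) (insert_one j us) ! k = insert_one j (merge (Suc (Suc i') - 1) us) ! k"
      using assms i k by cases (simp_all add: nth_merge_Suc length_insert_one length_merge_Suc nth_insert_one_less nth_insert_one_eq nth_insert_one_Suc)
  qed (use assms i in \<open>simp add: length_insert_one length_merge_Suc\<close>)
qed

lemma merge_Cons: "1 \<le> i \<Longrightarrow> merge (Suc i) (u # us) = u # merge i us"
  by (cases i) (auto simp: merge_def One_nat_def)

lemma merge_1_Cons: "merge 1 (u # v # us) = (u * v) # us"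
  by (simp add: merge_def One_nat_def)

lemma merge_append1: "1 \<le> i \<Longrightarrow> i < length us \<Longrightarrow> merge i (us @ vs) = merge i us @ vs"
  by (auto simp: merge_def nth_append)

lemma merge_last: "merge (Suc (length us)) (us @ [u, v]) = us @ [u * v]"
  by (simp add: merge_def One_nat_def nth_append)

lemma insert_one_Cons: "insert_one (Suc j) (u # us) = u # insert_one j us"
  by (simp add: insert_one_def)

lemma insert_one_append1: "j \<le> length us \<Longrightarrow> insert_one j (us @ vs) = insert_one j us @ vs"
  by (simp add: insert_one_def)

section \<open>The vertical cosimplicial structure\<close>

text \<open>These are the identities of the Hochschild complex with coefficients in the bimodule of \<open>q\<close>-tensors; by
evaluation they become identities between lists, together with the associativity of the two actions for the
outer cofaces.\<close>

lemma delta_v_delta_v: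
  assumes f: "f \<in> GS H n q" and ij: "i < j" "j \<le> n + 2"
  shows "delta_v H (Suc n) q j (delta_v H n q i f) = delta_v H (Suc n) q i (delta_v H n q (j - 1) f)"
proof (rule GS_eqI[of _ "Suc (Suc n)" q])
  have d: "delta_v H n q i f \<in> GS H (Suc n) q" "delta_v H n q (j - 1) f \<in> GS H (Suc n) q"
    using f ij by (auto intro: delta_v_in)
  show "delta_v H (Suc n) q j (delta_v H n q i f) \<in> GS H (Suc (Suc n)) q"
    "delta_v H (Suc n) q i (delta_v H n q (j - 1) f) \<in> GS H (Suc (Suc n)) q"
    using d ij by (auto intro: delta_v_in)
  fix us :: "'h list" and \<psi> assume us: "length us = Suc (Suc n)" and ml: "ml q \<psi>"
  obtain u us' where u: "us = u # us'" "length us' = Suc n" using us by (auto simp: len_Suc)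
  obtain v w where v: "us' = v # w" "length w = n" using u by (auto simp: len_Suc)
  obtain us'' z where z: "us = us'' @ [z]" "length us'' = Suc n"
    using us by (cases us rule: rev_cases) auto
  obtain x y where x: "us'' = x @ [y]" "length x = n"
    using z by (cases us'' rule: rev_cases) auto
  note simps = delta_v_0 delta_v_last delta_v_mid f d ml ml_L ml_R delta_v_in length_merge
  consider "i = 0" "j = 1" | "i = 0" "2 \<le> j" "j \<le> Suc n" | "i = 0" "j = n + 2" |
    "1 \<le> i" "j \<le> Suc n" | "1 \<le> i" "i \<le> n" "j = n + 2" | "i = Suc n" "j = n + 2"
    using ij by linarith
  then show "ev (delta_v H (Suc n) q j (delta_v H n q i f)) us \<psi> = ev (delta_v H (Suc n) q i (delta_v H n q (j - 1) f)) us \<psi>"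
  proof cases
    case 1
    then show ?thesis
      using u v by (simp add: simps merge_1_Cons) (rule ev_cong[OF f], simp_all add: L_L ml)
  next
    case 2
    define k where "k = j - 1"
    have k: "j = Suc k" "1 \<le> k" "k \<le> n" using 2 by (auto simp: k_def)
    then show ?thesis using u v 2(1) by (simp add: simps merge_Cons)
  next
    case 3
    obtain t where t: "us = u # t @ [z]" "length t = n"
      using u z by (cases us'') auto
    have "ev (delta_v H (Suc n) q j (delta_v H n q i f)) us \<psi> = ev f t (L q u (R q z \<psi>))"
      using delta_v_last(2)[OF d(1), of "u # t" \<psi> z] t 3 by (simp add: simps)
    also have "\<dots> = ev f t (R q z (L q u \<psi>))" by (rule ev_cong[OF f t(2) L_R])
    also have "\<dots> = ev (delta_v H (Suc n) q i (delta_v H n q (j - 1) f)) us \<psi>"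
      using t 3 d by (simp add: simps)
    finally show ?thesis .
  next
    case 4
    then show ?thesis using us ij by (simp add: simps merge_merge)
  next
    case 5
    then show ?thesis using z by (simp add: simps merge_append1 delta_v_last(2)[of _ "Suc n"])
  next
    case 6
    have "merge (Suc n) us = x @ [y * z]" using merge_last[of x y z] x z by simp
    then show ?thesis
      using 6 z x us by (simp add: simps delta_v_last(2)[of _ "Suc n"] del: append_assoc)
        (rule ev_cong[OF f], simp_all add: R_R ml)
  qed
qed

lemma sigma_v_sigma_v:
  assumes f: "f \<in> GS H (n + 2) q" and ij: "i \<le> j" "j \<le> n"
  shows "sigma_v H (Suc n) q j (sigma_v H (n + 2) q i f) = sigma_v H (Suc n) q i (sigma_v H (n + 2) q (Suc j) f)"
proof (rule GS_eqI[of _ n q])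
  have f': "f \<in> GS H (Suc (Suc n)) q" using f by simp
  have d: "sigma_v H (n + 2) q i f \<in> GS H (Suc n) q" "sigma_v H (n + 2) q (Suc j) f \<in> GS H (Suc n) q"
    using sigma_v(1)[OF f'] ij by auto
  show "sigma_v H (Suc n) q j (sigma_v H (n + 2) q i f) \<in> GS H n q"
    "sigma_v H (Suc n) q i (sigma_v H (n + 2) q (Suc j) f) \<in> GS H n q"
    using d ij by (auto intro: sigma_v(1))
  fix us :: "'h list" and \<psi> assume us: "length us = n" and ml: "ml q \<psi>"
  show "ev (sigma_v H (Suc n) q j (sigma_v H (n + 2) q i f)) us \<psi> = ev (sigma_v H (Suc n) q i (sigma_v H (n + 2) q (Suc j) f)) us \<psi>"
    using ij us sigma_v(2)[OF f', of i "insert_one j us"] sigma_v(2)[OF f', of "Suc j" "insert_one i us"]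
    by (simp add: sigma_v(2)[OF d(1)[simplified]] sigma_v(2)[OF d(2)[simplified]] length_insert_one insert_one_insert_one)
qed

lemma sigma_v_delta_v:
  assumes f: "f \<in> GS H n q" and j: "j \<le> n"
  shows "i < j \<Longrightarrow> sigma_v H (Suc n) q j (delta_v H n q i f) = delta_v H (n - 1) q i (sigma_v H n q (j - 1) f)"
    and "i = j \<or> i = Suc j \<Longrightarrow> sigma_v H (Suc n) q j (delta_v H n q i f) = f"
    and "Suc j < i \<Longrightarrow> i \<le> Suc n \<Longrightarrow> sigma_v H (Suc n) q j (delta_v H n q i f) = delta_v H (n - 1) q (i - 1) (sigma_v H n q j f)"
proof -
  have lhs: "sigma_v H (Suc n) q j (delta_v H n q i f) \<in> GS H n q" if "i \<le> Suc n"
    using delta_v_in[OF f that] j by (rule sigma_v(1))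
  note simps = delta_v_0 delta_v_last delta_v_mid f ml_L ml_R delta_v_in length_merge sigma_v length_insert_one
  show "sigma_v H (Suc n) q j (delta_v H n q i f) = delta_v H (n - 1) q i (sigma_v H n q (j - 1) f)" if "i < j"
  proof -
    define m where "m = n - 1"
    have n: "n = Suc m" using that j by (simp add: m_def)
    have s: "sigma_v H n q (j - 1) f \<in> GS H m q" using f that j n by (auto intro: sigma_v(1))
    show ?thesis
    proof (rule GS_eqI[OF lhs, of _])
      show "delta_v H (n - 1) q i (sigma_v H n q (j - 1) f) \<in> GS H n q"
        using delta_v_in[OF s] that j n by simp
      fix us :: "'h list" and \<psi> assume us: "length us = n" and ml: "ml q \<psi>"
      obtain u w where u: "us = u # w" "length w = m" using us n by (auto simp: len_Suc)
      have "0 < j" using that by simp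
      then obtain k where k: "j = Suc k" by (cases j) auto
      show "ev (sigma_v H (Suc n) q j (delta_v H n q i f)) us \<psi> = ev (delta_v H (n - 1) q i (sigma_v H n q (j - 1) f)) us \<psi>"
      proof (cases "i = 0")
        case True
        have "insert_one j us = u # insert_one k w" by (simp add: u k insert_one_Cons)
        then show ?thesis
          using True u us k j n s f ml by (simp add: simps sigma_v(2)[of _ m])
      next
        case False
        then show ?thesis
          using that us k j n s f ml
          by (simp add: simps sigma_v(2)[of _ m] merge_insert_one_less)
      qed
    qed (use that j in simp)
  qed
  show "sigma_v H (Suc n) q j (delta_v H n q i f) = f" if ij: "i = j \<or> i = Suc j"
  proof (rule GS_eqI[OF lhs f])
    fix us :: "'h list" and \<psi> assume us: "length us = n" and ml: "ml q \<psi>"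
    have d: "delta_v H n q i f \<in> GS H (Suc n) q" using f ij j by (auto intro: delta_v_in)
    consider "i = 0" "j = 0" | "i = Suc n" "j = n" | "1 \<le> i" "i \<le> n" using ij j by linarith
    then show "ev (sigma_v H (Suc n) q j (delta_v H n q i f)) us \<psi> = ev f us \<psi>"
    proof cases
      case 1
      then have "insert_one j us = 1 # us" by (simp add: insert_one_def)
      then show ?thesis using us d ml 1 by (simp add: simps) (rule ev_cong[OF f], simp_all add: L_one)
    next
      case 2
      then have "insert_one j us = us @ [1]" using us by (simp add: insert_one_def)
      then show ?thesis using us d ml 2 by (simp add: simps) (rule ev_cong[OF f], simp_all add: R_one)
    next
      case 3
      then show ?thesis using us d ml j ij by (simp add: simps merge_insert_one_eq)
    qed
  qed (use ij j in auto)
  show "sigma_v H (Suc n) q j (delta_v H n q i f) = delta_v H (n - 1) q (i - 1) (sigma_v H n q j f)" if i: "Suc j < i" "i \<le> Suc n"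
  proof -
    define m where "m = n - 1"
    have n: "n = Suc m" using i j by (simp add: m_def)
    have s: "sigma_v H n q j f \<in> GS H m q" using f i j n by (auto intro: sigma_v(1))
    show ?thesis
    proof (rule GS_eqI[OF lhs, of _])
      show "delta_v H (n - 1) q (i - 1) (sigma_v H n q j f) \<in> GS H n q"
        using delta_v_in[OF s] i j n by simp
      fix us :: "'h list" and \<psi> assume us: "length us = n" and ml: "ml q \<psi>"
      obtain w u where u: "us = w @ [u]" "length w = m" using us n by (cases us rule: rev_cases) auto
      show "ev (sigma_v H (Suc n) q j (delta_v H n q i f)) us \<psi> = ev (delta_v H (n - 1) q (i - 1) (sigma_v H n q j f)) us \<psi>"
      proof (cases "i = Suc n")
        case True
        have "insert_one j us = insert_one j w @ [u]" using i u n by (simp add: insert_one_append1)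
        then show ?thesis
          using True u i j n s f ml by (simp add: simps sigma_v(2)[of _ m])
      next
        case False
        define k where "k = i - 1"
        have k: "i = Suc k" "1 \<le> k" "k \<le> m" using False i n by (auto simp: k_def)
        then show ?thesis
          using i us j n s f ml by (simp add: simps sigma_v(2)[of _ m] merge_insert_one_greater)
      qed
    qed (use i in simp)
  qed
qed

section \<open>Maps of coalgebras over the Hopf algebra\<close>

text \<open>Coalgebra maps between tensor powers of \<open>H\<close>, given on lists, that are compatible with the product of all
entries. This is the structure of the arguments that the horizontal maps see.\<close>

definition coalgebra_map :: "nat \<Rightarrow> nat \<Rightarrow> ('h list \<Rightarrow> 'h list) \<Rightarrow> bool" where
  "coalgebra_map n m \<phi> \<longleftrightarrow> (\<forall>us. length us = n \<longrightarrow> length (\<phi> us) = m \<and> prod_list (\<phi> us) = prod_list us \<and>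
    (\<forall>G. (\<forall>b. length b = m \<longrightarrow> ml m (\<lambda>a. G a b)) \<longrightarrow> (\<forall>a. length a = m \<longrightarrow> ml m (\<lambda>b. G a b)) \<longrightarrow>
      sws (\<phi> us) G = sws us (\<lambda>a b. G (\<phi> a) (\<phi> b))))"

lemma coalgebra_map_length: "coalgebra_map n m \<phi> \<Longrightarrow> length us = n \<Longrightarrow> length (\<phi> us) = m"
  and coalgebra_map_prod: "coalgebra_map n m \<phi> \<Longrightarrow> length us = n \<Longrightarrow> prod_list (\<phi> us) = prod_list us"
  by (auto simp: coalgebra_map_def)

lemma coalgebra_map_sws:
  "coalgebra_map n m \<phi> \<Longrightarrow> length us = n \<Longrightarrow> (\<And>b. length b = m \<Longrightarrow> ml m (\<lambda>a. G a b)) \<Longrightarrow>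
    (\<And>a. length a = m \<Longrightarrow> ml m (\<lambda>b. G a b)) \<Longrightarrow> sws (\<phi> us) G = sws us (\<lambda>a b. G (\<phi> a) (\<phi> b))"
  by (simp add: coalgebra_map_def)

lemma ml_sws1: "ml n (\<lambda>us. sws us G)" by (rule mlI, rule lin_sws1, rule entry_lin_slot)

lemma ml_sws2: "(\<And>a b. length a = length u \<Longrightarrow> length b = length u \<Longrightarrow> ml n (\<lambda>x. G a b x)) \<Longrightarrow> ml n (\<lambda>x. sws u (\<lambda>a b. G a b x))"
  unfolding ml_def by (auto intro: lin_sws2)

lemma coalgebra_map_sws3:
  assumes \<phi>: "coalgebra_map n m \<phi>" and us: "length us = n"
    and K: "\<And>b c. length b = m \<Longrightarrow> length c = m \<Longrightarrow> ml m (\<lambda>a. K a b c)"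
      "\<And>a c. length a = m \<Longrightarrow> length c = m \<Longrightarrow> ml m (\<lambda>b. K a b c)"
      "\<And>a b. length a = m \<Longrightarrow> length b = m \<Longrightarrow> ml m (\<lambda>c. K a b c)"
  shows "sws (\<phi> us) (\<lambda>a r. sws r (\<lambda>b c. K a b c)) = sws us (\<lambda>a r. sws r (\<lambda>b c. K (\<phi> a) (\<phi> b) (\<phi> c)))"
proof -
  have "sws (\<phi> us) (\<lambda>a r. sws r (\<lambda>b c. K a b c)) = sws us (\<lambda>a r. sws (\<phi> r) (\<lambda>b c. K (\<phi> a) b c))"
    by (rule coalgebra_map_sws[OF \<phi> us]) (rule ml_sws2 ml_sws1; (rule K)?; simp)+
  also have "\<dots> = sws us (\<lambda>a r. sws r (\<lambda>b c. K (\<phi> a) (\<phi> b) (\<phi> c)))"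
    by (rule sws_cong_len, rule coalgebra_map_sws[OF \<phi>])
      (use us in \<open>simp_all add: K coalgebra_map_length[OF \<phi>]\<close>)
  finally show ?thesis .
qed

lemma coalgebra_map_merge:
  assumes "1 \<le> i" "i \<le> n" shows "coalgebra_map (Suc n) n (merge i)"
  unfolding coalgebra_map_def
proof (intro allI impI conjI)
  fix us :: "'h list" assume us: "length us = Suc n"
  show "length (merge i us) = n" using assms us by (simp add: length_merge)
  have "i - 1 < length us" using assms us by simp
  then obtain A x B' where 1: "us = A @ x # B'" "length A = i - 1" by (rule split_nth)
  then obtain y B where 2: "B' = y # B" using us assms by (cases B') auto
  have 3: "merge i us = A @ (x * y) # B" using 1 2 assms by (simp add: merge_append)
  show "prod_list (merge i us) = prod_list us" unfolding 3 by (simp add: 1 2 mult.assoc)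
  fix G assume G: "\<forall>b. length b = n \<longrightarrow> ml n (\<lambda>a. G a b)" "\<forall>a. length a = n \<longrightarrow> ml n (\<lambda>b. G a b)"
  have len: "length A + Suc (length B) = n" using us 1 2 by simp
  have "sws (merge i us) G = sws A (\<lambda>a a'. sw (x * y) (\<lambda>s s'. sws B (\<lambda>b b'. G (a @ s # b) (a' @ s' # b'))))"
    by (simp add: 3 sws_append)
  also have "\<dots> = sws A (\<lambda>a a'. sw x (\<lambda>s s'. sw y (\<lambda>t t'. sws B (\<lambda>b b'. G (a @ (s * t) # b) (a' @ (s' * t') # b')))))"
  proof (rule sws_cong_len, rule sw_mult)
    fix a a' :: "'h list" and s assume l: "length a = length A" "length a' = length A"
    show "lin (\<lambda>s'. sws B (\<lambda>b b'. G (a @ s' # b) (a' @ s # b')))"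
      "lin (\<lambda>s'. sws B (\<lambda>b b'. G (a @ s # b) (a' @ s' # b')))"
      by (rule lin_sws2, rule lin_mlD[OF G(1)[rule_format]] lin_mlD[OF G(2)[rule_format]], use l len in \<open>simp_all add: entry_lin_slot\<close>)+
  qed
  also have "\<dots> = sws us (\<lambda>a b. G (merge i a) (merge i b))"
    unfolding 1(1) 2 sws_append sws.simps
    by (intro sws_cong_len sw_cong_bas) (use 1 assms in \<open>simp add: merge_append cong: sws_cong\<close>)
  finally show "sws (merge i us) G = sws us (\<lambda>a b. G (merge i a) (merge i b))" .
qed

lemma coalgebra_map_insert_one:
  assumes "j \<le> n" shows "coalgebra_map n (Suc n) (insert_one j)"
  unfolding coalgebra_map_def
proof (intro allI impI conjI)
  fix us :: "'h list" assume us: "length us = n"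
  show "length (insert_one j us) = Suc n" using assms us by (simp add: length_insert_one)
  obtain A B where 1: "us = A @ B" "length A = j"
    using us assms by (metis append_take_drop_id length_take min.absorb2)
  have 3: "insert_one j us = A @ 1 # B" using 1 by (simp add: insert_one_def)
  show "prod_list (insert_one j us) = prod_list us" unfolding 3 by (simp add: 1)
  fix G assume G: "\<forall>b. length b = Suc n \<longrightarrow> ml (Suc n) (\<lambda>a. G a b)" "\<forall>a. length a = Suc n \<longrightarrow> ml (Suc n) (\<lambda>b. G a b)"
  have len: "length A + length B = n" using us 1 by simp
  have "sws (insert_one j us) G = sws A (\<lambda>a a'. sw 1 (\<lambda>s s'. sws B (\<lambda>b b'. G (a @ s # b) (a' @ s' # b'))))"
    by (simp add: 3 sws_append)
  also have "\<dots> = sws A (\<lambda>a a'. sws B (\<lambda>b b'. G (a @ 1 # b) (a' @ 1 # b')))"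
  proof (rule sws_cong_len, rule sw_one)
    fix a a' :: "'h list" and s assume l: "length a = length A" "length a' = length A"
    show "lin (\<lambda>s'. sws B (\<lambda>b b'. G (a @ s' # b) (a' @ s # b')))"
      "lin (\<lambda>s'. sws B (\<lambda>b b'. G (a @ s # b) (a' @ s' # b')))"
      by (rule lin_sws2, rule lin_mlD[OF G(1)[rule_format]] lin_mlD[OF G(2)[rule_format]], use l len in \<open>simp_all add: entry_lin_slot\<close>)+
  qed
  also have "\<dots> = sws us (\<lambda>a b. G (insert_one j a) (insert_one j b))"
    unfolding 1(1) sws_append
    by (intro sws_cong_len) (use 1 in \<open>simp add: insert_one_def\<close>)
  finally show "sws (insert_one j us) G = sws us (\<lambda>a b. G (insert_one j a) (insert_one j b))" .
qed

end

context involutive_hopf_algebra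
begin

section \<open>The vertical cyclic operator\<close>

lemma tau_alg_in: "f \<in> GS H n q \<Longrightarrow> tau_alg H n q f \<in> GS H n q"
  by (cases "n = 0") (simp_all add: tau_alg_0 tau_alg)

lemma ml_vtau_slots:
  assumes g: "cochain (Suc n) q g"
  shows "ml (Suc n) (\<lambda>a. g (S (\<pi> b) # butlast a) (R q (last a) (L q (\<pi> c) \<psi>)))"
    and "length a = Suc n \<Longrightarrow> ml m (\<lambda>b. g (S (\<pi> b) # butlast a) (R q (last a) (L q (\<pi> c) \<psi>)))"
    and "length a = Suc n \<Longrightarrow> ml m (\<lambda>c. g (S (\<pi> b) # butlast a) (R q (last a) (L q (\<pi> c) \<psi>)))"
proof -
  show "ml (Suc n) (\<lambda>a. g (S (\<pi> b) # butlast a) (R q (last a) (L q (\<pi> c) \<psi>)))"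
    by (rule ml_front_last[OF g])
  show "ml m (\<lambda>b. g (S (\<pi> b) # butlast a) (R q (last a) (L q (\<pi> c) \<psi>)))" if "length a = Suc n"
    by (rule mlI, rule cochain_lin1[OF g], intro entry_lin_Cons1 linH_antipode linH_prod entry_lin_slot) (use that in simp)
  show "ml m (\<lambda>c. g (S (\<pi> b) # butlast a) (R q (last a) (L q (\<pi> c) \<psi>)))" if "length a = Suc n"
    by (rule mlI, rule cochain_lin2[OF g _ lin_R2[OF lin_L1]]; (intro linH_prod entry_lin_slot)?) (use that in simp_all)
qed

text \<open>The legs of \<open>\<phi> us\<close> are the images of the legs of \<open>us\<close>, and the products of legs are unchanged.\<close>

lemma vtau_coalg:
  assumes g: "cochain (Suc m) q g" and \<phi>: "coalgebra_map n (Suc m) \<phi>" and us: "length us = n"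
  shows "vtau q g (\<phi> us) \<psi> = sws us (\<lambda>a r. sws r (\<lambda>b c. g (S (\<pi> b) # butlast (\<phi> a)) (R q (last (\<phi> a)) (L q (\<pi> c) \<psi>))))"
proof -
  have "vtau q g (\<phi> us) \<psi> = sws us (\<lambda>a r. sws r (\<lambda>b c. g (S (\<pi> (\<phi> b)) # butlast (\<phi> a)) (R q (last (\<phi> a)) (L q (\<pi> (\<phi> c)) \<psi>))))"
    unfolding vtau_def by (rule coalgebra_map_sws3[OF \<phi> us]) (simp_all add: ml_vtau_slots[OF g])
  then show ?thesis using us by (simp add: coalgebra_map_prod[OF \<phi>] cong: sws_cong)
qed

text \<open>In \<open>\<tau> \<delta>\<^sub>0 f\<close> the argument \<open>S(U\<^sub>2)\<close> acts from the left on the value of \<open>f\<close>, where \<open>U\<^sub>3 S(U\<^sub>2)\<close> cancels.\<close>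

lemma tau_alg_delta_v_0:
  assumes f: "f \<in> GS H n q"
  shows "tau_alg H (Suc n) q (delta_v H n q 0 f) = delta_v H n q (Suc n) f"
proof (rule GS_eqI[of _ "Suc n" q])
  have d: "delta_v H n q 0 f \<in> GS H (Suc n) q" by (rule delta_v_0[OF f])
  show "tau_alg H (Suc n) q (delta_v H n q 0 f) \<in> GS H (Suc n) q" by (rule tau_alg_in[OF d])
  show "delta_v H n q (Suc n) f \<in> GS H (Suc n) q" by (rule delta_v_last[OF f])
  fix us :: "'h list" and \<psi> assume us: "length us = Suc n" and ml: "ml q \<psi>"
  have "ev (tau_alg H (Suc n) q (delta_v H n q 0 f)) us \<psi>
    = sws us (\<lambda>a r. sws r (\<lambda>b c. ev f (butlast a) (L q (S (\<pi> b)) (R q (last a) (L q (\<pi> c) \<psi>)))))"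
    unfolding ev_tau_alg[OF d us ml] vtau_def
    by (intro sws_cong_len) (use us in \<open>simp add: delta_v_0[OF f] ml ml_L ml_R\<close>)
  also have "\<dots> = sws us (\<lambda>a r. sws r (\<lambda>b c. ev f (butlast a) (R q (last a) (L q (\<pi> c * S (\<pi> b)) \<psi>))))"
    by (intro sws_cong_len ev_cong[OF f]) (use us in \<open>simp_all add: L_R L_L ml cong: R_cong\<close>)
  also have "\<dots> = ev f (butlast us) (R q (last us) (L q 1 \<psi>))"
  proof (rule sws_cancel_right[where G = "\<lambda>a. ev f (butlast a) (R q (last a) (L q 1 \<psi>))"])
    fix m a :: "'h list" assume a: "length a = length us"
    show "sws m (\<lambda>b c. ev f (butlast a) (R q (last a) (L q (\<pi> c * S (\<pi> b)) \<psi>))) = counits m * ev f (butlast a) (R q (last a) (L q 1 \<psi>))"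
      by (rule sws_cancel4[where F = "\<lambda>z. ev f (butlast a) (R q (last a) (L q z \<psi>))"],
          rule lin_ev2[OF f], rule lin_R2, rule lin_L1, rule linH_id) (use us a in simp_all)
  next
    show "ml (length us) (\<lambda>a. ev f (butlast a) (R q (last a) (L q 1 \<psi>)))"
      unfolding us by (rule ml_butlast_last[OF cochain_ev[OF f]])
  qed
  also have "\<dots> = ev f (butlast us) (R q (last us) \<psi>)"
    by (rule ev_cong[OF f]) (use us in \<open>simp_all add: L_one ml cong: R_cong\<close>)
  also have "\<dots> = ev (delta_v H n q (Suc n) f) us \<psi>"
    using us delta_v_last(2)[OF f, of "butlast us" \<psi> "last us"] ml by (cases us rule: rev_cases) auto
  finally show "ev (tau_alg H (Suc n) q (delta_v H n q 0 f)) us \<psi> = ev (delta_v H n q (Suc n) f) us \<psi>" .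
qed


lemma LR_simps:
  assumes "ml q \<psi>" "length v = q"
  shows "L q x (L q y \<psi>) v = L q (y * x) \<psi> v" "R q x (R q y \<psi>) v = R q (x * y) \<psi> v"
    "L q x (R q y \<psi>) v = R q y (L q x \<psi>) v"
  using assms by (simp_all add: L_L R_R L_R)

lemma vtau_cong:
  assumes "length us = Suc n"
    and "\<And>a b c. length a = Suc n \<Longrightarrow> length b = Suc n \<Longrightarrow> length c = Suc n \<Longrightarrow>
      g (S (\<pi> b) # butlast a) (R q (last a) (L q (\<pi> c) \<psi>)) = h a b c"
  shows "vtau q g us \<psi> = sws us (\<lambda>a r. sws r (\<lambda>b c. h a b c))"
  unfolding vtau_def by (intro sws_cong_len assms(2)) (simp_all add: assms(1))

lemma tau_alg_delta_v_ge2: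
  assumes f: "f \<in> GS H n q" and k: "1 \<le> k" "k \<le> n"
  shows "tau_alg H (Suc n) q (delta_v H n q (Suc k) f) = delta_v H n q k (tau_alg H n q f)"
proof (rule GS_eqI[of _ "Suc n" q])
  obtain m where m: "n = Suc m" using k by (cases n) auto
  have d: "delta_v H n q (Suc k) f \<in> GS H (Suc n) q" by (rule delta_v_in[OF f]) (use k in simp)
  have t: "tau_alg H n q f \<in> GS H n q" by (rule tau_alg_in[OF f])
  show "tau_alg H (Suc n) q (delta_v H n q (Suc k) f) \<in> GS H (Suc n) q" by (rule tau_alg_in[OF d])
  show "delta_v H n q k (tau_alg H n q f) \<in> GS H (Suc n) q" by (rule delta_v_in[OF t]) (use k in simp)
  fix us :: "'h list" and \<psi> assume us: "length us = Suc n" and ml: "ml q \<psi>"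
  have "ev (delta_v H n q k (tau_alg H n q f)) us \<psi> = vtau q (ev f) (merge k us) \<psi>"
    using delta_v_mid(2)[OF t k us] ev_tau_alg[of f m q "merge k us" \<psi>] f us k ml m by (simp add: length_merge)
  also have "\<dots> = sws us (\<lambda>a r. sws r (\<lambda>b c. ev f (S (\<pi> b) # butlast (merge k a)) (R q (last (merge k a)) (L q (\<pi> c) \<psi>))))"
    by (rule vtau_coalg[where m = m]) (use f us k m in \<open>simp_all add: cochain_ev coalgebra_map_merge\<close>)
  also have "\<dots> = vtau q (ev (delta_v H n q (Suc k) f)) us \<psi>"
  proof (rule vtau_cong[OF us, symmetric])
    fix a b c :: "'h list" assume a: "length a = Suc n"
    obtain a' x where x: "a = a' @ [x]" "length a' = n" using a by (cases a rule: rev_cases) auto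
    show "ev (delta_v H n q (Suc k) f) (S (\<pi> b) # butlast a) (R q (last a) (L q (\<pi> c) \<psi>))
      = ev f (S (\<pi> b) # butlast (merge k a)) (R q (last (merge k a)) (L q (\<pi> c) \<psi>))"
    proof (cases "k = n")
      case False
      then have "merge k a = merge k a' @ [x]" using k x by (simp add: merge_append1)
      then show ?thesis using False k x by (simp add: delta_v_mid[OF f] merge_Cons)
    next
      case True
      obtain a'' y where y: "a' = a'' @ [y]" "length a'' = m" using x m by (cases a' rule: rev_cases) auto
      have 1: "merge k a = a'' @ [y * x]" using merge_last[of a'' y x] True x y m by simp
      have "ev (delta_v H n q (Suc n) f) ((S (\<pi> b) # a'') @ [y]) (R q x (L q (\<pi> c) \<psi>))
        = ev f (S (\<pi> b) # a'') (R q y (R q x (L q (\<pi> c) \<psi>)))"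
        by (rule delta_v_last[OF f]) (use y m in \<open>simp_all add: ml ml_L ml_R\<close>)
      also have "\<dots> = ev f (S (\<pi> b) # a'') (R q (y * x) (L q (\<pi> c) \<psi>))"
        by (rule ev_cong[OF f]) (use y m in \<open>simp_all add: R_R ml_L ml\<close>)
      finally show ?thesis using 1 x y True by (simp add: butlast_append)
    qed
  qed
  also have "\<dots> = ev (tau_alg H (Suc n) q (delta_v H n q (Suc k) f)) us \<psi>"
    by (rule ev_tau_alg[OF d us ml, symmetric])
  finally show "ev (tau_alg H (Suc n) q (delta_v H n q (Suc k) f)) us \<psi> = ev (delta_v H n q k (tau_alg H n q f)) us \<psi>" by simp
qed

text \<open>The coface \<open>\<delta>\<^sub>1\<close> multiplies \<open>S(U\<^sub>2)\<close> by the first leg of the first argument \<open>u\<close>; this cancels against the last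
factor \<open>S(u\<^sub>2)\<close> of \<open>S(U\<^sub>2)\<close>, and \<open>u\<^sub>3\<close>, the first factor of \<open>U\<^sub>3\<close>, acts last.\<close>

lemma tau_alg_delta_v_1_pos:
  assumes f: "f \<in> GS H n q" and n: "n = Suc m"
  shows "tau_alg H (Suc n) q (delta_v H n q 1 f) = delta_v H n q 0 (tau_alg H n q f)"
proof (rule GS_eqI[of _ "Suc n" q])
  have d: "delta_v H n q 1 f \<in> GS H (Suc n) q" by (rule delta_v_in[OF f]) simp
  have t: "tau_alg H n q f \<in> GS H n q" by (rule tau_alg_in[OF f])
  show "tau_alg H (Suc n) q (delta_v H n q 1 f) \<in> GS H (Suc n) q" by (rule tau_alg_in[OF d])
  show "delta_v H n q 0 (tau_alg H n q f) \<in> GS H (Suc n) q" by (rule delta_v_in[OF t]) simp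
  fix us :: "'h list" and \<psi> assume us: "length us = Suc n" and ml: "ml q \<psi>"
  obtain u w where u: "us = u # w" "length w = n" using us by (auto simp: len_Suc)
  have lw: "length w = Suc m" using u n by simp
  have d1: "ev (delta_v H n q 1 f) (s # x # t) \<chi> = ev f (s * x # t) \<chi>" if "length t = m" for s x t \<chi>
    using delta_v_mid(2)[OF f, of 1 "s # x # t"] n that by (simp add: merge_1_Cons)
  define F where "F t z = sws w (\<lambda>a r. sws r (\<lambda>b c. ev f (S (\<pi> b) * t # butlast a) (R q (last a) (L q (z * \<pi> c) \<psi>))))" for t z
  have lF1: "lin (\<lambda>t. F t z)" for z
    unfolding F_def
    by (rule lin_sws2, rule lin_sws2, rule lin_ev1[OF f], intro entry_lin_Cons1 linH_mult_left linH_id) (use u n in simp)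
  have lF2: "lin (\<lambda>z. F t z)" for t
    unfolding F_def
    by (rule lin_sws2, rule lin_sws2, rule lin_ev2[OF f], rule lin_R2, rule lin_L1, intro linH_mult_right linH_id) (use u n in simp_all)
  have "ev (tau_alg H (Suc n) q (delta_v H n q 1 f)) us \<psi>
    = sw u (\<lambda>x s. sws w (\<lambda>a r. sw s (\<lambda>y z. sws r (\<lambda>b c. ev (delta_v H n q 1 f) (S (y * \<pi> b) # butlast (x # a)) (R q (last (x # a)) (L q (z * \<pi> c) \<psi>))))))"
    using ev_tau_alg[OF d us ml] by (simp add: vtau_def u(1) del: butlast.simps last.simps)
  also have "\<dots> = sw u (\<lambda>x s. sws w (\<lambda>a r. sw s (\<lambda>y z. sws r (\<lambda>b c. ev f (S (\<pi> b) * (S y * x) # butlast a) (R q (last a) (L q (z * \<pi> c) \<psi>))))))"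
    by (intro sw_cong_bas sws_cong_len) (use lw in \<open>auto simp: d1 antipode_mult mult.assoc\<close>)
  also have "\<dots> = sw u (\<lambda>x s. sw s (\<lambda>y z. F (S y * x) z))"
    by (simp only: sws_sw_swap F_def)
  also have "\<dots> = F 1 u"
    by (rule sw_cancel_left[where G = "F 1"]) (rule sw_cancel3[where F = "\<lambda>t. F t _"], rule lF1, rule lF2)
  also have "\<dots> = vtau q (ev f) w (L q u \<psi>)"
    unfolding F_def by (rule vtau_cong[OF lw, symmetric])
      (use n in \<open>simp, intro ev_cong[OF f] R_cong, simp_all add: L_L ml\<close>)
  also have "\<dots> = ev (delta_v H n q 0 (tau_alg H n q f)) us \<psi>"
    using delta_v_0(2)[OF t u(2) ml, of u] ev_tau_alg[of f m q w "L q u \<psi>"] u n f ml by (simp add: ml_L)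
  finally show "ev (tau_alg H (Suc n) q (delta_v H n q 1 f)) us \<psi> = ev (delta_v H n q 0 (tau_alg H n q f)) us \<psi>" .
qed

text \<open>In degree 0 the coface \<open>\<delta>\<^sub>1\<close> is the last one, which acts from the right.\<close>

lemma tau_alg_delta_v_1_zero:
  assumes f: "f \<in> GS H 0 q"
  shows "tau_alg H 1 q (delta_v H 0 q 1 f) = delta_v H 0 q 0 f"
proof (rule GS_eqI[of _ "Suc 0" q])
  have d: "delta_v H 0 q (Suc 0) f \<in> GS H (Suc 0) q" by (rule delta_v_in[OF f]) simp
  show "tau_alg H 1 q (delta_v H 0 q 1 f) \<in> GS H (Suc 0) q" using tau_alg_in[OF d] by (simp add: One_nat_def)
  show "delta_v H 0 q 0 f \<in> GS H (Suc 0) q" by (rule delta_v_in[OF f]) simp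
  fix us :: "'h list" and \<psi> assume us: "length us = Suc 0" and ml: "ml q \<psi>"
  obtain u where u: "us = [u]" using us by (auto simp: len_Suc)
  have l: "lin (\<lambda>t. ev f [] (R q t (L q c \<psi>)))" "lin (\<lambda>c. ev f [] (R q t (L q c \<psi>)))" for c t
    by (rule lin_ev2[OF f], intro lin_R1 linH_id, simp)
      (rule lin_ev2[OF f], rule lin_R2, intro lin_L1 linH_id, simp_all)
  have "ev (tau_alg H 1 q (delta_v H 0 q 1 f)) us \<psi> = sw u (\<lambda>a r. sw r (\<lambda>b c. ev (delta_v H 0 q (Suc 0) f) ([] @ [S b]) (R q a (L q c \<psi>))))"
    using ev_tau_alg[OF d us ml] by (simp add: One_nat_def vtau_def u)
  also have "\<dots> = sw u (\<lambda>a r. sw r (\<lambda>b c. ev f [] (R q (S b) (R q a (L q c \<psi>)))))"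
    by (simp only: delta_v_last(2)[OF f] ml ml_L ml_R list.size)
  also have "\<dots> = sw u (\<lambda>a r. sw r (\<lambda>b c. ev f [] (R q (S b * a) (L q c \<psi>))))"
    by (intro sw_cong_bas ev_cong[OF f]) (simp_all add: R_R ml_L ml)
  also have "\<dots> = ev f [] (R q 1 (L q u \<psi>))"
    by (rule sw_cancel_left[where G = "\<lambda>u. ev f [] (R q 1 (L q u \<psi>))"])
      (rule sw_cancel3[where F = "\<lambda>t. ev f [] (R q t (L q _ \<psi>))"], rule l, rule l)
  also have "\<dots> = ev f [] (L q u \<psi>)" by (rule ev_cong[OF f]) (simp_all add: R_one ml ml_L)
  also have "\<dots> = ev (delta_v H 0 q 0 f) us \<psi>" by (simp add: u delta_v_0[OF f] ml)
  finally show "ev (tau_alg H 1 q (delta_v H 0 q 1 f)) us \<psi> = ev (delta_v H 0 q 0 f) us \<psi>" .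
qed

lemma tau_alg_delta_v:
  assumes f: "f \<in> GS H n q" and i: "1 \<le> i" "i \<le> Suc n"
  shows "tau_alg H (Suc n) q (delta_v H n q i f) = delta_v H n q (i - 1) (tau_alg H n q f)"
proof (cases "i = 1")
  case True
  show ?thesis
  proof (cases n)
    case 0
    then show ?thesis using True tau_alg_delta_v_1_zero f by (simp add: tau_alg_0 One_nat_def)
  next
    case (Suc m)
    then show ?thesis using True tau_alg_delta_v_1_pos[OF f] by simp
  qed
next
  case False
  define k where "k = i - 1"
  have "i = Suc k" "1 \<le> k" "k \<le> n" using False i by (auto simp: k_def)
  then show ?thesis using tau_alg_delta_v_ge2[OF f] by simp
qed

lemma tau_alg_sigma_v:
  assumes f: "f \<in> GS H (Suc n) q" and i: "1 \<le> i" "i \<le> n"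
  shows "tau_alg H n q (sigma_v H (Suc n) q i f) = sigma_v H (Suc n) q (i - 1) (tau_alg H (Suc n) q f)"
proof (rule GS_eqI[of _ n q])
  obtain m where m: "n = Suc m" using i by (cases n) auto
  define k where "k = i - 1"
  have k: "i = Suc k" "k < n" using i by (auto simp: k_def)
  have s: "sigma_v H (Suc n) q i f \<in> GS H n q" by (rule sigma_v[OF f]) (use i in simp)
  have t: "tau_alg H (Suc n) q f \<in> GS H (Suc n) q" by (rule tau_alg_in[OF f])
  show "tau_alg H n q (sigma_v H (Suc n) q i f) \<in> GS H n q" by (rule tau_alg_in[OF s])
  show "sigma_v H (Suc n) q (i - 1) (tau_alg H (Suc n) q f) \<in> GS H n q" by (rule sigma_v[OF t]) (use i in simp)
  fix us :: "'h list" and \<psi> assume us: "length us = n" and ml: "ml q \<psi>"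
  have "ev (sigma_v H (Suc n) q k (tau_alg H (Suc n) q f)) us \<psi> = vtau q (ev f) (insert_one k us) \<psi>"
    using f us k ml by (simp add: sigma_v[OF t] ev_tau_alg length_insert_one)
  also have "\<dots> = sws us (\<lambda>a r. sws r (\<lambda>b c. ev f (S (\<pi> b) # butlast (insert_one k a)) (R q (last (insert_one k a)) (L q (\<pi> c) \<psi>))))"
    by (rule vtau_coalg[where m = n]) (use f us k in \<open>simp_all add: cochain_ev coalgebra_map_insert_one\<close>)
  also have "\<dots> = vtau q (ev (sigma_v H (Suc n) q i f)) us \<psi>"
  proof (rule vtau_cong[OF us[unfolded m], symmetric])
    fix a b c :: "'h list" assume a: "length a = Suc m"
    obtain a' x where x: "a = a' @ [x]" "length a' = m" using a by (cases a rule: rev_cases) auto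
    have "insert_one k a = insert_one k a' @ [x]" using x k m by (simp add: insert_one_append1)
    then show "ev (sigma_v H (Suc n) q i f) (S (\<pi> b) # butlast a) (R q (last a) (L q (\<pi> c) \<psi>))
      = ev f (S (\<pi> b) # butlast (insert_one k a)) (R q (last (insert_one k a)) (L q (\<pi> c) \<psi>))"
      using x i m k sigma_v(2)[OF f, of i "S (\<pi> b) # a'" "R q x (L q (\<pi> c) \<psi>)"] by (simp add: insert_one_Cons)
  qed
  also have "\<dots> = ev (tau_alg H n q (sigma_v H (Suc n) q i f)) us \<psi>"
    using s us ml m by (simp add: ev_tau_alg)
  finally show "ev (tau_alg H n q (sigma_v H (Suc n) q i f)) us \<psi> = ev (sigma_v H (Suc n) q (i - 1) (tau_alg H (Suc n) q f)) us \<psi>"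
    using k by simp
qed

text \<open>Half of the square of the cyclic operator: on an argument list of the form \<open>(S(U\<^sub>2), u\<^sub>1)\<close> all products of
legs cancel, so that \<open>\<tau>\<close> merely lets the last entry act from the right and puts a unit in front.\<close>

lemma ev_tau_alg_cycle:
  assumes f: "f \<in> GS H (Suc n) q" and m: "length m = n" and ml: "ml q \<psi>"
  shows "sws m (\<lambda>a b. ev (tau_alg H (Suc n) q f) (S (\<pi> b) # a) \<psi>)
    = sws m (\<lambda>a b. ev f (1 # butlast (S (\<pi> b) # a)) (R q (last (S (\<pi> b) # a)) \<psi>))"
proof -
  let ?K = "\<lambda>p x z. ev f (S x # butlast p) (R q (last p) (L q z \<psi>))"
  have "sws m (\<lambda>a b. ev (tau_alg H (Suc n) q f) (S (\<pi> b) # a) \<psi>)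
    = sws m (\<lambda>a b. sws (S (\<pi> b) # a) (\<lambda>p r. sws r (\<lambda>q s. ?K p (\<pi> q) (\<pi> s))))"
    by (rule sws_cong_len) (use m in \<open>simp add: ev_tau_alg[OF f _ ml] vtau_def del: sws.simps\<close>)
  also have "\<dots> = sws m (\<lambda>a b. ?K (S (\<pi> b) # a) 1 1)"
  proof (rule sws_cycle_prod2_one)
    show "ml (Suc (length m)) (\<lambda>p. ?K p x z)" for x z
      unfolding m by (rule ml_front_last[OF cochain_ev[OF f]])
    show "lin (\<lambda>x. ?K p x z)" if "length p = Suc (length m)" for p z
      by (rule lin_ev1[OF f], intro entry_lin_Cons1 linH_antipode linH_id) (use that m in simp)
    show "lin (\<lambda>z. ?K p x z)" if "length p = Suc (length m)" for p x
      by (rule lin_ev2[OF f], rule lin_R2, intro lin_L1 linH_id) (use that m in simp_all)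
  qed
  also have "\<dots> = sws m (\<lambda>a b. ev f (1 # butlast (S (\<pi> b) # a)) (R q (last (S (\<pi> b) # a)) \<psi>))"
    unfolding antipode_one
    by (intro sws_cong_len ev_cong[OF f] R_cong) (use m in \<open>simp_all add: L_one ml del: butlast.simps last.simps\<close>)
  finally show ?thesis .
qed

lemma tau_alg_sigma_v_0:
  assumes f: "f \<in> GS H (Suc n) q"
  shows "tau_alg H n q (sigma_v H (Suc n) q 0 f) = sigma_v H (Suc n) q n (tau_alg H (Suc n) q (tau_alg H (Suc n) q f))"
proof (rule GS_eqI[of _ n q])
  have s: "sigma_v H (Suc n) q 0 f \<in> GS H n q" by (rule sigma_v[OF f]) simp
  have t: "tau_alg H (Suc n) q f \<in> GS H (Suc n) q" by (rule tau_alg_in[OF f])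
  have tt: "tau_alg H (Suc n) q (tau_alg H (Suc n) q f) \<in> GS H (Suc n) q" by (rule tau_alg_in[OF t])
  show "tau_alg H n q (sigma_v H (Suc n) q 0 f) \<in> GS H n q" by (rule tau_alg_in[OF s])
  show "sigma_v H (Suc n) q n (tau_alg H (Suc n) q (tau_alg H (Suc n) q f)) \<in> GS H n q" by (rule sigma_v[OF tt]) simp
  fix us :: "'h list" and \<psi> assume us: "length us = n" and ml: "ml q \<psi>"
  have "ev (sigma_v H (Suc n) q n (tau_alg H (Suc n) q (tau_alg H (Suc n) q f))) us \<psi> = vtau q (ev (tau_alg H (Suc n) q f)) (insert_one n us) \<psi>"
    using us ml t by (simp add: sigma_v[OF tt] ev_tau_alg length_insert_one)
  also have "\<dots> = sws us (\<lambda>a r. sws r (\<lambda>b c. ev (tau_alg H (Suc n) q f) (S (\<pi> b) # butlast (insert_one n a)) (R q (last (insert_one n a)) (L q (\<pi> c) \<psi>))))"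
    by (rule vtau_coalg[where m = n]) (use t us in \<open>simp_all add: cochain_ev coalgebra_map_insert_one\<close>)
  also have "\<dots> = sws us (\<lambda>a r. sws r (\<lambda>b c. ev (tau_alg H (Suc n) q f) (S (\<pi> b) # a) (L q (\<pi> c) \<psi>)))"
    by (intro sws_cong_len) (use us in \<open>simp add: insert_one_def, intro ev_cong[OF t], simp_all add: R_one ml_L ml\<close>)
  also have "\<dots> = sws us (\<lambda>m c. sws m (\<lambda>a b. ev f (1 # butlast (S (\<pi> b) # a)) (R q (last (S (\<pi> b) # a)) (L q (\<pi> c) \<psi>))))"
    unfolding sws_coassoc[symmetric] by (rule sws_cong_len, rule ev_tau_alg_cycle[OF f]) (use us in \<open>simp_all add: ml_L ml\<close>)
  also have "\<dots> = sws us (\<lambda>a r. sws r (\<lambda>b c. ev f (1 # butlast (S (\<pi> b) # a)) (R q (last (S (\<pi> b) # a)) (L q (\<pi> c) \<psi>))))"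
    by (rule sws_coassoc)
  also have "\<dots> = ev (tau_alg H n q (sigma_v H (Suc n) q 0 f)) us \<psi>"
  proof (cases n)
    case 0
    have "ev f [1] (R q 1 (L q 1 \<psi>)) = ev f [1] \<psi>"
      by (rule ev_cong[OF f]) (simp_all add: 0 R_one L_one ml ml_L)
    then show ?thesis using us 0 f by (simp add: tau_alg_0 antipode_one sigma_v insert_one_def)
  next
    case (Suc k)
    have "vtau q (ev (sigma_v H (Suc n) q 0 f)) us \<psi> = sws us (\<lambda>a r. sws r (\<lambda>b c. ev f (1 # butlast (S (\<pi> b) # a)) (R q (last (S (\<pi> b) # a)) (L q (\<pi> c) \<psi>))))"
    proof (rule vtau_cong[of _ k])
      fix a b c :: "'h list" assume "length a = Suc k"
      then show "ev (sigma_v H (Suc n) q 0 f) (S (\<pi> b) # butlast a) (R q (last a) (L q (\<pi> c) \<psi>))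
        = ev f (1 # butlast (S (\<pi> b) # a)) (R q (last (S (\<pi> b) # a)) (L q (\<pi> c) \<psi>))"
        using sigma_v(2)[OF f, of 0 "S (\<pi> b) # butlast a"] Suc by (auto simp: insert_one_def)
    qed (use us Suc in simp)
    then show ?thesis using s us ml Suc by (simp add: ev_tau_alg)
  qed
  finally show "ev (tau_alg H n q (sigma_v H (Suc n) q 0 f)) us \<psi> = ev (sigma_v H (Suc n) q n (tau_alg H (Suc n) q (tau_alg H (Suc n) q f))) us \<psi>" by simp
qed


section \<open>Powers of the vertical cyclic operator\<close>

text \<open>The operators \<open>\<iota>\<close> and \<open>\<rho>\<close>: \<open>(\<iota> g)(u) = U\<^sub>3 \<triangleright> g(S(U\<^sub>2), u\<^sub>1)\<close> and
\<open>(\<rho> g)(a\<^sup>0, \<dots>, a\<^sup>p) = S(a\<^sup>p\<^sub>2) \<triangleright> g(a\<^sup>p\<^sub>3, a\<^sup>0, \<dots>, a\<^sup>p\<^sup>-\<^sup>1) \<triangleleft> a\<^sup>p\<^sub>1\<close>. The first one is a left inverse of the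
coface \<open>\<delta>\<^sub>0\<close>, an extra codegeneracy; through it \<open>\<tau>\<close> turns into \<open>\<rho>\<close>, whose powers are easily computed
because it touches one argument at a time.\<close>

definition vdegen :: "nat \<Rightarrow> ('h list \<Rightarrow> ('h list \<Rightarrow> 'k) \<Rightarrow> 'k) \<Rightarrow> 'h list \<Rightarrow> ('h list \<Rightarrow> 'k) \<Rightarrow> 'k" where
  "vdegen q g us \<psi> = sws us (\<lambda>a r. sws r (\<lambda>b c. g (S (\<pi> b) # a) (L q (\<pi> c) \<psi>)))"

definition vshift :: "nat \<Rightarrow> ('h list \<Rightarrow> ('h list \<Rightarrow> 'k) \<Rightarrow> 'k) \<Rightarrow> 'h list \<Rightarrow> ('h list \<Rightarrow> 'k) \<Rightarrow> 'k" where
  "vshift q g us \<psi> = sw (last us) (\<lambda>x r. sw r (\<lambda>y z. g (z # butlast us) (R q x (L q (S y) \<psi>))))"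

lemma cochain_vshift:
  assumes g: "cochain (Suc p) q g" shows "cochain (Suc p) q (vshift q g)"
  unfolding cochain_def
proof (intro conjI allI impI)
  fix \<psi>
  show "ml (Suc p) (\<lambda>us. vshift q g us \<psi>)"
  proof (rule ml_snocI)
    show "lin (\<lambda>h. vshift q g (t @ [h]) \<psi>)" for t
      unfolding vshift_def last_snoc butlast_snoc by (rule lin_sw1[OF linH_id])
    show "ml p (\<lambda>t. vshift q g (t @ [h]) \<psi>)" for h
      unfolding vshift_def last_snoc butlast_snoc
      by (rule mlI, rule lin_sw2, rule lin_sw2, rule cochain_lin1[OF g], intro entry_lin_Cons2 entry_lin_slot) simp
  qed
next
  fix us :: "'h list" assume us: "length us = Suc p"
  show "fsupp (\<lambda>v. length v = q) (vshift q g us)"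
    unfolding vshift_def[abs_def]
    by (intro fsupp_bind_sw fsupp_L[of q "\<lambda>\<psi>. g _ (R q _ \<psi>)"] fsupp_R cochain_fsupp[OF g]) (use us in simp)
qed

lemma vshift_snoc: "vshift q g (us @ [u]) \<psi> = sw u (\<lambda>x r. sw r (\<lambda>y z. g (z # us) (R q x (L q (S y) \<psi>))))"
  by (simp add: vshift_def)

text \<open>On the left one has to split the list \<open>(S(U\<^sub>2), u\<^sub>1)\<close> into three legs, two of which enter only through their
products. These products reduce to \<open>S\<close> of two legs \<open>y\<^sub>2\<close>, \<open>y\<^sub>1\<close> of the last argument (\<open>sws_cycle_prod2\<close>);
\<open>\<iota>\<close> applies \<open>S\<close> once more to the first of them and thus brings \<open>y\<^sub>2\<close> itself to the front.\<close>

lemma vtau_vdegen: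
  assumes g: "cochain (Suc p) q g" and us: "length us = p" and p: "p \<noteq> 0" and ml: "ml q \<psi>"
  shows "vtau q (vdegen q g) us \<psi> = vdegen q (vshift q g) us \<psi>"
proof -
  obtain w l where w: "us = w @ [l]" "Suc (length w) = p" using us p by (cases us rule: rev_cases) auto
  let ?T = "\<lambda>a b c x y1 y2 y3 z. g (y2 # S (\<pi> b * y3) # a) (R q x (L q (\<pi> c * z * S y1) \<psi>))"
  have K: "sws m (\<lambda>a b. sws (S (\<pi> b * y) # a) (\<lambda>p r. sws r (\<lambda>t s. g (S (\<pi> t) # p) (L q (\<pi> s) (R q x (L q (\<pi> c * z) \<psi>))))))
    = sws m (\<lambda>a b. sw y (\<lambda>y1 r. sw r (\<lambda>y2 y3. ?T a b c x y1 y2 y3 z)))" if m: "length m = length w" for m c x y z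
  proof -
    let ?K = "\<lambda>p X Z. g (S X # p) (L q Z (R q x (L q (\<pi> c * z) \<psi>)))"
    have "sws m (\<lambda>a b. sws (S (\<pi> b * y) # a) (\<lambda>p r. sws r (\<lambda>t s. ?K p (\<pi> t) (\<pi> s))))
      = sws m (\<lambda>a b. sw y (\<lambda>y1 r. sw r (\<lambda>y2 y3. ?K (S (\<pi> b * y3) # a) (S y2) (S y1))))"
    proof (rule sws_cycle_prod2)
      show "ml (Suc (length m)) (\<lambda>p. ?K p X Z)" for X Z
        by (rule mlI, rule cochain_lin1[OF g], intro entry_lin_Cons2 entry_lin_slot) (use m w in simp)
      show "lin (\<lambda>X. ?K p X Z)" if "length p = Suc (length m)" for p Z
        by (rule cochain_lin1[OF g], intro entry_lin_Cons1 linH_antipode linH_id) (use m w that in simp)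
      show "lin (\<lambda>Z. ?K p X Z)" if "length p = Suc (length m)" for p X
        by (rule cochain_lin2[OF g], use m w that in simp, rule lin_L1, rule linH_id)
    qed
    also have "\<dots> = sws m (\<lambda>a b. sw y (\<lambda>y1 r. sw r (\<lambda>y2 y3. ?T a b c x y1 y2 y3 z)))"
      unfolding antipode_antipode
      by (intro sws_cong_len sw_cong_bas cochain_cong[OF g]) (use m w in \<open>simp_all add: LR_simps ml ml_L cong: R_cong\<close>)
    finally show ?thesis .
  qed
  have "vtau q (vdegen q g) us \<psi> = sws w (\<lambda>m c. sws m (\<lambda>a b. sw l (\<lambda>x s. sw s (\<lambda>y z. vdegen q g (S (\<pi> b * y) # a) (R q x (L q (\<pi> c * z) \<psi>))))))"
    unfolding w(1) vtau_snoc by (rule sws_coassoc[symmetric])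
  also have "\<dots> = sws w (\<lambda>m c. sw l (\<lambda>x s. sw s (\<lambda>y z. sws m (\<lambda>a b. sws (S (\<pi> b * y) # a) (\<lambda>p r. sws r (\<lambda>t s. g (S (\<pi> t) # p) (L q (\<pi> s) (R q x (L q (\<pi> c * z) \<psi>)))))))))"
    unfolding vdegen_def by (simp only: sws_sw_swap)
  also have "\<dots> = sws w (\<lambda>m c. sw l (\<lambda>x s. sw s (\<lambda>y z. sws m (\<lambda>a b. sw y (\<lambda>y1 r. sw r (\<lambda>y2 y3. ?T a b c x y1 y2 y3 z))))))"
    by (intro sws_cong_len sw_cong_bas K)
  also have "\<dots> = sws w (\<lambda>m c. sws m (\<lambda>a b. sw l (\<lambda>x s. sw s (\<lambda>y z. sw y (\<lambda>y1 r. sw r (\<lambda>y2 y3. ?T a b c x y1 y2 y3 z))))))"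
    by (simp only: sws_sw_swap)
  also have "\<dots> = sws w (\<lambda>a r. sws r (\<lambda>b c. sw l (\<lambda>x s. sw s (\<lambda>y1 s. sw s (\<lambda>y2 s. sw s (\<lambda>y3 z. ?T a b c x y1 y2 y3 z))))))"
    by (simp only: sws_coassoc sw_coassoc)
  also have "\<dots> = sws w (\<lambda>a r. sws r (\<lambda>b c. sw l (\<lambda>x s. sw x (\<lambda>x1 r. sw r (\<lambda>x2 x3. sw s (\<lambda>y z. ?T a b c x1 x2 x3 y z))))))"
    by (simp only: sw_coassoc)
  also have "\<dots> = sws w (\<lambda>a r. sws r (\<lambda>b c. sw l (\<lambda>x s. sw s (\<lambda>y z. sw x (\<lambda>x1 r. sw r (\<lambda>x2 x3. ?T a b c x1 x2 x3 y z))))))"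
    by (subst (2) sw_swap, subst sw_swap) (rule refl)
  also have "\<dots> = sws w (\<lambda>a r. sws r (\<lambda>b c. sw l (\<lambda>x s. sw s (\<lambda>y z. vshift q g ((S (\<pi> b * y) # a) @ [x]) (L q (\<pi> c * z) \<psi>)))))"
    unfolding vshift_snoc
    by (intro sws_cong_len sw_cong_bas cochain_cong[OF g]) (use w in \<open>simp_all add: LR_simps ml mult.assoc cong: R_cong\<close>)
  also have "\<dots> = vdegen q (vshift q g) us \<psi>"
    unfolding w(1) vdegen_def by (simp add: sws_append sws_sw_swap)
  finally show ?thesis .
qed

text \<open>After as many steps as \<open>B\<close> has entries, \<open>B\<close> has moved to the front and its first two legs
conjugate the value: \<open>S(B\<^sub>2) \<triangleright> g(b\<^sub>3, A) \<triangleleft> B\<^sub>1\<close>.\<close>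

lemma vshift_power:
  assumes "cochain (Suc p) q g" "length A + length B = Suc p" "ml q \<psi>"
  shows "(vshift q ^^ length B) g (A @ B) \<psi> = sws B (\<lambda>b1 r. sws r (\<lambda>b2 b3. g (b3 @ A) (R q (\<pi> b1) (L q (S (\<pi> b2)) \<psi>))))"
  using assms
proof (induction B arbitrary: A g)
  case Nil
  have "g A \<psi> = g A (R q 1 (L q 1 \<psi>))"
    by (rule cochain_cong[OF Nil(1)]) (use Nil in \<open>simp_all add: R_one L_one ml_L\<close>)
  then show ?case by (simp add: antipode_one)
next
  case (Cons x B)
  have "(vshift q ^^ length (x # B)) g (A @ x # B) \<psi> = (vshift q ^^ length B) (vshift q g) ((A @ [x]) @ B) \<psi>"
    by (simp add: funpow_swap1)
  also have "\<dots> = sws B (\<lambda>b1 r. sws r (\<lambda>b2 b3. vshift q g ((b3 @ A) @ [x]) (R q (\<pi> b1) (L q (S (\<pi> b2)) \<psi>))))"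
    by (subst Cons.IH) (use Cons.prems in \<open>simp_all add: cochain_vshift\<close>)
  also have "\<dots> = sws B (\<lambda>b1 r. sws r (\<lambda>b2 b3. sw x (\<lambda>x1 s. sw s (\<lambda>x2 x3. g (x3 # b3 @ A) (R q (x1 * \<pi> b1) (L q (S (x2 * \<pi> b2)) \<psi>))))))"
    unfolding vshift_snoc
    by (intro sws_cong_len sw_cong_bas cochain_cong[OF Cons.prems(1)])
      (use Cons.prems in \<open>simp_all add: LR_simps ml_L ml_R antipode_mult cong: R_cong\<close>)
  also have "\<dots> = sws (x # B) (\<lambda>b1 r. sws r (\<lambda>b2 b3. g (b3 @ A) (R q (\<pi> b1) (L q (S (\<pi> b2)) \<psi>))))"
    by (simp add: sws_sw_swap)
  finally show ?case .
qed

lemma vdegen_delta_v_0: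
  assumes f: "f \<in> GS H p q" and us: "length us = p" and ml: "ml q \<psi>"
  shows "vdegen q (ev (delta_v H p q 0 f)) us \<psi> = ev f us \<psi>"
proof -
  have "vdegen q (ev (delta_v H p q 0 f)) us \<psi> = sws us (\<lambda>a r. sws r (\<lambda>b c. ev f a (L q (\<pi> c * S (\<pi> b)) \<psi>)))"
    unfolding vdegen_def
    by (intro sws_cong_len) (use us in \<open>simp add: delta_v_0[OF f] ml ml_L, intro ev_cong[OF f], simp_all add: L_L ml\<close>)
  also have "\<dots> = ev f us (L q 1 \<psi>)"
    by (rule sws_cancel_right[where G = "\<lambda>a. ev f a (L q 1 \<psi>)"])
      (rule sws_cancel4[where F = "\<lambda>z. ev f _ (L q z \<psi>)"], rule lin_ev2[OF f], intro lin_L1 linH_id,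
        use us ml_ev[OF f] in simp_all)
  also have "\<dots> = ev f us \<psi>" by (rule ev_cong[OF f us]) (simp add: L_one ml)
  finally show ?thesis .
qed

lemma tau_alg_pow_in: "f \<in> GS H p q \<Longrightarrow> (tau_alg H p q ^^ k) f \<in> GS H p q"
  by (induction k) (simp_all add: tau_alg_in)

lemma cochain_vshift_pow: "cochain (Suc p) q g \<Longrightarrow> cochain (Suc p) q ((vshift q ^^ k) g)"
  by (induction k) (simp_all add: cochain_vshift)

lemma ev_tau_alg_pow:
  assumes f: "f \<in> GS H p q" and p: "p \<noteq> 0"
  shows "length us = p \<Longrightarrow> ml q \<psi> \<Longrightarrow> ev ((tau_alg H p q ^^ k) f) us \<psi> = vdegen q ((vshift q ^^ k) (ev (delta_v H p q 0 f))) us \<psi>"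
proof (induction k arbitrary: us \<psi>)
  case 0
  then show ?case by (simp add: vdegen_delta_v_0[OF f])
next
  case (Suc k)
  let ?g = "(vshift q ^^ k) (ev (delta_v H p q 0 f))"
  obtain p' where p': "p = Suc p'" using p by (cases p) auto
  have d: "cochain (Suc p) q (ev (delta_v H p q 0 f))" by (rule cochain_ev[OF delta_v_in[OF f]]) simp
  have "ev ((tau_alg H p q ^^ Suc k) f) us \<psi> = vtau q (ev ((tau_alg H p q ^^ k) f)) us \<psi>"
    using tau_alg_pow_in[OF f, of k] Suc.prems p' by (simp add: ev_tau_alg)
  also have "\<dots> = vtau q (vdegen q ?g) us \<psi>"
    unfolding vtau_def[of _ "vdegen q ?g"] by (rule vtau_cong[of _ p']) (use Suc p' in \<open>simp_all add: ml_L ml_R\<close>)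
  also have "\<dots> = vdegen q (vshift q ?g) us \<psi>"
    by (rule vtau_vdegen[OF cochain_vshift_pow[OF d]]) (use Suc.prems p in simp_all)
  finally show ?case by simp
qed

text \<open>\<open>\<tau>\<^sup>p\<^sup>+\<^sup>1 f(u) = U\<^sub>5 S(U\<^sub>2) \<triangleright> f(u\<^sub>3) \<triangleleft> S(U\<^sub>4) U\<^sub>1\<close>. By \<open>vshift_power\<close> for the whole list \<open>a = (S(U\<^sub>2), u\<^sub>1)\<close>, the
operator \<open>\<rho>\<^sup>p\<^sup>+\<^sup>1\<close> is the conjugation \<open>S(A\<^sub>2) \<triangleright> g(a\<^sub>3) \<triangleleft> A\<^sub>1\<close>. For \<open>g = \<delta>\<^sub>0 f\<close> the first entry of \<open>a\<^sub>3\<close> acts from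
the left and cancels against its neighbour in \<open>S(A\<^sub>2)\<close>.\<close>

lemma tau_alg_full_power:
  assumes f: "f \<in> GS H p q" and us: "length us = p" and ml: "ml q \<psi>"
  shows "ev ((tau_alg H p q ^^ Suc p) f) us \<psi> =
    sws us (\<lambda>a r. sws r (\<lambda>b r. sws r (\<lambda>c r. sws r (\<lambda>d e.
      ev f c (R q (S (\<pi> d) * \<pi> a) (L q (\<pi> e * S (\<pi> b)) \<psi>))))))"
proof (cases "p = 0")
  case True
  have "ev f [] (R q 1 (L q 1 \<psi>)) = ev f [] \<psi>"
    by (rule ev_cong[OF f]) (use True in \<open>simp_all add: R_one L_one ml ml_L\<close>)
  then show ?thesis using True us by (simp add: tau_alg_0 antipode_one)
next
  case False
  let ?g = "ev (delta_v H p q 0 f)"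
  have d: "cochain (Suc p) q ?g" by (rule cochain_ev[OF delta_v_in[OF f]]) simp
  let ?T = "\<lambda>a1 a2 a3 b c. ev f a3 (R q (S (\<pi> b) * \<pi> a1) (L q (\<pi> c * S (\<pi> a2)) \<psi>))"
  have inner: "(vshift q ^^ Suc p) ?g (S (\<pi> b) # a) (L q (\<pi> c) \<psi>) = sws a (\<lambda>a1 r. sws r (\<lambda>a2 a3. ?T a1 a2 a3 b c))"
    if a: "length a = p" for a b c
  proof -
    let ?M = "\<lambda>a1 a2 a3 s1 t. ev f a3 (R q (s1 * \<pi> a1) (L q (\<pi> c * S (\<pi> a2) * t) \<psi>))"
    have lt: "lin (\<lambda>t. ?M a1 a2 a3 s1 t)" "lin (\<lambda>s1. ?M a1 a2 a3 s1 t)" if "length a3 = p" for a1 a2 a3 s1 t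
      using that by - (rule lin_ev2[OF f], rule lin_R2, intro lin_L1 linH_mult_left linH_id, simp_all,
         rule lin_ev2[OF f], intro lin_R1 linH_mult_right linH_id, simp_all)
    have "(vshift q ^^ Suc p) ?g ([] @ (S (\<pi> b) # a)) (L q (\<pi> c) \<psi>)
      = sws (S (\<pi> b) # a) (\<lambda>b1 r. sws r (\<lambda>b2 b3. ?g (b3 @ []) (R q (\<pi> b1) (L q (S (\<pi> b2)) (L q (\<pi> c) \<psi>)))))"
      using vshift_power[OF d, of "[]" "S (\<pi> b) # a" "L q (\<pi> c) \<psi>"] a ml by (simp add: ml_L del: sws.simps)
    also have "\<dots> = sw (S (\<pi> b)) (\<lambda>s1 s. sws a (\<lambda>a1 r. sw s (\<lambda>s2 s3. sws r (\<lambda>a2 a3. ?M a1 a2 a3 s1 (S s2 * s3)))))"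
      unfolding sws.simps append_Nil2
      by (intro sw_cong_bas sws_cong_len)
        (use a in \<open>simp add: delta_v_0[OF f] ml ml_L ml_R, intro ev_cong[OF f],
          simp_all add: LR_simps ml ml_L ml_R antipode_mult mult.assoc cong: R_cong\<close>)
    also have "\<dots> = sw (S (\<pi> b)) (\<lambda>s1 s. counit H s * sws a (\<lambda>a1 r. sws r (\<lambda>a2 a3. ?M a1 a2 a3 s1 1)))"
    proof (intro sw_cong_bas)
      fix s1 s
      have "sw s (\<lambda>s2 s3. sws a (\<lambda>a1 r. sws r (\<lambda>a2 a3. ?M a1 a2 a3 s1 (S s2 * s3))))
        = counit H s * sws a (\<lambda>a1 r. sws r (\<lambda>a2 a3. ?M a1 a2 a3 s1 1))"
        by (rule sw_cancel1[where F = "\<lambda>t. sws a (\<lambda>a1 r. sws r (\<lambda>a2 a3. ?M a1 a2 a3 s1 t))"])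
          (intro lin_sws2 lt, use a in simp)
      then show "sws a (\<lambda>a1 r. sw s (\<lambda>s2 s3. sws r (\<lambda>a2 a3. ?M a1 a2 a3 s1 (S s2 * s3))))
        = counit H s * sws a (\<lambda>a1 r. sws r (\<lambda>a2 a3. ?M a1 a2 a3 s1 1))"
        by (simp only: sws_sw_swap)
    qed
    also have "\<dots> = sws a (\<lambda>a1 r. sws r (\<lambda>a2 a3. ?M a1 a2 a3 (S (\<pi> b)) 1))"
      by (rule sw_counit_right[where F = "\<lambda>s1. sws a (\<lambda>a1 r. sws r (\<lambda>a2 a3. ?M a1 a2 a3 s1 1))"])
        (intro lin_sws2 lt, use a in simp)
    finally show ?thesis by simp
  qed
  have "ev ((tau_alg H p q ^^ Suc p) f) us \<psi> = sws us (\<lambda>a r. sws r (\<lambda>b c. sws a (\<lambda>a1 r. sws r (\<lambda>a2 a3. ?T a1 a2 a3 b c))))"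
    unfolding ev_tau_alg_pow[OF f False us ml] vdegen_def
    by (intro sws_cong_len inner) (use us in simp)
  also have "\<dots> = sws us (\<lambda>a r. sws a (\<lambda>a1 s. sws s (\<lambda>a2 a3. sws r (\<lambda>b c. ?T a1 a2 a3 b c))))"
    by (subst sws_swap, subst (2) sws_swap) (rule refl)
  also have "\<dots> = sws us (\<lambda>a1 r. sws r (\<lambda>a2 r. sws r (\<lambda>a3 r. sws r (\<lambda>b c. ?T a1 a2 a3 b c))))"
    by (simp only: sws_coassoc)
  finally show ?thesis .
qed

end

context hopf_algebra
begin

section \<open>The horizontal cosimplicial structure\<close>

lemma ml_snocD: "ml (Suc n) \<psi> \<Longrightarrow> ml n (\<lambda>v. \<psi> (v @ [a]))"
  by (rule mlI, erule lin_mlD) (simp_all add: entry_lin_append1 entry_lin_slot del: append_assoc)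

lemmas ml_ConsD = lin_ml_Cons

lemma dup_Cons: "1 \<le> i \<Longrightarrow> dup (Suc i) \<psi> (x # v) = dup i (\<lambda>v. \<psi> (x # v)) v"
  by (cases i) (simp_all add: dup_def One_nat_def)

lemma dup_1_Cons: "dup 1 \<psi> (x # v) = sw x (\<lambda>a b. \<psi> (a # b # v))"
  by (simp add: dup_def One_nat_def)

lemma dup_snoc: "1 \<le> i \<Longrightarrow> i \<le> length v \<Longrightarrow> dup i \<psi> (v @ [x]) = dup i (\<lambda>v. \<psi> (v @ [x])) v"
  by (cases i) (simp_all add: dup_def nth_append One_nat_def)

lemma dup_last: "dup (Suc (length v)) \<psi> (v @ [x]) = sw x (\<lambda>a b. \<psi> (v @ [a, b]))"
  by (simp add: dup_def)

lemma del_Cons: "del (Suc j) \<psi> (x # v) = del j (\<lambda>v. \<psi> (x # v)) v"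
  by (simp add: del_def One_nat_def)

lemma del_0_Cons: "del 0 \<psi> (x # v) = counit H x * \<psi> v"
  by (simp add: del_def One_nat_def)

lemma del_snoc: "j < length v \<Longrightarrow> del j \<psi> (v @ [x]) = del j (\<lambda>v. \<psi> (v @ [x])) v"
  by (simp add: del_def nth_append)

lemma del_last: "del (length v) \<psi> (v @ [x]) = counit H x * \<psi> v"
  by (simp add: del_def)

lemma split_nth2:
  assumes "i < j" "j < length v"
  obtains A x B y C where "v = A @ x # B @ y # C" "length A = i" "Suc (length A + length B) = j"
proof -
  obtain A' y C where 1: "v = A' @ y # C" "length A' = j" using split_nth[OF assms(2)] .
  have "i < length A'" using 1 assms by simp
  then obtain A x B where 2: "A' = A @ x # B" "length A = i" using split_nth by blast
  show ?thesis by (rule that[of A x B y C]) (use 1 2 in simp_all)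
qed

text \<open>This and the next lemmas are the cosimplicial identities of the coalgebra \<open>H\<close>, transposed to forms:
coassociativity when two adjacent factors are concerned, and the counit law in \<open>dup_del_eq\<close>.\<close>

lemma dup_dup:
  assumes ij: "1 \<le> i" "i < j" "j \<le> Suc (length v)"
  shows "dup i (dup j \<psi>) v = dup (j - 1) (dup i \<psi>) v"
proof (cases "j = Suc i")
  case True
  obtain A z B where v: "v = A @ z # B" "length A = i - 1" by (rule split_nth[of "i - 1" v]) (use ij True in auto)
  have "dup (Suc i) \<psi> ((A @ [x]) @ y # B) = sw y (\<lambda>y z. \<psi> (A @ x # y # z # B))" for x y
    by (subst dup_append) (use v ij in simp_all)
  then have 1: "dup (Suc i) \<psi> (A @ x # y # B) = sw y (\<lambda>y z. \<psi> (A @ x # y # z # B))" for x y by simp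
  have 2: "dup i \<psi> (A @ x # y # B) = sw x (\<lambda>x z. \<psi> (A @ x # z # y # B))" for x y
    by (rule dup_append) (use v ij in simp_all)
  have "dup i (dup j \<psi>) v = sw z (\<lambda>a r. sw r (\<lambda>b c. \<psi> (A @ a # b # c # B)))"
    unfolding v(1) True by (subst dup_append) (use v ij 1 in simp_all)
  also have "\<dots> = dup (j - 1) (dup i \<psi>) v"
    unfolding v(1) True by (subst dup_append) (use v ij 2 in \<open>simp_all add: sw_coassoc\<close>)
  finally show ?thesis .
next
  case False
  then have "i - 1 < j - 2" "j - 2 < length v" using ij by auto
  then obtain A x B y C where v: "v = A @ x # B @ y # C" "length A = i - 1" "Suc (length A + length B) = j - 2"
    by (rule split_nth2)
  have 1: "dup j \<psi> (A @ a # b # B @ y # C) = sw y (\<lambda>c d. \<psi> (A @ a # b # B @ c # d # C))" for a b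
    using dup_append[of "A @ a # b # B" j \<psi> y C] v ij False by simp
  have 2: "dup (j - 1) \<chi> v = sw y (\<lambda>c d. \<chi> (A @ x # B @ c # d # C))" for \<chi>
    using dup_append[of "A @ x # B" "j - 1" \<chi> y C] v ij False by simp
  have 3: "dup i \<chi> (A @ x # D) = sw x (\<lambda>a b. \<chi> (A @ a # b # D))" for \<chi> D
    by (rule dup_append) (use v ij in simp_all)
  have "dup i (dup j \<psi>) v = sw x (\<lambda>a b. sw y (\<lambda>c d. \<psi> (A @ a # b # B @ c # d # C)))"
    unfolding v(1) 3 1 ..
  also have "\<dots> = sw y (\<lambda>c d. sw x (\<lambda>a b. \<psi> (A @ a # b # B @ c # d # C)))" by (rule sw_swap)
  finally show ?thesis unfolding 2 3 .
qed

lemma del_del: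
  assumes "i \<le> j" "Suc j < length v"
  shows "del i (del j \<psi>) v = del (Suc j) (del i \<psi>) v"
proof -
  obtain A x B y C where v: "v = A @ x # B @ y # C" "length A = i" "Suc (length A + length B) = Suc j"
    by (rule split_nth2[of i "Suc j" v]) (use assms in auto)
  show ?thesis
    using v del_append[of "A @ x # B" "Suc j" "del i \<psi>" y C] del_append[of "A @ B" j \<psi> y C]
    by (simp add: del_append mult.left_commute)
qed

lemma dup_del_less:
  assumes "1 \<le> i" "i < j" "j \<le> length v"
  shows "dup i (del j \<psi>) v = del (j - 1) (dup i \<psi>) v"
proof -
  have "i - 1 < j - 1" "j - 1 < length v" using assms by auto
  then obtain A x B y C where v: "v = A @ x # B @ y # C" "length A = i - 1" "Suc (length A + length B) = j - 1"
    by (rule split_nth2)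
  have 1: "del j \<psi> (A @ a # b # B @ y # C) = counit H y * \<psi> (A @ a # b # B @ C)" for a b
    using del_append[of "A @ a # b # B" j \<psi> y C] v assms by simp
  have 2: "del (j - 1) \<chi> v = counit H y * \<chi> (A @ x # B @ C)" for \<chi>
    using del_append[of "A @ x # B" "j - 1" \<chi> y C] v assms by simp
  have 3: "dup i \<chi> (A @ x # D) = sw x (\<lambda>a b. \<chi> (A @ a # b # D))" for \<chi> D
    by (rule dup_append) (use v assms in simp_all)
  show ?thesis unfolding 2 3 by (simp add: v(1) 3 1 sw_mult_left)
qed

lemma dup_del_eq:
  assumes "1 \<le> i" "i \<le> length v" "ml (length v) \<psi>" "i = j \<or> i = Suc j"
  shows "dup i (del j \<psi>) v = \<psi> v"
proof -
  obtain A z B where v: "v = A @ z # B" "length A = i - 1" by (rule split_nth[of "i - 1" v]) (use assms in auto)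
  have 3: "dup i \<chi> v = sw z (\<lambda>a b. \<chi> (A @ a # b # B))" for \<chi>
    unfolding v(1) by (rule dup_append) (use v assms in simp_all)
  have l: "lin (\<lambda>z. \<psi> (A @ z # B))" by (rule lin_mlD[OF assms(3)]) (simp_all add: v entry_lin_slot)
  show ?thesis
  proof (cases "i = j")
    case True
    have "del j \<psi> (A @ a # b # B) = counit H b * \<psi> (A @ a # B)" for a b
      using del_append[of "A @ [a]" j \<psi> b B] v assms True by simp
    then show ?thesis unfolding 3 by (simp add: v(1) sw_counit_right l)
  next
    case False
    then have "del j \<psi> (A @ a # b # B) = counit H a * \<psi> (A @ b # B)" for a b
      using del_append[of A j \<psi> a "b # B"] v assms by simp
    then show ?thesis unfolding 3 by (simp add: v(1) sw_counit_left l)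
  qed
qed

lemma dup_del_greater:
  assumes "Suc j < i" "i \<le> length v"
  shows "dup i (del j \<psi>) v = del j (dup (i - 1) \<psi>) v"
proof -
  have "j < i - 1" "i - 1 < length v" using assms by auto
  then obtain A x B y C where v: "v = A @ x # B @ y # C" "length A = j" "Suc (length A + length B) = i - 1"
    by (rule split_nth2)
  have 1: "dup (i - 1) \<psi> (A @ B @ y # C) = sw y (\<lambda>a b. \<psi> (A @ B @ a # b # C))"
    using dup_append[of "A @ B" "i - 1" \<psi> y C] v assms by simp
  have 2: "dup i \<chi> v = sw y (\<lambda>a b. \<chi> (A @ x # B @ a # b # C))" for \<chi>
    using dup_append[of "A @ x # B" i \<chi> y C] v assms by simp
  show ?thesis unfolding 2 by (simp add: v(1) del_append[OF v(2)] 1 sw_mult_left)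
qed

lemma ev_swap:
  assumes "f \<in> GS H p q" "length us = p"
  shows "ev f us (\<lambda>v. sws u (\<lambda>a b. G v a b)) = sws u (\<lambda>a b. ev f us (\<lambda>v. G v a b))"
    and "ev f us (\<lambda>v. sw x (\<lambda>a b. G' v a b)) = sw x (\<lambda>a b. ev f us (\<lambda>v. G' v a b))"
    and "ev f us (\<lambda>v. c * K v) = c * ev f us K"
  by (rule fsupp_sws_swap[OF fsupp_ev[OF assms]] fsupp_sw_swap[OF fsupp_ev[OF assms]] fsupp_mult[OF fsupp_ev[OF assms]])+

lemma sw_prod_form:
  assumes "ml (Suc (Suc n)) \<psi>" "length v + length w = n"
  shows "sw (prod_list us) (\<lambda>x y. \<psi> (v @ x # y # w)) = sws us (\<lambda>a b. \<psi> (v @ prod_list a # prod_list b # w))"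
proof (rule sw_prod)
  show "lin (\<lambda>x. \<psi> (v @ x # y # w))" for y by (rule lin_mlD[OF assms(1)]) (use assms(2) in \<open>simp_all add: entry_lin_slot\<close>)
  show "lin (\<lambda>y. \<psi> (v @ x # y # w))" for x
    by (rule lin_mlD[OF assms(1)], intro entry_lin_append2 entry_lin_Cons2 entry_lin_id) (use assms(2) in simp)
qed

lemma delta_h_delta_h:
  assumes f: "f \<in> GS H p n" and ij: "i < j" "j \<le> n + 2"
  shows "delta_h H p (Suc n) j (delta_h H p n i f) = delta_h H p (Suc n) i (delta_h H p n (j - 1) f)"
proof (rule GS_eqI[of _ p "Suc (Suc n)"])
  have d: "delta_h H p n i f \<in> GS H p (Suc n)" "delta_h H p n (j - 1) f \<in> GS H p (Suc n)"
    using f ij by (auto intro: delta_h_in)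
  show "delta_h H p (Suc n) j (delta_h H p n i f) \<in> GS H p (Suc (Suc n))"
    "delta_h H p (Suc n) i (delta_h H p n (j - 1) f) \<in> GS H p (Suc (Suc n))"
    using d ij by (auto intro: delta_h_in)
  fix us :: "'h list" and \<psi> assume us: "length us = p" and ml: "ml (Suc (Suc n)) \<psi>"
  note simps = delta_h_0 delta_h_last delta_h_mid f d ml ml_ConsD ml_snocD ml_dup us
  have dl: "g \<in> GS H p (Suc n) \<Longrightarrow> ev (delta_h H p (Suc n) (Suc (Suc n)) g) us \<psi> = sws us (\<lambda>a b. ev g a (\<lambda>v. \<psi> (v @ [prod_list b])))" for g
    by (rule delta_h_last) (use us ml in simp_all)
  consider "i = 0" "j = 1" | "i = 0" "2 \<le> j" "j \<le> Suc n" | "i = 0" "j = n + 2" |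
    "1 \<le> i" "j \<le> Suc n" | "1 \<le> i" "i \<le> n" "j = n + 2" | "i = Suc n" "j = n + 2"
    using ij by linarith
  then show "ev (delta_h H p (Suc n) j (delta_h H p n i f)) us \<psi> = ev (delta_h H p (Suc n) i (delta_h H p n (j - 1) f)) us \<psi>"
  proof cases
    case 1
    have "ev (delta_h H p (Suc n) j (delta_h H p n i f)) us \<psi> = sws us (\<lambda>a b. ev f b (\<lambda>v. sw (prod_list a) (\<lambda>x y. \<psi> ([] @ x # y # v))))"
      using 1 by (simp add: simps dup_1_Cons)
    also have "\<dots> = sws us (\<lambda>a b. ev f b (\<lambda>v. sws a (\<lambda>x y. \<psi> ([] @ prod_list x # prod_list y # v))))"
      by (intro sws_cong_len ev_cong[OF f] sw_prod_form[OF ml]) (use us in simp_all)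
    also have "\<dots> = sws us (\<lambda>a b. sws a (\<lambda>x y. ev f b (\<lambda>v. \<psi> (prod_list x # prod_list y # v))))"
      by (rule sws_cong_len) (use us in \<open>simp add: ev_swap[OF f]\<close>)
    also have "\<dots> = sws us (\<lambda>a r. sws r (\<lambda>b c. ev f c (\<lambda>v. \<psi> (prod_list a # prod_list b # v))))"
      by (rule sws_coassoc)
    also have "\<dots> = ev (delta_h H p (Suc n) i (delta_h H p n (j - 1) f)) us \<psi>"
      using 1 by (simp add: simps cong: sws_cong)
    finally show ?thesis .
  next
    case 2
    define k where "k = j - 1"
    have k: "j = Suc k" "1 \<le> k" "k \<le> n" using 2 by (auto simp: k_def)
    then show ?thesis using 2(1) by (simp add: simps dup_Cons cong: sws_cong)
  next
    case 3
    then show ?thesis by (simp add: simps dl sws_coassoc cong: sws_cong)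
  next
    case 4
    then show ?thesis using ij by (simp add: simps) (rule ev_cong[OF f us], simp add: dup_dup)
  next
    case 5
    have "sws us (\<lambda>a b. ev f a (dup i (\<lambda>v. \<psi> (v @ [prod_list b])))) = sws us (\<lambda>a b. ev f a (\<lambda>v. dup i \<psi> (v @ [prod_list b])))"
      by (intro sws_cong_len ev_cong[OF f]) (use us 5 in \<open>simp_all add: dup_snoc\<close>)
    then show ?thesis using 5 by (simp add: simps dl cong: sws_cong)
  next
    case 6
    have "ev (delta_h H p (Suc n) i (delta_h H p n (j - 1) f)) us \<psi> = sws us (\<lambda>a b. ev f a (\<lambda>v. dup (Suc n) \<psi> (v @ [prod_list b])))"
      using 6 by (simp add: simps)
    also have "\<dots> = sws us (\<lambda>a b. ev f a (\<lambda>v. sws b (\<lambda>x y. \<psi> (v @ prod_list x # prod_list y # []))))"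
    proof (intro sws_cong_len ev_cong[OF f])
      fix a b v :: "'h list" assume v: "length v = n"
      show "dup (Suc n) \<psi> (v @ [prod_list b]) = sws b (\<lambda>x y. \<psi> (v @ prod_list x # prod_list y # []))"
        using dup_last[of v \<psi> "prod_list b"] sw_prod_form[OF ml, of v "[]" b] v by simp
    qed (use us in simp)
    also have "\<dots> = sws us (\<lambda>a r. sws r (\<lambda>b c. ev f a (\<lambda>v. \<psi> (v @ [prod_list b, prod_list c]))))"
      by (rule sws_cong_len) (use us in \<open>simp add: ev_swap[OF f]\<close>)
    also have "\<dots> = ev (delta_h H p (Suc n) j (delta_h H p n i f)) us \<psi>"
      using 6 by (simp add: simps dl sws_coassoc cong: sws_cong)
    finally show ?thesis by simp
  qed
qed

lemma sigma_h_sigma_h: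
  assumes f: "f \<in> GS H p (n + 2)" and ij: "i \<le> j" "j \<le> n"
  shows "sigma_h H p (Suc n) j (sigma_h H p (n + 2) i f) = sigma_h H p (Suc n) i (sigma_h H p (n + 2) (Suc j) f)"
proof (rule GS_eqI[of _ p n])
  have f': "f \<in> GS H p (Suc (Suc n))" using f by simp
  have d: "sigma_h H p (Suc (Suc n)) i f \<in> GS H p (Suc n)" "sigma_h H p (Suc (Suc n)) (Suc j) f \<in> GS H p (Suc n)"
    using sigma_h(1)[OF f'] ij by auto
  show "sigma_h H p (Suc n) j (sigma_h H p (n + 2) i f) \<in> GS H p n"
    "sigma_h H p (Suc n) i (sigma_h H p (n + 2) (Suc j) f) \<in> GS H p n"
    using d ij by (auto intro: sigma_h(1))
  fix us :: "'h list" and \<psi> assume us: "length us = p" and ml: "ml n \<psi>"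
  have "ev f us (del i (del j \<psi>)) = ev f us (del (Suc j) (del i \<psi>))"
    by (rule ev_cong[OF f' us]) (use ij in \<open>simp add: del_del\<close>)
  then show "ev (sigma_h H p (Suc n) j (sigma_h H p (n + 2) i f)) us \<psi> = ev (sigma_h H p (Suc n) i (sigma_h H p (n + 2) (Suc j) f)) us \<psi>"
    using ij us ml by (simp add: sigma_h(2)[OF d(1)] sigma_h(2)[OF d(2)] sigma_h(2)[OF f'] ml_del)
qed

lemma sigma_h_delta_h:
  assumes f: "f \<in> GS H p n" and j: "j \<le> n"
  shows "i < j \<Longrightarrow> sigma_h H p (Suc n) j (delta_h H p n i f) = delta_h H p (n - 1) i (sigma_h H p n (j - 1) f)"
    and "i = j \<or> i = Suc j \<Longrightarrow> sigma_h H p (Suc n) j (delta_h H p n i f) = f"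
    and "Suc j < i \<Longrightarrow> i \<le> Suc n \<Longrightarrow> sigma_h H p (Suc n) j (delta_h H p n i f) = delta_h H p (n - 1) (i - 1) (sigma_h H p n j f)"
proof -
  have lhs: "sigma_h H p (Suc n) j (delta_h H p n i f) \<in> GS H p n" if "i \<le> Suc n"
    using delta_h_in[OF f that] j by (rule sigma_h(1))
  have lhs_ev: "ev (sigma_h H p (Suc n) j (delta_h H p n i f)) us \<psi> = ev (delta_h H p n i f) us (del j \<psi>)"
    if "i \<le> Suc n" "length us = p" "ml n \<psi>" for us \<psi>
    by (rule sigma_h(2)[OF delta_h_in[OF f that(1)] j that(2,3)])
  show "sigma_h H p (Suc n) j (delta_h H p n i f) = delta_h H p (n - 1) i (sigma_h H p n (j - 1) f)" if "i < j"
  proof -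
    define m where "m = n - 1"
    have n: "n = Suc m" using that j by (simp add: m_def)
    have s: "sigma_h H p (Suc m) (j - 1) f \<in> GS H p m" by (rule sigma_h(1)) (use f that j n in auto)
    show ?thesis
    proof (rule GS_eqI[OF lhs])
      show "delta_h H p (n - 1) i (sigma_h H p n (j - 1) f) \<in> GS H p n"
        using delta_h_in[OF s] that j n by simp
      fix us :: "'h list" and \<psi> assume us: "length us = p" and ml: "ml n \<psi>"
      have "0 < j" using that by simp
      then obtain k where k: "j = Suc k" by (cases j) auto
      have fm: "f \<in> GS H p (Suc m)" and mlm: "ml (Suc m) \<psi>" using f ml n by auto
      have sev: "ev (sigma_h H p (Suc m) k f) b \<chi> = ev f b (del k \<chi>)" if "length b = p" "ml m \<chi>" for b \<chi>
        by (rule sigma_h(2)[OF fm]) (use that j k n in auto)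
      show "ev (sigma_h H p (Suc n) j (delta_h H p n i f)) us \<psi> = ev (delta_h H p (n - 1) i (sigma_h H p n (j - 1) f)) us \<psi>"
      proof (cases "i = 0")
        case True
        have "ev (delta_h H p n 0 f) us (del j \<psi>) = sws us (\<lambda>a b. ev f b (\<lambda>v. del j \<psi> (prod_list a # v)))"
          by (rule delta_h_0(2)[OF f us ml_del[OF ml j]])
        moreover have "ev (delta_h H p m 0 (sigma_h H p (Suc m) k f)) us \<psi> = sws us (\<lambda>a b. ev f b (\<lambda>v. del k (\<lambda>v. \<psi> (prod_list a # v)) v))"
          using delta_h_0(2)[OF s, of us \<psi>] k us mlm by (simp add: sev ml_ConsD cong: sws_cong)
        ultimately show ?thesis using True n k lhs_ev[OF _ us ml] by (simp add: del_Cons)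
      next
        case False
        have "ev (delta_h H p n i f) us (del j \<psi>) = ev f us (dup i (del j \<psi>))"
          by (rule delta_h_mid(2)[OF f]) (use False that j us ml_del[OF ml j] in auto)
        also have "\<dots> = ev f us (del k (dup i \<psi>))"
          by (rule ev_cong[OF f us]) (use dup_del_less[of i j _ \<psi>] False that j k in auto)
        also have "\<dots> = ev (delta_h H p m i (sigma_h H p (Suc m) k f)) us \<psi>"
          using delta_h_mid(2)[OF s, of i us \<psi>] False that j k us mlm n by (simp add: sev ml_dup)
        finally show ?thesis using that j us ml n k using lhs_ev[OF _ us ml] by simp
      qed
    qed (use that j in simp)
  qed
  show "sigma_h H p (Suc n) j (delta_h H p n i f) = f" if ij: "i = j \<or> i = Suc j"
  proof (rule GS_eqI[OF lhs f])
    show i: "i \<le> Suc n" using ij j by auto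
    fix us :: "'h list" and \<psi> assume us: "length us = p" and ml: "ml n \<psi>"
    consider "i = 0" "j = 0" | "i = Suc n" "j = n" | "1 \<le> i" "i \<le> n" using ij j by linarith
    then show "ev (sigma_h H p (Suc n) j (delta_h H p n i f)) us \<psi> = ev f us \<psi>"
    proof cases
      case 1
      have "ev (delta_h H p n 0 f) us (del 0 \<psi>) = sws us (\<lambda>a b. counits a * ev f b \<psi>)"
        using delta_h_0(2)[OF f us, of "del 0 \<psi>"] us ml_del[OF ml, of 0]
        by (simp add: del_0_Cons ev_swap[OF f] counit_prod cong: sws_cong)
      then show ?thesis using 1 us ml_ev[OF f] lhs_ev[OF i us ml] by (simp add: sws_counit_left)
    next
      case 2
      have "ev (delta_h H p n (Suc n) f) us (del n \<psi>) = sws us (\<lambda>a b. ev f a (\<lambda>v. del n \<psi> (v @ [prod_list b])))"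
        by (rule delta_h_last(2)[OF f us ml_del[OF ml]]) simp
      also have "\<dots> = sws us (\<lambda>a b. ev f a (\<lambda>v. counits b * \<psi> v))"
        by (intro sws_cong_len ev_cong[OF f]) (use us del_last in \<open>auto simp: counit_prod\<close>)
      also have "\<dots> = sws us (\<lambda>a b. counits b * ev f a \<psi>)"
        by (rule sws_cong_len) (use us in \<open>simp add: ev_swap[OF f]\<close>)
      finally show ?thesis using 2 us ml_ev[OF f] lhs_ev[OF i us ml] by (simp add: sws_counit_right)
    next
      case 3
      have "ev (delta_h H p n i f) us (del j \<psi>) = ev f us (dup i (del j \<psi>))"
        by (rule delta_h_mid(2)[OF f]) (use 3 us ml_del[OF ml j] in auto)
      also have "\<dots> = ev f us \<psi>"
        by (rule ev_cong[OF f us], rule dup_del_eq) (use 3 ij ml in auto)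
      finally show ?thesis using lhs_ev[OF i us ml] by simp
    qed
  qed
  show "sigma_h H p (Suc n) j (delta_h H p n i f) = delta_h H p (n - 1) (i - 1) (sigma_h H p n j f)" if i: "Suc j < i" "i \<le> Suc n"
  proof -
    define m where "m = n - 1"
    have n: "n = Suc m" using i j by (simp add: m_def)
    have fm: "f \<in> GS H p (Suc m)" using f n by simp
    have jm: "j \<le> m" using i n by simp
    have s: "sigma_h H p (Suc m) j f \<in> GS H p m" by (rule sigma_h(1)[OF fm jm])
    have sev: "ev (sigma_h H p (Suc m) j f) b \<chi> = ev f b (del j \<chi>)" if "length b = p" "ml m \<chi>" for b \<chi>
      by (rule sigma_h(2)[OF fm jm that])
    show ?thesis
    proof (rule GS_eqI[OF lhs])
      show "delta_h H p (n - 1) (i - 1) (sigma_h H p n j f) \<in> GS H p n"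
        using delta_h_in[OF s] i j n by simp
      fix us :: "'h list" and \<psi> assume us: "length us = p" and ml: "ml n \<psi>"
      have mlm: "ml (Suc m) \<psi>" using ml n by simp
      show "ev (sigma_h H p (Suc n) j (delta_h H p n i f)) us \<psi> = ev (delta_h H p (n - 1) (i - 1) (sigma_h H p n j f)) us \<psi>"
      proof (cases "i = Suc n")
        case True
        have "ev (delta_h H p n (Suc n) f) us (del j \<psi>) = sws us (\<lambda>a b. ev f a (\<lambda>v. del j \<psi> (v @ [prod_list b])))"
          by (rule delta_h_last(2)[OF f us ml_del[OF ml j]])
        also have "\<dots> = sws us (\<lambda>a b. ev f a (del j (\<lambda>v. \<psi> (v @ [prod_list b]))))"
          by (intro sws_cong_len ev_cong[OF f]) (use us n jm in \<open>auto simp: del_snoc\<close>)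
        also have "\<dots> = ev (delta_h H p m (Suc m) (sigma_h H p (Suc m) j f)) us \<psi>"
          using delta_h_last(2)[OF s, of us \<psi>] us mlm by (simp add: sev ml_snocD cong: sws_cong)
        finally show ?thesis using True us ml n using lhs_ev[OF _ us ml] by simp
      next
        case False
        define k where "k = i - 1"
        have k: "i = Suc k" "1 \<le> k" "k \<le> m" using False i n by (auto simp: k_def)
        have "ev (delta_h H p n i f) us (del j \<psi>) = ev f us (dup i (del j \<psi>))"
          by (rule delta_h_mid(2)[OF f]) (use k n us ml_del[OF ml j] in auto)
        also have "\<dots> = ev f us (del j (dup k \<psi>))"
          by (rule ev_cong[OF f us]) (use dup_del_greater[of j i _ \<psi>] i k n in auto)
        also have "\<dots> = ev (delta_h H p m k (sigma_h H p (Suc m) j f)) us \<psi>"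
          using delta_h_mid(2)[OF s, of k us \<psi>] k us mlm by (simp add: sev ml_dup)
        finally show ?thesis using i us ml n k using lhs_ev[OF _ us ml] by simp
      qed
    qed (use i in simp)
  qed
qed


section \<open>Comultiplication and counit of a factor are bimodule maps\<close>

lemma L_sw: "L k u (\<lambda>v. sw x (\<lambda>a b. G v a b)) w = sw x (\<lambda>a b. L k u (\<lambda>v. G v a b) w)"
  and R_sw: "R k u (\<lambda>v. sw x (\<lambda>a b. G v a b)) w = sw x (\<lambda>a b. R k u (\<lambda>v. G v a b) w)"
  unfolding L_def R_def by (rule swn_sw_swap)+

lemma L_mult: "L k u (\<lambda>v. c * G v) w = c * L k u G w"
  and R_mult: "R k u (\<lambda>v. c * G v) w = c * R k u G w"
  unfolding L_def R_def by (rule swn_mult_left)+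

lemma L_mid: "length A = k \<Longrightarrow> L (k + Suc m) g \<chi> (A @ z # B) =
    sw g (\<lambda>g1 r. sw r (\<lambda>g2 g3. L k g1 (\<lambda>A. L m g3 (\<lambda>B. \<chi> (A @ (g2 * z) # B)) B) A))"
  and R_mid: "length A = k \<Longrightarrow> R (k + Suc m) g \<chi> (A @ z # B) =
    sw g (\<lambda>g1 r. sw r (\<lambda>g2 g3. R k g1 (\<lambda>A. R m g3 (\<lambda>B. \<chi> (A @ (z * g2) # B)) B) A))"
  by (simp_all only: L_append R_append L_Cons R_Cons L_sw R_sw)

lemma L_mid2: "length A = k \<Longrightarrow> L (k + Suc (Suc m)) g \<chi> (A @ x # y # B) =
    sw g (\<lambda>g1 r. sw r (\<lambda>g2 r. sw r (\<lambda>g3 g4. L k g1 (\<lambda>A. L m g4 (\<lambda>B. \<chi> (A @ (g2 * x) # (g3 * y) # B)) B) A)))"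
  and R_mid2: "length A = k \<Longrightarrow> R (k + Suc (Suc m)) g \<chi> (A @ x # y # B) =
    sw g (\<lambda>g1 r. sw r (\<lambda>g2 r. sw r (\<lambda>g3 g4. R k g1 (\<lambda>A. R m g4 (\<lambda>B. \<chi> (A @ (x * g2) # (y * g3) # B)) B) A)))"
  by (simp_all only: L_append R_append L_Cons R_Cons L_sw R_sw)

text \<open>The transpose of \<open>\<Delta>(u\<^sub>2 z) = \<Delta>(u\<^sub>2) \<Delta>(z)\<close> inside an iterated coproduct of \<open>u\<close>, with \<open>z\<close> the duplicated factor.\<close>

lemma L_dup:
  assumes ml: "ml (Suc n) \<psi>" and i: "1 \<le> i" "i \<le> n" and w: "length w = n"
  shows "L n g (dup i \<psi>) w = dup i (L (Suc n) g \<psi>) w"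
    and "R n g (dup i \<psi>) w = dup i (R (Suc n) g \<psi>) w"
proof -
  obtain A z B where v: "w = A @ z # B" "length A = i - 1" by (rule split_nth[of "i - 1" w]) (use i w in auto)
  define k m where "k = length A" and "m = length B"
  have n: "n = k + Suc m" "Suc n = k + Suc (Suc m)" using v w by (auto simp: k_def m_def)
  have d: "dup i \<chi> (A' @ y # B') = sw y (\<lambda>a b. \<chi> (A' @ a # b # B'))" if "length A' = k" for A' \<chi> y B'
    by (rule dup_append) (use that v i in \<open>simp_all add: k_def\<close>)
  have lin: "lin (\<lambda>a. \<psi> (A' @ a # b # B'))" "lin (\<lambda>b. \<psi> (A' @ a # b # B'))" if "length A' = k" "length B' = m" for A' B' a b
    by (rule lin_mlD[OF ml], use that n in \<open>simp_all add: entry_lin_slot\<close>)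
      (rule lin_mlD[OF ml], intro entry_lin_append2 entry_lin_Cons2 entry_lin_id, use that n in simp)
  have "L n g (dup i \<psi>) w = sw g (\<lambda>g1 r. sw r (\<lambda>g2 g3. L k g1 (\<lambda>A. L m g3 (\<lambda>B. sw (g2 * z) (\<lambda>a b. \<psi> (A @ a # b # B))) B) A))"
    unfolding v(1) n(1) L_mid[OF k_def[symmetric]]
    by (intro sw_cong_bas L_cong d) (simp_all add: k_def m_def)
  also have "\<dots> = sw g (\<lambda>g1 r. sw r (\<lambda>g2 g3. L k g1 (\<lambda>A. L m g3 (\<lambda>B. sw g2 (\<lambda>p q. sw z (\<lambda>a b. \<psi> (A @ (p * a) # (q * b) # B)))) B) A))"
    by (intro sw_cong_bas L_cong sw_mult lin) (simp_all add: k_def m_def)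
  also have "\<dots> = sw g (\<lambda>g1 r. sw r (\<lambda>g2 g3. sw g2 (\<lambda>p q. sw z (\<lambda>a b. L k g1 (\<lambda>A. L m g3 (\<lambda>B. \<psi> (A @ (p * a) # (q * b) # B)) B) A))))"
    by (simp only: L_sw)
  also have "\<dots> = sw g (\<lambda>g1 r. sw r (\<lambda>p r. sw r (\<lambda>q g3. sw z (\<lambda>a b. L k g1 (\<lambda>A. L m g3 (\<lambda>B. \<psi> (A @ (p * a) # (q * b) # B)) B) A))))"
    by (simp only: sw_coassoc)
  also have "\<dots> = sw z (\<lambda>a b. sw g (\<lambda>g1 r. sw r (\<lambda>p r. sw r (\<lambda>q g3. L k g1 (\<lambda>A. L m g3 (\<lambda>B. \<psi> (A @ (p * a) # (q * b) # B)) B) A))))"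
    by (simp only: sw_swap[of _ z])
  also have "\<dots> = dup i (L (Suc n) g \<psi>) w"
    unfolding v(1) d[OF k_def[symmetric]] n(2) L_mid2[OF k_def[symmetric]] ..
  finally show "L n g (dup i \<psi>) w = dup i (L (Suc n) g \<psi>) w" .
  have "R n g (dup i \<psi>) w = sw g (\<lambda>g1 r. sw r (\<lambda>g2 g3. R k g1 (\<lambda>A. R m g3 (\<lambda>B. sw (z * g2) (\<lambda>a b. \<psi> (A @ a # b # B))) B) A))"
    unfolding v(1) n(1) R_mid[OF k_def[symmetric]]
    by (intro sw_cong_bas R_cong d) (simp_all add: k_def m_def)
  also have "\<dots> = sw g (\<lambda>g1 r. sw r (\<lambda>g2 g3. R k g1 (\<lambda>A. R m g3 (\<lambda>B. sw z (\<lambda>a b. sw g2 (\<lambda>p q. \<psi> (A @ (a * p) # (b * q) # B)))) B) A))"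
    by (intro sw_cong_bas R_cong sw_mult lin) (simp_all add: k_def m_def)
  also have "\<dots> = sw g (\<lambda>g1 r. sw r (\<lambda>g2 g3. sw z (\<lambda>a b. sw g2 (\<lambda>p q. R k g1 (\<lambda>A. R m g3 (\<lambda>B. \<psi> (A @ (a * p) # (b * q) # B)) B) A))))"
    by (simp only: R_sw)
  also have "\<dots> = sw z (\<lambda>a b. sw g (\<lambda>g1 r. sw r (\<lambda>g2 g3. sw g2 (\<lambda>p q. R k g1 (\<lambda>A. R m g3 (\<lambda>B. \<psi> (A @ (a * p) # (b * q) # B)) B) A))))"
    by (simp only: sw_swap[of _ z])
  also have "\<dots> = sw z (\<lambda>a b. sw g (\<lambda>g1 r. sw r (\<lambda>p r. sw r (\<lambda>q g3. R k g1 (\<lambda>A. R m g3 (\<lambda>B. \<psi> (A @ (a * p) # (b * q) # B)) B) A))))"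
    by (simp only: sw_coassoc)
  also have "\<dots> = dup i (R (Suc n) g \<psi>) w"
    unfolding v(1) d[OF k_def[symmetric]] n(2) R_mid2[OF k_def[symmetric]] ..
  finally show "R n g (dup i \<psi>) w = dup i (R (Suc n) g \<psi>) w" .
qed

lemma L_del:
  assumes ml: "ml n \<psi>" and j: "j \<le> n" and w: "length w = Suc n"
  shows "L (Suc n) g (del j \<psi>) w = del j (L n g \<psi>) w"
    and "R (Suc n) g (del j \<psi>) w = del j (R n g \<psi>) w"
proof -
  obtain A z B where v: "w = A @ z # B" "length A = j" by (rule split_nth[of j w]) (use j w in auto)
  define k m where "k = length A" and "m = length B"
  have n: "Suc n = k + Suc m" "n = k + m" using v w by (auto simp: k_def m_def)
  have d: "del j \<chi> (A' @ y # B') = counit H y * \<chi> (A' @ B')" if "length A' = k" for A' \<chi> y B'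
    by (rule del_append) (use that v in \<open>simp_all add: k_def\<close>)
  have "L (Suc n) g (del j \<psi>) w = sw g (\<lambda>g1 r. sw r (\<lambda>g2 g3. L k g1 (\<lambda>A. L m g3 (\<lambda>B. counit H (g2 * z) * \<psi> (A @ B)) B) A))"
    unfolding v(1) n(1) L_mid[OF k_def[symmetric]]
    by (intro sw_cong_bas L_cong d) (simp_all add: k_def m_def)
  also have "\<dots> = counit H z * sw g (\<lambda>g1 r. sw r (\<lambda>g2 g3. counit H g2 * L k g1 (\<lambda>A. L m g3 (\<lambda>B. \<psi> (A @ B)) B) A))"
    by (simp only: L_mult counit_mult sw_mult_left[symmetric] mult.assoc mult.left_commute)
  also have "\<dots> = counit H z * sw g (\<lambda>g1 g3. L k g1 (\<lambda>A. L m g3 (\<lambda>B. \<psi> (A @ B)) B) A)"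
    by (subst sw_counit_left) (rule lin_L2, rule lin_L1, simp_all add: linH_id k_def)
  also have "\<dots> = del j (L n g \<psi>) w"
    unfolding v(1) d[OF k_def[symmetric]] n(2) L_append[OF k_def[symmetric]] ..
  finally show "L (Suc n) g (del j \<psi>) w = del j (L n g \<psi>) w" .
  have "R (Suc n) g (del j \<psi>) w = sw g (\<lambda>g1 r. sw r (\<lambda>g2 g3. R k g1 (\<lambda>A. R m g3 (\<lambda>B. counit H (z * g2) * \<psi> (A @ B)) B) A))"
    unfolding v(1) n(1) R_mid[OF k_def[symmetric]]
    by (intro sw_cong_bas R_cong d) (simp_all add: k_def m_def)
  also have "\<dots> = counit H z * sw g (\<lambda>g1 r. sw r (\<lambda>g2 g3. counit H g2 * R k g1 (\<lambda>A. R m g3 (\<lambda>B. \<psi> (A @ B)) B) A))"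
    by (simp only: R_mult counit_mult sw_mult_left[symmetric] mult.assoc mult.left_commute)
  also have "\<dots> = counit H z * sw g (\<lambda>g1 g3. R k g1 (\<lambda>A. R m g3 (\<lambda>B. \<psi> (A @ B)) B) A)"
    by (subst sw_counit_left) (rule lin_R2, rule lin_R1, simp_all add: linH_id k_def)
  also have "\<dots> = del j (R n g \<psi>) w"
    unfolding v(1) d[OF k_def[symmetric]] n(2) R_append[OF k_def[symmetric]] ..
  finally show "R (Suc n) g (del j \<psi>) w = del j (R n g \<psi>) w" .
qed

end

context involutive_hopf_algebra
begin

section \<open>The horizontal cyclic operator\<close>

lemma ml_tau_form': "ml n \<psi> \<Longrightarrow> n \<noteq> 0 \<Longrightarrow> ml n (tau_form n x y \<psi>)"
  using ml_tau_form[of "n - 1" \<psi>] by simp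

definition htau :: "nat \<Rightarrow> ('h list \<Rightarrow> ('h list \<Rightarrow> 'k) \<Rightarrow> 'k) \<Rightarrow> 'h list \<Rightarrow> ('h list \<Rightarrow> 'k) \<Rightarrow> 'k" where
  "htau n g us \<psi> = sws us (\<lambda>a r. sws r (\<lambda>b c. g b (tau_form n (\<pi> a) (\<pi> c) \<psi>)))"

lemma ev_tau_coalg: "f \<in> GS H p n \<Longrightarrow> n \<noteq> 0 \<Longrightarrow> length us = p \<Longrightarrow> ml n \<psi> \<Longrightarrow> ev (tau_coalg H p n f) us \<psi> = htau n (ev f) us \<psi>"
  by (simp add: tau_coalg htau_def)

lemma htau_cong:
  assumes "\<And>a b c. length a = length us \<Longrightarrow> length b = length us \<Longrightarrow> length c = length us \<Longrightarrow> g b (tau_form n (\<pi> a) (\<pi> c) \<psi>) = h a b c"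
  shows "htau n g us \<psi> = sws us (\<lambda>a r. sws r (\<lambda>b c. h a b c))"
  unfolding htau_def by (intro sws_cong_len assms) simp_all

text \<open>The transpose of \<open>S(h\<^sub>1) \<triangleright> (h\<^sub>2 \<triangleright> v \<otimes> y) = v \<otimes> S(h) y\<close>: the antipode reverses the legs of \<open>h\<^sub>1\<close>, so that the
leg acting on \<open>v\<close> is adjacent to \<open>h\<^sub>2\<close>.\<close>

lemma L_antipode_snoc:
  assumes ml: "ml (Suc m) \<psi>" and v: "length v = m"
  shows "sw h (\<lambda>a b. L m b (\<lambda>v. L (Suc m) (S a) \<psi> (v @ [y])) v) = \<psi> (v @ [S h * y])"
proof -
  have l: "lin (\<lambda>d. \<psi> (w @ [d * y]))" if "length w = m" for w
    by (rule lin_mlD[OF ml], intro entry_lin_append2 entry_lin_Cons1 linH_mult_right linH_id) (use that in simp)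
  have 1: "L (Suc m) (S a) \<psi> (w @ [y]) = sw a (\<lambda>c d. L m (S d) (\<lambda>v. \<psi> (v @ [S c * y])) w)" if w: "length w = m" for w a
  proof -
    have "L (Suc m) (S a) \<psi> (w @ [y]) = sw (S a) (\<lambda>c d. L m c (\<lambda>v. \<psi> (v @ [d * y])) w)"
      by (rule L_snoc[OF w])
    also have "\<dots> = sw a (\<lambda>c d. L m (S d) (\<lambda>v. \<psi> (v @ [S c * y])) w)"
      by (rule sw_antipode) (rule lin_L1, rule linH_id, rule lin_L2, rule l, assumption, rule w)
    finally show ?thesis .
  qed
  have mlc: "ml m (\<lambda>v. \<psi> (v @ [S c * y]))" for c by (rule ml_snocD[OF ml])
  have "sw h (\<lambda>a b. L m b (\<lambda>v. L (Suc m) (S a) \<psi> (v @ [y])) v)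
    = sw h (\<lambda>a b. L m b (\<lambda>v. sw a (\<lambda>c d. L m (S d) (\<lambda>v. \<psi> (v @ [S c * y])) v)) v)"
    by (intro sw_cong_bas L_cong 1 v)
  also have "\<dots> = sw h (\<lambda>a b. sw a (\<lambda>c d. L m (S d * b) (\<lambda>v. \<psi> (v @ [S c * y])) v))"
    by (simp only: L_sw L_L[OF mlc v])
  also have "\<dots> = sw h (\<lambda>c r. sw r (\<lambda>d b. L m (S d * b) (\<lambda>v. \<psi> (v @ [S c * y])) v))"
    by (rule sw_coassoc)
  also have "\<dots> = L m 1 (\<lambda>v. \<psi> (v @ [S h * y])) v"
  proof (rule sw_cancel_right[where G = "\<lambda>h. L m 1 (\<lambda>v. \<psi> (v @ [S h * y])) v"])
    show "sw r (\<lambda>d b. L m (S d * b) (\<lambda>v. \<psi> (v @ [S c * y])) v) = counit H r * L m 1 (\<lambda>v. \<psi> (v @ [S c * y])) v" for r c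
      by (rule sw_cancel1[where F = "\<lambda>t. L m t (\<lambda>v. \<psi> (v @ [S c * y])) v"], rule lin_L1, rule linH_id)
    show "lin (\<lambda>h. L m 1 (\<lambda>v. \<psi> (v @ [S h * y])) v)"
      by (rule lin_L2, rule lin_comp[OF l, of _ S], assumption, rule linH_antipode', rule v)
  qed
  also have "\<dots> = \<psi> (v @ [S h * y])" by (rule L_one[OF mlc v])
  finally show ?thesis .
qed

text \<open>A left action before \<open>\<tau>\<close> is absorbed by the last tensor factor.\<close>

lemma L_tau_form:
  assumes ml: "ml (Suc m) \<psi>" and v: "length v = Suc m"
  shows "L (Suc m) g (tau_form (Suc m) x y \<psi>) v = tau_form (Suc m) x (S g * y) \<psi> v"
proof -
  obtain h w where w: "v = h # w" "length w = m" using v by (auto simp: len_Suc)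
  have "L (Suc m) g (tau_form (Suc m) x y \<psi>) v = sw g (\<lambda>g1 g2. L m g2 (\<lambda>v. L (Suc m) (x * S (g1 * h)) \<psi> (v @ [y])) w)"
    unfolding w(1) L_Cons tau_form_Cons ..
  also have "\<dots> = sw g (\<lambda>g1 g2. L m g2 (\<lambda>v. L (Suc m) (S g1) (L (Suc m) (x * S h) \<psi>) (v @ [y])) w)"
    by (intro sw_cong_bas L_cong w) (simp_all add: L_L ml antipode_mult mult.assoc)
  also have "\<dots> = L (Suc m) (x * S h) \<psi> (w @ [S g * y])"
    by (rule L_antipode_snoc[OF ml_L[OF ml] w(2)])
  finally show ?thesis unfolding w(1) tau_form_Cons .
qed

text \<open>The first tensor factor of \<open>\<delta>\<^sub>0 f\<close> is the product \<open>U\<^sub>2\<close>, and in \<open>\<tau> \<delta>\<^sub>0 f\<close> it appears as \<open>U\<^sub>1 S(U\<^sub>2)\<close>.\<close>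

lemma tau_coalg_delta_h_0:
  assumes f: "f \<in> GS H p n"
  shows "tau_coalg H p (Suc n) (delta_h H p n 0 f) = delta_h H p n (Suc n) f"
proof (rule GS_eqI[of _ p "Suc n"])
  have d: "delta_h H p n 0 f \<in> GS H p (Suc n)" by (rule delta_h_in[OF f]) simp
  show "tau_coalg H p (Suc n) (delta_h H p n 0 f) \<in> GS H p (Suc n)" by (rule tau_coalg_in[OF d])
  show "delta_h H p n (Suc n) f \<in> GS H p (Suc n)" by (rule delta_h_in[OF f]) simp
  fix us :: "'h list" and \<psi> assume us: "length us = p" and ml: "ml (Suc n) \<psi>"
  define F where "F s t = sws s (\<lambda>b c. ev f b (\<lambda>v. L (Suc n) t \<psi> (v @ [\<pi> c])))" for s t
  have lF: "lin (F s)" if "length s = p" for s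
    unfolding F_def by (rule lin_sws2, rule lin_ev2[OF f], rule lin_L1, rule linH_id) (use that in simp)
  have "ev (tau_coalg H p (Suc n) (delta_h H p n 0 f)) us \<psi> = htau (Suc n) (ev (delta_h H p n 0 f)) us \<psi>"
    by (rule ev_tau_coalg[OF d _ us ml]) simp
  also have "\<dots> = sws us (\<lambda>a r. sws r (\<lambda>b c. sws b (\<lambda>b1 b2. ev f b2 (\<lambda>v. L (Suc n) (\<pi> a * S (\<pi> b1)) \<psi> (v @ [\<pi> c])))))"
    by (rule htau_cong) (use us in \<open>simp add: delta_h_0(2)[OF f] ml ml_tau_form' tau_form_Cons\<close>)
  also have "\<dots> = sws us (\<lambda>a r. sws r (\<lambda>b1 s. F s (\<pi> a * S (\<pi> b1))))"
    unfolding F_def by (simp only: sws_coassoc)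
  also have "\<dots> = F us 1"
  proof (rule sws_cancel_left[where G = "\<lambda>s. F s 1"])
    fix m c :: "'h list" assume "length c = length us"
    then show "sws m (\<lambda>a b. F c (\<pi> a * S (\<pi> b))) = counits m * F c 1"
      using us by (intro sws_cancel2 lF) simp
  qed (unfold F_def, rule ml_sws1)
  also have "\<dots> = sws us (\<lambda>b c. ev f b (\<lambda>v. \<psi> (v @ [\<pi> c])))"
    unfolding F_def by (intro sws_cong_len ev_cong[OF f]) (use us in \<open>simp_all add: L_one ml\<close>)
  also have "\<dots> = ev (delta_h H p n (Suc n) f) us \<psi>"
    by (rule delta_h_last(2)[OF f us ml, symmetric])
  finally show "ev (tau_coalg H p (Suc n) (delta_h H p n 0 f)) us \<psi> = ev (delta_h H p n (Suc n) f) us \<psi>" .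
qed

text \<open>\<open>\<Delta>(A S(h\<^sub>1)) (h\<^sub>2 \<otimes> 1) = A\<^sub>1 \<otimes> A\<^sub>2 S(h)\<close>.\<close>

lemma sw_untwist:
  assumes "\<And>t. lin (\<lambda>s. K s t)" "\<And>s. lin (\<lambda>t. K s t)"
  shows "sw h (\<lambda>x y. sw (A * S x) (\<lambda>s t. K (s * y) t)) = sw A (\<lambda>a b. K a (b * S h))"
proof -
  note rules = lin_sw1 lin_sw2 lin_comp[OF assms(1)] lin_comp[OF assms(2)] linH_id linH_mult_left linH_mult_right linH_antipode
  have 1: "sw (A * S x) (\<lambda>s t. K (s * y) t) = sw A (\<lambda>a b. sw x (\<lambda>x1 x2. K (a * (S x2 * y)) (b * S x1)))" for x y
  proof -
    have "sw (A * S x) (\<lambda>s t. K (s * y) t) = sw A (\<lambda>a b. sw (S x) (\<lambda>s t. K (a * s * y) (b * t)))"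
      by (rule sw_mult) (intro rules)+
    also have "\<dots> = sw A (\<lambda>a b. sw x (\<lambda>x1 x2. K (a * (S x2 * y)) (b * S x1)))"
      by (subst sw_antipode) (intro rules | simp add: mult.assoc)+
    finally show ?thesis .
  qed
  have "sw h (\<lambda>x y. sw (A * S x) (\<lambda>s t. K (s * y) t)) = sw A (\<lambda>a b. sw h (\<lambda>x y. sw x (\<lambda>x1 x2. K (a * (S x2 * y)) (b * S x1))))"
    unfolding 1 by (rule sw_swap)
  also have "\<dots> = sw A (\<lambda>a b. sw h (\<lambda>x1 r. sw r (\<lambda>x2 y. K (a * (S x2 * y)) (b * S x1))))"
    by (simp only: sw_coassoc)
  also have "\<dots> = sw A (\<lambda>a b. K (a * 1) (b * S h))"
  proof (rule sw_cong_bas)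
    fix a b
    show "sw h (\<lambda>x1 r. sw r (\<lambda>x2 y. K (a * (S x2 * y)) (b * S x1))) = K (a * 1) (b * S h)"
      by (rule sw_cancel_right[where G = "\<lambda>h. K (a * 1) (b * S h)"])
        (rule sw_cancel1[where F = "\<lambda>z. K (a * z) (b * S _)"], (intro rules)+)
  qed
  finally show ?thesis by simp
qed

text \<open>Doubling the first factor \<open>h\<close> of the value leaves \<open>h\<^sub>2\<close> as the first factor on which \<open>U\<^sub>1 S(h\<^sub>1)\<close> acts; by
\<open>sw_untwist\<close> the first factor of the result is a leg of \<open>U\<^sub>1\<close> alone.\<close>

lemma tau_coalg_delta_h_1_pos:
  assumes f: "f \<in> GS H p n" and n: "n \<noteq> 0"
  shows "tau_coalg H p (Suc n) (delta_h H p n 1 f) = delta_h H p n 0 (tau_coalg H p n f)"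
proof (rule GS_eqI[of _ p "Suc n"])
  have d: "delta_h H p n 1 f \<in> GS H p (Suc n)" by (rule delta_h_in[OF f]) simp
  have t: "tau_coalg H p n f \<in> GS H p n" by (rule tau_coalg_in[OF f])
  show "tau_coalg H p (Suc n) (delta_h H p n 1 f) \<in> GS H p (Suc n)" by (rule tau_coalg_in[OF d])
  show "delta_h H p n 0 (tau_coalg H p n f) \<in> GS H p (Suc n)" by (rule delta_h_in[OF t]) simp
  fix us :: "'h list" and \<psi> assume us: "length us = p" and ml: "ml (Suc n) \<psi>"
  have key: "dup 1 (tau_form (Suc n) (\<pi> a) y \<psi>) v = sws a (\<lambda>a1 a2. tau_form n (\<pi> a2) y (\<lambda>v. \<psi> (\<pi> a1 # v)) v)"
    if v: "length v = n" for a y v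
  proof -
    obtain h w where w: "v = h # w" "length w + 1 = n" using v n by (cases v) auto
    let ?K = "\<lambda>s t. L n t (\<lambda>v. \<psi> (s # v)) (w @ [y])"
    have l: "lin (\<lambda>s. ?K s t)" "lin (\<lambda>t. ?K s t)" for s t
      by (rule lin_L2, rule lin_mlD[OF ml], rule entry_lin_id, use w in simp_all) (rule lin_L1, rule linH_id)
    have "dup 1 (tau_form (Suc n) (\<pi> a) y \<psi>) v = sw h (\<lambda>x z. L (Suc n) (\<pi> a * S x) \<psi> (z # w @ [y]))"
      by (simp add: w dup_1_Cons tau_form_Cons)
    also have "\<dots> = sw h (\<lambda>x z. sw (\<pi> a * S x) (\<lambda>s t. ?K (s * z) t))" by (simp only: L_Cons)
    also have "\<dots> = sw (\<pi> a) (\<lambda>s t. ?K s (t * S h))" by (rule sw_untwist) (fact l)+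
    also have "\<dots> = sws a (\<lambda>a1 a2. ?K (\<pi> a1) (\<pi> a2 * S h))"
      by (rule sw_prod, rule l(1), rule lin_comp[OF l(2)], intro linH_mult_right linH_id)
    finally show ?thesis by (simp add: w tau_form_Cons)
  qed
  have "ev (tau_coalg H p (Suc n) (delta_h H p n 1 f)) us \<psi> = htau (Suc n) (ev (delta_h H p n 1 f)) us \<psi>"
    by (rule ev_tau_coalg[OF d _ us ml]) simp
  also have "\<dots> = sws us (\<lambda>a r. sws r (\<lambda>b c. ev f b (\<lambda>v. sws a (\<lambda>a1 a2. tau_form n (\<pi> a2) (\<pi> c) (\<lambda>v. \<psi> (\<pi> a1 # v)) v))))"
  proof (rule htau_cong)
    fix a b c :: "'h list" assume len: "length b = length us"
    have "ev (delta_h H p n 1 f) b (tau_form (Suc n) (\<pi> a) (\<pi> c) \<psi>) = ev f b (dup 1 (tau_form (Suc n) (\<pi> a) (\<pi> c) \<psi>))"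
      by (rule delta_h_mid(2)[OF f]) (use len us n ml in \<open>simp_all add: ml_tau_form\<close>)
    also have "\<dots> = ev f b (\<lambda>v. sws a (\<lambda>a1 a2. tau_form n (\<pi> a2) (\<pi> c) (\<lambda>v. \<psi> (\<pi> a1 # v)) v))"
      by (rule ev_cong[OF f _ key]) (use len us in simp)
    finally show "ev (delta_h H p n 1 f) b (tau_form (Suc n) (\<pi> a) (\<pi> c) \<psi>) = ev f b (\<lambda>v. sws a (\<lambda>a1 a2. tau_form n (\<pi> a2) (\<pi> c) (\<lambda>v. \<psi> (\<pi> a1 # v)) v))" .
  qed
  also have "\<dots> = sws us (\<lambda>a r. sws r (\<lambda>b c. sws a (\<lambda>a1 a2. ev f b (tau_form n (\<pi> a2) (\<pi> c) (\<lambda>v. \<psi> (\<pi> a1 # v))))))"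
    by (intro sws_cong_len) (use us in \<open>simp add: ev_swap[OF f]\<close>)
  also have "\<dots> = sws us (\<lambda>a r. sws a (\<lambda>a1 a2. sws r (\<lambda>b c. ev f b (tau_form n (\<pi> a2) (\<pi> c) (\<lambda>v. \<psi> (\<pi> a1 # v))))))"
    by (rule sws_cong_len, rule sws_swap)
  also have "\<dots> = sws us (\<lambda>a1 r. htau n (ev f) r (\<lambda>v. \<psi> (\<pi> a1 # v)))"
    unfolding htau_def by (rule sws_coassoc)
  also have "\<dots> = ev (delta_h H p n 0 (tau_coalg H p n f)) us \<psi>"
    using us by (simp add: delta_h_0(2)[OF t us ml] ev_tau_coalg[OF f n] ml_ConsD[OF ml] cong: sws_cong)
  finally show "ev (tau_coalg H p (Suc n) (delta_h H p n 1 f)) us \<psi> = ev (delta_h H p n 0 (tau_coalg H p n f)) us \<psi>" .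
qed

lemma L_1: "lin (\<lambda>x. \<psi> [x]) \<Longrightarrow> L (Suc 0) u \<psi> [y] = \<psi> [u * y]"
  using sw_counit_right[where F = "\<lambda>a. \<psi> [a * y]", OF lin_comp[where F = "\<lambda>x. \<psi> [x]", OF _ linH_mult_right[OF linH_id]]]
  by (simp add: L_Cons L_0)

lemma tau_coalg_delta_h_1_zero:
  assumes f: "f \<in> GS H p 0"
  shows "tau_coalg H p (Suc 0) (delta_h H p 0 (Suc 0) f) = delta_h H p 0 0 f"
proof (rule GS_eqI[of _ p "Suc 0"])
  have d: "delta_h H p 0 (Suc 0) f \<in> GS H p (Suc 0)" by (rule delta_h_in[OF f]) simp
  show "tau_coalg H p (Suc 0) (delta_h H p 0 (Suc 0) f) \<in> GS H p (Suc 0)" by (rule tau_coalg_in[OF d])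
  show "delta_h H p 0 0 f \<in> GS H p (Suc 0)" by (rule delta_h_in[OF f]) simp
  fix us :: "'h list" and \<psi> assume us: "length us = p" and ml: "ml (Suc 0) \<psi>"
  have l: "lin (\<lambda>x. \<psi> [x])" by (rule lin_mlD[OF ml entry_lin_id]) simp
  have "ev (tau_coalg H p (Suc 0) (delta_h H p 0 (Suc 0) f)) us \<psi> = htau (Suc 0) (ev (delta_h H p 0 (Suc 0) f)) us \<psi>"
    by (rule ev_tau_coalg[OF d _ us ml]) simp
  also have "\<dots> = sws us (\<lambda>a r. sws r (\<lambda>b c. sws b (\<lambda>b1 b2. ev f b1 (\<lambda>v. \<psi> [\<pi> a * (S (\<pi> b2) * \<pi> c)]))))"
  proof (rule htau_cong)
    fix a b c :: "'h list" assume len: "length b = length us"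
    have "ev (delta_h H p 0 (Suc 0) f) b (tau_form (Suc 0) (\<pi> a) (\<pi> c) \<psi>) = sws b (\<lambda>b1 b2. ev f b1 (\<lambda>v. tau_form (Suc 0) (\<pi> a) (\<pi> c) \<psi> (v @ [\<pi> b2])))"
      by (rule delta_h_last(2)[OF f]) (use len us ml in \<open>simp_all add: ml_tau_form\<close>)
    also have "\<dots> = sws b (\<lambda>b1 b2. ev f b1 (\<lambda>v. \<psi> [\<pi> a * (S (\<pi> b2) * \<pi> c)]))"
      by (intro sws_cong_len ev_cong[OF f]) (use len us in \<open>simp_all add: tau_form_Cons L_1[of \<psi>] l mult.assoc\<close>)
    finally show "ev (delta_h H p 0 (Suc 0) f) b (tau_form (Suc 0) (\<pi> a) (\<pi> c) \<psi>) = sws b (\<lambda>b1 b2. ev f b1 (\<lambda>v. \<psi> [\<pi> a * (S (\<pi> b2) * \<pi> c)]))" .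
  qed
  also have "\<dots> = sws us (\<lambda>a r. sws r (\<lambda>b1 s. sws s (\<lambda>b2 c. ev f b1 (\<lambda>v. \<psi> [\<pi> a * (S (\<pi> b2) * \<pi> c)]))))"
    by (simp only: sws_coassoc)
  also have "\<dots> = sws us (\<lambda>a b. ev f b (\<lambda>v. \<psi> [\<pi> a * 1]))"
  proof (rule sws_cong_len)
    fix a r :: "'h list" assume r: "length r = length us"
    show "sws r (\<lambda>b1 s. sws s (\<lambda>b2 c. ev f b1 (\<lambda>v. \<psi> [\<pi> a * (S (\<pi> b2) * \<pi> c)]))) = ev f r (\<lambda>v. \<psi> [\<pi> a * 1])"
    proof (rule sws_cancel_right[where G = "\<lambda>b. ev f b (\<lambda>v. \<psi> [\<pi> a * 1])"])
      fix m b :: "'h list" assume "length b = length r"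
      then show "sws m (\<lambda>b2 c. ev f b (\<lambda>v. \<psi> [\<pi> a * (S (\<pi> b2) * \<pi> c)])) = counits m * ev f b (\<lambda>v. \<psi> [\<pi> a * 1])"
        by (intro sws_cancel1[where F = "\<lambda>z. ev f b (\<lambda>v. \<psi> [\<pi> a * z])"] lin_ev2[OF f] lin_comp[OF l] linH_mult_left linH_id)
          (use r us in simp)
    qed (use ml_ev[OF f] r us in simp)
  qed
  also have "\<dots> = sws us (\<lambda>a b. ev f b (\<lambda>v. \<psi> (\<pi> a # v)))"
    by (intro sws_cong_len ev_cong[OF f]) (use us in simp_all)
  also have "\<dots> = ev (delta_h H p 0 0 f) us \<psi>" by (rule delta_h_0(2)[OF f us ml, symmetric])
  finally show "ev (tau_coalg H p (Suc 0) (delta_h H p 0 (Suc 0) f)) us \<psi> = ev (delta_h H p 0 0 f) us \<psi>" .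
qed

text \<open>For \<open>k < n\<close> the doubled factor is only shifted. For \<open>k = n\<close> the coface on the left is the last one, while on
the right the doubled factor is the product of the third legs, whose coproduct is a product of legs.\<close>

lemma tau_coalg_delta_h_ge2:
  assumes f: "f \<in> GS H p n" and k: "1 \<le> k" "k \<le> n"
  shows "tau_coalg H p (Suc n) (delta_h H p n (Suc k) f) = delta_h H p n k (tau_coalg H p n f)"
proof (rule GS_eqI[of _ p "Suc n"])
  have n: "n \<noteq> 0" using k by auto
  have d: "delta_h H p n (Suc k) f \<in> GS H p (Suc n)" by (rule delta_h_in[OF f]) (use k in simp)
  have t: "tau_coalg H p n f \<in> GS H p n" by (rule tau_coalg_in[OF f])
  show "tau_coalg H p (Suc n) (delta_h H p n (Suc k) f) \<in> GS H p (Suc n)" by (rule tau_coalg_in[OF d])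
  show "delta_h H p n k (tau_coalg H p n f) \<in> GS H p (Suc n)" by (rule delta_h_in[OF t]) (use k in simp)
  fix us :: "'h list" and \<psi> assume us: "length us = p" and ml: "ml (Suc n) \<psi>"
  have rhs: "ev (delta_h H p n k (tau_coalg H p n f)) us \<psi> = htau n (ev f) us (dup k \<psi>)"
    using delta_h_mid(2)[OF t k us ml] ev_tau_coalg[OF f n us ml_dup[OF ml k]] by simp
  have lhs: "ev (tau_coalg H p (Suc n) (delta_h H p n (Suc k) f)) us \<psi> = htau (Suc n) (ev (delta_h H p n (Suc k) f)) us \<psi>"
    by (rule ev_tau_coalg[OF d _ us ml]) simp
  show "ev (tau_coalg H p (Suc n) (delta_h H p n (Suc k) f)) us \<psi> = ev (delta_h H p n k (tau_coalg H p n f)) us \<psi>"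
  proof (cases "k = n")
    case False
    have "htau (Suc n) (ev (delta_h H p n (Suc k) f)) us \<psi> = htau n (ev f) us (dup k \<psi>)"
      unfolding htau_def[of n]
    proof (rule htau_cong)
      fix a b c :: "'h list" assume len: "length b = length us"
      have "ev (delta_h H p n (Suc k) f) b (tau_form (Suc n) (\<pi> a) (\<pi> c) \<psi>) = ev f b (dup (Suc k) (tau_form (Suc n) (\<pi> a) (\<pi> c) \<psi>))"
        by (rule delta_h_mid(2)[OF f]) (use len us False k ml in \<open>simp_all add: ml_tau_form\<close>)
      also have "\<dots> = ev f b (tau_form n (\<pi> a) (\<pi> c) (dup k \<psi>))"
      proof (rule ev_cong[OF f])
        fix v :: "'h list" assume "length v = n"
        then obtain h w where w: "v = h # w" "length w + 1 = n" using n by (cases v) auto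
        have "dup (Suc k) (tau_form (Suc n) (\<pi> a) (\<pi> c) \<psi>) v = dup k (\<lambda>v. L (Suc n) (\<pi> a * S h) \<psi> (v @ [\<pi> c])) w"
          using k by (simp add: w dup_Cons tau_form_Cons)
        also have "\<dots> = dup k (L (Suc n) (\<pi> a * S h) \<psi>) (w @ [\<pi> c])"
          by (rule dup_snoc[symmetric]) (use w k False in auto)
        also have "\<dots> = L n (\<pi> a * S h) (dup k \<psi>) (w @ [\<pi> c])"
          by (rule L_dup(1)[symmetric]) (use w k ml in auto)
        finally show "dup (Suc k) (tau_form (Suc n) (\<pi> a) (\<pi> c) \<psi>) v = tau_form n (\<pi> a) (\<pi> c) (dup k \<psi>) v"
          by (simp add: w tau_form_Cons)
      qed (use len us in simp)
      finally show "ev (delta_h H p n (Suc k) f) b (tau_form (Suc n) (\<pi> a) (\<pi> c) \<psi>) = ev f b (tau_form n (\<pi> a) (\<pi> c) (dup k \<psi>))" .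
    qed
    then show ?thesis using lhs rhs by simp
  next
    case True
    let ?X = "\<lambda>a b c1 c2. ev f b (\<lambda>v. tau_form (Suc n) (\<pi> a) (\<pi> c2) \<psi> (v @ [\<pi> c1]))"
    have 1: "htau (Suc n) (ev (delta_h H p n (Suc k) f)) us \<psi> = sws us (\<lambda>a r. sws r (\<lambda>b c. sws b (\<lambda>b1 b2. ?X a b1 b2 c)))"
      by (rule htau_cong) (use True us in \<open>simp add: delta_h_last(2)[OF f] ml_tau_form ml\<close>)
    have 2: "htau n (ev f) us (dup k \<psi>) = sws us (\<lambda>a r. sws r (\<lambda>b c. sws c (\<lambda>c1 c2. ?X a b c1 c2)))"
    proof (rule htau_cong)
      fix a b c :: "'h list" assume len: "length b = length us"
      have "ev f b (tau_form n (\<pi> a) (\<pi> c) (dup k \<psi>)) = ev f b (\<lambda>v. sws c (\<lambda>c1 c2. tau_form (Suc n) (\<pi> a) (\<pi> c2) \<psi> (v @ [\<pi> c1])))"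
      proof (rule ev_cong[OF f])
        fix v :: "'h list" assume "length v = n"
        then obtain h w where w: "v = h # w" "Suc (length w) = n" using n by (cases v) auto
        have "tau_form n (\<pi> a) (\<pi> c) (dup k \<psi>) v = dup (Suc (length w)) (L (Suc n) (\<pi> a * S h) \<psi>) (w @ [\<pi> c])"
          using L_dup(1)[OF ml k, of "w @ [\<pi> c]" "\<pi> a * S h"] w True by (simp add: tau_form_Cons)
        also have "\<dots> = sw (\<pi> c) (\<lambda>x y. L (Suc n) (\<pi> a * S h) \<psi> (w @ [x, y]))" by (rule dup_last)
        also have "\<dots> = sws c (\<lambda>c1 c2. L (Suc n) (\<pi> a * S h) \<psi> (w @ [\<pi> c1, \<pi> c2]))"
          by (rule sw_prod_form[of "length w"]) (use w ml in \<open>simp_all add: ml_L\<close>)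
        finally show "tau_form n (\<pi> a) (\<pi> c) (dup k \<psi>) v = sws c (\<lambda>c1 c2. tau_form (Suc n) (\<pi> a) (\<pi> c2) \<psi> (v @ [\<pi> c1]))"
          by (simp add: w tau_form_Cons)
      qed (use len us in simp)
      then show "ev f b (tau_form n (\<pi> a) (\<pi> c) (dup k \<psi>)) = sws c (\<lambda>c1 c2. ?X a b c1 c2)"
        using len us by (simp add: ev_swap[OF f])
    qed
    show ?thesis unfolding lhs rhs 1 2 by (simp only: sws_coassoc)
  qed
qed

lemma tau_coalg_delta_h:
  assumes f: "f \<in> GS H p n" and i: "1 \<le> i" "i \<le> Suc n"
  shows "tau_coalg H p (Suc n) (delta_h H p n i f) = delta_h H p n (i - 1) (tau_coalg H p n f)"
proof (cases "i = 1")
  case True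
  then show ?thesis
    using tau_coalg_delta_h_1_zero[of f p] tau_coalg_delta_h_1_pos[OF f] f
    by (cases "n = 0") (simp_all add: tau_coalg_0 One_nat_def)
next
  case False
  define k where "k = i - 1"
  have "i = Suc k" "1 \<le> k" "k \<le> n" using False i by (auto simp: k_def)
  then show ?thesis using tau_coalg_delta_h_ge2[OF f] by simp
qed

lemma tau_coalg_sigma_h:
  assumes f: "f \<in> GS H p (Suc n)" and i: "1 \<le> i" "i \<le> n"
  shows "tau_coalg H p n (sigma_h H p (Suc n) i f) = sigma_h H p (Suc n) (i - 1) (tau_coalg H p (Suc n) f)"
proof (rule GS_eqI[of _ p n])
  define k where "k = i - 1"
  have k: "i = Suc k" "k < n" using i by (auto simp: k_def)
  have n: "n \<noteq> 0" using i by auto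
  have s: "sigma_h H p (Suc n) i f \<in> GS H p n" by (rule sigma_h(1)[OF f i(2)])
  have t: "tau_coalg H p (Suc n) f \<in> GS H p (Suc n)" by (rule tau_coalg_in[OF f])
  show "tau_coalg H p n (sigma_h H p (Suc n) i f) \<in> GS H p n" by (rule tau_coalg_in[OF s])
  show "sigma_h H p (Suc n) (i - 1) (tau_coalg H p (Suc n) f) \<in> GS H p n" by (rule sigma_h(1)[OF t]) (use i in simp)
  fix us :: "'h list" and \<psi> assume us: "length us = p" and ml: "ml n \<psi>"
  have "ev (tau_coalg H p n (sigma_h H p (Suc n) i f)) us \<psi> = htau n (ev (sigma_h H p (Suc n) i f)) us \<psi>"
    by (rule ev_tau_coalg[OF s n us ml])
  also have "\<dots> = htau (Suc n) (ev f) us (del k \<psi>)"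
    unfolding htau_def[of "Suc n"]
  proof (rule htau_cong)
    fix a b c :: "'h list" assume len: "length b = length us"
    have "ev (sigma_h H p (Suc n) i f) b (tau_form n (\<pi> a) (\<pi> c) \<psi>) = ev f b (del i (tau_form n (\<pi> a) (\<pi> c) \<psi>))"
      by (rule sigma_h(2)[OF f i(2)]) (use len us ml n in \<open>simp_all add: ml_tau_form'\<close>)
    also have "\<dots> = ev f b (tau_form (Suc n) (\<pi> a) (\<pi> c) (del k \<psi>))"
    proof (rule ev_cong[OF f])
      fix v :: "'h list" assume "length v = Suc n"
      then obtain h w where w: "v = h # w" "length w = n" by (auto simp: len_Suc)
      have "del i (tau_form n (\<pi> a) (\<pi> c) \<psi>) v = del k (\<lambda>v. L n (\<pi> a * S h) \<psi> (v @ [\<pi> c])) w"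
        by (simp add: w k del_Cons tau_form_Cons)
      also have "\<dots> = del k (L n (\<pi> a * S h) \<psi>) (w @ [\<pi> c])" by (rule del_snoc[symmetric]) (use w k in simp)
      also have "\<dots> = L (Suc n) (\<pi> a * S h) (del k \<psi>) (w @ [\<pi> c])"
        by (rule L_del(1)[OF ml, symmetric]) (use w k in simp_all)
      finally show "del i (tau_form n (\<pi> a) (\<pi> c) \<psi>) v = tau_form (Suc n) (\<pi> a) (\<pi> c) (del k \<psi>) v"
        by (simp add: w tau_form_Cons)
    qed (use len us in simp)
    finally show "ev (sigma_h H p (Suc n) i f) b (tau_form n (\<pi> a) (\<pi> c) \<psi>) = ev f b (tau_form (Suc n) (\<pi> a) (\<pi> c) (del k \<psi>))" .
  qed
  also have "\<dots> = ev (tau_coalg H p (Suc n) f) us (del k \<psi>)"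
    by (rule ev_tau_coalg[OF f _ us ml_del[OF ml], symmetric]) (use k in simp_all)
  also have "\<dots> = ev (sigma_h H p (Suc n) k (tau_coalg H p (Suc n) f)) us \<psi>"
    by (rule sigma_h(2)[OF t _ us ml, symmetric]) (use k in simp)
  finally show "ev (tau_coalg H p n (sigma_h H p (Suc n) i f)) us \<psi> = ev (sigma_h H p (Suc n) (i - 1) (tau_coalg H p (Suc n) f)) us \<psi>"
    by (simp add: k_def)
qed

text \<open>The transpose of the map \<open>h \<otimes> v \<mapsto> x S(h) \<triangleright> v\<close>.\<close>

definition contract_form :: "nat \<Rightarrow> 'h \<Rightarrow> ('h list \<Rightarrow> 'k) \<Rightarrow> 'h list \<Rightarrow> 'k" where
  "contract_form n x \<psi> v = L n (x * S (hd v)) \<psi> (tl v)"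

lemma contract_form_Cons: "contract_form n x \<psi> (h # v) = L n (x * S h) \<psi> v"
  by (simp add: contract_form_def)

lemma ml_contract_form: "ml n \<psi> \<Longrightarrow> ml (Suc n) (contract_form n x \<psi>)"
  by (rule ml_ConsI; simp only: contract_form_Cons) (intro lin_L1 linH_mult_left linH_antipode linH_id, erule ml_L)

lemma tau_form_del_last:
  assumes ml: "ml n \<psi>" and v: "length v = Suc n"
  shows "tau_form (Suc n) x y (del n \<psi>) v = counit H y * contract_form n x \<psi> v"
proof -
  obtain h w where w: "v = h # w" "length w = n" using v by (auto simp: len_Suc)
  show ?thesis
    using L_del(1)[OF ml, of n "w @ [y]" "x * S h"] w del_last[of w "L n (x * S h) \<psi>" y] by (simp add: tau_form_Cons contract_form_Cons)
qed

text \<open>Transposed: \<open>g = x' S(h)\<close> acts on a tensor with first factor \<open>k\<close>, and this factor, now \<open>g\<^sub>1 k\<close>, is contracted.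
The remaining factors are acted on by \<open>x S(g\<^sub>1 k) g\<^sub>2 = x S(k) S(g\<^sub>1) g\<^sub>2\<close>, where \<open>g\<close> cancels. This is the
reason for \<open>\<tau> \<sigma>\<^sub>0 = \<sigma>\<^sub>n \<tau>\<^sup>2\<close>.\<close>

lemma tau_form_contract_form:
  assumes ml: "ml n \<psi>" and v: "length v = n" and n: "n \<noteq> 0"
  shows "tau_form (Suc n) x' y (contract_form n x \<psi>) (h # v) = counit H x' * (counit H h * tau_form n x y \<psi> v)"
proof -
  obtain m where m: "n = Suc m" using n by (cases n) auto
  obtain k w where w: "v = k # w" "length w = m" using v m by (auto simp: len_Suc)
  have "tau_form (Suc n) x' y (contract_form n x \<psi>) (h # v) = sw (x' * S h) (\<lambda>g1 g2. L n g2 (\<lambda>v. contract_form n x \<psi> (g1 * k # v)) (w @ [y]))"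
    by (simp add: tau_form_Cons w L_Cons)
  also have "\<dots> = sw (x' * S h) (\<lambda>g1 g2. L n (x * S k * (S g1 * g2)) \<psi> (w @ [y]))"
  proof (rule sw_cong_bas)
    fix g1 g2
    have "L n g2 (\<lambda>v. contract_form n x \<psi> (g1 * k # v)) (w @ [y]) = L n g2 (L n (x * S k * S g1) \<psi>) (w @ [y])"
      by (rule L_cong) (use w m in \<open>simp_all add: contract_form_Cons antipode_mult mult.assoc\<close>)
    then show "L n g2 (\<lambda>v. contract_form n x \<psi> (g1 * k # v)) (w @ [y]) = L n (x * S k * (S g1 * g2)) \<psi> (w @ [y])"
      using L_L[OF ml, of "w @ [y]" g2 "x * S k * S g1"] w m by (simp add: mult.assoc)
  qed
  also have "\<dots> = counit H (x' * S h) * L n (x * S k * 1) \<psi> (w @ [y])"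
    by (rule sw_cancel1[where F = "\<lambda>t. L n (x * S k * t) \<psi> (w @ [y])"]) (intro lin_L1 linH_mult_left linH_id)
  finally show ?thesis by (simp add: counit_mult counit_antipode w tau_form_Cons mult.assoc)
qed

lemma tau_form_contract_form_0: "length v = Suc 0 \<Longrightarrow> tau_form (Suc 0) x' y (contract_form 0 x \<psi>) v = counit H x' * (counit H x * (counit H y * del 0 \<psi> v))"
proof -
  assume "length v = Suc 0"
  then obtain h where v: "v = [h]" by (auto simp: len_Suc)
  have "lin (\<lambda>z. contract_form 0 x \<psi> [z])" unfolding contract_form_Cons by (intro lin_L1 linH_mult_left linH_antipode linH_id)
  then show ?thesis
    by (simp add: v tau_form_Cons L_1 contract_form_Cons L_0 counit_mult counit_antipode del_0_Cons mult.left_commute mult.commute)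
qed

lemma tau_coalg_sigma_h_0:
  assumes f: "f \<in> GS H p (Suc n)"
  shows "tau_coalg H p n (sigma_h H p (Suc n) 0 f) = sigma_h H p (Suc n) n (tau_coalg H p (Suc n) (tau_coalg H p (Suc n) f))"
proof (rule GS_eqI[of _ p n])
  have s: "sigma_h H p (Suc n) 0 f \<in> GS H p n" by (rule sigma_h(1)[OF f]) simp
  have t: "tau_coalg H p (Suc n) f \<in> GS H p (Suc n)" by (rule tau_coalg_in[OF f])
  have tt: "tau_coalg H p (Suc n) (tau_coalg H p (Suc n) f) \<in> GS H p (Suc n)" by (rule tau_coalg_in[OF t])
  show "tau_coalg H p n (sigma_h H p (Suc n) 0 f) \<in> GS H p n" by (rule tau_coalg_in[OF s])
  show "sigma_h H p (Suc n) n (tau_coalg H p (Suc n) (tau_coalg H p (Suc n) f)) \<in> GS H p n" by (rule sigma_h(1)[OF tt]) simp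
  fix us :: "'h list" and \<psi> assume us: "length us = p" and ml: "ml n \<psi>"
  have "ev (sigma_h H p (Suc n) n (tau_coalg H p (Suc n) (tau_coalg H p (Suc n) f))) us \<psi> = htau (Suc n) (ev (tau_coalg H p (Suc n) f)) us (del n \<psi>)"
    using sigma_h(2)[OF tt _ us ml] ev_tau_coalg[OF t _ us ml_del[OF ml]] by simp
  also have "\<dots> = sws us (\<lambda>a r. sws r (\<lambda>b c. counits c * ev (tau_coalg H p (Suc n) f) b (contract_form n (\<pi> a) \<psi>)))"
  proof (rule htau_cong)
    fix a b c :: "'h list" assume len: "length b = length us"
    have "ev (tau_coalg H p (Suc n) f) b (tau_form (Suc n) (\<pi> a) (\<pi> c) (del n \<psi>)) = ev (tau_coalg H p (Suc n) f) b (\<lambda>v. counits c * contract_form n (\<pi> a) \<psi> v)"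
      by (rule ev_cong[OF t]) (use len us in \<open>simp_all add: tau_form_del_last[OF ml] counit_prod\<close>)
    then show "ev (tau_coalg H p (Suc n) f) b (tau_form (Suc n) (\<pi> a) (\<pi> c) (del n \<psi>)) = counits c * ev (tau_coalg H p (Suc n) f) b (contract_form n (\<pi> a) \<psi>)"
      using len us by (simp add: ev_swap[OF t])
  qed
  also have "\<dots> = sws us (\<lambda>a b. ev (tau_coalg H p (Suc n) f) b (contract_form n (\<pi> a) \<psi>))"
    by (rule sws_cong_len, rule sws_counit_right) (use ml_ev[OF t] us in simp)
  also have "\<dots> = sws us (\<lambda>a b. htau (Suc n) (ev f) b (contract_form n (\<pi> a) \<psi>))"
    by (rule sws_cong_len, rule ev_tau_coalg[OF f]) (use us in \<open>simp_all add: ml_contract_form ml\<close>)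
  also have "\<dots> = ev (tau_coalg H p n (sigma_h H p (Suc n) 0 f)) us \<psi>"
  proof (cases "n = 0")
    case True
    have "sws us (\<lambda>a b. htau (Suc n) (ev f) b (contract_form n (\<pi> a) \<psi>)) = sws us (\<lambda>a b. counits a * ev f b (del 0 \<psi>))"
    proof (rule sws_cong_len)
      fix a b :: "'h list" assume b: "length b = length us"
      have "htau (Suc n) (ev f) b (contract_form n (\<pi> a) \<psi>) = sws b (\<lambda>a' r. sws r (\<lambda>b' c'. counits a' * (counits a * (counits c' * ev f b' (del 0 \<psi>)))))"
      proof (rule htau_cong)
        fix a' b' c' :: "'h list" assume len: "length b' = length b"
        have "ev f b' (tau_form (Suc n) (\<pi> a') (\<pi> c') (contract_form n (\<pi> a) \<psi>)) = ev f b' (\<lambda>v. counits a' * (counits a * (counits c' * del 0 \<psi> v)))"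
          by (rule ev_cong[OF f]) (use len b us True in \<open>simp_all add: tau_form_contract_form_0 counit_prod\<close>)
        then show "ev f b' (tau_form (Suc n) (\<pi> a') (\<pi> c') (contract_form n (\<pi> a) \<psi>)) = counits a' * (counits a * (counits c' * ev f b' (del 0 \<psi>)))"
          using len b us by (simp add: ev_swap[OF f])
      qed
      also have "\<dots> = counits a * sws b (\<lambda>a' r. counits a' * sws r (\<lambda>b' c'. counits c' * ev f b' (del 0 \<psi>)))"
        by (simp only: sws_mult_left[symmetric] mult.left_commute)
      also have "\<dots> = counits a * ev f b (del 0 \<psi>)"
        using b us ml_ev[OF f] by (simp add: sws_counit_left sws_counit_right ml_sws1 cong: sws_cong)
      finally show "htau (Suc n) (ev f) b (contract_form n (\<pi> a) \<psi>) = counits a * ev f b (del 0 \<psi>)" .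
    qed
    also have "\<dots> = ev f us (del 0 \<psi>)" using us ml_ev[OF f] by (simp add: sws_counit_left)
    also have "\<dots> = ev (tau_coalg H p n (sigma_h H p (Suc n) 0 f)) us \<psi>"
      using True sigma_h(2)[OF f _ us ml, of 0] by (simp add: tau_coalg_0)
    finally show ?thesis .
  next
    case False
    have "sws us (\<lambda>a b. htau (Suc n) (ev f) b (contract_form n (\<pi> a) \<psi>)) = sws us (\<lambda>a b. sws b (\<lambda>b' c'. ev f b' (del 0 (tau_form n (\<pi> a) (\<pi> c') \<psi>))))"
    proof (rule sws_cong_len)
      fix a b :: "'h list" assume b: "length b = length us"
      have "htau (Suc n) (ev f) b (contract_form n (\<pi> a) \<psi>) = sws b (\<lambda>a' r. sws r (\<lambda>b' c'. counits a' * ev f b' (del 0 (tau_form n (\<pi> a) (\<pi> c') \<psi>))))"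
      proof (rule htau_cong)
        fix a' b' c' :: "'h list" assume len: "length b' = length b"
        have "ev f b' (tau_form (Suc n) (\<pi> a') (\<pi> c') (contract_form n (\<pi> a) \<psi>)) = ev f b' (\<lambda>v. counits a' * del 0 (tau_form n (\<pi> a) (\<pi> c') \<psi>) v)"
        proof (rule ev_cong[OF f])
          fix v :: "'h list" assume "length v = Suc n"
          then obtain h w where w: "v = h # w" "length w = n" by (auto simp: len_Suc)
          show "tau_form (Suc n) (\<pi> a') (\<pi> c') (contract_form n (\<pi> a) \<psi>) v = counits a' * del 0 (tau_form n (\<pi> a) (\<pi> c') \<psi>) v"
            by (simp add: w tau_form_contract_form[OF ml w(2) False] counit_prod del_0_Cons)
        qed (use len b us in simp)
        then show "ev f b' (tau_form (Suc n) (\<pi> a') (\<pi> c') (contract_form n (\<pi> a) \<psi>)) = counits a' * ev f b' (del 0 (tau_form n (\<pi> a) (\<pi> c') \<psi>))"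
          using len b us by (simp add: ev_swap[OF f])
      qed
      also have "\<dots> = sws b (\<lambda>b' c'. ev f b' (del 0 (tau_form n (\<pi> a) (\<pi> c') \<psi>)))"
        unfolding sws_mult_left by (rule sws_counit_left, rule ml_sws1)
      finally show "htau (Suc n) (ev f) b (contract_form n (\<pi> a) \<psi>) = sws b (\<lambda>b' c'. ev f b' (del 0 (tau_form n (\<pi> a) (\<pi> c') \<psi>)))" .
    qed
    also have "\<dots> = htau n (ev (sigma_h H p (Suc n) 0 f)) us \<psi>"
      unfolding htau_def
      by (intro sws_cong_len) (use us False in \<open>simp add: sigma_h(2)[OF f] ml_tau_form' ml\<close>)
    also have "\<dots> = ev (tau_coalg H p n (sigma_h H p (Suc n) 0 f)) us \<psi>"
      by (rule ev_tau_coalg[OF s False us ml, symmetric])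
    finally show ?thesis .
  qed
  finally show "ev (tau_coalg H p n (sigma_h H p (Suc n) 0 f)) us \<psi> = ev (sigma_h H p (Suc n) n (tau_coalg H p (Suc n) (tau_coalg H p (Suc n) f))) us \<psi>" by simp
qed


section \<open>Powers of the horizontal cyclic operator\<close>

text \<open>The horizontal analogue of \<open>vdegen\<close> and \<open>vshift\<close>: the left inverse
\<open>(\<iota> g)(u) = U\<^sub>1 S(g\<^sup>0(u\<^sub>2)) \<triangleright> (g\<^sup>1(u\<^sub>2) \<otimes> \<cdots> \<otimes> g\<^sup>q(u\<^sub>2))\<close> of the coface \<open>\<delta>\<^sub>0\<close>, and the rotation
\<open>(\<rho> g)(u) = g\<^sup>1(u\<^sub>2) \<otimes> \<cdots> \<otimes> g\<^sup>q(u\<^sub>2) \<otimes> g\<^sup>0(u\<^sub>2) S(U\<^sub>1) U\<^sub>3\<close> of the tensor factors, with \<open>\<tau> \<iota> = \<iota> \<rho>\<close>.\<close>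

definition hdegen :: "nat \<Rightarrow> ('h list \<Rightarrow> ('h list \<Rightarrow> 'k) \<Rightarrow> 'k) \<Rightarrow> 'h list \<Rightarrow> ('h list \<Rightarrow> 'k) \<Rightarrow> 'k" where
  "hdegen q g us \<psi> = sws us (\<lambda>a b. g b (contract_form q (\<pi> a) \<psi>))"

definition rotate_form :: "'h \<Rightarrow> ('h list \<Rightarrow> 'k) \<Rightarrow> 'h list \<Rightarrow> 'k" where
  "rotate_form t \<psi> v = \<psi> (tl v @ [hd v * t])"

definition hshift :: "('h list \<Rightarrow> ('h list \<Rightarrow> 'k) \<Rightarrow> 'k) \<Rightarrow> 'h list \<Rightarrow> ('h list \<Rightarrow> 'k) \<Rightarrow> 'k" where
  "hshift g us \<psi> = sws us (\<lambda>a r. sws r (\<lambda>b c. g b (rotate_form (S (\<pi> a) * \<pi> c) \<psi>)))"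

lemma rotate_form_Cons: "rotate_form t \<psi> (h # v) = \<psi> (v @ [h * t])"
  by (simp add: rotate_form_def)

lemma ml_rotate_form:
  assumes "ml (Suc n) \<psi>" shows "ml (Suc n) (rotate_form t \<psi>)"
proof (rule ml_ConsI; simp only: rotate_form_Cons)
  show "lin (\<lambda>h. \<psi> (v @ [h * t]))" if "length v = n" for v
    by (rule lin_mlD[OF assms], intro entry_lin_append2 entry_lin_Cons1 linH_mult_right linH_id) (use that in simp)
  show "ml n (\<lambda>v. \<psi> (v @ [h * t]))" for h by (rule ml_snocD[OF assms])
qed

lemma cochain_swap:
  assumes "cochain p q g" "length us = p"
  shows "g us (\<lambda>v. sws u (\<lambda>a b. G v a b)) = sws u (\<lambda>a b. g us (\<lambda>v. G v a b))"
    and "g us (\<lambda>v. sw x (\<lambda>a b. G' v a b)) = sw x (\<lambda>a b. g us (\<lambda>v. G' v a b))"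
    and "g us (\<lambda>v. c * K v) = c * g us K"
  by (rule fsupp_sws_swap[OF cochain_fsupp[OF assms]] fsupp_sw_swap[OF cochain_fsupp[OF assms]] fsupp_mult[OF cochain_fsupp[OF assms]])+

lemma cochain_hshift:
  assumes g: "cochain p (Suc q) g" shows "cochain p (Suc q) (hshift g)"
  unfolding cochain_def
proof (intro conjI allI impI)
  show "ml p (\<lambda>us. hshift g us \<psi>)" for \<psi> unfolding hshift_def by (rule ml_sws1)
  fix us :: "'h list" assume us: "length us = p"
  show "fsupp (\<lambda>v. length v = Suc q) (hshift g us)"
    unfolding hshift_def[abs_def] rotate_form_def[abs_def]
    by (intro fsupp_bind_sws cochain_bind[OF g] fsupp_single) (use us in simp_all)
qed

lemma cochain_hshift_pow: "cochain p (Suc q) g \<Longrightarrow> cochain p (Suc q) ((hshift ^^ k) g)"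
  by (induction k) (simp_all add: cochain_hshift)

lemma hdegen_delta_h_0:
  assumes f: "f \<in> GS H p q" and us: "length us = p" and ml: "ml q \<psi>"
  shows "hdegen q (ev (delta_h H p q 0 f)) us \<psi> = ev f us \<psi>"
proof -
  have "hdegen q (ev (delta_h H p q 0 f)) us \<psi> = sws us (\<lambda>a r. sws r (\<lambda>b c. ev f c (L q (\<pi> a * S (\<pi> b)) \<psi>)))"
    unfolding hdegen_def by (rule sws_cong_len) (use us in \<open>simp add: delta_h_0(2)[OF f] ml_contract_form ml contract_form_Cons\<close>)
  also have "\<dots> = ev f us (L q 1 \<psi>)"
    by (rule sws_cancel_left[where G = "\<lambda>c. ev f c (L q 1 \<psi>)"])
      (rule sws_cancel2[where F = "\<lambda>z. ev f _ (L q z \<psi>)"], rule lin_ev2[OF f], intro lin_L1 linH_id,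
        use us ml_ev[OF f] in simp_all)
  also have "\<dots> = ev f us \<psi>" by (rule ev_cong[OF f us]) (simp add: L_one ml)
  finally show ?thesis .
qed

lemma htau_hdegen:
  assumes g: "cochain p (Suc q) g" and us: "length us = p" and q: "q \<noteq> 0" and ml: "ml q \<psi>"
  shows "htau q (hdegen q g) us \<psi> = hdegen q (hshift g) us \<psi>"
proof -
  obtain m where m: "q = Suc m" using q by (cases q) auto
  have "htau q (hdegen q g) us \<psi> = sws us (\<lambda>a r. sws r (\<lambda>b c. sws b (\<lambda>b1 b2. g b2 (rotate_form (S (\<pi> b1) * \<pi> c) (contract_form q (\<pi> a) \<psi>)))))"
    unfolding htau_def hdegen_def
  proof (intro sws_cong_len cochain_cong[OF g])
    fix x y z :: 'h and v :: "'h list" assume "length v = Suc q"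
    then obtain h w where w: "v = h # w" "length w = q" by (auto simp: len_Suc)
    obtain k w' where w': "w = k # w'" "length w' = m" using w m by (auto simp: len_Suc)
    have "contract_form q y (tau_form q x z \<psi>) v = tau_form q x (S (y * S h) * z) \<psi> w"
      using L_tau_form[of m \<psi> w] ml w m by (simp add: contract_form_Cons)
    then show "contract_form q y (tau_form q x z \<psi>) v = rotate_form (S y * z) (contract_form q x \<psi>) v"
      by (simp add: w w' tau_form_Cons rotate_form_Cons contract_form_Cons antipode_mult mult.assoc)
  qed (use us in simp)
  also have "\<dots> = hdegen q (hshift g) us \<psi>"
    unfolding hdegen_def hshift_def by (simp only: sws_coassoc)
  finally show ?thesis .
qed

lemma sw_S_prod_prod:
  assumes "\<And>b. lin (\<lambda>a. G a b)" "\<And>a. lin (\<lambda>b. G a b)"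
  shows "sw (S (\<pi> p) * \<pi> q) G = sws p (\<lambda>p1 p2. sws q (\<lambda>q1 q2. G (S (\<pi> p2) * \<pi> q1) (S (\<pi> p1) * \<pi> q2)))"
proof -
  note rules = lin_sw2 lin_sws2 lin_comp[OF assms(1)] lin_comp[OF assms(2)] linH_id linH_mult_left linH_mult_right linH_antipode
  have "sw (S (\<pi> p) * \<pi> q) G = sw (S (\<pi> p)) (\<lambda>a b. sw (\<pi> q) (\<lambda>c d. G (a * c) (b * d)))"
    by (rule sw_mult) (fact assms)+
  also have "\<dots> = sw (S (\<pi> p)) (\<lambda>a b. sws q (\<lambda>q1 q2. G (a * \<pi> q1) (b * \<pi> q2)))"
    by (subst sw_prod) (intro rules refl)+
  also have "\<dots> = sw (\<pi> p) (\<lambda>a b. sws q (\<lambda>q1 q2. G (S b * \<pi> q1) (S a * \<pi> q2)))"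
    by (rule sw_antipode) (intro rules)+
  also have "\<dots> = sws p (\<lambda>p1 p2. sws q (\<lambda>q1 q2. G (S (\<pi> p2) * \<pi> q1) (S (\<pi> p1) * \<pi> q2)))"
    by (rule sw_prod) (intro rules)+
  finally show ?thesis .
qed

text \<open>After \<open>k\<close> rotations the first \<open>k\<close> factors stand at the back, acted on from the right by \<open>S(U\<^sub>1) U\<^sub>3\<close>. The
induction step is \<open>\<Delta>(S(A) C) = S(A\<^sub>2) C\<^sub>1 \<otimes> S(A\<^sub>1) C\<^sub>2\<close>: one leg acts on the first \<open>k\<close> factors, the other
one multiplies the next factor.\<close>

lemma hshift_power:
  assumes g: "cochain p (Suc q) g"
  shows "length us = p \<Longrightarrow> ml (Suc q) \<psi> \<Longrightarrow> k \<le> Suc q \<Longrightarrow>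
    (hshift ^^ k) g us \<psi> = sws us (\<lambda>a r. sws r (\<lambda>b c. g b (\<lambda>v. R k (S (\<pi> a) * \<pi> c) (\<lambda>x. \<psi> (drop k v @ x)) (take k v))))"
proof (induction k arbitrary: us \<psi>)
  case 0
  have "sws us (\<lambda>a r. sws r (\<lambda>b c. g b (\<lambda>v. R 0 (S (\<pi> a) * \<pi> c) (\<lambda>x. \<psi> (drop 0 v @ x)) (take 0 v))))
    = sws us (\<lambda>a r. sws r (\<lambda>b c. counits a * (counits c * g b \<psi>)))"
    by (intro sws_cong_len) (use 0 in \<open>simp add: R_0 counit_mult counit_antipode counit_prod cochain_swap[OF g] mult.assoc\<close>)
  also have "\<dots> = g us \<psi>"
    using 0 cochain_ml[OF g] by (simp add: sws_mult_left sws_counit_left sws_counit_right cong: sws_cong)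
  finally show ?case by simp
next
  case (Suc k)
  let ?Y = "\<lambda>g1 t v. R k g1 (\<lambda>x. \<psi> (drop (Suc k) v @ x @ [v ! k * t])) (take k v)"
  have rotate_form: "rotate_form t \<psi> (drop k v @ x) = \<psi> (drop (Suc k) v @ x @ [v ! k * t])" if "length v = Suc q" for v x t
    using that Suc.prems(3) Cons_nth_drop_Suc[of k v, symmetric] by (simp add: rotate_form_Cons)
  have "(hshift ^^ Suc k) g us \<psi> = sws us (\<lambda>a r. sws r (\<lambda>b c. (hshift ^^ k) g b (rotate_form (S (\<pi> a) * \<pi> c) \<psi>)))"
    by (simp add: hshift_def)
  also have "\<dots> = sws us (\<lambda>a r. sws r (\<lambda>b c. sws b (\<lambda>b1 r. sws r (\<lambda>b2 b3. g b2 (?Y (S (\<pi> b1) * \<pi> b3) (S (\<pi> a) * \<pi> c))))))"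
  proof (intro sws_cong_len)
    fix a b c r :: "'h list" assume "length r = length us" "length b = length r"
    then have b: "length b = p" using Suc.prems by simp
    have "(hshift ^^ k) g b (rotate_form (S (\<pi> a) * \<pi> c) \<psi>) = sws b (\<lambda>b1 r. sws r (\<lambda>b2 b3. g b2 (\<lambda>v. R k (S (\<pi> b1) * \<pi> b3) (\<lambda>x. rotate_form (S (\<pi> a) * \<pi> c) \<psi> (drop k v @ x)) (take k v))))"
      by (rule Suc.IH[OF b]) (use Suc.prems in \<open>simp_all add: ml_rotate_form\<close>)
    also have "\<dots> = sws b (\<lambda>b1 r. sws r (\<lambda>b2 b3. g b2 (?Y (S (\<pi> b1) * \<pi> b3) (S (\<pi> a) * \<pi> c))))"
      by (intro sws_cong_len cochain_cong[OF g]) (use b in \<open>simp_all add: rotate_form\<close>)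
    finally show "(hshift ^^ k) g b (rotate_form (S (\<pi> a) * \<pi> c) \<psi>) = sws b (\<lambda>b1 r. sws r (\<lambda>b2 b3. g b2 (?Y (S (\<pi> b1) * \<pi> b3) (S (\<pi> a) * \<pi> c))))" .
  qed
  also have "\<dots> = sws us (\<lambda>p1 r. sws r (\<lambda>p2 r. sws r (\<lambda>m r. sws r (\<lambda>q1 q2. g m (?Y (S (\<pi> p2) * \<pi> q1) (S (\<pi> p1) * \<pi> q2))))))"
    by (simp only: sws_coassoc)
  also have "\<dots> = sws us (\<lambda>a r. sws a (\<lambda>p1 p2. sws r (\<lambda>b c. sws c (\<lambda>q1 q2. g b (?Y (S (\<pi> p2) * \<pi> q1) (S (\<pi> p1) * \<pi> q2))))))"
    by (simp only: sws_coassoc)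
  also have "\<dots> = sws us (\<lambda>a r. sws r (\<lambda>b c. sws a (\<lambda>p1 p2. sws c (\<lambda>q1 q2. g b (?Y (S (\<pi> p2) * \<pi> q1) (S (\<pi> p1) * \<pi> q2))))))"
    by (rule sws_cong_len, rule sws_swap)
  also have "\<dots> = sws us (\<lambda>a r. sws r (\<lambda>b c. g b (\<lambda>v. R (Suc k) (S (\<pi> a) * \<pi> c) (\<lambda>x. \<psi> (drop (Suc k) v @ x)) (take (Suc k) v))))"
  proof (intro sws_cong_len)
    fix a b c r :: "'h list" assume "length r = length us" "length b = length r"
    then have b: "length b = p" using Suc.prems by simp
    have "g b (\<lambda>v. R (Suc k) (S (\<pi> a) * \<pi> c) (\<lambda>x. \<psi> (drop (Suc k) v @ x)) (take (Suc k) v))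
      = g b (\<lambda>v. sws a (\<lambda>p1 p2. sws c (\<lambda>q1 q2. ?Y (S (\<pi> p2) * \<pi> q1) (S (\<pi> p1) * \<pi> q2) v)))"
    proof (rule cochain_cong[OF g b])
      fix v :: "'h list" assume v: "length v = Suc q"
      have k: "k < length v" using v Suc.prems by simp
      have "R (Suc k) (S (\<pi> a) * \<pi> c) (\<lambda>x. \<psi> (drop (Suc k) v @ x)) (take (Suc k) v) = sw (S (\<pi> a) * \<pi> c) (\<lambda>g1 t. ?Y g1 t v)"
        unfolding take_Suc_conv_app_nth[OF k] by (rule R_snoc) (use k in simp)
      also have "\<dots> = sws a (\<lambda>p1 p2. sws c (\<lambda>q1 q2. ?Y (S (\<pi> p2) * \<pi> q1) (S (\<pi> p1) * \<pi> q2) v))"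
      proof (rule sw_S_prod_prod)
        show "lin (\<lambda>g1. ?Y g1 t v)" for t by (rule lin_R1[OF linH_id])
        show "lin (\<lambda>t. ?Y g1 t v)" for g1
          by (rule lin_R2, rule lin_mlD[OF Suc.prems(2)], intro entry_lin_append2 entry_lin_Cons1 linH_mult_left linH_id) (use k v in simp_all)
      qed
      finally show "R (Suc k) (S (\<pi> a) * \<pi> c) (\<lambda>x. \<psi> (drop (Suc k) v @ x)) (take (Suc k) v) = sws a (\<lambda>p1 p2. sws c (\<lambda>q1 q2. ?Y (S (\<pi> p2) * \<pi> q1) (S (\<pi> p1) * \<pi> q2) v))" .
    qed
    then show "sws a (\<lambda>p1 p2. sws c (\<lambda>q1 q2. g b (?Y (S (\<pi> p2) * \<pi> q1) (S (\<pi> p1) * \<pi> q2))))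
      = g b (\<lambda>v. R (Suc k) (S (\<pi> a) * \<pi> c) (\<lambda>x. \<psi> (drop (Suc k) v @ x)) (take (Suc k) v))"
      by (simp only: cochain_swap[OF g b])
  qed
  finally show ?case .
qed

lemma tau_coalg_pow_in: "f \<in> GS H p q \<Longrightarrow> (tau_coalg H p q ^^ k) f \<in> GS H p q"
  by (induction k) (simp_all add: tau_coalg_in)

lemma ev_tau_coalg_pow:
  assumes f: "f \<in> GS H p q" and q: "q \<noteq> 0"
  shows "length us = p \<Longrightarrow> ml q \<psi> \<Longrightarrow> ev ((tau_coalg H p q ^^ k) f) us \<psi> = hdegen q ((hshift ^^ k) (ev (delta_h H p q 0 f))) us \<psi>"
proof (induction k arbitrary: us \<psi>)
  case 0
  then show ?case by (simp add: hdegen_delta_h_0[OF f])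
next
  case (Suc k)
  let ?g = "(hshift ^^ k) (ev (delta_h H p q 0 f))"
  have d: "cochain p (Suc q) (ev (delta_h H p q 0 f))" by (rule cochain_ev[OF delta_h_in[OF f]]) simp
  have "ev ((tau_coalg H p q ^^ Suc k) f) us \<psi> = htau q (ev ((tau_coalg H p q ^^ k) f)) us \<psi>"
    using ev_tau_coalg[OF tau_coalg_pow_in[OF f] q Suc.prems] by simp
  also have "\<dots> = htau q (hdegen q ?g) us \<psi>"
    unfolding htau_def[of _ "hdegen q ?g"] by (rule htau_cong) (use Suc q in \<open>simp add: ml_tau_form'\<close>)
  also have "\<dots> = hdegen q (hshift ?g) us \<psi>"
    by (rule htau_hdegen[OF cochain_hshift_pow[OF d]]) (use Suc.prems q in simp_all)
  finally show ?case by simp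
qed

text \<open>\<open>\<tau>\<^sup>q\<^sup>+\<^sup>1 f(u) = U\<^sub>1 S(U\<^sub>4) \<triangleright> f(u\<^sub>3) \<triangleleft> S(U\<^sub>2) U\<^sub>5\<close>. For \<open>g = \<delta>\<^sub>0 f\<close> and the full rotation the factors are in their
original order again, multiplied by \<open>S(U\<^sub>1) U\<^sub>3\<close> from the right; applying \<open>\<iota>\<close> contracts the first one.\<close>

lemma tau_coalg_full_power:
  assumes f: "f \<in> GS H p q" and us: "length us = p" and ml: "ml q \<psi>"
  shows "ev ((tau_coalg H p q ^^ Suc q) f) us \<psi> =
    sws us (\<lambda>a r. sws r (\<lambda>b r. sws r (\<lambda>c r. sws r (\<lambda>d e.
      ev f c (R q (S (\<pi> b) * \<pi> e) (L q (\<pi> a * S (\<pi> d)) \<psi>))))))"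
proof (cases "q = 0")
  case True
  have "sws us (\<lambda>a r. sws r (\<lambda>b r. sws r (\<lambda>c r. sws r (\<lambda>d e. ev f c (R q (S (\<pi> b) * \<pi> e) (L q (\<pi> a * S (\<pi> d)) \<psi>))))))
    = sws us (\<lambda>a r. sws r (\<lambda>b r. sws r (\<lambda>c r. sws r (\<lambda>d e. counits a * (counits b * (counits d * (counits e * ev f c \<psi>)))))))"
  proof (intro sws_cong_len)
    fix a b c d e r s t :: "'h list" assume "length r = length us" "length s = length r" "length c = length s"
    then have c: "length c = p" using us by simp
    have "ev f c (R q (S (\<pi> b) * \<pi> e) (L q (\<pi> a * S (\<pi> d)) \<psi>)) = ev f c (\<lambda>v. counits a * (counits b * (counits d * (counits e * \<psi> v))))"
      by (rule ev_cong[OF f c]) (simp add: True R_0 L_0 counit_mult counit_antipode counit_prod mult.assoc mult.left_commute)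
    then show "ev f c (R q (S (\<pi> b) * \<pi> e) (L q (\<pi> a * S (\<pi> d)) \<psi>)) = counits a * (counits b * (counits d * (counits e * ev f c \<psi>)))"
      by (simp add: ev_swap[OF f c])
  qed
  also have "\<dots> = sws us (\<lambda>a r. sws r (\<lambda>b r. sws r (\<lambda>c r. counits a * (counits b * (counits r * ev f c \<psi>)))))"
  proof (intro sws_cong_len)
    fix a b c r :: "'h list"
    have "sws r (\<lambda>d e. counits d * counits e) = counits r" by (rule sws_counit_left) (rule mlI, rule lin_counits, rule entry_lin_slot)
    then show "sws r (\<lambda>d e. counits a * (counits b * (counits d * (counits e * ev f c \<psi>)))) = counits a * (counits b * (counits r * ev f c \<psi>))"
      using sws_mult_right[of r "\<lambda>d e. counits d * counits e" "ev f c \<psi>"] by (simp add: sws_mult_left mult.assoc)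
  qed
  also have "\<dots> = ev f us \<psi>"
    using us ml_ev[OF f] by (simp add: sws_mult_left sws_counit_left sws_counit_right cong: sws_cong)
  finally show ?thesis using True by (simp add: tau_coalg_0)
next
  case False
  let ?g = "ev (delta_h H p q 0 f)"
  have d: "cochain p (Suc q) ?g" by (rule cochain_ev[OF delta_h_in[OF f]]) simp
  let ?M = "\<lambda>a0 p1 t m q1 q2. ev f m (R q (S (\<pi> p1) * \<pi> q2) (L q (\<pi> a0 * S (\<pi> q1) * t) \<psi>))"
  have lt: "lin (\<lambda>t. ?M a0 p1 t m q1 q2)" if "length m = p" for a0 p1 t m q1 q2
    using that by - (rule lin_ev2[OF f], rule lin_R2, intro lin_L1 linH_mult_left linH_id, simp_all)
  have inner: "(hshift ^^ Suc q) ?g b0 (contract_form q (\<pi> a0) \<psi>) = sws b0 (\<lambda>b1 r. sws r (\<lambda>b2 b3. sws b2 (\<lambda>m1 m2. sws b1 (\<lambda>p1 p2. sws b3 (\<lambda>q1 q2.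
      ?M a0 p1 (\<pi> p2 * S (\<pi> m1)) m2 q1 q2)))))" if b0: "length b0 = p" for a0 b0
  proof -
    have "(hshift ^^ Suc q) ?g b0 (contract_form q (\<pi> a0) \<psi>) = sws b0 (\<lambda>b1 r. sws r (\<lambda>b2 b3. ?g b2 (\<lambda>v. R (Suc q) (S (\<pi> b1) * \<pi> b3) (\<lambda>x. contract_form q (\<pi> a0) \<psi> (drop (Suc q) v @ x)) (take (Suc q) v))))"
      by (rule hshift_power[OF d b0 ml_contract_form[OF ml]]) simp
    also have "\<dots> = sws b0 (\<lambda>b1 r. sws r (\<lambda>b2 b3. ?g b2 (R (Suc q) (S (\<pi> b1) * \<pi> b3) (contract_form q (\<pi> a0) \<psi>))))"
      by (intro sws_cong_len cochain_cong[OF d]) (use b0 in simp_all)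
    also have "\<dots> = sws b0 (\<lambda>b1 r. sws r (\<lambda>b2 b3. sws b2 (\<lambda>m1 m2. ev f m2 (\<lambda>v. R (Suc q) (S (\<pi> b1) * \<pi> b3) (contract_form q (\<pi> a0) \<psi>) (\<pi> m1 # v)))))"
      by (intro sws_cong_len delta_h_0(2)[OF f]) (use b0 in \<open>simp_all add: ml_R ml_contract_form ml\<close>)
    also have "\<dots> = sws b0 (\<lambda>b1 r. sws r (\<lambda>b2 b3. sws b2 (\<lambda>m1 m2. ev f m2 (\<lambda>v. sws b1 (\<lambda>p1 p2. sws b3 (\<lambda>q1 q2.
        R q (S (\<pi> p1) * \<pi> q2) (L q (\<pi> a0 * S (\<pi> q1) * (\<pi> p2 * S (\<pi> m1))) \<psi>) v))))))"
    proof (intro sws_cong_len ev_cong[OF f])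
      fix b1 b3 m1 v :: "'h list" assume v: "length v = q"
      have "R (Suc q) (S (\<pi> b1) * \<pi> b3) (contract_form q (\<pi> a0) \<psi>) (\<pi> m1 # v) = sw (S (\<pi> b1) * \<pi> b3) (\<lambda>g1 g2. R q g2 (L q (\<pi> a0 * (S g1 * S (\<pi> m1))) \<psi>) v)"
        unfolding R_Cons by (intro sw_cong_bas R_cong v) (simp add: contract_form_Cons antipode_mult)
      also have "\<dots> = sws b1 (\<lambda>p1 p2. sws b3 (\<lambda>q1 q2. R q (S (\<pi> p1) * \<pi> q2) (L q (\<pi> a0 * (S (S (\<pi> p2) * \<pi> q1) * S (\<pi> m1))) \<psi>) v))"
        by (rule sw_S_prod_prod) (rule lin_R2, intro lin_L1 linH_mult_left linH_mult_right linH_antipode linH_id, rule v, rule lin_R1[OF linH_id])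
      finally show "R (Suc q) (S (\<pi> b1) * \<pi> b3) (contract_form q (\<pi> a0) \<psi>) (\<pi> m1 # v) = sws b1 (\<lambda>p1 p2. sws b3 (\<lambda>q1 q2.
        R q (S (\<pi> p1) * \<pi> q2) (L q (\<pi> a0 * S (\<pi> q1) * (\<pi> p2 * S (\<pi> m1))) \<psi>) v))"
        by (simp add: antipode_mult mult.assoc)
    qed (use b0 in simp)
    also have "\<dots> = sws b0 (\<lambda>b1 r. sws r (\<lambda>b2 b3. sws b2 (\<lambda>m1 m2. sws b1 (\<lambda>p1 p2. sws b3 (\<lambda>q1 q2.
      ?M a0 p1 (\<pi> p2 * S (\<pi> m1)) m2 q1 q2)))))"
      by (intro sws_cong_len) (use b0 in \<open>simp add: ev_swap[OF f]\<close>)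
    finally show ?thesis .
  qed
  have "ev ((tau_coalg H p q ^^ Suc q) f) us \<psi> = sws us (\<lambda>a0 b0. sws b0 (\<lambda>b1 r. sws r (\<lambda>b2 b3. sws b2 (\<lambda>m1 m2. sws b1 (\<lambda>p1 p2. sws b3 (\<lambda>q1 q2.
      ?M a0 p1 (\<pi> p2 * S (\<pi> m1)) m2 q1 q2))))))"
    unfolding ev_tau_coalg_pow[OF f False us ml] hdegen_def by (intro sws_cong_len inner) (use us in simp)
  also have "\<dots> = sws us (\<lambda>a0 b0. sws b0 (\<lambda>b1 r. sws b1 (\<lambda>p1 p2. sws r (\<lambda>b2 b3. sws b2 (\<lambda>m1 m2. sws b3 (\<lambda>q1 q2.
      ?M a0 p1 (\<pi> p2 * S (\<pi> m1)) m2 q1 q2))))))"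
    by (intro sws_cong_len, subst sws_swap, subst (2) sws_swap) (rule refl)
  also have "\<dots> = sws us (\<lambda>a0 r. sws r (\<lambda>p1 r. sws r (\<lambda>p2 r. sws r (\<lambda>m1 r. sws r (\<lambda>m2 r. sws r (\<lambda>q1 q2.
      ?M a0 p1 (\<pi> p2 * S (\<pi> m1)) m2 q1 q2))))))"
    by (simp only: sws_coassoc)
  also have "\<dots> = sws us (\<lambda>a0 r. sws r (\<lambda>p1 r. sws r (\<lambda>m2 r. sws r (\<lambda>q1 q2. ?M a0 p1 1 m2 q1 q2))))"
  proof (rule sws_cong_len, rule sws_cong_len)
    fix a0 p1 r s :: "'h list" assume "length s = length us" "length r = length s"
    then have r: "length r = p" using us by simp
    show "sws r (\<lambda>p2 r. sws r (\<lambda>m1 r. sws r (\<lambda>m2 r. sws r (\<lambda>q1 q2. ?M a0 p1 (\<pi> p2 * S (\<pi> m1)) m2 q1 q2))))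
      = sws r (\<lambda>m2 r. sws r (\<lambda>q1 q2. ?M a0 p1 1 m2 q1 q2))"
    proof (rule sws_cancel_left[where G = "\<lambda>r. sws r (\<lambda>m2 r. sws r (\<lambda>q1 q2. ?M a0 p1 1 m2 q1 q2))"])
      fix m c :: "'h list" assume "length c = length r"
      then show "sws m (\<lambda>p2 m1. sws c (\<lambda>m2 r. sws r (\<lambda>q1 q2. ?M a0 p1 (\<pi> p2 * S (\<pi> m1)) m2 q1 q2)))
        = counits m * sws c (\<lambda>m2 r. sws r (\<lambda>q1 q2. ?M a0 p1 1 m2 q1 q2))"
        by (intro sws_cancel2[where F = "\<lambda>t. sws c (\<lambda>m2 r. sws r (\<lambda>q1 q2. ?M a0 p1 t m2 q1 q2))"] lin_sws2 lt) (use r in simp)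
    qed (rule ml_sws1)
  qed
  finally show ?thesis by simp
qed


section \<open>The two full powers are inverse to each other\<close>

lemma cochain_lin_LR:
  assumes g: "cochain p q g" and us: "length us = p"
  shows "lin (\<lambda>t. g us (R q (x * t * x') (L q y \<psi>)))" "lin (\<lambda>t. g us (R q x (L q (y * t * y') \<psi>)))"
  by (rule cochain_lin2[OF g us], intro lin_R1 linH_mult_left linH_mult_right linH_id)
    (rule cochain_lin2[OF g us], rule lin_R2, intro lin_L1 linH_mult_left linH_mult_right linH_id)

text \<open>Inserting one full power into the other gives nine legs. Four pairs of adjacent legs cancel one after
another, until \<open>f(u)\<close> remains.\<close>

lemma cylindrical_identity:
  assumes f: "f \<in> GS H p q"
  shows "(tau_alg H p q ^^ Suc p) ((tau_coalg H p q ^^ Suc q) f) = f"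
proof (rule GS_eqI[OF _ f])
  let ?h = "(tau_coalg H p q ^^ Suc q) f"
  have h: "?h \<in> GS H p q" by (rule tau_coalg_pow_in[OF f])
  show "(tau_alg H p q ^^ Suc p) ?h \<in> GS H p q" by (rule tau_alg_pow_in[OF h])
  fix us :: "'h list" and \<psi> assume us: "length us = p" and ml: "ml q \<psi>"
  let ?X = "\<lambda>u x y. ev f u (R q x (L q y \<psi>))"
  note g = cochain_ev[OF f]
  have lX: "lin (\<lambda>t. ?X u (x * t * x') y)" "lin (\<lambda>t. ?X u x (y * t * y'))" if "length u = p" for u x x' y y'
    using cochain_lin_LR[OF g that] by auto
  have mlX: "ml p (\<lambda>u. ?X u x y)" for x y by (rule cochain_ml[OF g])
  have "ev ((tau_alg H p q ^^ Suc p) ?h) us \<psi> = sws us (\<lambda>a r. sws r (\<lambda>b r. sws r (\<lambda>c r. sws r (\<lambda>d e.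
      ev ?h c (R q (S (\<pi> d) * \<pi> a) (L q (\<pi> e * S (\<pi> b)) \<psi>))))))"
    by (rule tau_alg_full_power[OF h us ml])
  also have "\<dots> = sws us (\<lambda>a r. sws r (\<lambda>b r. sws r (\<lambda>c r. sws r (\<lambda>d e.
      sws c (\<lambda>a' r. sws r (\<lambda>b' r. sws r (\<lambda>c' r. sws r (\<lambda>d' e'.
        ?X c' (S (\<pi> b') * (\<pi> e' * S (\<pi> d)) * \<pi> a) (\<pi> e * (S (\<pi> b) * \<pi> a') * S (\<pi> d'))))))))))"
  proof (intro sws_cong_len)
    fix a b c d e r s t :: "'h list" assume "length r = length us" "length s = length r" "length c = length s"
    then have c: "length c = p" using us by simp
    show "ev ?h c (R q (S (\<pi> d) * \<pi> a) (L q (\<pi> e * S (\<pi> b)) \<psi>)) = sws c (\<lambda>a' r. sws r (\<lambda>b' r. sws r (\<lambda>c' r. sws r (\<lambda>d' e'.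
        ?X c' (S (\<pi> b') * (\<pi> e' * S (\<pi> d)) * \<pi> a) (\<pi> e * (S (\<pi> b) * \<pi> a') * S (\<pi> d'))))))"
      unfolding tau_coalg_full_power[OF f c ml_R[OF ml_L[OF ml]]]
      by (intro sws_cong_len ev_cong[OF f]) (use c in \<open>simp_all add: LR_simps ml ml_L ml_R cong: R_cong\<close>, simp_all add: mult.assoc)
  qed
  also have "\<dots> = sws us (\<lambda>a r. sws r (\<lambda>b r. sws r (\<lambda>c t. sws c (\<lambda>a' r. sws r (\<lambda>b' r. sws r (\<lambda>c' r. sws r (\<lambda>d' e'. sws t (\<lambda>d e.
        ?X c' (S (\<pi> b') * (\<pi> e' * S (\<pi> d)) * \<pi> a) (\<pi> e * (S (\<pi> b) * \<pi> a') * S (\<pi> d'))))))))))"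
  proof (rule sws_cong_len, rule sws_cong_len, rule sws_cong_len)
    fix a b c t :: "'h list"
    let ?Z = "\<lambda>a' b' c' d' e' d e. ?X c' (S (\<pi> b') * (\<pi> e' * S (\<pi> d)) * \<pi> a) (\<pi> e * (S (\<pi> b) * \<pi> a') * S (\<pi> d'))"
    show "sws t (\<lambda>d e. sws c (\<lambda>a' r. sws r (\<lambda>b' r. sws r (\<lambda>c' r. sws r (\<lambda>d' e'. ?Z a' b' c' d' e' d e)))))
      = sws c (\<lambda>a' r. sws r (\<lambda>b' r. sws r (\<lambda>c' r. sws r (\<lambda>d' e'. sws t (\<lambda>d e. ?Z a' b' c' d' e' d e)))))"
      by (simp only: sws_swap[of t])
  qed
  also have "\<dots> = sws us (\<lambda>a r. sws r (\<lambda>b r. sws r (\<lambda>a' r. sws r (\<lambda>b' r. sws r (\<lambda>c' r. sws r (\<lambda>d' r. sws r (\<lambda>e' r. sws r (\<lambda>d e.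
        ?X c' (S (\<pi> b') * (\<pi> e' * S (\<pi> d)) * \<pi> a) (\<pi> e * (S (\<pi> b) * \<pi> a') * S (\<pi> d'))))))))))"
    by (simp only: sws_coassoc)
  \<comment> \<open>the adjacent legs \<open>b\<close>, \<open>a'\<close> cancel\<close>
  also have "\<dots> = sws us (\<lambda>a r. sws r (\<lambda>b' r. sws r (\<lambda>c' r. sws r (\<lambda>d' r. sws r (\<lambda>e' r. sws r (\<lambda>d e.
        ?X c' (S (\<pi> b') * (\<pi> e' * S (\<pi> d)) * \<pi> a) (\<pi> e * 1 * S (\<pi> d'))))))))"
  proof (rule sws_cong_len)
    fix a r :: "'h list" assume r: "length r = length us"
    let ?G = "\<lambda>t r. sws r (\<lambda>b' r. sws r (\<lambda>c' r. sws r (\<lambda>d' r. sws r (\<lambda>e' r. sws r (\<lambda>d e.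
        ?X c' (S (\<pi> b') * (\<pi> e' * S (\<pi> d)) * \<pi> a) (\<pi> e * t * S (\<pi> d')))))))"
    show "sws r (\<lambda>b r. sws r (\<lambda>a' r. ?G (S (\<pi> b) * \<pi> a') r)) = ?G 1 r"
    proof (rule sws_cancel_left[where G = "?G 1"])
      fix m c :: "'h list" assume "length c = length r"
      then show "sws m (\<lambda>b a'. ?G (S (\<pi> b) * \<pi> a') c) = counits m * ?G 1 c"
        by (intro sws_cancel1[where F = "\<lambda>t. ?G t c"] lin_sws2 lX) (use r us in simp)
    qed (rule ml_sws1)
  qed
  \<comment> \<open>then \<open>e'\<close>, \<open>d\<close>\<close>
  also have "\<dots> = sws us (\<lambda>a r. sws r (\<lambda>b' r. sws r (\<lambda>c' r. sws r (\<lambda>d' e.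
        ?X c' (S (\<pi> b') * 1 * \<pi> a) (\<pi> e * 1 * S (\<pi> d'))))))"
  proof (intro sws_cong_len)
    fix a b' c' d' r s t u :: "'h list" assume "length r = length us" "length s = length r" "length c' = length s"
    then have c: "length c' = p" using us by simp
    let ?G = "\<lambda>t e. ?X c' (S (\<pi> b') * t * \<pi> a) (\<pi> e * 1 * S (\<pi> d'))"
    show "sws t (\<lambda>e' r. sws r (\<lambda>d e. ?G (\<pi> e' * S (\<pi> d)) e)) = ?G 1 t"
      by (rule sws_cancel_left[where G = "?G 1"])
        (rule sws_cancel2[where F = "\<lambda>t. ?G t _"], rule lX[OF c], rule mlI, rule cochain_lin2[OF g c], rule lin_R2,
          intro lin_L1 linH_mult_right linH_prod entry_lin_slot)
  qed
  \<comment> \<open>then \<open>d'\<close>, \<open>e\<close>\<close>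
  also have "\<dots> = sws us (\<lambda>a r. sws r (\<lambda>b' r. sws r (\<lambda>c' r. counits r * ?X c' (S (\<pi> b') * 1 * \<pi> a) 1)))"
  proof (intro sws_cong_len)
    fix a b' c' r s t :: "'h list" assume "length r = length us" "length s = length r" "length c' = length s"
    then have c: "length c' = p" using us by simp
    have "sws t (\<lambda>d' e. ?X c' (S (\<pi> b') * 1 * \<pi> a) (1 * (\<pi> e * S (\<pi> d')) * 1)) = counits t * ?X c' (S (\<pi> b') * 1 * \<pi> a) (1 * 1 * 1)"
      by (rule sws_cancel4[where F = "\<lambda>t. ?X c' (S (\<pi> b') * 1 * \<pi> a) (1 * t * 1)"], rule lX[OF c])
    then show "sws t (\<lambda>d' e. ?X c' (S (\<pi> b') * 1 * \<pi> a) (\<pi> e * 1 * S (\<pi> d'))) = counits t * ?X c' (S (\<pi> b') * 1 * \<pi> a) 1"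
      by simp
  qed
  also have "\<dots> = sws us (\<lambda>a r. sws r (\<lambda>b' c'. ?X c' (1 * (S (\<pi> b') * \<pi> a) * 1) 1))"
    by (intro sws_cong_len) (use us mlX in \<open>simp add: sws_counit_right\<close>)
  \<comment> \<open>and finally \<open>a\<close>, \<open>b'\<close>\<close>
  also have "\<dots> = ?X us (1 * 1 * 1) 1"
    by (rule sws_cancel_left[where G = "\<lambda>u. ?X u (1 * 1 * 1) 1"])
      (rule sws_cancel3[where F = "\<lambda>t. ?X _ (1 * t * 1) 1"], rule lX, use us mlX in simp_all)
  also have "\<dots> = ev f us \<psi>"
    by (rule ev_cong[OF f us]) (simp add: R_one L_one ml ml_L)
  finally show "ev ((tau_alg H p q ^^ Suc p) ?h) us \<psi> = ev f us \<psi>" .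
qed


section \<open>Horizontal maps induced by bimodule maps\<close>

text \<open>Transposes of linear maps between tensor powers that are compatible with both diagonal actions.\<close>

definition bimodule_op :: "nat \<Rightarrow> nat \<Rightarrow> (('h list \<Rightarrow> 'k) \<Rightarrow> 'h list \<Rightarrow> 'k) \<Rightarrow> bool" where
  "bimodule_op n m D \<longleftrightarrow> (\<forall>\<psi>. ml m \<psi> \<longrightarrow> ml n (D \<psi>) \<and>
     (\<forall>g v. length v = n \<longrightarrow> L n g (D \<psi>) v = D (L m g \<psi>) v \<and> R n g (D \<psi>) v = D (R m g \<psi>) v))"

lemma bimodule_op_dup: "1 \<le> i \<Longrightarrow> i \<le> n \<Longrightarrow> bimodule_op n (Suc n) (dup i)"
  by (simp add: bimodule_op_def ml_dup L_dup)

lemma bimodule_op_del: "j \<le> n \<Longrightarrow> bimodule_op (Suc n) n (del j)"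
  by (simp add: bimodule_op_def ml_del L_del)

lemma bimodule_op_ml: "bimodule_op n m D \<Longrightarrow> ml m \<psi> \<Longrightarrow> ml n (D \<psi>)"
  by (simp add: bimodule_op_def)

lemma bimodule_op_L: "bimodule_op n m D \<Longrightarrow> ml m \<psi> \<Longrightarrow> length v = n \<Longrightarrow> L n g (D \<psi>) v = D (L m g \<psi>) v"
  and bimodule_op_R: "bimodule_op n m D \<Longrightarrow> ml m \<psi> \<Longrightarrow> length v = n \<Longrightarrow> R n g (D \<psi>) v = D (R m g \<psi>) v"
  by (simp_all add: bimodule_op_def)

context
  fixes n m D and P :: "nat \<Rightarrow> (('k, 'h) tensor \<Rightarrow> ('k, 'h) tensor) \<Rightarrow> ('k, 'h) tensor \<Rightarrow> ('k, 'h) tensor"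
  assumes D: "bimodule_op n m D"
    and P_in: "\<And>p f. f \<in> GS H p n \<Longrightarrow> P p f \<in> GS H p m"
    and P_ev: "\<And>p f us \<psi>. f \<in> GS H p n \<Longrightarrow> length us = p \<Longrightarrow> ml m \<psi> \<Longrightarrow> ev (P p f) us \<psi> = ev f us (D \<psi>)"
begin

lemma bimodule_op_delta_v:
  assumes f: "f \<in> GS H p n" and i: "i \<le> Suc p"
  shows "delta_v H p m i (P p f) = P (Suc p) (delta_v H p n i f)"
proof (rule GS_eqI[of _ "Suc p" m])
  note Pf = P_in[OF f]
  have d: "delta_v H p n i f \<in> GS H (Suc p) n" by (rule delta_v_in[OF f i])
  show "delta_v H p m i (P p f) \<in> GS H (Suc p) m" by (rule delta_v_in[OF Pf i])
  show "P (Suc p) (delta_v H p n i f) \<in> GS H (Suc p) m" by (rule P_in[OF d])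
  fix us :: "'h list" and \<psi> assume us: "length us = Suc p" and ml: "ml m \<psi>"
  have rhs: "ev (P (Suc p) (delta_v H p n i f)) us \<psi> = ev (delta_v H p n i f) us (D \<psi>)" by (rule P_ev[OF d us ml])
  consider "i = 0" | "i = Suc p" | "1 \<le> i" "i \<le> p" using i by linarith
  then show "ev (delta_v H p m i (P p f)) us \<psi> = ev (P (Suc p) (delta_v H p n i f)) us \<psi>"
    unfolding rhs
  proof cases
    case 1
    obtain u w where u: "us = u # w" "length w = p" using us by (auto simp: len_Suc)
    have "ev f w (D (L m u \<psi>)) = ev f w (L n u (D \<psi>))"
      by (rule ev_cong[OF f u(2)]) (simp add: bimodule_op_L[OF D ml])
    then show "ev (delta_v H p m i (P p f)) us \<psi> = ev (delta_v H p n i f) us (D \<psi>)"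
      using 1 u by (simp add: delta_v_0(2)[OF Pf] delta_v_0(2)[OF f] P_ev[OF f] ml ml_L bimodule_op_ml[OF D])
  next
    case 2
    obtain w u where u: "us = w @ [u]" "length w = p" using us by (cases us rule: rev_cases) auto
    have "ev f w (D (R m u \<psi>)) = ev f w (R n u (D \<psi>))"
      by (rule ev_cong[OF f u(2)]) (simp add: bimodule_op_R[OF D ml])
    then show "ev (delta_v H p m i (P p f)) us \<psi> = ev (delta_v H p n i f) us (D \<psi>)"
      using 2 u by (simp add: delta_v_last(2)[OF Pf] delta_v_last(2)[OF f] P_ev[OF f] ml ml_R bimodule_op_ml[OF D])
  next
    case 3
    then show "ev (delta_v H p m i (P p f)) us \<psi> = ev (delta_v H p n i f) us (D \<psi>)"
      using us by (simp add: delta_v_mid(2)[OF Pf] delta_v_mid(2)[OF f] P_ev[OF f] ml length_merge)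
  qed
qed

lemma bimodule_op_sigma_v:
  assumes f: "f \<in> GS H (Suc p) n" and i: "i \<le> p"
  shows "sigma_v H (Suc p) m i (P (Suc p) f) = P p (sigma_v H (Suc p) n i f)"
proof (rule GS_eqI[of _ p m])
  note Pf = P_in[OF f]
  have d: "sigma_v H (Suc p) n i f \<in> GS H p n" by (rule sigma_v(1)[OF f i])
  show "sigma_v H (Suc p) m i (P (Suc p) f) \<in> GS H p m" by (rule sigma_v(1)[OF Pf i])
  show "P p (sigma_v H (Suc p) n i f) \<in> GS H p m" by (rule P_in[OF d])
  fix us :: "'h list" and \<psi> assume us: "length us = p" and ml: "ml m \<psi>"
  show "ev (sigma_v H (Suc p) m i (P (Suc p) f)) us \<psi> = ev (P p (sigma_v H (Suc p) n i f)) us \<psi>"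
    using us i by (simp add: P_ev[OF d us ml] sigma_v(2)[OF Pf i us] sigma_v(2)[OF f i us] P_ev[OF f _ ml] length_insert_one)
qed

lemma bimodule_op_tau_alg:
  assumes f: "f \<in> GS H p n"
  shows "tau_alg H p m (P p f) = P p (tau_alg H p n f)"
proof (cases p)
  case 0
  then show ?thesis by (simp add: tau_alg_0)
next
  case (Suc k)
  note Pf = P_in[OF f]
  have t: "tau_alg H p n f \<in> GS H p n" by (rule tau_alg_in[OF f])
  show ?thesis
  proof (rule GS_eqI[of _ p m])
    show "tau_alg H p m (P p f) \<in> GS H p m" by (rule tau_alg_in[OF Pf])
    show "P p (tau_alg H p n f) \<in> GS H p m" by (rule P_in[OF t])
    fix us :: "'h list" and \<psi> assume us: "length us = p" and ml: "ml m \<psi>"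
    have "ev (tau_alg H p m (P p f)) us \<psi> = vtau m (ev (P p f)) us \<psi>"
      using Pf us ml Suc by (simp add: ev_tau_alg)
    also have "\<dots> = vtau n (ev f) us (D \<psi>)"
      unfolding vtau_def[of n]
    proof (rule vtau_cong)
      show "length us = Suc k" using us Suc by simp
      fix a b c :: "'h list" assume "length a = Suc k"
      then have len: "length (S (\<pi> b) # butlast a) = p" using Suc by simp
      have "ev (P p f) (S (\<pi> b) # butlast a) (R m (last a) (L m (\<pi> c) \<psi>)) = ev f (S (\<pi> b) # butlast a) (D (R m (last a) (L m (\<pi> c) \<psi>)))"
        by (rule P_ev[OF f len]) (simp add: ml_R ml_L ml)
      also have "\<dots> = ev f (S (\<pi> b) # butlast a) (R n (last a) (L n (\<pi> c) (D \<psi>)))"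
      proof (rule ev_cong[OF f len])
        fix v :: "'h list" assume v: "length v = n"
        have "R n (last a) (L n (\<pi> c) (D \<psi>)) v = R n (last a) (D (L m (\<pi> c) \<psi>)) v"
          by (rule R_cong[OF _ v]) (simp add: bimodule_op_L[OF D ml])
        then show "D (R m (last a) (L m (\<pi> c) \<psi>)) v = R n (last a) (L n (\<pi> c) (D \<psi>)) v"
          by (simp add: bimodule_op_R[OF D ml_L[OF ml] v])
      qed
      finally show "ev (P p f) (S (\<pi> b) # butlast a) (R m (last a) (L m (\<pi> c) \<psi>)) = ev f (S (\<pi> b) # butlast a) (R n (last a) (L n (\<pi> c) (D \<psi>)))" .
    qed
    also have "\<dots> = ev (P p (tau_alg H p n f)) us \<psi>"
      unfolding P_ev[OF t us ml]
      using ev_tau_alg[of f k n us "D \<psi>"] f us Suc bimodule_op_ml[OF D ml] by simp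
    finally show "ev (tau_alg H p m (P p f)) us \<psi> = ev (P p (tau_alg H p n f)) us \<psi>" .
  qed
qed

end


section \<open>Vertical maps induced by maps of coalgebras\<close>

context
  fixes p p' \<phi> and Q :: "nat \<Rightarrow> (('k, 'h) tensor \<Rightarrow> ('k, 'h) tensor) \<Rightarrow> ('k, 'h) tensor \<Rightarrow> ('k, 'h) tensor"
  assumes \<phi>: "coalgebra_map p' p \<phi>"
    and Q_in: "\<And>q f. f \<in> GS H p q \<Longrightarrow> Q q f \<in> GS H p' q"
    and Q_ev: "\<And>q f us \<psi>. f \<in> GS H p q \<Longrightarrow> length us = p' \<Longrightarrow> ev (Q q f) us \<psi> = ev f (\<phi> us) \<psi>"
begin

lemma coalgebra_map_delta_h_0:
  assumes f: "f \<in> GS H p q"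
  shows "Q (Suc q) (delta_h H p q 0 f) = delta_h H p' q 0 (Q q f)"
proof (rule GS_eqI[of _ p' "Suc q"])
  have d: "delta_h H p q 0 f \<in> GS H p (Suc q)" by (rule delta_h_in[OF f]) simp
  show "Q (Suc q) (delta_h H p q 0 f) \<in> GS H p' (Suc q)" by (rule Q_in[OF d])
  show "delta_h H p' q 0 (Q q f) \<in> GS H p' (Suc q)" by (rule delta_h_in[OF Q_in[OF f]]) simp
  fix us :: "'h list" and \<psi> assume us: "length us = p'" and ml: "ml (Suc q) \<psi>"
  have "ev (Q (Suc q) (delta_h H p q 0 f)) us \<psi> = sws (\<phi> us) (\<lambda>a b. ev f b (\<lambda>v. \<psi> (\<pi> a # v)))"
    by (simp add: Q_ev[OF d us] delta_h_0(2)[OF f _ ml] coalgebra_map_length[OF \<phi> us])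
  also have "\<dots> = sws us (\<lambda>a b. ev f (\<phi> b) (\<lambda>v. \<psi> (\<pi> (\<phi> a) # v)))"
  proof (rule coalgebra_map_sws[OF \<phi> us])
    show "ml p (\<lambda>a. ev f b (\<lambda>v. \<psi> (\<pi> a # v)))" if "length b = p" for b
      by (rule mlI, rule lin_ev2[OF f _ that], rule lin_mlD[OF ml], intro entry_lin_Cons1 linH_prod entry_lin_slot) simp
  qed (rule ml_ev[OF f])
  also have "\<dots> = ev (delta_h H p' q 0 (Q q f)) us \<psi>"
    using us by (simp add: delta_h_0(2)[OF Q_in[OF f] us ml] Q_ev[OF f] coalgebra_map_prod[OF \<phi>] cong: sws_cong)
  finally show "ev (Q (Suc q) (delta_h H p q 0 f)) us \<psi> = ev (delta_h H p' q 0 (Q q f)) us \<psi>" .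
qed

lemma coalgebra_map_tau_coalg:
  assumes f: "f \<in> GS H p q"
  shows "Q q (tau_coalg H p q f) = tau_coalg H p' q (Q q f)"
proof (cases "q = 0")
  case True
  then show ?thesis by (simp add: tau_coalg_0)
next
  case False
  have t: "tau_coalg H p q f \<in> GS H p q" by (rule tau_coalg_in[OF f])
  show ?thesis
  proof (rule GS_eqI[of _ p' q])
    show "Q q (tau_coalg H p q f) \<in> GS H p' q" by (rule Q_in[OF t])
    show "tau_coalg H p' q (Q q f) \<in> GS H p' q" by (rule tau_coalg_in[OF Q_in[OF f]])
    fix us :: "'h list" and \<psi> assume us: "length us = p'" and ml: "ml q \<psi>"
    have "ev (Q q (tau_coalg H p q f)) us \<psi> = htau q (ev f) (\<phi> us) \<psi>"
      by (simp add: Q_ev[OF t us] ev_tau_coalg[OF f False _ ml] coalgebra_map_length[OF \<phi> us])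
    also have "\<dots> = sws us (\<lambda>a r. sws r (\<lambda>b c. ev f (\<phi> b) (tau_form q (\<pi> (\<phi> a)) (\<pi> (\<phi> c)) \<psi>)))"
      unfolding htau_def
    proof (rule coalgebra_map_sws3[OF \<phi> us])
      show "ml p (\<lambda>a. ev f b (tau_form q (\<pi> a) (\<pi> c) \<psi>))" if "length b = p" for b c
        by (rule mlI, rule lin_ev2[OF f _ that], rule lin_TH1, rule linH_prod, rule entry_lin_slot)
      show "ml p (\<lambda>c. ev f b (tau_form q (\<pi> a) (\<pi> c) \<psi>))" if "length b = p" for a b
        by (rule mlI, rule lin_ev2[OF f _ that], rule lin_TH2, rule linH_prod, rule entry_lin_slot) (simp_all add: ml False)
    qed (rule ml_ev[OF f])
    also have "\<dots> = htau q (ev (Q q f)) us \<psi>"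
      unfolding htau_def using us by (simp add: Q_ev[OF f] coalgebra_map_prod[OF \<phi>] cong: sws_cong)
    also have "\<dots> = ev (tau_coalg H p' q (Q q f)) us \<psi>"
      by (rule ev_tau_coalg[OF Q_in[OF f] False us ml, symmetric])
    finally show "ev (Q q (tau_coalg H p q f)) us \<psi> = ev (tau_coalg H p' q (Q q f)) us \<psi>" .
  qed
qed

lemma coalgebra_map_delta_h_last:
  assumes f: "f \<in> GS H p q"
  shows "Q (Suc q) (delta_h H p q (Suc q) f) = delta_h H p' q (Suc q) (Q q f)"
proof -
  have d: "delta_h H p q 0 f \<in> GS H p (Suc q)" by (rule delta_h_in[OF f]) simp
  show ?thesis
    unfolding tau_coalg_delta_h_0[OF f, symmetric] tau_coalg_delta_h_0[OF Q_in[OF f], symmetric]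
    by (simp add: coalgebra_map_tau_coalg[OF d] coalgebra_map_delta_h_0[OF f])
qed

end


section \<open>The remaining mixed relations\<close>

text \<open>The diagonal action of \<open>u\<^sup>0\<close> on a tensor with first factor \<open>U\<close> multiplies this factor by a leg of \<open>u\<^sup>0\<close>, which
is what the enlarged argument list contributes to the product.\<close>

lemma delta_v_0_delta_h_0:
  assumes f: "f \<in> GS H p q"
  shows "delta_v H p (Suc q) 0 (delta_h H p q 0 f) = delta_h H (Suc p) q 0 (delta_v H p q 0 f)"
proof (rule GS_eqI[of _ "Suc p" "Suc q"])
  have h: "delta_h H p q 0 f \<in> GS H p (Suc q)" by (rule delta_h_in[OF f]) simp
  have v: "delta_v H p q 0 f \<in> GS H (Suc p) q" by (rule delta_v_in[OF f]) simp
  show "delta_v H p (Suc q) 0 (delta_h H p q 0 f) \<in> GS H (Suc p) (Suc q)" by (rule delta_v_in[OF h]) simp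
  show "delta_h H (Suc p) q 0 (delta_v H p q 0 f) \<in> GS H (Suc p) (Suc q)" by (rule delta_h_in[OF v]) simp
  fix us :: "'h list" and \<psi> assume us: "length us = Suc p" and ml: "ml (Suc q) \<psi>"
  obtain u w where u: "us = u # w" "length w = p" using us by (auto simp: len_Suc)
  have "ev (delta_v H p (Suc q) 0 (delta_h H p q 0 f)) us \<psi> = sws w (\<lambda>a b. ev f b (\<lambda>v. L (Suc q) u \<psi> (\<pi> a # v)))"
    by (simp add: u delta_v_0(2)[OF h] delta_h_0(2)[OF f] ml ml_L)
  also have "\<dots> = sws w (\<lambda>a b. sw u (\<lambda>u1 u2. ev f b (L q u2 (\<lambda>v. \<psi> ((u1 * \<pi> a) # v)))))"
    unfolding L_Cons by (intro sws_cong_len) (use u in \<open>simp add: ev_swap[OF f]\<close>)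
  also have "\<dots> = ev (delta_h H (Suc p) q 0 (delta_v H p q 0 f)) us \<psi>"
    unfolding delta_h_0(2)[OF v us ml]
    using u by (simp add: sws_sw_swap delta_v_0(2)[OF f] ml_ConsD[OF ml] cong: sws_cong)
  finally show "ev (delta_v H p (Suc q) 0 (delta_h H p q 0 f)) us \<psi> = ev (delta_h H (Suc p) q 0 (delta_v H p q 0 f)) us \<psi>" .
qed

text \<open>Let \<open>u\<close> be the new argument. Its leg acting on the values of \<open>f\<close> reappears in the last factor as \<open>S(u\<^sub>2) u\<^sub>3\<close>
and cancels; \<open>u\<^sub>1\<close> acts on the result.\<close>

lemma delta_v_0_tau_coalg:
  assumes f: "f \<in> GS H p q"
  shows "delta_v H p q 0 (tau_coalg H p q f) = tau_coalg H (Suc p) q (delta_v H p q 0 f)"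
proof (cases "q = 0")
  case True
  then show ?thesis by (simp add: tau_coalg_0)
next
  case False
  then obtain m where m: "q = Suc m" by (cases q) auto
  have h: "tau_coalg H p q f \<in> GS H p q" by (rule tau_coalg_in[OF f])
  have v: "delta_v H p q 0 f \<in> GS H (Suc p) q" by (rule delta_v_in[OF f]) simp
  show ?thesis
  proof (rule GS_eqI[of _ "Suc p" q])
    show "delta_v H p q 0 (tau_coalg H p q f) \<in> GS H (Suc p) q" by (rule delta_v_in[OF h]) simp
    show "tau_coalg H (Suc p) q (delta_v H p q 0 f) \<in> GS H (Suc p) q" by (rule tau_coalg_in[OF v])
    fix us :: "'h list" and \<psi> assume us: "length us = Suc p" and ml: "ml q \<psi>"
    obtain u w where u: "us = u # w" "length w = p" using us by (auto simp: len_Suc)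
    let ?F = "\<lambda>x t. sws w (\<lambda>a r. sws r (\<lambda>b c. ev f b (tau_form q (x * \<pi> a) (t * \<pi> c) \<psi>)))"
    have lF: "lin (\<lambda>t. ?F x t)" "lin (\<lambda>x. ?F x t)" for x t
      by (rule lin_sws2, rule lin_sws2, rule lin_ev2[OF f], rule lin_TH2, intro linH_mult_right linH_id, use u ml False in simp_all)
        (rule lin_sws2, rule lin_sws2, rule lin_ev2[OF f], rule lin_TH1, intro linH_mult_right linH_id, use u in simp)
    have "ev (tau_coalg H (Suc p) q (delta_v H p q 0 f)) us \<psi> = htau q (ev (delta_v H p q 0 f)) us \<psi>"
      by (rule ev_tau_coalg[OF v False us ml])
    also have "\<dots> = sw u (\<lambda>x s. sws w (\<lambda>a r. sw s (\<lambda>y z. sws r (\<lambda>b c. ev f b (L q y (tau_form q (x * \<pi> a) (z * \<pi> c) \<psi>))))))"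
      unfolding htau_def u(1) sws.simps
      by (intro sw_cong_bas sws_cong_len) (use u False ml in \<open>simp add: delta_v_0(2)[OF f] ml_tau_form'\<close>)
    also have "\<dots> = sw u (\<lambda>x s. sws w (\<lambda>a r. sw s (\<lambda>y z. sws r (\<lambda>b c. ev f b (tau_form q (x * \<pi> a) (S y * z * \<pi> c) \<psi>)))))"
      by (intro sw_cong_bas sws_cong_len ev_cong[OF f]) (use u m ml in \<open>simp_all add: L_tau_form mult.assoc\<close>)
    also have "\<dots> = sw u (\<lambda>x s. sw s (\<lambda>y z. ?F x (S y * z)))"
      by (simp only: sws_sw_swap)
    also have "\<dots> = ?F u 1"
      by (rule sw_cancel_right[where G = "\<lambda>x. ?F x 1"]) (rule sw_cancel1[where F = "?F _"], rule lF, rule lF)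
    also have "\<dots> = sws w (\<lambda>a r. sws r (\<lambda>b c. ev f b (tau_form q (\<pi> a) (\<pi> c) (L q u \<psi>))))"
    proof (intro sws_cong_len ev_cong[OF f])
      fix a b c v r :: "'h list" assume "length v = q"
      then obtain h v' where v': "v = h # v'" "length v' = m" using m by (auto simp: len_Suc)
      show "tau_form q (u * \<pi> a) (1 * \<pi> c) \<psi> v = tau_form q (\<pi> a) (\<pi> c) (L q u \<psi>) v"
        using L_L[OF ml, of "v' @ [\<pi> c]" "\<pi> a * S h" u] v' m by (simp add: tau_form_Cons mult.assoc)
    qed (use u in simp)
    also have "\<dots> = ev (delta_v H p q 0 (tau_coalg H p q f)) us \<psi>"
      using ev_tau_coalg[OF f False u(2) ml_L[OF ml], of u] by (simp add: u delta_v_0(2)[OF h] ml htau_def)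
    finally show "ev (delta_v H p q 0 (tau_coalg H p q f)) us \<psi> = ev (tau_coalg H (Suc p) q (delta_v H p q 0 f)) us \<psi>" by simp
  qed
qed

text \<open>Legs of the product of all arguments: the last argument, which plays a special role in the vertical
cyclic operator, is separated from the others.\<close>

lemma sw_fold:
  assumes "\<And>b. lin (\<lambda>a. G a b)" "\<And>a. lin (\<lambda>b. G a b)"
  shows "sws r (\<lambda>b c. sw s (\<lambda>y z. G (\<pi> b * y) (\<pi> c * z))) = sw (\<pi> r * s) G"
proof -
  have "sw (\<pi> r * s) G = sw (\<pi> r) (\<lambda>b c. sw s (\<lambda>y z. G (b * y) (c * z)))"
    by (rule sw_mult) (fact assms)+
  also have "\<dots> = sws r (\<lambda>b c. sw s (\<lambda>y z. G (\<pi> b * y) (\<pi> c * z)))"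
    by (rule sw_prod) (rule lin_sw2, rule lin_comp[OF assms(1)] lin_comp[OF assms(2)], intro linH_mult_right linH_id)+
  finally show ?thesis by simp
qed

text \<open>The splitting of \<open>sws_cycle\<close> next to a further leg \<open>c\<close>, \<open>z\<close>, which stands for the left action in the cyclic
operator. The legs of the antipode closest to \<open>c\<close>, \<open>z\<close> are grouped with it.\<close>

lemma cycle_split:
  assumes K: "\<And>t c z. length t = Suc (length w) \<Longrightarrow> ml (Suc (length w)) (\<lambda>p. K p t c z)"
    "\<And>p c z. length p = Suc (length w) \<Longrightarrow> ml (Suc (length w)) (\<lambda>t. K p t c z)"
  shows "sws w (\<lambda>m c. sw l (\<lambda>y z. sws m (\<lambda>a b. sws (S (\<pi> b * y) # a) (\<lambda>p t. K p t c z))))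
    = sws w (\<lambda>a1 r. sws r (\<lambda>a2 u. sws u (\<lambda>b1 r. sw l (\<lambda>y1 s. sws r (\<lambda>b2 c. sw s (\<lambda>y2 z. K (S (\<pi> b2 * y2) # a1) (S (\<pi> b1 * y1) # a2) c z))))))"
proof -
  have "sws w (\<lambda>m c. sw l (\<lambda>y z. sws m (\<lambda>a b. sws (S (\<pi> b * y) # a) (\<lambda>p t. K p t c z))))
    = sws w (\<lambda>m c. sw l (\<lambda>y z. sws m (\<lambda>a1 r. sws r (\<lambda>a2 r. sws r (\<lambda>b1 b2. sw y (\<lambda>y1 y2. K (S (\<pi> b2 * y2) # a1) (S (\<pi> b1 * y1) # a2) c z))))))"
  proof (rule sws_cong_len, intro sw_cong_bas)
    fix m c :: "'h list" and y z assume m: "length m = length w"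
    show "sws m (\<lambda>a b. sws (S (\<pi> b * y) # a) (\<lambda>p t. K p t c z))
      = sws m (\<lambda>a1 r. sws r (\<lambda>a2 r. sws r (\<lambda>b1 b2. sw y (\<lambda>y1 y2. K (S (\<pi> b2 * y2) # a1) (S (\<pi> b1 * y1) # a2) c z))))"
      by (rule sws_cycle) (use m in \<open>simp_all add: K\<close>)
  qed
  then show ?thesis by (simp only: sws_sw_swap sws_coassoc sw_coassoc)
qed

text \<open>If the last two groups of legs cancel each other, the legs before them absorb the counits.\<close>

lemma fold_cancel:
  assumes \<Phi>: "\<And>b y t. length b = length u \<Longrightarrow> sw t (\<Phi> b y) = counit H t * G b y"
    and l: "\<And>b y B. length b = length u \<Longrightarrow> lin (\<Phi> b y B)" "\<And>b y D. length b = length u \<Longrightarrow> lin (\<lambda>B. \<Phi> b y B D)"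
    and G: "\<And>y. ml (length u) (\<lambda>b. G b y)" "\<And>b. length b = length u \<Longrightarrow> lin (G b)"
  shows "sws u (\<lambda>b r. sw l (\<lambda>y s. sws r (\<lambda>c d. sw s (\<lambda>z z'. \<Phi> b y (\<pi> c * z) (\<pi> d * z'))))) = G u l"
proof -
  have "sws u (\<lambda>b r. sw l (\<lambda>y s. sws r (\<lambda>c d. sw s (\<lambda>z z'. \<Phi> b y (\<pi> c * z) (\<pi> d * z')))))
    = sws u (\<lambda>b r. sw l (\<lambda>y s. counit H s * (counits r * G b y)))"
    by (rule sws_cong_len, intro sw_cong_bas) (simp add: sw_fold l \<Phi> counit_mult counit_prod)
  also have "\<dots> = sws u (\<lambda>b r. counits r * G b l)"
    by (rule sws_cong_len, rule sw_counit_right[where F = "\<lambda>y. counits _ * G _ y"]) (rule lin_rules G(2) | simp add: G(2))+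
  also have "\<dots> = G u l" by (rule sws_counit_right[OF G(1)])
  finally show ?thesis .
qed


text \<open>The vertical cyclic operator on a cochain whose values are themselves Sweedler sums over the arguments.\<close>

lemma vtau_split:
  assumes g: "\<And>lst \<chi>. length lst = Suc (length w) \<Longrightarrow> ml q \<chi> \<Longrightarrow> g lst \<chi> = sws lst (\<lambda>p t. K p t \<chi>)"
    and K1: "\<And>t \<chi>. length t = Suc (length w) \<Longrightarrow> ml q \<chi> \<Longrightarrow> ml (Suc (length w)) (\<lambda>p. K p t \<chi>)"
    and K2: "\<And>p \<chi>. length p = Suc (length w) \<Longrightarrow> ml q \<chi> \<Longrightarrow> ml (Suc (length w)) (\<lambda>t. K p t \<chi>)"
    and ml: "ml q \<psi>"
  shows "vtau q g (w @ [l]) \<psi> = sws w (\<lambda>a1 r. sws r (\<lambda>a2 r. sws r (\<lambda>b1 r. sw l (\<lambda>x s. sw s (\<lambda>y1 s.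
    sws r (\<lambda>b2 c. sw s (\<lambda>y2 z. K (S (\<pi> b2 * y2) # a1) (S (\<pi> b1 * y1) # a2) (R q x (L q (\<pi> c * z) \<psi>)))))))))"
proof -
  let ?\<chi> = "\<lambda>x c z. R q x (L q (\<pi> c * z) \<psi>)"
  have "vtau q g (w @ [l]) \<psi> = sws w (\<lambda>m c. sws m (\<lambda>a b. sw l (\<lambda>x s. sw s (\<lambda>y z. sws (S (\<pi> b * y) # a) (\<lambda>p t. K p t (?\<chi> x c z))))))"
    unfolding vtau_snoc sws_coassoc
    by (intro sws_cong_len sw_cong_bas g) (simp_all add: ml_L ml_R ml)
  also have "\<dots> = sw l (\<lambda>x s. sws w (\<lambda>m c. sw s (\<lambda>y z. sws m (\<lambda>a b. sws (S (\<pi> b * y) # a) (\<lambda>p t. K p t (?\<chi> x c z))))))"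
    by (simp only: sws_sw_swap)
  also have "\<dots> = sw l (\<lambda>x s. sws w (\<lambda>a1 r. sws r (\<lambda>a2 r. sws r (\<lambda>b1 r. sw s (\<lambda>y1 s.
    sws r (\<lambda>b2 c. sw s (\<lambda>y2 z. K (S (\<pi> b2 * y2) # a1) (S (\<pi> b1 * y1) # a2) (?\<chi> x c z))))))))"
    by (intro sw_cong_bas cycle_split) (simp_all add: K1 K2 ml_L ml_R ml)
  finally show ?thesis by (simp only: sws_sw_swap)
qed

text \<open>The first factor of the value at the arguments \<open>(S(U\<^sub>2), u\<^sub>1)\<close> is their product. After splitting, its factor
\<open>S(U\<^sub>4)\<close> meets the left action of \<open>U\<^sub>5\<close>, and the two cancel in this factor.\<close>

lemma tau_alg_delta_h_0:
  assumes f: "f \<in> GS H p q"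
  shows "tau_alg H p (Suc q) (delta_h H p q 0 f) = delta_h H p q 0 (tau_alg H p q f)"
proof (cases p)
  case 0
  then show ?thesis by (simp add: tau_alg_0)
next
  case (Suc k)
  have h: "delta_h H p q 0 f \<in> GS H p (Suc q)" by (rule delta_h_in[OF f]) simp
  have t: "tau_alg H p q f \<in> GS H p q" by (rule tau_alg_in[OF f])
  show ?thesis
  proof (rule GS_eqI[of _ p "Suc q"])
    show "tau_alg H p (Suc q) (delta_h H p q 0 f) \<in> GS H p (Suc q)" by (rule tau_alg_in[OF h])
    show "delta_h H p q 0 (tau_alg H p q f) \<in> GS H p (Suc q)" by (rule delta_h_in[OF t]) simp
    fix us :: "'h list" and \<psi> assume us: "length us = p" and ml: "ml (Suc q) \<psi>"
    obtain w l where w: "us = w @ [l]" "length w = k" using us Suc by (cases us rule: rev_cases) auto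
    let ?K = "\<lambda>p t \<chi>. ev f t (\<lambda>v. \<chi> (\<pi> p # v))"
    let ?\<Psi> = "\<lambda>x. R (Suc q) x \<psi>"
    let ?T = "\<lambda>a1 a2 b1 x y D. ev f (S (\<pi> b1 * y) # a2) (L q D (\<lambda>v. ?\<Psi> x (\<pi> a1 # v)))"
    have "ev (tau_alg H p (Suc q) (delta_h H p q 0 f)) us \<psi> = vtau (Suc q) (ev (delta_h H p q 0 f)) (w @ [l]) \<psi>"
      using h us ml Suc w by (simp add: ev_tau_alg)
    also have "\<dots> = sws w (\<lambda>a1 r. sws r (\<lambda>a2 r. sws r (\<lambda>b1 r. sw l (\<lambda>x s. sw s (\<lambda>y1 s.
      sws r (\<lambda>b2 c. sw s (\<lambda>y2 z. ?K (S (\<pi> b2 * y2) # a1) (S (\<pi> b1 * y1) # a2) (R (Suc q) x (L (Suc q) (\<pi> c * z) \<psi>)))))))))"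
    proof (rule vtau_split)
      fix lst :: "'h list" and \<chi> assume "length lst = Suc (length w)" "ml (Suc q) \<chi>"
      then show "ev (delta_h H p q 0 f) lst \<chi> = sws lst (\<lambda>p t. ?K p t \<chi>)"
        by (intro delta_h_0(2)[OF f]) (use w Suc in simp_all)
    next
      fix t :: "'h list" and \<chi> assume t: "length t = Suc (length w)" and \<chi>: "ml (Suc q) \<chi>"
      show "ml (Suc (length w)) (\<lambda>p. ?K p t \<chi>)"
        by (rule mlI, rule lin_ev2[OF f], rule lin_mlD[OF \<chi>], intro entry_lin_Cons1 linH_prod entry_lin_slot) (use t w Suc in simp_all)
      show "ml (Suc (length w)) (\<lambda>t. ev f t (\<lambda>v. \<chi> (\<pi> p # v)))" for p using ml_ev[OF f] w Suc by simp
    qed (rule ml)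
    also have "\<dots> = sws w (\<lambda>a1 r. sws r (\<lambda>a2 r. sws r (\<lambda>b1 r. sw l (\<lambda>x s. sw s (\<lambda>y1 s. ?T a1 a2 b1 x y1 (\<pi> r * s))))))"
    proof (rule sws_cong_len, rule sws_cong_len, rule sws_cong_len, intro sw_cong_bas)
      fix a1 r' a2 r'' b1 r :: "'h list" and x y1 s
      assume "length r' = length w" "length a2 = length r'"
      then have len: "length (S (\<pi> b1 * y1) # a2) = p" using w Suc by simp
      let ?M = "\<lambda>t D. ev f (S (\<pi> b1 * y1) # a2) (L q D (\<lambda>v. ?\<Psi> x (t * \<pi> a1 # v)))"
      have mlx: "ml (Suc q) (?\<Psi> x)" by (rule ml_R[OF ml])
      have lM: "lin (\<lambda>t. ?M t D)" "lin (\<lambda>D. ?M t D)" for t D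
        by (rule lin_ev2[OF f _ len], rule lin_L2, rule lin_mlD[OF mlx], intro entry_lin_Cons1 linH_mult_right linH_id, simp_all)
          (rule lin_ev2[OF f _ len], rule lin_L1[OF linH_id])
      let ?G = "\<lambda>B D. sw D (\<lambda>d1 d2. ?M (d1 * S B) d2)"
      have "sws r (\<lambda>b2 c. sw s (\<lambda>y2 z. ?K (S (\<pi> b2 * y2) # a1) (S (\<pi> b1 * y1) # a2) (R (Suc q) x (L (Suc q) (\<pi> c * z) \<psi>))))
        = sws r (\<lambda>b2 c. sw s (\<lambda>y2 z. ?G (\<pi> b2 * y2) (\<pi> c * z)))"
      proof (intro sws_cong_len sw_cong_bas)
        fix b2 c :: "'h list" and y2 z
        have "?K (S (\<pi> b2 * y2) # a1) (S (\<pi> b1 * y1) # a2) (R (Suc q) x (L (Suc q) (\<pi> c * z) \<psi>))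
          = ev f (S (\<pi> b1 * y1) # a2) (\<lambda>v. sw (\<pi> c * z) (\<lambda>d1 d2. L q d2 (\<lambda>v. ?\<Psi> x (d1 * S (\<pi> b2 * y2) * \<pi> a1 # v)) v))"
          by (rule ev_cong[OF f len]) (simp add: L_R[symmetric] L_Cons mult.assoc)
        then show "?K (S (\<pi> b2 * y2) # a1) (S (\<pi> b1 * y1) # a2) (R (Suc q) x (L (Suc q) (\<pi> c * z) \<psi>)) = ?G (\<pi> b2 * y2) (\<pi> c * z)"
          by (simp only: ev_swap[OF f len])
      qed
      also have "\<dots> = sw (\<pi> r * s) ?G"
        by (rule sw_fold) (rule lin_sw2, rule lin_comp[OF lM(1)], intro linH_mult_left linH_antipode linH_id, rule lin_sw')
      also have "\<dots> = ?M 1 (\<pi> r * s)"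
        by (rule sw_cancel_left[where G = "?M 1", unfolded sw_coassoc])
          (rule sw_cancel4[where F = "\<lambda>t. ?M t _"], rule lM, rule lM)
      finally show "sws r (\<lambda>b2 c. sw s (\<lambda>y2 z. ?K (S (\<pi> b2 * y2) # a1) (S (\<pi> b1 * y1) # a2) (R (Suc q) x (L (Suc q) (\<pi> c * z) \<psi>))))
        = ?T a1 a2 b1 x y1 (\<pi> r * s)" by simp
    qed
    also have "\<dots> = sws w (\<lambda>a1 r. sws r (\<lambda>a2 r. sws r (\<lambda>b1 r. sw l (\<lambda>x s. sw s (\<lambda>y s. sw x (\<lambda>x1 x2.
        ev f (S (\<pi> b1 * y) # a2) (R q x2 (L q (\<pi> r * s) (\<lambda>v. \<psi> (\<pi> a1 * x1 # v))))))))))"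
    proof (rule sws_cong_len, rule sws_cong_len, rule sws_cong_len, intro sw_cong_bas)
      fix a1 r' a2 r'' b1 r :: "'h list" and x y s
      assume "length r' = length w" "length a2 = length r'"
      then have len: "length (S (\<pi> b1 * y) # a2) = p" using w Suc by simp
      show "?T a1 a2 b1 x y (\<pi> r * s) = sw x (\<lambda>x1 x2. ev f (S (\<pi> b1 * y) # a2) (R q x2 (L q (\<pi> r * s) (\<lambda>v. \<psi> (\<pi> a1 * x1 # v)))))"
        unfolding R_Cons L_sw ev_swap[OF f len]
        by (intro sw_cong_bas ev_cong[OF f len]) (rule L_R)
    qed
    also have "\<dots> = sws w (\<lambda>a1 r. sws r (\<lambda>a2 r. sws r (\<lambda>b1 r. sw l (\<lambda>x s. sw x (\<lambda>x1 x2. sw s (\<lambda>y s.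
        ev f (S (\<pi> b1 * y) # a2) (R q x2 (L q (\<pi> r * s) (\<lambda>v. \<psi> (\<pi> a1 * x1 # v))))))))))"
      by (intro sws_cong_len sw_cong_bas, subst sw_swap) (rule refl)
    also have "\<dots> = sws w (\<lambda>a1 r. sw l (\<lambda>x1 s. vtau q (ev f) (r @ [s]) (\<lambda>v. \<psi> (\<pi> a1 * x1 # v))))"
      unfolding vtau_snoc by (simp only: sw_coassoc sws_sw_swap)
    also have "\<dots> = ev (delta_h H p q 0 (tau_alg H p q f)) us \<psi>"
      unfolding delta_h_0(2)[OF t us ml]
      using w Suc f ml_ConsD[OF ml] by (simp add: sws_append ev_tau_alg cong: sws_cong)
    finally show "ev (tau_alg H p (Suc q) (delta_h H p q 0 f)) us \<psi> = ev (delta_h H p q 0 (tau_alg H p q f)) us \<psi>" .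
  qed
qed


section \<open>The two cyclic operators commute\<close>

text \<open>The common form that both compositions take: the transpose of
\<open>h \<otimes> v \<mapsto> y S(h) \<triangleright> ((v \<triangleleft> x) \<otimes> 1)\<close>, where \<open>x\<close> is a leg of the last argument.\<close>

definition tau_tau_form :: "nat \<Rightarrow> 'h \<Rightarrow> 'h \<Rightarrow> ('h list \<Rightarrow> 'k) \<Rightarrow> 'h list \<Rightarrow> 'k" where
  "tau_tau_form m x y \<psi> v = R m x (\<lambda>v'. L (Suc m) (y * S (hd v)) \<psi> (v' @ [1])) (tl v)"

lemma tau_form_R_antipode:
  assumes ml: "ml (Suc m) \<psi>" and v: "length v = Suc m"
  shows "sw x (\<lambda>a b. tau_form (Suc m) y (S b) (R (Suc m) a \<psi>) v) = tau_tau_form m x y \<psi> v"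
proof -
  obtain h w where w: "v = h # w" "length w = m" using v by (auto simp: len_Suc)
  let ?\<chi> = "L (Suc m) (y * S h) \<psi>"
  have l: "lin (\<lambda>t. ?\<chi> (v @ [t]))" if "length v = m" for v
    by (rule lin_L3[OF ml]) (use that in \<open>simp_all add: entry_lin_append2 entry_lin_slot entry_lin_id lin_rules\<close>)
  have "sw x (\<lambda>a b. tau_form (Suc m) y (S b) (R (Suc m) a \<psi>) v) = sw x (\<lambda>a r. sw r (\<lambda>b c. R m a (\<lambda>v. ?\<chi> (v @ [S c * b])) w))"
    unfolding w(1) tau_form_Cons L_R R_snoc[OF w(2)] sw_coassoc ..
  also have "\<dots> = R m x (\<lambda>v. ?\<chi> (v @ [1])) w"
    by (rule sw_cancel_right[where G = "\<lambda>a. R m a (\<lambda>v. ?\<chi> (v @ [1])) w"])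
      (rule sw_cancel3[where F = "\<lambda>t. R m _ (\<lambda>v. ?\<chi> (v @ [t])) w"], rule lin_R2, erule l, rule w(2), rule lin_R1[OF linH_id])
  finally show ?thesis by (simp add: tau_tau_form_def w)
qed

lemma R_tau_form_antipode:
  assumes ml: "ml (Suc m) \<psi>" and v: "length v = Suc m"
  shows "sw x (\<lambda>a b. R (Suc m) b (tau_form (Suc m) (y * a) 1 \<psi>) v) = tau_tau_form m x y \<psi> v"
proof -
  obtain h w where w: "v = h # w" "length w = m" using v by (auto simp: len_Suc)
  let ?F = "\<lambda>t b. R m b (\<lambda>v. L (Suc m) (y * t * S h) \<psi> (v @ [1])) w"
  have "sw x (\<lambda>a b. R (Suc m) b (tau_form (Suc m) (y * a) 1 \<psi>) v) = sw x (\<lambda>a r. sw r (\<lambda>b c. ?F (a * S b) c))"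
    unfolding w(1) R_Cons tau_form_Cons by (simp add: antipode_mult mult.assoc)
  also have "\<dots> = ?F 1 x"
    by (rule sw_cancel_left[where G = "?F 1"]; (rule sw_cancel2[where F = "\<lambda>t. ?F t _"])?)
      (rule lin_R2, rule lin_L1, intro linH_mult_left linH_mult_right linH_id, rule w(2), rule lin_R1[OF linH_id])
  finally show ?thesis by (simp add: tau_tau_form_def w)
qed

text \<open>Let \<open>w\<close> be the arguments without the last one \<open>l\<close>. Both sides are reduced to the same normal form, the sum over
three legs of \<open>w\<close> and two of \<open>l\<close> of \<open>f(S(W\<^sub>3 l\<^sub>2), w\<^sub>2)\<close> followed by the map of \<open>tau_tau_form\<close> for \<open>y = W\<^sub>1\<close>,
\<open>x = l\<^sub>1\<close>. On the left, the arguments \<open>(S(U\<^sub>2), u\<^sub>1)\<close> are split into three parts: the product of the last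
one collapses to \<open>S\<close> of a leg of \<open>l\<close>, which cancels against the right action in the last tensor factor, and the
antipode in the first one cancels against the left action of \<open>U\<^sub>3\<close>. On the right, the left action of \<open>U\<^sub>3\<close>
moves to the last tensor factor by \<open>L_tau_form\<close> and cancels there, while the right action on the first tensor
factor cancels against \<open>l\<^sub>1\<close>.\<close>

lemma tau_alg_tau_coalg:
  assumes f: "f \<in> GS H p q"
  shows "tau_alg H p q (tau_coalg H p q f) = tau_coalg H p q (tau_alg H p q f)"
proof (cases "p = 0 \<or> q = 0")
  case True
  then show ?thesis by (auto simp: tau_alg_0 tau_coalg_0)
next
  case False
  then obtain k m where k: "p = Suc k" and m: "q = Suc m" by (auto simp: gr0_conv_Suc)
  have q: "q \<noteq> 0" using False by simp
  have h: "tau_coalg H p q f \<in> GS H p q" by (rule tau_coalg_in[OF f])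
  have v: "tau_alg H p q f \<in> GS H p q" by (rule tau_alg_in[OF f])
  show ?thesis
  proof (rule GS_eqI[of _ p q])
    show "tau_alg H p q (tau_coalg H p q f) \<in> GS H p q" by (rule tau_alg_in[OF h])
    show "tau_coalg H p q (tau_alg H p q f) \<in> GS H p q" by (rule tau_coalg_in[OF v])
    fix us :: "'h list" and \<psi> assume us: "length us = p" and ml: "ml q \<psi>"
    obtain w l where w: "us = w @ [l]" "length w = k" using us k by (cases us rule: rev_cases) auto
    have len: "length (z # a) = p" if "length a = length w" for z and a :: "'h list" using that w k by simp
    let ?\<chi> = "\<lambda>x c z. R q x (L q (\<pi> c * z) \<psi>)"
    let ?N = "sws w (\<lambda>a1 r. sws r (\<lambda>a2 u. sw l (\<lambda>x s. ev f (S (\<pi> u * s) # a2) (tau_tau_form m x (\<pi> a1) \<psi>))))"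
    have th: "lin (\<lambda>X. ev f t (tau_form q (g X) y \<chi>))" if "linH g" "length t = p" for g t y \<chi>
      by (rule lin_ev2[OF f], rule lin_TH1[OF that(1)], rule that(2))
    have gl: "ml n (\<lambda>u. ev f (S (\<pi> u * s) # a) \<chi>)" if "length a = k" "n = k" for n a s \<chi>
      by (rule mlI, rule lin_ev1[OF f], intro entry_lin_Cons1 linH_antipode linH_mult_right linH_prod entry_lin_slot) (use that k in simp)
    have gs: "lin (\<lambda>s. ev f (S (\<pi> u * s) # a) \<chi>)" if "length a = k" for a u \<chi>
      by (rule lin_ev1[OF f], intro entry_lin_Cons1 linH_antipode linH_mult_left linH_id) (use that k in simp)
    have "ev (tau_alg H p q (tau_coalg H p q f)) us \<psi> = vtau q (ev (tau_coalg H p q f)) (w @ [l]) \<psi>"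
      using ev_tau_alg[of "tau_coalg H p q f" k q us \<psi>] h us ml k w by simp
    also have "\<dots> = sws w (\<lambda>m c. sw l (\<lambda>x s. sw s (\<lambda>y z. sws m (\<lambda>a b. ev (tau_coalg H p q f) (S (\<pi> b * y) # a) (?\<chi> x c z)))))"
      unfolding vtau_snoc sws_coassoc[symmetric] by (simp only: sws_sw_swap)
    also have "\<dots> = sws w (\<lambda>m c. sw l (\<lambda>x s. sw s (\<lambda>y z. sws m (\<lambda>a b. sw y (\<lambda>y0 y1.
      sws (S (\<pi> b * y1) # a) (\<lambda>p t. ev f t (tau_form q (\<pi> p) (S y0) (?\<chi> x c z))))))))"
    proof (rule sws_cong_len, intro sw_cong_bas)
      fix n c :: "'h list" and x y z assume n: "length n = length w"
      let ?K = "\<lambda>n \<sigma>. sws n (\<lambda>p t. ev f t (tau_form q (\<pi> p) \<sigma> (?\<chi> x c z)))"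
      have "sws n (\<lambda>a b. ev (tau_coalg H p q f) (S (\<pi> b * y) # a) (?\<chi> x c z)) = sws n (\<lambda>a b. sws (S (\<pi> b * y) # a) (\<lambda>n t. ?K n (\<pi> t)))"
        by (rule sws_cong_len) (use n in \<open>simp add: ev_tau_coalg[OF f q len] htau_def ml_L ml_R ml sws_coassoc del: sws.simps\<close>)
      also have "\<dots> = sws n (\<lambda>a b. sw y (\<lambda>y0 y1. ?K (S (\<pi> b * y1) # a) (S y0)))"
      proof (rule sws_cycle_prod)
        show "ml (Suc (length n)) (\<lambda>n. ?K n \<sigma>)" for \<sigma> by (rule mlI, rule lin_sws1, rule entry_lin_slot)
        show "lin (?K n')" if "length n' = Suc (length n)" for n'
          by (rule lin_sws2, rule lin_ev2[OF f], rule lin_TH2[OF linH_id]) (use that n w k q in \<open>simp_all add: ml_L ml_R ml\<close>)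
      qed
      finally show "sws n (\<lambda>a b. ev (tau_coalg H p q f) (S (\<pi> b * y) # a) (?\<chi> x c z)) = sws n (\<lambda>a b. sw y (\<lambda>y0 y1. ?K (S (\<pi> b * y1) # a) (S y0)))" .
    qed
    also have "\<dots> = sw l (\<lambda>x s. sw s (\<lambda>y0 s. sws w (\<lambda>m c. sw s (\<lambda>y z. sws m (\<lambda>a b. sws (S (\<pi> b * y) # a)
      (\<lambda>p t. ev f t (tau_form q (\<pi> p) (S y0) (?\<chi> x c z))))))))"
      by (simp only: sws_sw_swap sw_coassoc)
    also have "\<dots> = sw l (\<lambda>x s. sw s (\<lambda>y0 s. sws w (\<lambda>a1 r. sws r (\<lambda>a2 u. ev f (S (\<pi> u * s) # a2) (tau_form q (\<pi> a1) (S y0) (R q x \<psi>))))))"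
    proof (intro sw_cong_bas)
      fix x y0 s
      let ?K = "\<lambda>P t D. ev f t (tau_form q (D * P) (S y0) (R q x \<psi>))"
      have "sws w (\<lambda>m c. sw s (\<lambda>y z. sws m (\<lambda>a b. sws (S (\<pi> b * y) # a) (\<lambda>p t. ev f t (tau_form q (\<pi> p) (S y0) (?\<chi> x c z))))))
        = sws w (\<lambda>a1 r. sws r (\<lambda>a2 u. sws u (\<lambda>b1 r. sw s (\<lambda>y1 s. sws r (\<lambda>b2 c. sw s (\<lambda>y2 z.
          ev f (S (\<pi> b1 * y1) # a2) (tau_form q (\<pi> (S (\<pi> b2 * y2) # a1)) (S y0) (?\<chi> x c z))))))))"
      proof (rule cycle_split)
        show "ml (Suc (length w)) (\<lambda>p. ev f t (tau_form q (\<pi> p) (S y0) (?\<chi> x c z)))" if "length t = Suc (length w)" for t c z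
          by (rule mlI, rule th, rule linH_prod, rule entry_lin_slot) (use that w k in simp)
        show "ml (Suc (length w)) (\<lambda>t. ev f t (tau_form q (\<pi> n) (S y0) (?\<chi> x c z)))" for n c z
          using ml_ev[OF f] w k by simp
      qed
      also have "\<dots> = sws w (\<lambda>a1 r. sws r (\<lambda>a2 u. ?K (\<pi> a1) (S (\<pi> u * s) # a2) 1))"
      proof (rule sws_cong_len, rule sws_cong_len)
        fix a1 r a2 u :: "'h list" assume r: "length r = length w" and a2: "length a2 = length r" and u: "length u = length r"
        have t: "length (S z # a2) = p" for z using r a2 w k by simp
        let ?\<Phi> = "\<lambda>b y B D. ?K (S B * \<pi> a1) (S (\<pi> b * y) # a2) D"
        have RL: "R q x (L q g \<psi>) = L q g (R q x \<psi>)" for g by (rule ext, rule L_R[symmetric])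
        have "sws u (\<lambda>b1 r. sw s (\<lambda>y1 s. sws r (\<lambda>b2 c. sw s (\<lambda>y2 z. ev f (S (\<pi> b1 * y1) # a2) (tau_form q (\<pi> (S (\<pi> b2 * y2) # a1)) (S y0) (?\<chi> x c z))))))
          = sws u (\<lambda>b1 r. sw s (\<lambda>y1 s. sws r (\<lambda>b2 c. sw s (\<lambda>y2 z. ?\<Phi> b1 y1 (\<pi> b2 * y2) (\<pi> c * z)))))"
          by (intro sws_cong_len sw_cong_bas ev_cong[OF f t]) (use q in \<open>simp_all add: tau_form_def RL L_L ml ml_R mult.assoc\<close>)
        also have "\<dots> = ?K (\<pi> a1) (S (\<pi> u * s) # a2) 1"
        proof (rule fold_cancel[where G = "\<lambda>b y. ?K (\<pi> a1) (S (\<pi> b * y) # a2) 1"])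
          show "sw D (?\<Phi> b y) = counit H D * ?K (\<pi> a1) (S (\<pi> b * y) # a2) 1" for b y D
            using sw_cancel4[where F = "\<lambda>X. ev f (S (\<pi> b * y) # a2) (tau_form q (X * \<pi> a1) (S y0) (R q x \<psi>))" and u = D]
            by (simp add: th[OF linH_mult_right[OF linH_id] t] mult.assoc)
        qed (use r a2 u w in \<open>auto intro!: th lin_rules t gl gs\<close>)
        finally show "sws u (\<lambda>b1 r. sw s (\<lambda>y1 s. sws r (\<lambda>b2 c. sw s (\<lambda>y2 z. ev f (S (\<pi> b1 * y1) # a2) (tau_form q (\<pi> (S (\<pi> b2 * y2) # a1)) (S y0) (?\<chi> x c z))))))
          = ?K (\<pi> a1) (S (\<pi> u * s) # a2) 1" .
      qed
      finally show "sws w (\<lambda>m c. sw s (\<lambda>y z. sws m (\<lambda>a b. sws (S (\<pi> b * y) # a) (\<lambda>p t. ev f t (tau_form q (\<pi> p) (S y0) (?\<chi> x c z))))))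
        = sws w (\<lambda>a1 r. sws r (\<lambda>a2 u. ev f (S (\<pi> u * s) # a2) (tau_form q (\<pi> a1) (S y0) (R q x \<psi>))))" by simp
    qed
    also have "\<dots> = sws w (\<lambda>a1 r. sws r (\<lambda>a2 u. sw l (\<lambda>r s. sw r (\<lambda>x y0. ev f (S (\<pi> u * s) # a2) (tau_form q (\<pi> a1) (S y0) (R q x \<psi>))))))"
      by (simp only: sws_sw_swap sw_coassoc)
    also have "\<dots> = ?N"
    proof (rule sws_cong_len, rule sws_cong_len, intro sw_cong_bas)
      fix a1 r a2 u :: "'h list" and x s assume "length r = length w" "length a2 = length r"
      then have t: "length (S (\<pi> u * s) # a2) = p" using w k by simp
      show "sw x (\<lambda>x y0. ev f (S (\<pi> u * s) # a2) (tau_form q (\<pi> a1) (S y0) (R q x \<psi>))) = ev f (S (\<pi> u * s) # a2) (tau_tau_form m x (\<pi> a1) \<psi>)"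
        unfolding ev_swap(2)[OF f t, symmetric] by (rule ev_cong[OF f t]) (use m ml in \<open>simp add: tau_form_R_antipode\<close>)
    qed
    finally have lhs: "ev (tau_alg H p q (tau_coalg H p q f)) us \<psi> = ?N" .

    have "ev (tau_coalg H p q (tau_alg H p q f)) us \<psi> = htau q (ev (tau_alg H p q f)) (w @ [l]) \<psi>"
      using ev_tau_coalg[OF v q us ml] w by simp
    also have "\<dots> = sws w (\<lambda>P r. sw l (\<lambda>x s. sws r (\<lambda>t c. sw s (\<lambda>y z. vtau q (ev f) (t @ [y]) (tau_form q (\<pi> P * x) (\<pi> c * z) \<psi>)))))"
      unfolding htau_def sws_append sws.simps
      by (rule sws_cong_len, intro sw_cong_bas, rule sws_cong_len, intro sw_cong_bas)
        (use f w k q ml in \<open>simp add: ev_tau_alg ml_tau_form'\<close>)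
    also have "\<dots> = sws w (\<lambda>P r. sws r (\<lambda>a u. sw l (\<lambda>x s. sw s (\<lambda>x' s. sws u (\<lambda>b r. sw s (\<lambda>y s. sws r (\<lambda>c d. sw s (\<lambda>z z'.
      ev f (S (\<pi> b * y) # a) (R q x' (L q (\<pi> c * z) (tau_form q (\<pi> P * x) (\<pi> d * z') \<psi>)))))))))))"
      unfolding vtau_snoc by (simp only: sws_sw_swap sws_coassoc sw_coassoc)
    also have "\<dots> = sws w (\<lambda>P r. sws r (\<lambda>a u. sw l (\<lambda>x s. sw s (\<lambda>x' s. ev f (S (\<pi> u * s) # a) (R q x' (tau_form q (\<pi> P * x) 1 \<psi>))))))"
    proof (rule sws_cong_len, rule sws_cong_len, intro sw_cong_bas)
      fix P r a u :: "'h list" and x s x' s' assume r: "length r = length w" and a: "length a = length r" and u: "length u = length r"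
      have t: "length (S z # a) = p" for z using r a w k by simp
      let ?F = "\<lambda>b y X. ev f (S (\<pi> b * y) # a) (R q x' (tau_form q (\<pi> P * x) X \<psi>))"
      let ?\<Phi> = "\<lambda>b y B D. ?F b y (S B * D)"
      have lF: "lin (\<lambda>X. ?F b y (g X))" if "linH g" for b y g
        by (rule lin_ev2[OF f _ t], rule lin_R2, rule lin_TH2[OF that ml _ q])
      have "sws u (\<lambda>b r. sw s' (\<lambda>y s. sws r (\<lambda>c d. sw s (\<lambda>z z'. ev f (S (\<pi> b * y) # a) (R q x' (L q (\<pi> c * z) (tau_form q (\<pi> P * x) (\<pi> d * z') \<psi>)))))))
        = sws u (\<lambda>b r. sw s' (\<lambda>y s. sws r (\<lambda>c d. sw s (\<lambda>z z'. ?\<Phi> b y (\<pi> c * z) (\<pi> d * z')))))"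
        by (intro sws_cong_len sw_cong_bas ev_cong[OF f t] R_cong) (use m ml in \<open>simp_all add: L_tau_form\<close>)
      also have "\<dots> = ?F u s' 1"
      proof (rule fold_cancel[where G = "\<lambda>b y. ?F b y 1"])
        show "sw D (?\<Phi> b y) = counit H D * ?F b y 1" for b y D
          by (rule sw_cancel1[where F = "?F b y"], rule lF[OF linH_id])
      qed (use r a u w in \<open>auto intro!: lF lin_rules gl gs\<close>)
      finally show "sws u (\<lambda>b r. sw s' (\<lambda>y s. sws r (\<lambda>c d. sw s (\<lambda>z z'. ev f (S (\<pi> b * y) # a) (R q x' (L q (\<pi> c * z) (tau_form q (\<pi> P * x) (\<pi> d * z') \<psi>)))))))
        = ?F u s' 1" .
    qed
    also have "\<dots> = sws w (\<lambda>P r. sws r (\<lambda>a u. sw l (\<lambda>r s. sw r (\<lambda>x x'. ev f (S (\<pi> u * s) # a) (R q x' (tau_form q (\<pi> P * x) 1 \<psi>))))))"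
      by (simp only: sw_coassoc)
    also have "\<dots> = ?N"
    proof (rule sws_cong_len, rule sws_cong_len, intro sw_cong_bas)
      fix P r a u :: "'h list" and x s assume "length r = length w" "length a = length r"
      then have t: "length (S (\<pi> u * s) # a) = p" using w k by simp
      show "sw x (\<lambda>x x'. ev f (S (\<pi> u * s) # a) (R q x' (tau_form q (\<pi> P * x) 1 \<psi>))) = ev f (S (\<pi> u * s) # a) (tau_tau_form m x (\<pi> P) \<psi>)"
        unfolding ev_swap(2)[OF f t, symmetric] by (rule ev_cong[OF f t]) (use m ml in \<open>simp add: R_tau_form_antipode\<close>)
    qed
    finally show "ev (tau_alg H p q (tau_coalg H p q f)) us \<psi> = ev (tau_coalg H p q (tau_alg H p q f)) us \<psi>"
      unfolding lhs by simp
  qed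
qed


section \<open>All mixed relations\<close>

text \<open>Inner horizontal cofaces and horizontal codegeneracies are bimodule maps of the coefficients; inner vertical
cofaces and vertical codegeneracies are coalgebra maps of the arguments.\<close>

lemma delta_h_mid_vertical:
  assumes j: "1 \<le> j" "j \<le> q"
  shows "f \<in> GS H p q \<Longrightarrow> i \<le> Suc p \<Longrightarrow> delta_v H p (Suc q) i (delta_h H p q j f) = delta_h H (Suc p) q j (delta_v H p q i f)"
    and "f \<in> GS H (Suc p) q \<Longrightarrow> i \<le> p \<Longrightarrow> sigma_v H (Suc p) (Suc q) i (delta_h H (Suc p) q j f) = delta_h H p q j (sigma_v H (Suc p) q i f)"
    and "f \<in> GS H p q \<Longrightarrow> tau_alg H p (Suc q) (delta_h H p q j f) = delta_h H p q j (tau_alg H p q f)"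
  using bimodule_op_delta_v[OF bimodule_op_dup[OF j], where P = "\<lambda>p. delta_h H p q j"]
    bimodule_op_sigma_v[OF bimodule_op_dup[OF j], where P = "\<lambda>p. delta_h H p q j"]
    bimodule_op_tau_alg[OF bimodule_op_dup[OF j], where P = "\<lambda>p. delta_h H p q j"]
    delta_h_mid[OF _ j] by blast+

lemma sigma_h_vertical:
  assumes j: "j \<le> q"
  shows "f \<in> GS H p (Suc q) \<Longrightarrow> i \<le> Suc p \<Longrightarrow> delta_v H p q i (sigma_h H p (Suc q) j f) = sigma_h H (Suc p) (Suc q) j (delta_v H p (Suc q) i f)"
    and "f \<in> GS H (Suc p) (Suc q) \<Longrightarrow> i \<le> p \<Longrightarrow> sigma_v H (Suc p) q i (sigma_h H (Suc p) (Suc q) j f) = sigma_h H p (Suc q) j (sigma_v H (Suc p) (Suc q) i f)"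
    and "f \<in> GS H p (Suc q) \<Longrightarrow> tau_alg H p q (sigma_h H p (Suc q) j f) = sigma_h H p (Suc q) j (tau_alg H p (Suc q) f)"
  using bimodule_op_delta_v[OF bimodule_op_del[OF j], where P = "\<lambda>p. sigma_h H p (Suc q) j"]
    bimodule_op_sigma_v[OF bimodule_op_del[OF j], where P = "\<lambda>p. sigma_h H p (Suc q) j"]
    bimodule_op_tau_alg[OF bimodule_op_del[OF j], where P = "\<lambda>p. sigma_h H p (Suc q) j"]
    sigma_h[OF _ j] by blast+

lemma delta_v_mid_horizontal:
  assumes i: "1 \<le> i" "i \<le> p" and f: "f \<in> GS H p q"
  shows "delta_v H p (Suc q) i (delta_h H p q 0 f) = delta_h H (Suc p) q 0 (delta_v H p q i f)"
    and "delta_v H p (Suc q) i (delta_h H p q (Suc q) f) = delta_h H (Suc p) q (Suc q) (delta_v H p q i f)"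
    and "delta_v H p q i (tau_coalg H p q f) = tau_coalg H (Suc p) q (delta_v H p q i f)"
  using coalgebra_map_delta_h_0[OF coalgebra_map_merge[OF i], where Q = "\<lambda>q. delta_v H p q i"]
    coalgebra_map_delta_h_last[OF coalgebra_map_merge[OF i], where Q = "\<lambda>q. delta_v H p q i"]
    coalgebra_map_tau_coalg[OF coalgebra_map_merge[OF i], where Q = "\<lambda>q. delta_v H p q i"]
    delta_v_mid[OF _ i] f by blast+

lemma sigma_v_horizontal:
  assumes i: "i \<le> p" and f: "f \<in> GS H (Suc p) q"
  shows "sigma_v H (Suc p) (Suc q) i (delta_h H (Suc p) q 0 f) = delta_h H p q 0 (sigma_v H (Suc p) q i f)"
    and "sigma_v H (Suc p) (Suc q) i (delta_h H (Suc p) q (Suc q) f) = delta_h H p q (Suc q) (sigma_v H (Suc p) q i f)"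
    and "sigma_v H (Suc p) q i (tau_coalg H (Suc p) q f) = tau_coalg H p q (sigma_v H (Suc p) q i f)"
  using coalgebra_map_delta_h_0[OF coalgebra_map_insert_one[OF i], where Q = "\<lambda>q. sigma_v H (Suc p) q i"]
    coalgebra_map_delta_h_last[OF coalgebra_map_insert_one[OF i], where Q = "\<lambda>q. sigma_v H (Suc p) q i"]
    coalgebra_map_tau_coalg[OF coalgebra_map_insert_one[OF i], where Q = "\<lambda>q. sigma_v H (Suc p) q i"]
    sigma_v[OF _ i] f by blast+

text \<open>In this and the next two lemmas the last coface is replaced by \<open>\<tau> \<delta>\<^sub>0\<close>.\<close>

lemma delta_v_tau_coalg:
  assumes f: "f \<in> GS H p q" and i: "i \<le> Suc p"
  shows "delta_v H p q i (tau_coalg H p q f) = tau_coalg H (Suc p) q (delta_v H p q i f)"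
proof -
  consider "i = 0" | "1 \<le> i" "i \<le> p" | "i = Suc p" using i by linarith
  then show ?thesis
  proof cases
    case 1
    then show ?thesis by (simp add: delta_v_0_tau_coalg[OF f])
  next
    case 2
    then show ?thesis by (rule delta_v_mid_horizontal(3)[OF _ _ f])
  next
    case 3
    then show ?thesis
      using tau_alg_delta_v_0[OF tau_coalg_in[OF f]] tau_alg_delta_v_0[OF f]
        tau_alg_tau_coalg[OF delta_v_in[OF f, of 0]] delta_v_0_tau_coalg[OF f] by simp
  qed
qed

lemma tau_alg_delta_h:
  assumes f: "f \<in> GS H p q" and j: "j \<le> Suc q"
  shows "tau_alg H p (Suc q) (delta_h H p q j f) = delta_h H p q j (tau_alg H p q f)"
proof -
  consider "j = 0" | "1 \<le> j" "j \<le> q" | "j = Suc q" using j by linarith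
  then show ?thesis
  proof cases
    case 1
    then show ?thesis by (simp add: tau_alg_delta_h_0[OF f])
  next
    case 2
    then show ?thesis by (rule delta_h_mid_vertical(3)[OF _ _ f])
  next
    case 3
    then show ?thesis
      using tau_coalg_delta_h_0[OF tau_alg_in[OF f]] tau_coalg_delta_h_0[OF f]
        tau_alg_tau_coalg[OF delta_h_in[OF f, of 0]] tau_alg_delta_h_0[OF f] by simp
  qed
qed

lemma delta_v_delta_h:
  assumes f: "f \<in> GS H p q" and i: "i \<le> Suc p" and j: "j \<le> Suc q"
  shows "delta_v H p (Suc q) i (delta_h H p q j f) = delta_h H (Suc p) q j (delta_v H p q i f)"
proof -
  have 0: "delta_v H p (Suc q) i (delta_h H p q 0 f) = delta_h H (Suc p) q 0 (delta_v H p q i f)"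
  proof -
    consider "i = 0" | "1 \<le> i" "i \<le> p" | "i = Suc p" using i by linarith
    then show ?thesis
    proof cases
      case 1
      then show ?thesis by (simp add: delta_v_0_delta_h_0[OF f])
    next
      case 2
      then show ?thesis by (rule delta_v_mid_horizontal(1)[OF _ _ f])
    next
      case 3
      then show ?thesis
        using tau_alg_delta_v_0[OF delta_h_in[OF f, of 0]] tau_alg_delta_v_0[OF f]
          tau_alg_delta_h_0[OF delta_v_in[OF f, of 0]] delta_v_0_delta_h_0[OF f] by simp
    qed
  qed
  consider "j = 0" | "1 \<le> j" "j \<le> q" | "j = Suc q" using j by linarith
  then show ?thesis
  proof cases
    case 1
    then show ?thesis using 0 by simp
  next
    case 2
    then show ?thesis by (rule delta_h_mid_vertical(1)[OF _ _ f i])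
  next
    case 3
    then show ?thesis
      using tau_coalg_delta_h_0[OF delta_v_in[OF f i]] tau_coalg_delta_h_0[OF f]
        delta_v_tau_coalg[OF delta_h_in[OF f, of 0] i] 0 by simp
  qed
qed

lemma sigma_v_delta_h:
  assumes f: "f \<in> GS H (Suc p) q" and i: "i \<le> p" and j: "j \<le> Suc q"
  shows "sigma_v H (Suc p) (Suc q) i (delta_h H (Suc p) q j f) = delta_h H p q j (sigma_v H (Suc p) q i f)"
proof -
  consider "j = 0" | "1 \<le> j" "j \<le> q" | "j = Suc q" using j by linarith
  then show ?thesis
    by cases (use sigma_v_horizontal[OF i f] delta_h_mid_vertical(2)[OF _ _ f i] in simp_all)
qed

section \<open>Linearity\<close>

lemma linear_delta_v: assumes i: "i \<le> Suc p" shows "linear_on hom_scale hom_scale (GS H p q) (GS H (Suc p) q) (delta_v H p q i)"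
proof -
  note D = delta_v_in[OF _ i]
  consider "i = 0" | "1 \<le> i" "i \<le> p" | "i = Suc p" using i by linarith
  then show ?thesis
  proof cases
    case 1
    show ?thesis
    proof (rule linear_on_GS[where \<Phi> = "\<lambda>us \<psi> g. g (tl us) (L q (hd us) \<psi>)"])
      fix f and us :: "'h list" and \<psi> assume f: "f \<in> GS H p q" and us: "length us = Suc p" and ml: "ml q \<psi>"
      obtain u w where "us = u # w" using us by (auto simp: len_Suc)
      then show "ev (delta_v H p q i f) us \<psi> = ev f (tl us) (L q (hd us) \<psi>)"
        using delta_v_0(2)[OF f _ ml, of w u] us 1 by simp
    qed (simp_all add: D)
  next
    case 2
    show ?thesis
      by (rule linear_on_GS[where \<Phi> = "\<lambda>us \<psi> g. g (merge i us) \<psi>"]) (simp_all add: D delta_v_mid(2)[OF _ 2])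
  next
    case 3
    show ?thesis
    proof (rule linear_on_GS[where \<Phi> = "\<lambda>us \<psi> g. g (butlast us) (R q (last us) \<psi>)"])
      fix f and us :: "'h list" and \<psi> assume f: "f \<in> GS H p q" and us: "length us = Suc p" and ml: "ml q \<psi>"
      obtain u w where "us = w @ [u]" using us by (cases us rule: rev_cases) auto
      then show "ev (delta_v H p q i f) us \<psi> = ev f (butlast us) (R q (last us) \<psi>)"
        using delta_v_last(2)[OF f _ ml, of w u] us 3 by simp
    qed (simp_all add: D)
  qed
qed

lemma linear_sigma_v: "j \<le> p \<Longrightarrow> linear_on hom_scale hom_scale (GS H (Suc p) q) (GS H p q) (sigma_v H (Suc p) q j)"
  by (rule linear_on_GS[where \<Phi> = "\<lambda>us \<psi> g. g (insert_one j us) \<psi>"]) (simp_all add: sigma_v)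

lemma linear_tau_alg: "linear_on hom_scale hom_scale (GS H p q) (GS H p q) (tau_alg H p q)"
proof (cases p)
  case 0
  then show ?thesis by (simp add: linear_on_def tau_alg_0 GS_plus GS_hscale)
next
  case (Suc k)
  show ?thesis unfolding Suc
    by (rule linear_on_GS[where \<Phi> = "\<lambda>us \<psi> g. vtau q g us \<psi>"])
      (simp_all add: tau_alg_in ev_tau_alg vtau_def sws_plus sws_mult_left)
qed

lemma linear_delta_h: assumes i: "i \<le> Suc q" shows "linear_on hom_scale hom_scale (GS H p q) (GS H p (Suc q)) (delta_h H p q i)"
proof -
  note D = delta_h_in[OF _ i]
  consider "i = 0" | "1 \<le> i" "i \<le> q" | "i = Suc q" using i by linarith
  then show ?thesis
  proof cases
    case 1
    show ?thesis
      by (rule linear_on_GS[where \<Phi> = "\<lambda>us \<psi> g. sws us (\<lambda>a b. g b (\<lambda>v. \<psi> (\<pi> a # v)))"])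
        (use 1 in \<open>simp_all add: D[unfolded 1] delta_h_0(2) sws_plus sws_mult_left\<close>)
  next
    case 2
    show ?thesis
      by (rule linear_on_GS[where \<Phi> = "\<lambda>us \<psi> g. g us (dup i \<psi>)"]) (simp_all add: D delta_h_mid(2)[OF _ 2])
  next
    case 3
    show ?thesis
      by (rule linear_on_GS[where \<Phi> = "\<lambda>us \<psi> g. sws us (\<lambda>a b. g a (\<lambda>v. \<psi> (v @ [\<pi> b])))"])
        (use 3 in \<open>simp_all add: D[unfolded 3] delta_h_last(2) sws_plus sws_mult_left\<close>)
  qed
qed

lemma linear_sigma_h: "j \<le> q \<Longrightarrow> linear_on hom_scale hom_scale (GS H p (Suc q)) (GS H p q) (sigma_h H p (Suc q) j)"
  by (rule linear_on_GS[where \<Phi> = "\<lambda>us \<psi> g. g us (del j \<psi>)"]) (simp_all add: sigma_h)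

lemma linear_tau_coalg: "linear_on hom_scale hom_scale (GS H p q) (GS H p q) (tau_coalg H p q)"
proof (cases "q = 0")
  case True
  then show ?thesis by (simp add: linear_on_def tau_coalg_0 GS_plus GS_hscale)
next
  case False
  show ?thesis
    by (rule linear_on_GS[where \<Phi> = "\<lambda>us \<psi> g. htau q g us \<psi>"])
      (simp_all add: tau_coalg_in ev_tau_coalg False htau_def sws_plus sws_mult_left)
qed

section \<open>The cylindrical module\<close>

lemma column: "para_cocyclic_module hom_scale (\<lambda>p. GS H p q) (\<lambda>p. delta_v H p q) (\<lambda>p. sigma_v H p q) (\<lambda>p. tau_alg H p q)"
proof -
  interpret module "hom_scale :: 'k \<Rightarrow> (('k,'h) tensor \<Rightarrow> ('k,'h) tensor) \<Rightarrow> _" by (rule module_hom)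
  show ?thesis
    by unfold_locales
      (rule GS_subspace linear_delta_v linear_sigma_v linear_tau_alg delta_v_delta_v sigma_v_sigma_v
        sigma_v_delta_v tau_alg_delta_v tau_alg_delta_v_0 tau_alg_sigma_v tau_alg_sigma_v_0; assumption?; simp?)+
qed

lemma row: "para_cocyclic_module hom_scale (\<lambda>q. GS H p q) (\<lambda>q. delta_h H p q) (\<lambda>q. sigma_h H p q) (\<lambda>q. tau_coalg H p q)"
proof -
  interpret module "hom_scale :: 'k \<Rightarrow> (('k,'h) tensor \<Rightarrow> ('k,'h) tensor) \<Rightarrow> _" by (rule module_hom)
  show ?thesis
    by unfold_locales
      (rule GS_subspace linear_delta_h linear_sigma_h linear_tau_coalg delta_h_delta_h sigma_h_sigma_h
        sigma_h_delta_h tau_coalg_delta_h tau_coalg_delta_h_0 tau_coalg_sigma_h tau_coalg_sigma_h_0; assumption?; simp?)+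
qed

lemma cylindrical:
  "cylindrical_module hom_scale (GS H) (delta_v H) (sigma_v H) (tau_alg H) (delta_h H) (sigma_h H) (tau_coalg H)"
  by (intro cylindrical_module.intro bi_para_cocyclic_module.intro cylindrical_module_axioms.intro column row)
    (rule delta_v_delta_h sigma_h_vertical delta_v_tau_coalg sigma_v_delta_h sigma_v_horizontal tau_alg_delta_h
      tau_alg_tau_coalg cylindrical_identity; assumption)+

end

section \<open>The diagonal of a cylindrical module\<close>

context cylindrical_module
begin

sublocale V: para_cocyclic_module scale "\<lambda>p. C p q" "\<lambda>p. dv p q" "\<lambda>p. sv p q" "\<lambda>p. tv p q" for q by (rule column)
sublocale W: para_cocyclic_module scale "\<lambda>q. C p q" "\<lambda>q. dh p q" "\<lambda>q. sh p q" "\<lambda>q. th p q" for p by (rule row)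

lemma linear_on_comp: "linear_on s1 s2 A B f \<Longrightarrow> linear_on s2 s3 B D g \<Longrightarrow> linear_on s1 s3 A D (g \<circ> f)"
  by (auto simp: linear_on_def Pi_iff)

lemma linear_on_mem: "linear_on s1 s2 A B f \<Longrightarrow> x \<in> A \<Longrightarrow> f x \<in> B"
  by (auto simp: linear_on_def)

lemma dv_in: "x \<in> C p q \<Longrightarrow> i \<le> Suc p \<Longrightarrow> dv p q i x \<in> C (Suc p) q"
  and sv_in: "x \<in> C (Suc p) q \<Longrightarrow> j \<le> p \<Longrightarrow> sv (Suc p) q j x \<in> C p q"
  and tv_in: "x \<in> C p q \<Longrightarrow> tv p q x \<in> C p q"
  and dh_in: "x \<in> C p q \<Longrightarrow> i \<le> Suc q \<Longrightarrow> dh p q i x \<in> C p (Suc q)"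
  and sh_in: "x \<in> C p (Suc q) \<Longrightarrow> j \<le> q \<Longrightarrow> sh p (Suc q) j x \<in> C p q"
  and th_in: "x \<in> C p q \<Longrightarrow> th p q x \<in> C p q"
  by (erule linear_on_mem[rotated], rule V.linear_d V.linear_s V.linear_t W.linear_d W.linear_s W.linear_t, assumption?)+

lemmas mem = dv_in sv_in tv_in dh_in sh_in th_in

lemma power_mem: "x \<in> C p q \<Longrightarrow> (th p q ^^ k) x \<in> C p q" "x \<in> C p q \<Longrightarrow> (tv p q ^^ k) x \<in> C p q"
  by (induction k) (simp_all add: tv_in th_in)

text \<open>The operators commute, so the power of the product is the product of the powers.\<close>

lemma diagonal_power: "x \<in> C n n \<Longrightarrow> ((tv n n \<circ> th n n) ^^ k) x = (tv n n ^^ k) ((th n n ^^ k) x)"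
proof (induction k)
  case (Suc k)
  have "th n n ((tv n n ^^ l) y) = (tv n n ^^ l) (th n n y)" if "y \<in> C n n" for l y
    by (induction l) (simp_all add: tv_th[symmetric] power_mem that)
  then show ?case using Suc by (simp add: power_mem)
qed simp

lemma diagonal_cocyclic:
  "cocyclic_module scale (\<lambda>n. C n n) (\<lambda>n i. dv n (Suc n) i \<circ> dh n n i) (\<lambda>n j. sv n (n - 1) j \<circ> sh n n j) (\<lambda>n. tv n n \<circ> th n n)"
proof unfold_locales
  fix n i j x
  show "V.subspace (C n n)" by (rule V.subspace_C)
  show "linear_on scale scale (C n n) (C (Suc n) (Suc n)) (dv n (Suc n) i \<circ> dh n n i)" if "i \<le> Suc n"
    using that by (intro linear_on_comp[OF W.linear_d V.linear_d])
  show "linear_on scale scale (C (Suc n) (Suc n)) (C n n) (sv (Suc n) (Suc n - 1) j \<circ> sh (Suc n) (Suc n) j)" if "j \<le> n"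
    using that by (simp add: linear_on_comp[OF W.linear_s V.linear_s])
  show "linear_on scale scale (C n n) (C n n) (tv n n \<circ> th n n)"
    by (rule linear_on_comp[OF W.linear_t V.linear_t])
  show "(dv (Suc n) (Suc (Suc n)) j \<circ> dh (Suc n) (Suc n) j) ((dv n (Suc n) i \<circ> dh n n i) x) =
    (dv (Suc n) (Suc (Suc n)) i \<circ> dh (Suc n) (Suc n) i) ((dv n (Suc n) (j - 1) \<circ> dh n n (j - 1)) x)"
    if "x \<in> C n n" "i < j" "j \<le> n + 2"
    using that W.d_d[OF that] V.d_d[of "dh n (Suc n) i (dh n n (j - 1) x)" n "n + 2" i j]
    by (simp add: dv_dh[symmetric] mem)
  show "(sv (Suc n) (Suc n - 1) j \<circ> sh (Suc n) (Suc n) j) ((sv (n + 2) (n + 2 - 1) i \<circ> sh (n + 2) (n + 2) i) x) =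
    (sv (Suc n) (Suc n - 1) i \<circ> sh (Suc n) (Suc n) i) ((sv (n + 2) (n + 2 - 1) (Suc j) \<circ> sh (n + 2) (n + 2) (Suc j)) x)"
    if "x \<in> C (n + 2) (n + 2)" "i \<le> j" "j \<le> n"
    using that W.s_s[OF that] V.s_s[of "sh (n + 2) (Suc n) i (sh (n + 2) (n + 2) (Suc j) x)" n n i j]
    by (simp add: sv_sh[symmetric] mem)
  show "(sv (Suc n) (Suc n - 1) j \<circ> sh (Suc n) (Suc n) j) ((dv n (Suc n) i \<circ> dh n n i) x) =
    (dv (n - 1) (Suc (n - 1)) i \<circ> dh (n - 1) (n - 1) i) ((sv n (n - 1) (j - 1) \<circ> sh n n (j - 1)) x)"
    if "x \<in> C n n" "i < j" "j \<le> n"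
  proof -
    have "n \<noteq> 0" using that by simp
    then obtain m where "n = Suc m" using not0_implies_Suc by blast
    then show ?thesis
      using that W.s_d_less[OF that] V.s_d_less[of "dh n m i (sh n n (j - 1) x)" n n i j]
      by (simp add: dv_sh[symmetric] sv_dh[symmetric] mem)
  qed
  show "(sv (Suc n) (Suc n - 1) j \<circ> sh (Suc n) (Suc n) j) ((dv n (Suc n) i \<circ> dh n n i) x) = x"
    if "x \<in> C n n" "i = j \<or> i = Suc j" "j \<le> n"
    using that W.s_d_eq[OF that] V.s_d_eq[OF that] by (auto simp: dv_sh[symmetric] mem)
  show "(sv (Suc n) (Suc n - 1) j \<circ> sh (Suc n) (Suc n) j) ((dv n (Suc n) i \<circ> dh n n i) x) =
    (dv (n - 1) (Suc (n - 1)) (i - 1) \<circ> dh (n - 1) (n - 1) (i - 1)) ((sv n (n - 1) j \<circ> sh n n j) x)"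
    if "x \<in> C n n" "Suc j < i" "i \<le> Suc n"
  proof -
    have "n \<noteq> 0" using that by simp
    then obtain m where "n = Suc m" using not0_implies_Suc by blast
    then show ?thesis
      using that W.s_d_greater[OF that] V.s_d_greater[of "dh n m (i - 1) (sh n n j x)" n n j i]
      by (simp add: dv_sh[symmetric] sv_dh[symmetric] mem)
  qed
  show "(tv (Suc n) (Suc n) \<circ> th (Suc n) (Suc n)) ((dv n (Suc n) i \<circ> dh n n i) x) =
    (dv n (Suc n) (i - 1) \<circ> dh n n (i - 1)) ((tv n n \<circ> th n n) x)"
    if "x \<in> C n n" "1 \<le> i" "i \<le> Suc n"
    using that by (simp add: dv_th[symmetric] tv_dh[symmetric] mem W.t_d V.t_d)
  show "(tv (Suc n) (Suc n) \<circ> th (Suc n) (Suc n)) ((dv n (Suc n) 0 \<circ> dh n n 0) x) = (dv n (Suc n) (Suc n) \<circ> dh n n (Suc n)) x"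
    if "x \<in> C n n"
    using that by (simp add: dv_th[symmetric] mem W.t_d_0 V.t_d_0)
  show "(tv n n \<circ> th n n) ((sv (Suc n) (Suc n - 1) i \<circ> sh (Suc n) (Suc n) i) x) =
    (sv (Suc n) (Suc n - 1) (i - 1) \<circ> sh (Suc n) (Suc n) (i - 1)) ((tv (Suc n) (Suc n) \<circ> th (Suc n) (Suc n)) x)"
    if "x \<in> C (Suc n) (Suc n)" "1 \<le> i" "i \<le> n"
    using that by (simp add: sv_th[symmetric] tv_sh[symmetric] mem W.t_s V.t_s)
  show "(tv n n \<circ> th n n) ((sv (Suc n) (Suc n - 1) 0 \<circ> sh (Suc n) (Suc n) 0) x) =
    (sv (Suc n) (Suc n - 1) n \<circ> sh (Suc n) (Suc n) n) ((tv (Suc n) (Suc n) \<circ> th (Suc n) (Suc n)) ((tv (Suc n) (Suc n) \<circ> th (Suc n) (Suc n)) x))"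
    if "x \<in> C (Suc n) (Suc n)"
    using that by (simp add: sv_th[symmetric] tv_sh[symmetric] tv_th[symmetric] mem W.t_s_0 V.t_s_0)
  show "((tv n n \<circ> th n n) ^^ Suc n) x = x" if "x \<in> C n n"
    using that by (simp only: diagonal_power cylindrical)
qed

end

theorem theoremA:
  fixes H :: "('k::field, 'h::ring_1) hopf"
  assumes "hopf_algebra H"
    and "antipode H \<circ> antipode H = id"
  shows "cylindrical_module hom_scale (GS H)
           (delta_v H) (sigma_v H) (tau_alg H) (delta_h H) (sigma_h H) (tau_coalg H) \<and>
         (\<forall>n. \<forall>f \<in> GS H n n. tau_diag H n f = (tau_alg H n n \<circ> tau_coalg H n n) f \<and>
                             tau_diag H n f = (tau_coalg H n n \<circ> tau_alg H n n) f) \<and>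
         cocyclic_module hom_scale (\<lambda>n. GS H n n) (delta_diag H) (sigma_diag H) (tau_diag H)"
proof -
  interpret involutive_hopf_algebra H
    using assms by (simp add: involutive_hopf_algebra_def involutive_hopf_algebra_axioms_def fun_eq_iff)
  interpret Cyl: cylindrical_module hom_scale "GS H" "delta_v H" "sigma_v H" "tau_alg H" "delta_h H" "sigma_h H" "tau_coalg H"
    by (rule cylindrical)
  show ?thesis
    using cylindrical Cyl.diagonal_cocyclic tau_alg_tau_coalg
    by (simp add: delta_diag_def[abs_def] sigma_diag_def[abs_def] tau_diag_def[abs_def])
qed

end
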